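(* There exists $\beta_0>0$ such that for all $h>0$ and all $0<\beta\le\beta_0$, $$\lim_{k\to\infty}\limsup_{N\to\infty}\mathbb{E}\left|\frac1N\log\mathbb{E}_k(Z_N^2)-2\operatorname{RS}(\beta,h)\right|\le0,$$ where $\mathbb{E}_k$ denotes conditional expectation with respect to $\mathcal{G}_k$.
   Context: Let $\beta>0$, $h>0$. For each $N$ let $\mathbf{g}=(g_{ij})_{1\le i,j\le N}$ have i.i.d. centered Gaussian entries of variance $1/N$ (all $N^2$ entries independent), and let $$Z_N=2^{-N}\sum_{\sigma\in\{-1,1\}^N}\exp\Big[\frac{\beta}{\sqrt2}\sum_{i,j=1}^N g_{ij}\sigma_i\sigma_j+h\sum_{i=1}^N\sigma_i\Big].$$ Put $$\operatorname{RS}(\beta,h)=\inf_{q'\ge0}\Big[E\log\cosh(h+\beta\sqrt{q'}Z)+\frac{\beta^2(1-q')^2}{4}\Big].$$ Here and below $Z,Z',Z''$ are independent standard Gaussian variables with expectation $E$. Let $q>0$ be the unique solution of $q=E\tanh^2(h+\beta\sqrt q Z)$, and $\operatorname{Th}(x)=\tanh(h+\beta x)$. On $\mathbb{R}^N$ use $\langle\mathbf{x},\mathbf{y}\rangle=\frac1N\sum_i x_iy_i$, $\|\mathbf{x}\|=\sqrt{\langle\mathbf{x},\mathbf{x}\rangle}$, and $(\mathbf{a}\otimes\mathbf{b})_{ij}=a_ib_j/N$. Functions act on vectors componentwise; $\mathbf{1}$ is the all-ones vector. Real sequences: $\gamma_1=E\tanh(h+\beta\sqrt q Z)$, $\rho_1=\sqrt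 q\,\gamma_1$, $$\psi(t)=E\operatorname{Th}(\sqrt tZ+\sqrt{q-t}Z')\operatorname{Th}(\sqrt tZ+\sqrt{q-t}Z'')\quad(0\le t\le q),$$ and for $k\ge2$, with $\Gamma_{k-1}^2=\sum_{j=1}^{k-1}\gamma_j^2$ ($\Gamma_0=0$), $$\rho_k=\psi(\rho_{k-1}),\qquad \gamma_k=\frac{\rho_k-\Gamma_{k-1}^2}{\sqrt{q-\Gamma_{k-1}^2}}.$$ It is known that $\Gamma_{k-1}^2<\rho_k<q$ for all $k$. Recursion of random objects: $\mathbf{g}^{(1)}=\mathbf{g}$, $\phi^{(1)}=\mathbf{1}$, $\mathbf{m}^{(1)}=\sqrt q\,\mathbf{1}$. Given $\mathbf{g}^{(s)},\phi^{(s)},\mathbf{m}^{(s)}$ for $s\le k$, put $$\xi^{(s)}=\mathbf{g}^{(s)}\phi^{(s)},\quad \eta^{(s)}=(\mathbf{g}^{(s)})^T\phi^{(s)},\quad \zeta^{(s)}=\frac{\xi^{(s)}+\eta^{(s)}}{\sqrt2},$$ $$\mathbf{h}^{(k+1)}=h\mathbf{1}+\beta\sum_{s=1}^{k-1}\gamma_s\zeta^{(s)}+\beta\sqrt{q-\Gamma_{k-1}^2}\,\zeta^{(k)},\quad \mathbf{m}^{(k+1)}=\tanh(\mathbf{h}^{(k+1)}),$$ $$\phi^{(k+1)}=\frac{\mathbf{m}^{(k+1)}-\sum_{s=1}^k\langle\mathbf{m}^{(k+1)},\phi^{(s)}\rangle\phi^{(s)}}{\|\mathbf{m}^{(k+1)}-\sum_{s=1}^k\langle\mathbf{m}^{(k+1)},\phi^{(s)}\rangle\phi^{(s)}\|},$$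 $$\mathbf{g}^{(k+1)}=\mathbf{g}^{(k)}-\Big(\xi^{(k)}\otimes\phi^{(k)}+\phi^{(k)}\otimes\eta^{(k)}-\langle\phi^{(k)},\xi^{(k)}\rangle\,\phi^{(k)}\otimes\phi^{(k)}\Big).$$ For $N>k$ the denominator is almost surely nonzero. All objects depend on $N$. Finally $\mathcal{G}_k=\sigma(\xi^{(m)},\eta^{(m)}:m\le k)$. *)

theory Defs
  imports "HOL-Probability.Probability"
begin

section \<open>Deterministic quantities\<close>

definition std_gauss :: "real measure" where
  "std_gauss = density lborel std_normal_density"

definition RS :: "real \<Rightarrow> real \<Rightarrow> real" where
  "RS \<beta> h = (INF q\<in>{0..}. (\<integral>z. ln (cosh (h + \<beta> * sqrt q * z)) \<partial>std_gauss)
                              + \<beta>\<^sup>2 * (1 - q)\<^sup>2 / 4)"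

definition sk_q :: "real \<Rightarrow> real \<Rightarrow> real" where
  "sk_q \<beta> h = (THE q. q > 0 \<and> q = (\<integral>z. (tanh (h + \<beta> * sqrt q * z))\<^sup>2 \<partial>std_gauss))"

definition Th :: "real \<Rightarrow> real \<Rightarrow> real \<Rightarrow> real" where
  "Th \<beta> h x = tanh (h + \<beta> * x)"

definition psi :: "real \<Rightarrow> real \<Rightarrow> real \<Rightarrow> real" where
  "psi \<beta> h t = (\<integral>(z, z', z'').
      Th \<beta> h (sqrt t * z + sqrt (sk_q \<beta> h - t) * z') *
      Th \<beta> h (sqrt t * z + sqrt (sk_q \<beta> h - t) * z'')
    \<partial>(std_gauss \<Otimes>\<^sub>M (std_gauss \<Otimes>\<^sub>M std_gauss)))"

definition gamma1 :: "real \<Rightarrow> real \<Rightarrow> real" where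
  "gamma1 \<beta> h = (\<integral>z. tanh (h + \<beta> * sqrt (sk_q \<beta> h) * z) \<partial>std_gauss)"

text \<open>All sequences below start at index 1; the value at index 0 is a dummy that is never used.\<close>

fun rho :: "real \<Rightarrow> real \<Rightarrow> nat \<Rightarrow> real" where
  "rho \<beta> h 0 = 0"
| "rho \<beta> h (Suc 0) = sqrt (sk_q \<beta> h) * gamma1 \<beta> h"
| "rho \<beta> h (Suc (Suc k)) = psi \<beta> h (rho \<beta> h (Suc k))"

fun gam :: "real \<Rightarrow> real \<Rightarrow> nat \<Rightarrow> real" where
  "gam \<beta> h 0 = 0"
| "gam \<beta> h (Suc 0) = gamma1 \<beta> h"
| "gam \<beta> h (Suc (Suc k)) =
     (rho \<beta> h (Suc (Suc k)) - (\<Sum>j=1..Suc k. (gam \<beta> h j)\<^sup>2)) /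
     sqrt (sk_q \<beta> h - (\<Sum>j=1..Suc k. (gam \<beta> h j)\<^sup>2))"

text \<open>\<open>Gam2 \<beta> h k\<close> is $\Gamma_k^2$, so that $\Gamma_0^2 = 0$.\<close>

definition Gam2 :: "real \<Rightarrow> real \<Rightarrow> nat \<Rightarrow> real" where
  "Gam2 \<beta> h k = (\<Sum>j=1..k. (gam \<beta> h j)\<^sup>2)"

section \<open>Vectors and matrices of size \<open>N\<close>\<close>

text \<open>Vectors and matrices are functions of which only the entries with indices in
  \<open>{1..N}\<close> matter, because \<open>N\<close> varies within the statement.\<close>

type_synonym vect = "nat \<Rightarrow> real"
type_synonym matr = "nat \<Rightarrow> nat \<Rightarrow> real"

definition ip :: "nat \<Rightarrow> vect \<Rightarrow> vect \<Rightarrow> real" where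
  "ip N x y = (\<Sum>i=1..N. x i * y i) / real N"

definition nrm :: "nat \<Rightarrow> vect \<Rightarrow> real" where
  "nrm N x = sqrt (ip N x x)"

definition tens :: "nat \<Rightarrow> vect \<Rightarrow> vect \<Rightarrow> matr" where
  "tens N a b = (\<lambda>i j. a i * b j / real N)"

definition mat_vec :: "nat \<Rightarrow> matr \<Rightarrow> vect \<Rightarrow> vect" where
  "mat_vec N A x = (\<lambda>i. \<Sum>j=1..N. A i j * x j)"

definition tr :: "matr \<Rightarrow> matr" where
  "tr A = (\<lambda>i j. A j i)"

section \<open>The recursion\<close>

text \<open>\<open>G\<close> is a realisation of the disorder matrix. The vector \<open>vh\<close> is $\mathbf{h}^{(k)}$,
  which is used for \<open>k \<ge> 2\<close> only. If a denominator vanishes, division by zero makes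
  \<open>phi\<close> the zero vector; for \<open>N\<close> large compared to the index this is a null event.\<close>

function gmat :: "real \<Rightarrow> real \<Rightarrow> nat \<Rightarrow> matr \<Rightarrow> nat \<Rightarrow> matr"
and phi :: "real \<Rightarrow> real \<Rightarrow> nat \<Rightarrow> matr \<Rightarrow> nat \<Rightarrow> vect"
and xi :: "real \<Rightarrow> real \<Rightarrow> nat \<Rightarrow> matr \<Rightarrow> nat \<Rightarrow> vect"
and eta :: "real \<Rightarrow> real \<Rightarrow> nat \<Rightarrow> matr \<Rightarrow> nat \<Rightarrow> vect"
and zeta :: "real \<Rightarrow> real \<Rightarrow> nat \<Rightarrow> matr \<Rightarrow> nat \<Rightarrow> vect"
and vh :: "real \<Rightarrow> real \<Rightarrow> nat \<Rightarrow> matr \<Rightarrow> nat \<Rightarrow> vect"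
and vm :: "real \<Rightarrow> real \<Rightarrow> nat \<Rightarrow> matr \<Rightarrow> nat \<Rightarrow> vect"
where
  "gmat \<beta> h N G 0 = (\<lambda>i j. 0)"
| "gmat \<beta> h N G (Suc 0) = G"
| "gmat \<beta> h N G (Suc (Suc k)) =
    (let g = gmat \<beta> h N G (Suc k); p = phi \<beta> h N G (Suc k);
         x = xi \<beta> h N G (Suc k); e = eta \<beta> h N G (Suc k)
     in (\<lambda>i j. g i j - (tens N x p i j + tens N p e i j - ip N p x * tens N p p i j)))"
| "phi \<beta> h N G 0 = (\<lambda>i. 0)"
| "phi \<beta> h N G (Suc 0) = (\<lambda>i. 1)"
| "phi \<beta> h N G (Suc (Suc k)) =
    (let m = vm \<beta> h N G (Suc (Suc k));
         r = (\<lambda>i. m i - (\<Sum>s=1..Suc k. ip N m (phi \<beta> h N G s) * phi \<beta> h N G s i))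
     in (\<lambda>i. r i / nrm N r))"
| "xi \<beta> h N G k = mat_vec N (gmat \<beta> h N G k) (phi \<beta> h N G k)"
| "eta \<beta> h N G k = mat_vec N (tr (gmat \<beta> h N G k)) (phi \<beta> h N G k)"
| "zeta \<beta> h N G k = (\<lambda>i. (xi \<beta> h N G k i + eta \<beta> h N G k i) / sqrt 2)"
| "vh \<beta> h N G 0 = (\<lambda>i. 0)"
| "vh \<beta> h N G (Suc k) = (\<lambda>i. h + \<beta> * (\<Sum>s=1..k-1. gam \<beta> h s * zeta \<beta> h N G s i)
      + \<beta> * sqrt (sk_q \<beta> h - Gam2 \<beta> h (k-1)) * zeta \<beta> h N G k i)"
| "vm \<beta> h N G 0 = (\<lambda>i. 0)"
| "vm \<beta> h N G (Suc 0) = (\<lambda>i. sqrt (sk_q \<beta> h))"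
| "vm \<beta> h N G (Suc (Suc k)) = (\<lambda>i. tanh (vh \<beta> h N G (Suc (Suc k)) i))"
  by pat_completeness auto
termination
  by (relation "Wellfounded.measure (case_sum
        (case_sum (\<lambda>(_, _, _, _, k). 5 * k + 2)
          (case_sum (\<lambda>(_, _, _, _, k). 5 * k + 2) (\<lambda>(_, _, _, _, k). 5 * k + 3)))
        (case_sum
          (case_sum (\<lambda>(_, _, _, _, k). 5 * k + 3) (\<lambda>(_, _, _, _, k). 5 * k + 4))
          (case_sum (\<lambda>(_, _, _, _, k). 5 * k) (\<lambda>(_, _, _, _, k). 5 * k + 1))))") auto

section \<open>The disorder, the partition function and the conditioning\<close>

definition partition_fun :: "real \<Rightarrow> real \<Rightarrow> nat \<Rightarrow> matr \<Rightarrow> real" where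
  "partition_fun \<beta> h N G =
     (\<Sum>\<sigma>\<in>{1..N} \<rightarrow>\<^sub>E {-1, 1}.
        exp (\<beta> / sqrt 2 * (\<Sum>i=1..N. \<Sum>j=1..N. G i j * \<sigma> i * \<sigma> j) + h * (\<Sum>i=1..N. \<sigma> i))) / 2 ^ N"

text \<open>The second argument of \<^const>\<open>normal_density\<close> is the standard deviation.\<close>

definition gaussian_disorder :: "nat \<Rightarrow> 'a measure \<Rightarrow> (nat \<Rightarrow> nat \<Rightarrow> 'a \<Rightarrow> real) \<Rightarrow> bool" where
  "gaussian_disorder N M g \<longleftrightarrow>
     prob_space M \<and>
     prob_space.indep_vars M (\<lambda>_. borel) (\<lambda>(i, j). g i j) ({1..N} \<times> {1..N}) \<and>
     (\<forall>i\<in>{1..N}. \<forall>j\<in>{1..N}. distributed M lborel (g i j) (normal_density 0 (sqrt (1 / real N))))"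

definition realise :: "(nat \<Rightarrow> nat \<Rightarrow> 'a \<Rightarrow> real) \<Rightarrow> 'a \<Rightarrow> matr" where
  "realise g \<omega> = (\<lambda>i j. g i j \<omega>)"

definition sigma_G :: "real \<Rightarrow> real \<Rightarrow> nat \<Rightarrow> 'a measure \<Rightarrow> (nat \<Rightarrow> nat \<Rightarrow> 'a \<Rightarrow> real) \<Rightarrow> nat \<Rightarrow> 'a measure"
where
  "sigma_G \<beta> h N M g k = sigma (space M)
     (\<Union>m\<in>{1..k}. \<Union>i\<in>{1..N}.
        {(\<lambda>\<omega>. xi \<beta> h N (realise g \<omega>) m i) -` A \<inter> space M | A. A \<in> sets borel} \<union>
        {(\<lambda>\<omega>. eta \<beta> h N (realise g \<omega>) m i) -` A \<inter> space M | A. A \<in> sets borel})"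

definition cond_second_moment ::
  "real \<Rightarrow> real \<Rightarrow> nat \<Rightarrow> 'a measure \<Rightarrow> (nat \<Rightarrow> nat \<Rightarrow> 'a \<Rightarrow> real) \<Rightarrow> nat \<Rightarrow> 'a \<Rightarrow> real" where
  "cond_second_moment \<beta> h N M g k =
     real_cond_exp M (sigma_G \<beta> h N M g k) (\<lambda>\<omega>. (partition_fun \<beta> h N (realise g \<omega>))\<^sup>2)"

end

theory Submission
  imports Defs
begin

text \<open>
  Given the first \<open>k\<close> steps of the recursion, the remaining disorder \<open>g\<^sup>(\<^sup>k\<^sup>+\<^sup>1\<^sup>)\<close> is the projection of an
  independent Gaussian matrix, so the conditional second moment is an explicit function of the vectors
  \<open>\<phi>\<^sup>s\<close>, \<open>\<zeta>\<^sup>s\<close> with \<open>s \<le> k\<close>: a double sum over spins \<open>\<sigma>\<close>, \<open>\<tau>\<close> in which the projected overlap of \<open>\<sigma>\<close> and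
  \<open>\<tau>\<close> enters quadratically. Replacing the conditionally Gaussian pieces by fresh vectors
  shows that \<open>\<zeta>\<^sup>1, \<dots>, \<zeta>\<^sup>k\<close> are, up to errors that vanish in normalised norm, independent
  standard Gaussian vectors. The law of large numbers then gives the limits of all inner products of
  \<open>m\<^sup>(\<^sup>k\<^sup>+\<^sup>1\<^sup>)\<close> with \<open>\<phi>\<^sup>s\<close> and \<open>\<zeta>\<^sup>s\<close>. Tilting the spins by the field \<open>h\<^sup>(\<^sup>k\<^sup>+\<^sup>1\<^sup>)\<close>, the exponent becomes a
  constant plus quadratic forms in \<open>\<sigma> - m\<^sup>(\<^sup>k\<^sup>+\<^sup>1\<^sup>)\<close>; for small \<open>\<beta>\<close> their exponential moments are bounded
  uniformly in \<open>N\<close>, and what remains is controlled by the limit of \<open>\<Gamma>\<^sub>k\<^sup>2\<close>, which is \<open>q\<close>.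
\<close>

section \<open>Gaussian measures\<close>

text \<open>Conditioning is carried out without conditional distributions. By
  \<open>theta_law\<close>, the revealed part \<open>dmat\<close>, built from fresh blocks
  \<open>v\<close>, plus the projection of an independent matrix has exactly the law of the
  disorder. The first k steps see only \<open>v\<close>, so conditioning on them is integration over
  the matrix alone. Identities of laws are obtained from characteristic functions of linear forms.
  The obstacle in the second moment is that an exponent of order N is summed over pairs of
  configurations. Terms of second order in the deviations cost only a bounded factor, because tilted
  spins are independent and sub-Gaussian, but a term of first order would change the exponent at
  order N. The tilt is right because Gaussian integration by parts makes the first-order terms
  cancel. The overlap couples two configurations; for fixed \<tau> it is a linear form in \<sigma> -
  m up to a small error, so its square joins the other quadratic forms. The resulting factor is a
  power of 2 depending on k only, hence harmless as N grows before k does.\<close>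

lemma sets_std_gauss [measurable_cong, simp]: "sets std_gauss = sets borel"
  by (simp add: std_gauss_def)

lemma space_std_gauss [simp]: "space std_gauss = UNIV"
  by (simp add: std_gauss_def)

lemma measurable_std_gauss [simp]: "measurable std_gauss N = measurable borel N"
  by (rule measurable_cong_sets) auto

lemma prob_space_std_gauss: "prob_space std_gauss"
  unfolding std_gauss_def by (rule prob_space_normal_density) simp

interpretation sg: prob_space std_gauss
  by (rule prob_space_std_gauss)

interpretation sgp: product_sigma_finite "\<lambda>_ :: 'i. std_gauss"
  by unfold_locales

lemma std_gauss_mgf: "(\<integral>\<^sup>+z. ennreal (exp (t * z)) \<partial>std_gauss) = ennreal (exp (t\<^sup>2 / 2))"
proof -
  have *: "std_normal_density z * exp (t * z) = exp (t\<^sup>2 / 2) * normal_density t 1 z" for z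
    by (simp add: normal_density_def flip: exp_add) (simp add: power2_eq_square field_simps)
  have "(\<integral>\<^sup>+z. ennreal (exp (t * z)) \<partial>std_gauss)
      = (\<integral>\<^sup>+z. ennreal (exp (t\<^sup>2 / 2)) * ennreal (normal_density t 1 z) \<partial>lborel)"
    unfolding std_gauss_def
    by (subst nn_integral_density)
       (auto simp flip: ennreal_mult simp: * intro!: nn_integral_cong)
  also have "\<dots> = ennreal (exp (t\<^sup>2 / 2)) * (\<integral>\<^sup>+z. ennreal (normal_density t 1 z) \<partial>lborel)"
    by (rule nn_integral_cmult) simp
  also have "(\<integral>\<^sup>+z. ennreal (normal_density t 1 z) \<partial>lborel) = 1"
    by (subst nn_integral_eq_integral) auto
  finally show ?thesis by simp
qed

lemma std_gauss_exp_sq: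
  assumes c: "c < 1/2"
  shows "(\<integral>\<^sup>+z. ennreal (exp (c * z\<^sup>2)) \<partial>std_gauss) = ennreal (1 / sqrt (1 - 2 * c))"
proof -
  define s where "s = 1 / sqrt (1 - 2 * c)"
  have s: "s > 0" "s\<^sup>2 = 1 / (1 - 2 * c)" using c by (auto simp: s_def power_divide)
  have *: "std_normal_density z * exp (c * z\<^sup>2) = s * normal_density 0 s z" for z
  proof -
    have "- z\<^sup>2 / 2 + c * z\<^sup>2 = - (z\<^sup>2) / (2 * s\<^sup>2)" using c by (simp add: s(2) field_simps)
    moreover have "sqrt (2 * pi * s\<^sup>2) = s * sqrt (2 * pi)" using s(1) by (simp add: real_sqrt_mult)
    ultimately show ?thesis using s(1)
      by (simp add: normal_density_def flip: exp_add)
  qed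
  have "(\<integral>\<^sup>+z. ennreal (exp (c * z\<^sup>2)) \<partial>std_gauss)
      = (\<integral>\<^sup>+z. ennreal s * ennreal (normal_density 0 s z) \<partial>lborel)"
    unfolding std_gauss_def using s(1)
    by (subst nn_integral_density)
       (auto simp flip: ennreal_mult simp: * intro!: nn_integral_cong)
  also have "\<dots> = ennreal s * (\<integral>\<^sup>+z. ennreal (normal_density 0 s z) \<partial>lborel)"
    by (rule nn_integral_cmult) simp
  also have "(\<integral>\<^sup>+z. ennreal (normal_density 0 s z) \<partial>lborel) = 1"
    using s(1) by (subst nn_integral_eq_integral) auto
  finally show ?thesis by (simp add: s_def)
qed

lemma std_gauss_integrable_power: "integrable std_gauss (\<lambda>z. z ^ k)"
  unfolding std_gauss_def by (rule integrable_std_normal_distribution_moment)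

lemma std_gauss_integrable_id [simp]: "integrable std_gauss (\<lambda>z. z)"
  using std_gauss_integrable_power[of 1] by simp

lemma std_gauss_moment1: "(\<integral>z. z \<partial>std_gauss) = 0"
  using integral_std_normal_distribution_moment_odd[of 1] by (simp add: std_gauss_def)

lemma std_gauss_moment2: "(\<integral>z. z\<^sup>2 \<partial>std_gauss) = 1"
  using std_normal_distribution_even_moments(1)[of 1] by (simp add: std_gauss_def)

lemma std_gauss_moment3: "(\<integral>z. z ^ 3 \<partial>std_gauss) = 0"
  using integral_std_normal_distribution_moment_odd[of 3] by (simp add: std_gauss_def)

lemma std_gauss_moment4: "(\<integral>z. z ^ 4 \<partial>std_gauss) = 3"
  using std_normal_distribution_even_moments(1)[of 2] by (simp add: std_gauss_def fact_numeral)

lemma cis_sum: "cis (\<Sum>i\<in>I. f i) = (\<Prod>i\<in>I. cis (f i))"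
  by (induction I rule: infinite_finite_induct) (auto simp flip: cis_mult)

lemma borel_measurable_cis [measurable]: "cis \<in> borel_measurable borel"
  by (intro borel_measurable_continuous_onI continuous_intros)

lemma (in prob_space) integrable_cis [simp]:
  "f \<in> borel_measurable M \<Longrightarrow> integrable M (\<lambda>x. cis (f x))"
  by (rule integrable_const_bound[where B=1]) auto

lemma char_eq_cis: "char M t = (\<integral>x. cis (t * x) \<partial>M)"
  by (simp add: char_def cis_conv_exp)

lemma std_gauss_cis: "(\<integral>z. cis (t * z) \<partial>std_gauss) = complex_of_real (exp (- (t\<^sup>2) / 2))"
  using fun_cong[OF char_std_normal_distribution, of t] by (simp add: char_eq_cis std_gauss_def)

section \<open>Finite families of independent standard Gaussians\<close>

definition gprod :: "'i set \<Rightarrow> ('i \<Rightarrow> real) measure" where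
  "gprod J = PiM J (\<lambda>_. std_gauss)"

lemma prob_space_gprod: "prob_space (gprod J)"
  unfolding gprod_def by (rule prob_space_PiM) (rule prob_space_std_gauss)

lemma sets_gprod [measurable_cong, simp]: "sets (gprod J) = sets (PiM J (\<lambda>_. borel))"
  unfolding gprod_def by (rule sets_PiM_cong) auto

lemma space_gprod: "space (gprod J) = (\<Pi>\<^sub>E i\<in>J. UNIV)"
  by (simp add: gprod_def space_PiM)

lemma measurable_gprod_component: "i \<in> J \<Longrightarrow> (\<lambda>x. x i) \<in> borel_measurable (gprod J)"
  by measurable

lemma gprod_mgf:
  assumes [simp]: "finite J"
  shows "(\<integral>\<^sup>+x. ennreal (exp (\<Sum>j\<in>J. t j * x j)) \<partial>gprod J) = ennreal (exp ((\<Sum>j\<in>J. (t j)\<^sup>2) / 2))"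
proof -
  have "(\<integral>\<^sup>+x. ennreal (exp (\<Sum>j\<in>J. t j * x j)) \<partial>gprod J)
      = (\<integral>\<^sup>+x. (\<Prod>j\<in>J. ennreal (exp (t j * x j))) \<partial>PiM J (\<lambda>_. std_gauss))"
    by (simp add: gprod_def exp_sum prod_ennreal)
  also have "\<dots> = (\<Prod>j\<in>J. ennreal (exp ((t j)\<^sup>2 / 2)))"
    by (subst sgp.product_nn_integral_prod) (auto simp: std_gauss_mgf)
  finally show ?thesis
    by (simp add: prod_ennreal sum_divide_distrib exp_sum)
qed

lemma gprod_exp_sq:
  assumes [simp]: "finite J" and c: "c < 1/2"
  shows "(\<integral>\<^sup>+x. ennreal (exp (c * (\<Sum>j\<in>J. (x j)\<^sup>2))) \<partial>gprod J) = ennreal ((1 / sqrt (1 - 2 * c)) ^ card J)"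
proof -
  have "(\<integral>\<^sup>+x. ennreal (exp (c * (\<Sum>j\<in>J. (x j)\<^sup>2))) \<partial>gprod J)
      = (\<integral>\<^sup>+x. (\<Prod>j\<in>J. ennreal (exp (c * (x j)\<^sup>2))) \<partial>PiM J (\<lambda>_. std_gauss))"
    by (simp add: gprod_def exp_sum prod_ennreal sum_distrib_left)
  also have "\<dots> = (\<Prod>j\<in>J. ennreal (1 / sqrt (1 - 2 * c)))"
    by (subst sgp.product_nn_integral_prod) (auto simp: std_gauss_exp_sq[OF c])
  finally show ?thesis using c by (simp add: ennreal_power)
qed

lemma gprod_cis:
  assumes [simp]: "finite J"
  shows "(\<integral>x. cis (\<Sum>j\<in>J. t j * x j) \<partial>gprod J) = complex_of_real (exp (- (\<Sum>j\<in>J. (t j)\<^sup>2) / 2))"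
proof -
  have "(\<integral>x. cis (\<Sum>j\<in>J. t j * x j) \<partial>gprod J)
      = (\<integral>x. (\<Prod>j\<in>J. cis (t j * x j)) \<partial>PiM J (\<lambda>_. std_gauss))"
    by (simp add: gprod_def cis_sum)
  also have "\<dots> = (\<Prod>j\<in>J. complex_of_real (exp (- (t j)\<^sup>2 / 2)))"
    by (subst sgp.product_integral_prod) (auto simp: std_gauss_cis)
  also have "\<dots> = complex_of_real (exp (\<Sum>j\<in>J. - (t j)\<^sup>2 / 2))"
    by (simp add: exp_sum)
  finally show ?thesis
    by (simp add: sum_divide_distrib sum_negf)
qed

lemma gaussian_law_real:
  assumes "prob_space M" and [measurable]: "X \<in> borel_measurable M"
    and c: "\<And>t. (\<integral>x. cis (t * X x) \<partial>M) = complex_of_real (exp (- (s * t)\<^sup>2 / 2))"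
  shows "distr M borel X = distr std_gauss borel (\<lambda>z. s * z)"
proof (rule Levy_uniqueness)
  interpret prob_space M by fact
  show "real_distribution (distr M borel X)" by (rule real_distribution_distr) fact
  show "real_distribution (distr std_gauss borel (\<lambda>z. s * z))" by (rule sg.real_distribution_distr) simp
  show "char (distr M borel X) = char (distr std_gauss borel (\<lambda>z. s * z))"
  proof
    fix t
    have "(\<integral>z. cis (t * (s * z)) \<partial>std_gauss) = complex_of_real (exp (- (s * t)\<^sup>2 / 2))"
    proof -
      have "t * (s * z) = (s * t) * z" for z by simp
      then show ?thesis using std_gauss_cis[of "s * t"] by (simp only:)
    qed
    moreover have "char (distr M borel X) t = (\<integral>x. cis (t * X x) \<partial>M)"
      unfolding char_eq_cis by (rule integral_distr[OF assms(2)]) measurable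
    moreover have "char (distr std_gauss borel (\<lambda>z. s * z)) t = (\<integral>z. cis (t * (s * z)) \<partial>std_gauss)"
      unfolding char_eq_cis by (intro integral_distr) auto
    ultimately show "char (distr M borel X) t = char (distr std_gauss borel (\<lambda>z. s * z)) t"
      by (simp only: c)
  qed
qed

section \<open>A law in several variables is determined by its characteristic function\<close>

lemma sets_PiM_borel_atMost:
  assumes [simp]: "finite I"
  shows "sets (PiM I (\<lambda>_. borel :: real measure))
       = sigma_sets (\<Pi>\<^sub>E i\<in>I. UNIV) (range (\<lambda>a. (\<Pi>\<^sub>E i\<in>I. {..a i})))"
proof -
  let ?E = "range (\<lambda>a. {..a::real})"
  have "sets (PiM I (\<lambda>_. borel :: real measure)) = sets (PiM I (\<lambda>_. sigma UNIV ?E))"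
    by (subst borel_eq_atMost) simp
  also have "\<dots> = sets (sigma (\<Pi>\<^sub>E i\<in>I. UNIV) {{f\<in>(\<Pi>\<^sub>E i\<in>I. UNIV). \<forall>i\<in>j. f i \<in> A i} | A j. j \<in> {I} \<and> A \<in> Pi j (\<lambda>_. ?E)})"
  proof (rule sets_PiM_sigma)
    show "\<exists>S\<subseteq>?E. countable S \<and> UNIV = \<Union>S" for i
    proof (intro exI conjI)
      show "range (\<lambda>n::nat. {..real n}) \<subseteq> ?E" by auto
      show "(UNIV :: real set) = \<Union> (range (\<lambda>n::nat. {..real n}))"
        by (auto simp: real_arch_simple)
    qed auto
  qed auto
  also have "{{f\<in>(\<Pi>\<^sub>E i\<in>I. UNIV). \<forall>i\<in>j. f i \<in> A i} | A j. j \<in> {I} \<and> A \<in> Pi j (\<lambda>_. ?E)}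
      = range (\<lambda>a. (\<Pi>\<^sub>E i\<in>I. {..a i}))" (is "?L = ?R")
  proof safe
    fix A assume A: "A \<in> Pi I (\<lambda>_. ?E)"
    then have "\<forall>i\<in>I. \<exists>a. A i = {..a}" by auto
    then obtain a where "\<forall>i\<in>I. A i = {..a i}" by metis
    then show "{f \<in> \<Pi>\<^sub>E i\<in>I. UNIV. \<forall>i\<in>I. f i \<in> A i} \<in> ?R"
      by (intro image_eqI[where x=a]) (auto simp: PiE_def extensional_def)
  next
    fix a :: "'a \<Rightarrow> real"
    show "\<exists>A j. (\<Pi>\<^sub>E i\<in>I. {..a i}) = {f\<in>(\<Pi>\<^sub>E i\<in>I. UNIV). \<forall>i\<in>j. f i \<in> A i} \<and> j \<in> {I} \<and> A \<in> Pi j (\<lambda>_. ?E)"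
      by (intro exI[of _ "\<lambda>i. {..a i}"] exI[of _ I]) (auto simp: PiE_def extensional_def)
  qed
  finally show ?thesis
    by (subst (asm) sets_measure_of) auto
qed

text \<open>Smoothing by a Gaussian of standard deviation \<open>1/n\<close> turns the characteristic function into a
  density, and the smoothed mass of an orthant tends to its mass if the corner is shifted by
  \<open>1/sqrt n\<close>.\<close>

lemma normal_density_eq_cis:
  assumes e: "e > 0"
  shows "complex_of_real (normal_density x e w)
       = complex_of_real (1 / sqrt (2 * pi * e\<^sup>2)) * (\<integral>s. cis (((w - x) / e) * s) \<partial>std_gauss)"
  by (subst std_gauss_cis) (use e in \<open>simp add: normal_density_def power_divide flip: of_real_mult\<close>)

definition bump :: "'i set \<Rightarrow> real \<Rightarrow> ('i \<Rightarrow> real) \<Rightarrow> ('i \<Rightarrow> real) \<Rightarrow> real" where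
  "bump I e w x = (\<Prod>i\<in>I. normal_density (x i) e (w i))"

lemma bump_nonneg: "bump I e w x \<ge> 0"
  by (simp add: bump_def prod_nonneg)

lemma borel_measurable_normal_density' [measurable (raw)]:
  assumes [measurable]: "f \<in> borel_measurable M" "g \<in> borel_measurable M"
  shows "(\<lambda>x. normal_density (f x) e (g x)) \<in> borel_measurable M"
  unfolding normal_density_def by (intro borel_measurable_times borel_measurable_const borel_measurable_exp
    borel_measurable_divide borel_measurable_uminus borel_measurable_power borel_measurable_diff assms measurable_compose[OF _ borel_measurable_exp])

text \<open>By Fubini the Gaussian frequency s is integrated last, so \<open>X\<close> enters only
  through its characteristic function at -s/e. Vectors with the same characteristic function
  therefore have the same smoothed density.\<close>

lemma bump_charfun:
  assumes [simp]: "finite I" and e: "e > 0" and "prob_space M" and X [measurable]: "X \<in> measurable M (PiM I (\<lambda>_. borel))"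
  shows "complex_of_real (\<integral>x. bump I e w (X x) \<partial>M) =
    complex_of_real ((1 / sqrt (2 * pi * e\<^sup>2)) ^ card I) *
     (\<integral>s. cis (\<Sum>i\<in>I. w i / e * s i) * (\<integral>x. cis (\<Sum>i\<in>I. (- s i / e) * X x i) \<partial>M) \<partial>gprod I)"
proof -
  interpret prob_space M by fact
  interpret g: prob_space "gprod I" by (rule prob_space_gprod)
  interpret P: pair_prob_space "gprod I" M ..
  have "complex_of_real (bump I e w y) = complex_of_real ((1 / sqrt (2 * pi * e\<^sup>2)) ^ card I) *
     (\<integral>s. cis (\<Sum>i\<in>I. ((w i - y i) / e) * s i) \<partial>gprod I)" for y
  proof -
    have "(\<integral>s. cis (\<Sum>i\<in>I. ((w i - y i) / e) * s i) \<partial>gprod I)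
        = (\<Prod>i\<in>I. \<integral>s. cis (((w i - y i) / e) * s) \<partial>std_gauss)"
      unfolding gprod_def cis_sum by (subst sgp.product_integral_prod) auto
    then show ?thesis
      unfolding bump_def of_real_prod normal_density_eq_cis[OF e] prod.distrib by simp
  qed
  then have "(\<integral>x. complex_of_real (bump I e w (X x)) \<partial>M) =
    complex_of_real ((1 / sqrt (2 * pi * e\<^sup>2)) ^ card I) *
     (\<integral>x. (\<integral>s. cis (\<Sum>i\<in>I. ((w i - X x i) / e) * s i) \<partial>gprod I) \<partial>M)"
    by simp
  also have "(\<integral>x. (\<integral>s. cis (\<Sum>i\<in>I. ((w i - X x i) / e) * s i) \<partial>gprod I) \<partial>M)
     = (\<integral>s. (\<integral>x. cis (\<Sum>i\<in>I. ((w i - X x i) / e) * s i) \<partial>M) \<partial>gprod I)"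
  proof (rule P.Fubini_integral)
    show "integrable (gprod I \<Otimes>\<^sub>M M) (\<lambda>(s, x). cis (\<Sum>i\<in>I. ((w i - X x i) / e) * s i))"
      unfolding case_prod_beta' by (rule P.integrable_cis) measurable
  qed
  also have "\<dots> = (\<integral>s. cis (\<Sum>i\<in>I. w i / e * s i) * (\<integral>x. cis (\<Sum>i\<in>I. (- s i / e) * X x i) \<partial>M) \<partial>gprod I)"
  proof (rule Bochner_Integration.integral_cong[OF refl])
    fix s
    have "cis (\<Sum>i\<in>I. ((w i - X x i) / e) * s i)
        = cis (\<Sum>i\<in>I. w i / e * s i) * cis (\<Sum>i\<in>I. (- s i / e) * X x i)" for x
    proof -
      have "(\<Sum>i\<in>I. ((w i - X x i) / e) * s i) = (\<Sum>i\<in>I. w i / e * s i) + (\<Sum>i\<in>I. (- s i / e) * X x i)"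
        unfolding sum.distrib[symmetric] by (rule sum.cong) (auto simp: field_simps diff_divide_distrib)
      then show ?thesis by (simp only: cis_mult)
    qed
    then show "(\<integral>x. cis (\<Sum>i\<in>I. ((w i - X x i) / e) * s i) \<partial>M)
        = cis (\<Sum>i\<in>I. w i / e * s i) * (\<integral>x. cis (\<Sum>i\<in>I. (- s i / e) * X x i) \<partial>M)"
      by simp
  qed
  finally show ?thesis by simp
qed

lemma normal_measure_atMost:
  assumes e: "e > 0"
  shows "(\<integral>\<^sup>+w. ennreal (normal_density x e w) * indicator {..b} w \<partial>lborel) = emeasure std_gauss {..(b - x) / e}"
proof -
  have "(\<integral>\<^sup>+w. ennreal (normal_density x e w) * indicator {..b} w \<partial>lborel)
     = \<bar>e\<bar> * (\<integral>\<^sup>+z. ennreal (normal_density x e (x + e * z)) * indicator {..b} (x + e * z) \<partial>lborel)"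
    using e by (subst nn_integral_real_affine[where c=e and t=x]) auto
  also have "\<dots> = (\<integral>\<^sup>+z. ennreal e * (ennreal (normal_density x e (x + e * z)) * indicator {..b} (x + e * z)) \<partial>lborel)"
    using e by (subst nn_integral_cmult) auto
  also have "\<dots> = (\<integral>\<^sup>+z. ennreal (std_normal_density z) * indicator {..(b - x) / e} z \<partial>lborel)"
  proof (rule nn_integral_cong)
    fix z
    have "e * normal_density x e (x + e * z) = std_normal_density z"
      using e by (simp add: normal_density_def real_sqrt_mult power_mult_distrib field_simps)
    moreover have "x + e * z \<le> b \<longleftrightarrow> z \<le> (b - x) / e" using e by (simp add: field_simps)
    ultimately show "ennreal e * (ennreal (normal_density x e (x + e * z)) * indicator {..b} (x + e * z))
       = ennreal (std_normal_density z) * indicator {..(b - x) / e} z"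
      using e by (auto simp: indicator_def simp flip: ennreal_mult)
  qed
  also have "\<dots> = emeasure std_gauss {..(b - x) / e}"
    unfolding std_gauss_def by (subst emeasure_density) auto
  finally show ?thesis .
qed

text \<open>Exchanging the integrals over \<open>w\<close> and \<open>x\<close> turns the smoothed
  mass of an orthant into the expectation of a product of one-dimensional Gaussian probabilities, a
  form in which the limit is easy. Nonnegative integrals justify the exchange although Lebesgue
  measure is infinite.\<close>

lemma bump_orthant:
  assumes [simp]: "finite I" and e: "e > 0" and "prob_space M" and X [measurable]: "X \<in> measurable M (PiM I (\<lambda>_. borel))"
  shows "(\<integral>\<^sup>+w. ennreal (\<integral>x. bump I e w (X x) \<partial>M) * (\<Prod>i\<in>I. indicator {..b i} (w i)) \<partial>PiM I (\<lambda>_. lborel))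
       = (\<integral>\<^sup>+x. (\<Prod>i\<in>I. emeasure std_gauss {..(b i - X x i) / e}) \<partial>M)"
proof -
  interpret prob_space M by fact
  interpret L: product_sigma_finite "\<lambda>_. lborel :: real measure" by standard
  interpret LI: sigma_finite_measure "PiM I (\<lambda>_. lborel :: real measure)" by (rule L.sigma_finite) simp
  interpret P: pair_sigma_finite M "PiM I (\<lambda>_. lborel :: real measure)" ..
  have bd: "normal_density x e w \<le> 1 / sqrt (2 * pi * e\<^sup>2)" for x w
  proof -
    have "exp (- (w - x)\<^sup>2 / (2 * e\<^sup>2)) \<le> 1" using e by simp
    then show ?thesis unfolding normal_density_def
      using mult_left_mono[of _ 1 "1 / sqrt (2 * pi * e\<^sup>2)"] by simp
  qed
  have mb [measurable]: "(\<lambda>x. bump I e w (X x)) \<in> borel_measurable M" for w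
    unfolding bump_def by measurable
  have int: "integrable M (\<lambda>x. bump I e w (X x))" for w
  proof (rule integrable_const_bound[where B="(1 / sqrt (2 * pi * e\<^sup>2)) ^ card I"])
    show "AE x in M. norm (bump I e w (X x)) \<le> (1 / sqrt (2 * pi * e\<^sup>2)) ^ card I"
    proof (rule AE_I2)
      fix x
      have "(\<Prod>i\<in>I. normal_density (X x i) e (w i)) \<le> (\<Prod>i\<in>I. 1 / sqrt (2 * pi * e\<^sup>2))"
        by (rule prod_mono) (simp only: bd normal_density_nonneg simp_thms)
      then have "bump I e w (X x) \<le> (1 / sqrt (2 * pi * e\<^sup>2)) ^ card I"
        by (simp only: bump_def prod_constant)
      then show "norm (bump I e w (X x)) \<le> (1 / sqrt (2 * pi * e\<^sup>2)) ^ card I"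
        by (simp only: real_norm_def abs_of_nonneg[OF bump_nonneg])
    qed
  qed (rule mb)
  have "(\<integral>\<^sup>+w. ennreal (\<integral>x. bump I e w (X x) \<partial>M) * (\<Prod>i\<in>I. indicator {..b i} (w i)) \<partial>PiM I (\<lambda>_. lborel))
     = (\<integral>\<^sup>+w. (\<integral>\<^sup>+x. ennreal (bump I e w (X x)) * (\<Prod>i\<in>I. indicator {..b i} (w i)) \<partial>M) \<partial>PiM I (\<lambda>_. lborel))"
  proof (rule nn_integral_cong)
    fix w
    have "(\<integral>\<^sup>+x. ennreal (bump I e w (X x)) * (\<Prod>i\<in>I. indicator {..b i} (w i)) \<partial>M)
      = (\<integral>\<^sup>+x. ennreal (bump I e w (X x)) \<partial>M) * (\<Prod>i\<in>I. indicator {..b i} (w i))"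
      by (rule nn_integral_multc[OF measurable_compose[OF mb measurable_ennreal]])
    also have "(\<integral>\<^sup>+x. ennreal (bump I e w (X x)) \<partial>M) = ennreal (\<integral>x. bump I e w (X x) \<partial>M)"
      by (rule nn_integral_eq_integral[OF int]) (simp add: bump_nonneg)
    finally show "ennreal (\<integral>x. bump I e w (X x) \<partial>M) * (\<Prod>i\<in>I. indicator {..b i} (w i))
      = (\<integral>\<^sup>+x. ennreal (bump I e w (X x)) * (\<Prod>i\<in>I. indicator {..b i} (w i)) \<partial>M)" ..
  qed
  also have "\<dots> = (\<integral>\<^sup>+x. (\<integral>\<^sup>+w. ennreal (bump I e w (X x)) * (\<Prod>i\<in>I. indicator {..b i} (w i)) \<partial>PiM I (\<lambda>_. lborel)) \<partial>M)"
    unfolding bump_def by (rule P.Fubini') measurable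
  also have "\<dots> = (\<integral>\<^sup>+x. (\<Prod>i\<in>I. emeasure std_gauss {..(b i - X x i) / e}) \<partial>M)"
  proof (rule nn_integral_cong)
    fix x
    have "(\<integral>\<^sup>+w. ennreal (bump I e w (X x)) * (\<Prod>i\<in>I. indicator {..b i} (w i)) \<partial>PiM I (\<lambda>_. lborel))
      = (\<integral>\<^sup>+w. (\<Prod>i\<in>I. ennreal (normal_density (X x i) e (w i)) * indicator {..b i} (w i)) \<partial>PiM I (\<lambda>_. lborel))"
      by (simp add: bump_def prod.distrib prod_ennreal)
    also have "\<dots> = (\<Prod>i\<in>I. emeasure std_gauss {..(b i - X x i) / e})"
      by (subst L.product_nn_integral_prod) (auto simp: normal_measure_atMost[OF e])
    finally show "(\<integral>\<^sup>+w. ennreal (bump I e w (X x)) * (\<Prod>i\<in>I. indicator {..b i} (w i)) \<partial>PiM I (\<lambda>_. lborel))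
      = (\<Prod>i\<in>I. emeasure std_gauss {..(b i - X x i) / e})" .
  qed
  finally show ?thesis .
qed

text \<open>The shift 1/sqrt(n+1) is much larger than the smoothing width 1/(n+1), so a point on the
  boundary of the closed orthant keeps its full weight. The shift still tends to 0, so a point
  outside loses its weight. No continuity of the distribution function has to be discussed.\<close>

lemma smoothed_orthant_limit:
  assumes [simp]: "finite I" and "prob_space M" and X [measurable]: "X \<in> measurable M (PiM I (\<lambda>_. borel))"
  shows "(\<lambda>n. \<integral>x. (\<Prod>i\<in>I. measure std_gauss {..(b i + 1 / sqrt (real (Suc n)) - X x i) * real (Suc n)}) \<partial>M)
      \<longlonglongrightarrow> measure (distr M (PiM I (\<lambda>_. borel)) X) (\<Pi>\<^sub>E i\<in>I. {..b i})"
proof -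
  interpret prob_space M by fact
  interpret G: real_distribution std_gauss by standard auto
  define F where "F n y = measure std_gauss {..y * real (Suc n)}" for n y
  have Fm [measurable]: "F n \<in> borel_measurable borel" for n
    by (intro borel_measurable_mono monoI) (auto simp: F_def intro!: sg.finite_measure_mono mult_right_mono)
  have lim: "(\<lambda>n. F n (c + 1 / sqrt (real (Suc n)))) \<longlonglongrightarrow> (if 0 \<le> c then 1 else 0)" for c
  proof (cases "0 \<le> c")
    case True
    have "filterlim (\<lambda>n. sqrt (real (Suc n))) at_top sequentially"
      by (rule filterlim_compose[OF sqrt_at_top], rule filterlim_compose[OF filterlim_real_sequentially filterlim_Suc])
    moreover have "sqrt (real (Suc n)) \<le> (c + 1 / sqrt (real (Suc n))) * real (Suc n)" for n
    proof -
      have "(c + 1 / sqrt (real (Suc n))) * real (Suc n) = c * real (Suc n) + real (Suc n) / sqrt (real (Suc n))"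
        by (simp add: distrib_right)
      then show ?thesis using True by (simp add: real_div_sqrt)
    qed
    ultimately have "filterlim (\<lambda>n. (c + 1 / sqrt (real (Suc n))) * real (Suc n)) at_top sequentially"
      by (rule filterlim_at_top_mono[OF _ always_eventually, OF _ allI])
    from filterlim_compose[OF G.cdf_lim_at_top_prob this] show ?thesis
      using True by (simp add: F_def cdf_def)
  next
    case False
    then have c: "c < 0" by simp
    have t: "(\<lambda>n. c + 1 / sqrt (real (Suc n))) \<longlonglongrightarrow> c + 0"
      by (intro tendsto_add tendsto_const tendsto_divide_0[OF tendsto_const] filterlim_at_top_imp_at_infinity)
         (rule filterlim_compose[OF sqrt_at_top], rule filterlim_compose[OF filterlim_real_sequentially filterlim_Suc])
    have u: "filterlim (\<lambda>n. real (Suc n)) at_top sequentially"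
      by (rule filterlim_compose[OF filterlim_real_sequentially filterlim_Suc])
    have "filterlim (\<lambda>n. (c + 1 / sqrt (real (Suc n))) * real (Suc n)) at_bot sequentially"
      by (rule filterlim_tendsto_neg_mult_at_bot[OF t _ u]) (use c in simp)
    from filterlim_compose[OF G.cdf_lim_at_bot this] show ?thesis
      using False by (simp add: F_def cdf_def)
  qed
  have l: "AE x in M. (\<lambda>n. \<Prod>i\<in>I. F n (b i - X x i + 1 / sqrt (real (Suc n))))
        \<longlonglongrightarrow> (\<Prod>i\<in>I. if 0 \<le> b i - X x i then 1 else 0)"
    by (intro AE_I2 tendsto_prod lim)
  have d: "AE x in M. norm (\<Prod>i\<in>I. F n (b i - X x i + 1 / sqrt (real (Suc n)))) \<le> 1" for n
    by (intro AE_I2) (auto simp: F_def abs_prod intro!: prod_le_1)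
  have "(\<lambda>n. \<integral>x. (\<Prod>i\<in>I. F n (b i - X x i + 1 / sqrt (real (Suc n)))) \<partial>M)
     \<longlonglongrightarrow> (\<integral>x. (\<Prod>i\<in>I. if 0 \<le> b i - X x i then 1 else 0) \<partial>M)"
    by (rule integral_dominated_convergence[OF _ _ _ l d]) auto
  also have "(\<lambda>x. (\<Prod>i\<in>I. if 0 \<le> b i - X x i then 1 else 0 :: real)) = (\<lambda>x. of_bool (\<forall>i\<in>I. X x i \<le> b i))"
    by (rule ext) (auto simp: of_bool_def intro!: prod.neutral)
  also have "(\<integral>x. (of_bool (\<forall>i\<in>I. X x i \<le> b i) :: real) \<partial>M) = (\<integral>x. indicator (\<Pi>\<^sub>E i\<in>I. {..b i}) (X x) \<partial>M)"
  proof (rule Bochner_Integration.integral_cong[OF refl])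
    fix x assume "x \<in> space M"
    then have "X x \<in> space (PiM I (\<lambda>_. borel))" using X by (rule measurable_space[rotated])
    then show "of_bool (\<forall>i\<in>I. X x i \<le> b i) = (indicator (\<Pi>\<^sub>E i\<in>I. {..b i}) (X x) :: real)"
      by (auto simp: indicator_def space_PiM PiE_def)
  qed
  also have "\<dots> = measure (distr M (PiM I (\<lambda>_. borel)) X) (\<Pi>\<^sub>E i\<in>I. {..b i})"
  proof -
    have A: "(\<Pi>\<^sub>E i\<in>I. {..b i}) \<in> sets (PiM I (\<lambda>_. borel))"
      by (intro sets_PiM_I_finite) auto
    have "(\<integral>x. (indicator (\<Pi>\<^sub>E i\<in>I. {..b i}) (X x) :: real) \<partial>M)
       = (\<integral>y. indicator (\<Pi>\<^sub>E i\<in>I. {..b i}) y \<partial>distr M (PiM I (\<lambda>_. borel)) X)"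
      using A by (intro integral_distr[symmetric] X borel_measurable_indicator)
    also have "\<dots> = measure (distr M (PiM I (\<lambda>_. borel)) X) ((\<Pi>\<^sub>E i\<in>I. {..b i}) \<inter> space (distr M (PiM I (\<lambda>_. borel)) X))"
      by (rule Bochner_Integration.integral_indicator)
    finally show ?thesis
      using sets.sets_into_space[OF A] by (simp add: Int_absorb2)
  qed
  finally show ?thesis unfolding F_def by (simp add: algebra_simps)
qed

text \<open>Closed orthants are stable under intersection and generate the product sigma-algebra, so
  it suffices to compare their masses, which are limits of smoothed masses.\<close>

theorem charfun_unique:
  assumes fI [simp]: "finite I" and "prob_space M" "prob_space M'"
    and X [measurable]: "X \<in> measurable M (PiM I (\<lambda>_. borel))"
    and Y [measurable]: "Y \<in> measurable M' (PiM I (\<lambda>_. borel))"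
    and eq: "\<And>t. (\<integral>x. cis (\<Sum>i\<in>I. t i * X x i) \<partial>M) = (\<integral>x. cis (\<Sum>i\<in>I. t i * Y x i) \<partial>M')"
  shows "distr M (PiM I (\<lambda>_. borel)) X = distr M' (PiM I (\<lambda>_. borel)) Y"
proof -
  interpret M: prob_space M by fact
  interpret M': prob_space M' by fact
  interpret DX: prob_space "distr M (PiM I (\<lambda>_. borel)) X" by (rule M.prob_space_distr) fact
  interpret DY: prob_space "distr M' (PiM I (\<lambda>_. borel)) Y" by (rule M'.prob_space_distr) fact
  interpret G: real_distribution std_gauss by standard auto
  have b: "(\<integral>x. bump I e w (X x) \<partial>M) = (\<integral>x. bump I e w (Y x) \<partial>M')" if "e > 0" for e w
    using bump_charfun[OF fI that \<open>prob_space M\<close> X, of w] bump_charfun[OF fI that \<open>prob_space M'\<close> Y, of w] eq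
    by (simp only: eq flip: of_real_eq_iff[where 'a=complex])
  have o: "(\<integral>\<^sup>+x. (\<Prod>i\<in>I. emeasure std_gauss {..(b i - X x i) / e}) \<partial>M)
      = (\<integral>\<^sup>+x. (\<Prod>i\<in>I. emeasure std_gauss {..(b i - Y x i) / e}) \<partial>M')" if "e > 0" for e b
    unfolding bump_orthant[OF fI that \<open>prob_space M\<close> X, symmetric] bump_orthant[OF fI that \<open>prob_space M'\<close> Y, symmetric]
    by (simp add: b[OF that])
  have mm [measurable]: "(\<lambda>y. measure std_gauss {..(c - y) / e}) \<in> borel_measurable borel" if "e > 0" for c e :: real
  proof -
    have "(\<lambda>y. - measure std_gauss {..(c - y) / e}) \<in> borel_measurable borel"
      using that by (intro borel_measurable_mono monoI) (auto intro!: sg.finite_measure_mono simp: divide_right_mono)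
    then show ?thesis by (simp only: borel_measurable_uminus_eq)
  qed
  have conv: "(\<integral>x. (\<Prod>i\<in>I. measure std_gauss {..(b i - Z x i) / e}) \<partial>Q)
     = enn2real (\<integral>\<^sup>+x. (\<Prod>i\<in>I. emeasure std_gauss {..(b i - Z x i) / e}) \<partial>Q)"
    if [measurable]: "Z \<in> measurable Q (PiM I (\<lambda>_. borel))" and "e > 0" for Z e b and Q :: "'z measure"
  proof -
    have "(\<lambda>x. \<Prod>i\<in>I. measure std_gauss {..(b i - Z x i) / e}) \<in> borel_measurable Q"
      by (intro borel_measurable_prod measurable_compose[OF _ mm[OF that(2)]]) measurable
    then show ?thesis
      by (subst integral_eq_nn_integral) (auto simp: prod_nonneg sg.emeasure_eq_measure prod_ennreal)
  qed
  have r: "(\<integral>x. (\<Prod>i\<in>I. measure std_gauss {..(b i - X x i) / e}) \<partial>M)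
      = (\<integral>x. (\<Prod>i\<in>I. measure std_gauss {..(b i - Y x i) / e}) \<partial>M')" if "e > 0" for e b
    unfolding conv[OF X that] conv[OF Y that] o[OF that] ..
  have m: "measure (distr M (PiM I (\<lambda>_. borel)) X) (\<Pi>\<^sub>E i\<in>I. {..b i})
         = measure (distr M' (PiM I (\<lambda>_. borel)) Y) (\<Pi>\<^sub>E i\<in>I. {..b i})" for b
  proof (rule LIMSEQ_unique[OF smoothed_orthant_limit[OF fI \<open>prob_space M\<close> X]])
    have "(\<integral>x. (\<Prod>i\<in>I. measure std_gauss {..(b i + 1 / sqrt (real (Suc n)) - X x i) * real (Suc n)}) \<partial>M)
      = (\<integral>x. (\<Prod>i\<in>I. measure std_gauss {..(b i + 1 / sqrt (real (Suc n)) - Y x i) * real (Suc n)}) \<partial>M')" for n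
      using r[of "1 / real (Suc n)" "\<lambda>i. b i + 1 / sqrt (real (Suc n))"] by simp
    then show "(\<lambda>n. \<integral>x. (\<Prod>i\<in>I. measure std_gauss {..(b i + 1 / sqrt (real (Suc n)) - X x i) * real (Suc n)}) \<partial>M)
      \<longlonglongrightarrow> measure (distr M' (PiM I (\<lambda>_. borel)) Y) (\<Pi>\<^sub>E i\<in>I. {..b i})"
      using smoothed_orthant_limit[OF fI \<open>prob_space M'\<close> Y] by simp
  qed
  show ?thesis
  proof (rule measure_eqI_generator_eq)
    let ?E = "range (\<lambda>a. (\<Pi>\<^sub>E i\<in>I. {..a i :: real}))"
    show "Int_stable ?E"
    proof (rule Int_stableI_image)
      fix a b :: "'a \<Rightarrow> real"
      show "\<exists>c\<in>UNIV. (\<Pi>\<^sub>E i\<in>I. {..a i}) \<inter> (\<Pi>\<^sub>E i\<in>I. {..b i}) = (\<Pi>\<^sub>E i\<in>I. {..c i})"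
        by (rule bexI[of _ "\<lambda>i. min (a i) (b i)"]) (auto simp: PiE_def)
    qed
    show "?E \<subseteq> Pow (\<Pi>\<^sub>E i\<in>I. UNIV)" by (auto simp: PiE_def)
    show "sets (distr M (PiM I (\<lambda>_. borel)) X) = sigma_sets (\<Pi>\<^sub>E i\<in>I. UNIV) ?E"
      "sets (distr M' (PiM I (\<lambda>_. borel)) Y) = sigma_sets (\<Pi>\<^sub>E i\<in>I. UNIV) ?E"
      by (simp_all add: sets_PiM_borel_atMost)
    show "range (\<lambda>n::nat. (\<Pi>\<^sub>E i\<in>I. {..real n})) \<subseteq> ?E" by auto
    show "(\<Union>n::nat. (\<Pi>\<^sub>E i\<in>I. {..real n})) = (\<Pi>\<^sub>E i\<in>I. UNIV)"
    proof safe
      fix x :: "'a \<Rightarrow> real" assume x: "x \<in> (\<Pi>\<^sub>E i\<in>I. UNIV)"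
      obtain n :: nat where n: "(\<Sum>i\<in>I. \<bar>x i\<bar>) \<le> real n" using real_arch_simple by blast
      have "x i \<le> real n" if "i \<in> I" for i
        using member_le_sum[of i I "\<lambda>i. \<bar>x i\<bar>"] that n by force
      then show "x \<in> (\<Union>n::nat. (\<Pi>\<^sub>E i\<in>I. {..real n}))" using x by (auto simp: PiE_def)
    qed auto
    show "emeasure (distr M (PiM I (\<lambda>_. borel)) X) (\<Pi>\<^sub>E i\<in>I. {..real n}) \<noteq> \<infinity>" for n :: nat
      by simp
    show "emeasure (distr M (PiM I (\<lambda>_. borel)) X) A = emeasure (distr M' (PiM I (\<lambda>_. borel)) Y) A" if "A \<in> ?E" for A
      using that m by (auto simp: DX.emeasure_eq_measure DY.emeasure_eq_measure)
  qed
qed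

lemma gaussian_law_gprod:
  assumes [simp]: "finite I" and "prob_space M" and X: "X \<in> measurable M (PiM I (\<lambda>_. borel))"
    and c: "\<And>t. (\<integral>x. cis (\<Sum>i\<in>I. t i * X x i) \<partial>M) = complex_of_real (exp (- (\<Sum>i\<in>I. (t i)\<^sup>2) / 2))"
  shows "distr M (PiM I (\<lambda>_. borel)) X = gprod I"
proof -
  have "distr M (PiM I (\<lambda>_. borel)) X = distr (gprod I) (PiM I (\<lambda>_. borel)) (\<lambda>x. x)"
    by (rule charfun_unique) (auto simp: assms prob_space_gprod gprod_cis X)
  also have "\<dots> = gprod I" by (rule distr_id2) simp
  finally show ?thesis .
qed

text \<open>Density times tanh tends to 0 at both ends, and its derivative is the density times the
  difference of the two integrands. The identity is the origin of the factor 1 - q in the limit of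
  the inner products of m with \<zeta>.\<close>

lemma std_gauss_ibp_tanh:
  "(\<integral>z. z * tanh (a + b * z) \<partial>std_gauss) = b * (\<integral>z. 1 - (tanh (a + b * z))\<^sup>2 \<partial>std_gauss)"
proof -
  have bt: "\<bar>tanh (x::real)\<bar> \<le> 1" for x
    using tanh_real_lt_1[of x] tanh_real_gt_neg1[of x] by linarith
  have m [measurable]: "(\<lambda>x::real. tanh x) \<in> borel_measurable borel"
    by (intro borel_measurable_continuous_onI continuous_intros) (auto simp: cosh_real_nonzero)
  have i1: "integrable std_gauss (\<lambda>z. z * tanh (a + b * z))"
  proof (rule Bochner_Integration.integrable_bound[OF std_gauss_integrable_id])
    show "AE z in std_gauss. norm (z * tanh (a + b * z)) \<le> norm z"
      using bt by (auto simp: abs_mult intro!: mult_left_le)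
  qed measurable
  have i2: "integrable std_gauss (\<lambda>z. 1 - (tanh (a + b * z))\<^sup>2)"
  proof (rule sg.integrable_const_bound[where B=1])
    show "AE z in std_gauss. norm (1 - (tanh (a + b * z))\<^sup>2) \<le> 1"
      using bt by (auto simp: abs_square_le_1)
  qed measurable
  have i3: "integrable std_gauss (\<lambda>z. b * (1 - (tanh (a + b * z))\<^sup>2) - z * tanh (a + b * z))"
    using i1 i2 by auto
  let ?f = "\<lambda>z. std_normal_density z * (b * (1 - (tanh (a + b * z))\<^sup>2) - z * tanh (a + b * z))"
  let ?F = "\<lambda>z. std_normal_density z * tanh (a + b * z)"
  have i4: "integrable lborel ?f"
    using i3 unfolding std_gauss_def by (subst (asm) integrable_density) auto
  have d: "(std_normal_density has_real_derivative (- z * std_normal_density z)) (at z)" for z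
    unfolding std_normal_density_def
    by (rule derivative_eq_intros refl | simp)+
  have dF: "(?F has_real_derivative ?f z) (at z)" for z
    by (auto intro!: derivative_eq_intros d simp: cosh_real_nonzero algebra_simps)
  have lim0: "(std_normal_density \<longlongrightarrow> 0) at_top" "(std_normal_density \<longlongrightarrow> 0) at_bot"
  proof -
    have "filterlim (\<lambda>x::real. (1/2) * x ^ 2) at_top at_top"
      by (rule filterlim_tendsto_pos_mult_at_top[OF tendsto_const]) (auto intro!: filterlim_pow_at_top filterlim_ident)
    then have "filterlim (\<lambda>x::real. - ((1/2) * x ^ 2)) at_bot at_top"
      unfolding filterlim_uminus_at_bot by simp
    from filterlim_compose[OF exp_at_bot this]
    have t: "((\<lambda>x::real. exp (- x\<^sup>2 / 2)) \<longlongrightarrow> 0) at_top" by simp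
    have "((\<lambda>x::real. exp (- x\<^sup>2 / 2)) \<longlongrightarrow> 0) at_bot"
      using t by (simp add: filterlim_at_bot_mirror)
    with t show "(std_normal_density \<longlongrightarrow> 0) at_top" "(std_normal_density \<longlongrightarrow> 0) at_bot"
      unfolding std_normal_density_def by (auto intro: tendsto_divide_zero)
  qed
  have lim: "(?F \<longlongrightarrow> 0) at_top" "(?F \<longlongrightarrow> 0) at_bot"
    by (rule Lim_null_comparison[OF _ lim0(1)] Lim_null_comparison[OF _ lim0(2)];
        auto simp: abs_mult intro!: always_eventually mult_left_le bt)+
  have "(LBINT z=-\<infinity>..\<infinity>. ?f z) = 0 - 0"
  proof (rule interval_integral_FTC_integrable)
    show "(?F has_vector_derivative ?f z) (at z)" for z
      using dF by (simp add: has_real_derivative_iff_has_vector_derivative)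
    show "isCont ?f z" for z
      unfolding std_normal_density_def by (intro continuous_intros) (auto simp: cosh_real_nonzero)
    show "set_integrable lborel (einterval (-\<infinity>) \<infinity>) ?f"
      using i4 by (simp add: set_integrable_def)
    show "((?F \<circ> real_of_ereal) \<longlongrightarrow> 0) (at_right (- \<infinity>))"
      using lim(2) by (simp add: ereal_tendsto_simps)
    show "((?F \<circ> real_of_ereal) \<longlongrightarrow> 0) (at_left \<infinity>)"
      using lim(1) by (simp add: ereal_tendsto_simps)
  qed simp
  then have "(\<integral>z. ?f z \<partial>lborel) = 0"
    by (simp add: interval_lebesgue_integral_def set_lebesgue_integral_def)
  then have "(\<integral>z. b * (1 - (tanh (a + b * z))\<^sup>2) - z * tanh (a + b * z) \<partial>std_gauss) = 0"
    unfolding std_gauss_def by (subst integral_density) auto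
  then show ?thesis using i1 i2 by simp
qed

section \<open>The recursion for a fixed matrix\<close>

declare gmat.simps [simp del] phi.simps [simp del] xi.simps [simp del] eta.simps [simp del]
  zeta.simps [simp del] vh.simps [simp del] vm.simps [simp del]

section \<open>Algebra of the normalised inner product\<close>

lemma ip_commute: "ip N x y = ip N y x"
  by (simp add: ip_def mult.commute)

lemma ip_add_left: "ip N (\<lambda>i. x i + y i) z = ip N x z + ip N y z"
  by (simp add: ip_def distrib_right sum.distrib add_divide_distrib)

lemma ip_diff_left: "ip N (\<lambda>i. x i - y i) z = ip N x z - ip N y z"
  by (simp add: ip_def left_diff_distrib sum_subtractf diff_divide_distrib)

lemma ip_scale_left: "ip N (\<lambda>i. c * x i) z = c * ip N x z"
  by (simp add: ip_def sum_distrib_left mult.assoc)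

lemma ip_divide_left: "ip N (\<lambda>i. x i / c) z = ip N x z / c"
  using ip_scale_left[of N "1 / c" x z] by simp

lemma ip_zero_left [simp]: "ip N (\<lambda>_. 0) z = 0"
  by (simp add: ip_def)

lemma ip_sum_left: "ip N (\<lambda>i. \<Sum>s\<in>S. f s i) z = (\<Sum>s\<in>S. ip N (f s) z)"
  by (induction S rule: infinite_finite_induct) (auto simp: ip_add_left)

lemma ip_add_right: "ip N z (\<lambda>i. x i + y i) = ip N z x + ip N z y"
  by (subst (1 2 3) ip_commute) (rule ip_add_left)

lemma ip_diff_right: "ip N z (\<lambda>i. x i - y i) = ip N z x - ip N z y"
  by (subst (1 2 3) ip_commute) (rule ip_diff_left)

lemma ip_scale_right: "ip N z (\<lambda>i. c * x i) = c * ip N z x"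
  by (subst (1 2) ip_commute) (rule ip_scale_left)

lemma ip_divide_right: "ip N z (\<lambda>i. x i / c) = ip N z x / c"
  by (subst (1 2) ip_commute) (rule ip_divide_left)

lemma ip_zero_right [simp]: "ip N z (\<lambda>_. 0) = 0"
  by (simp add: ip_def)

lemma ip_sum_right: "ip N z (\<lambda>i. \<Sum>s\<in>S. f s i) = (\<Sum>s\<in>S. ip N z (f s))"
  by (subst ip_commute, subst ip_sum_left) (simp add: ip_commute)

lemma ip_cong: "(\<And>i. i \<in> {1..N} \<Longrightarrow> x i = x' i) \<Longrightarrow> (\<And>i. i \<in> {1..N} \<Longrightarrow> y i = y' i) \<Longrightarrow> ip N x y = ip N x' y'"
  unfolding ip_def by (intro arg_cong2[of _ _ _ _ "(/)"] sum.cong) auto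

lemma ip_self_nonneg [simp]: "ip N x x \<ge> 0"
  by (simp add: ip_def sum_nonneg)

lemma nrm_nonneg [simp]: "nrm N x \<ge> 0"
  by (simp add: nrm_def)

lemma nrm_sq: "(nrm N x)\<^sup>2 = ip N x x"
  by (simp add: nrm_def)

lemma ip_cauchy_schwarz: "(ip N x y)\<^sup>2 \<le> ip N x x * ip N y y"
proof -
  have "(\<Sum>i=1..N. x i * y i)\<^sup>2 \<le> (\<Sum>i=1..N. (x i)\<^sup>2) * (\<Sum>i=1..N. (y i)\<^sup>2)"
    by (rule Cauchy_Schwarz_ineq_sum)
  then have "(\<Sum>i=1..N. x i * y i)\<^sup>2 / (real N)\<^sup>2 \<le> ((\<Sum>i=1..N. (x i)\<^sup>2) * (\<Sum>i=1..N. (y i)\<^sup>2)) / (real N)\<^sup>2"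
    by (rule divide_right_mono) simp
  then show ?thesis
    unfolding ip_def power_divide times_divide_times_eq by (simp only: power2_eq_square)
qed

lemma abs_ip_le: "\<bar>ip N x y\<bar> \<le> nrm N x * nrm N y"
  using real_sqrt_le_mono[OF ip_cauchy_schwarz[of N x y]] by (simp add: nrm_def real_sqrt_mult)

lemma nrm_triangle: "nrm N (\<lambda>i. x i + y i) \<le> nrm N x + nrm N y"
proof (rule power2_le_imp_le)
  have "(nrm N (\<lambda>i. x i + y i))\<^sup>2 = (nrm N x)\<^sup>2 + 2 * ip N x y + (nrm N y)\<^sup>2"
    by (simp add: nrm_sq ip_add_left ip_add_right ip_commute[of N y x])
  then show "(nrm N (\<lambda>i. x i + y i))\<^sup>2 \<le> (nrm N x + nrm N y)\<^sup>2"
    using abs_ip_le[of N x y] by (simp add: power2_sum)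
qed simp

lemma nrm_scale: "nrm N (\<lambda>i. c * x i) = \<bar>c\<bar> * nrm N x"
  by (simp add: nrm_def ip_scale_left ip_scale_right real_sqrt_mult mult.assoc[symmetric])

lemma nrm_sum: "nrm N (\<lambda>i. \<Sum>s\<in>S. f s i) \<le> (\<Sum>s\<in>S. nrm N (f s))"
proof (induction S rule: infinite_finite_induct)
  case (insert s S)
  then show ?case using nrm_triangle[of N "f s" "\<lambda>i. \<Sum>s\<in>S. f s i"] by simp
qed (simp_all add: nrm_def)

section \<open>One-sided and two-sided projections of a matrix\<close>

definition lp :: "nat \<Rightarrow> vect \<Rightarrow> matr \<Rightarrow> matr" where
  "lp N p A = (\<lambda>i j. A i j - p i * (\<Sum>a=1..N. p a * A a j) / real N)"

definition rp :: "nat \<Rightarrow> vect \<Rightarrow> matr \<Rightarrow> matr" where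
  "rp N p A = (\<lambda>i j. A i j - (\<Sum>b=1..N. A i b * p b) * p j / real N)"

text \<open>If \<open>ip N p p = 1\<close>, then \<open>lp\<close> and \<open>rp\<close> multiply by
  the projection off \<open>p\<close> from the left and from the right. By \<open>gstep_alt\<close>
  their composition is the update of the recursion; the factored form is the one in which
  commutation and adjointness can be seen.\<close>

definition gstep :: "nat \<Rightarrow> vect \<Rightarrow> matr \<Rightarrow> matr" where
  "gstep N p A = lp N p (rp N p A)"

lemma sum_mat_swap:
  "(\<Sum>a=1..N. p a * (\<Sum>b=1..N. A a b * q b)) = (\<Sum>b=1..N. (\<Sum>a=1..N. p a * A a b) * q b)"
  for A :: matr
  unfolding sum_distrib_left sum_distrib_right by (subst sum.swap) (simp add: mult.assoc)

lemma sum_sub_right: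
  "(\<Sum>a\<in>I. p a * (X a - S a * c / d)) = (\<Sum>a\<in>I. p a * X a) - (\<Sum>a\<in>I. p a * S a) * c / (d::real)"
  by (simp add: right_diff_distrib sum_subtractf sum_distrib_right sum_divide_distrib mult.assoc)

lemma sum_sub_left:
  "(\<Sum>a\<in>I. (X a - c * S a / d) * q a) = (\<Sum>a\<in>I. X a * q a) - c * (\<Sum>a\<in>I. S a * q a) / (d::real)"
  by (simp add: left_diff_distrib sum_subtractf sum_distrib_left sum_divide_distrib mult.assoc)

lemma lp_rp_commute: "lp N p (rp N q A) = rp N q (lp N p A)"
proof (intro ext)
  fix i j
  let ?S = "\<Sum>a=1..N. p a * (\<Sum>b=1..N. A a b * q b)"
  have e1: "(\<Sum>a=1..N. p a * (A a j - (\<Sum>b=1..N. A a b * q b) * q j / real N))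
      = (\<Sum>a=1..N. p a * A a j) - ?S * q j / real N"
    by (rule sum_sub_right)
  have e2: "(\<Sum>b=1..N. (A i b - p i * (\<Sum>a=1..N. p a * A a b) / real N) * q b)
      = (\<Sum>b=1..N. A i b * q b) - p i * (\<Sum>b=1..N. (\<Sum>a=1..N. p a * A a b) * q b) / real N"
    by (rule sum_sub_left)
  show "lp N p (rp N q A) i j = rp N q (lp N p A) i j"
    unfolding lp_def rp_def e1 e2 sum_mat_swap[symmetric]
    by (simp add: diff_divide_distrib left_diff_distrib right_diff_distrib mult_ac)
qed

lemma gstep_alt: "gstep N p A = (\<lambda>i j. A i j - (tens N (mat_vec N A p) p i j + tens N p (mat_vec N (tr A) p) i j
    - ip N p (mat_vec N A p) * tens N p p i j))"
proof (intro ext)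
  fix i j
  have e1: "(\<Sum>a=1..N. p a * (A a j - (\<Sum>b=1..N. A a b * p b) * p j / real N))
      = (\<Sum>a=1..N. p a * A a j) - (\<Sum>a=1..N. p a * (\<Sum>b=1..N. A a b * p b)) * p j / real N"
    by (rule sum_sub_right)
  have e2: "(\<Sum>a=1..N. A a j * p a) = (\<Sum>a=1..N. p a * A a j)" by (simp add: mult.commute)
  show "gstep N p A i j = A i j - (tens N (mat_vec N A p) p i j + tens N p (mat_vec N (tr A) p) i j
    - ip N p (mat_vec N A p) * tens N p p i j)"
    unfolding gstep_def lp_def rp_def e1 tens_def mat_vec_def tr_def ip_def e2
    by (simp add: diff_divide_distrib left_diff_distrib right_diff_distrib mult_ac)
qed

lemma lp_lp_commute:
  assumes "ip N p q = 0" shows "lp N p (lp N q A) = lp N q (lp N p A)"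
proof -
  have *: "lp N p (lp N q A) = (\<lambda>i j. A i j - q i * (\<Sum>a=1..N. q a * A a j) / real N - p i * (\<Sum>a=1..N. p a * A a j) / real N)"
    if "ip N p q = 0" for p q
  proof (intro ext)
    fix i j
    have "(\<Sum>a=1..N. p a * (A a j - q a * (\<Sum>a=1..N. q a * A a j) / real N))
       = (\<Sum>a=1..N. p a * A a j) - ip N p q * (\<Sum>a=1..N. q a * A a j)"
      by (simp add: ip_def right_diff_distrib sum_subtractf sum_distrib_right sum_divide_distrib mult.assoc)
    then show "lp N p (lp N q A) i j = A i j - q i * (\<Sum>a=1..N. q a * A a j) / real N - p i * (\<Sum>a=1..N. p a * A a j) / real N"
      unfolding lp_def using that by simp
  qed
  show ?thesis
    using *[OF assms] *[of q p] assms by (simp add: ip_commute[of N q p] algebra_simps)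
qed

lemma rp_rp_commute:
  assumes "ip N p q = 0" shows "rp N p (rp N q A) = rp N q (rp N p A)"
proof -
  have *: "rp N p A = tr (lp N p (tr A))" for p A
    by (simp add: rp_def lp_def tr_def mult.commute)
  have tt: "tr (tr A) = A" for A by (simp add: tr_def)
  show ?thesis unfolding * tt by (simp add: lp_lp_commute[OF assms])
qed

text \<open>Projections off orthogonal directions commute. This lets a new step be moved inside the
  earlier ones, next to the fresh matrix that it annihilates.\<close>

lemma gstep_commute:
  assumes "ip N p q = 0" shows "gstep N p (gstep N q A) = gstep N q (gstep N p A)"
proof -
  have "gstep N p (gstep N q A) = lp N p (lp N q (rp N p (rp N q A)))" for p q
    unfolding gstep_def lp_rp_commute[symmetric] ..
  then show ?thesis by (simp only: lp_lp_commute[OF assms] rp_rp_commute[OF assms])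
qed

lemma gstep_add: "gstep N p (\<lambda>i j. A i j + B i j) = (\<lambda>i j. gstep N p A i j + gstep N p B i j)"
  by (intro ext) (simp add: gstep_def lp_def rp_def sum.distrib sum_subtractf algebra_simps add_divide_distrib diff_divide_distrib)

lemma gstep_zero [simp]: "gstep N p (\<lambda>i j. 0) = (\<lambda>i j. 0)"
  by (simp add: gstep_def lp_def rp_def)

lemma gstep_scale: "gstep N p (\<lambda>i j. c * A i j) = (\<lambda>i j. c * gstep N p A i j)"
  by (intro ext) (simp add: gstep_def lp_def rp_def sum_distrib_left sum_subtractf algebra_simps)

definition pj :: "nat \<Rightarrow> vect \<Rightarrow> vect \<Rightarrow> vect" where
  "pj N p x = (\<lambda>i. x i - ip N x p * p i)"

lemma gstep_tens: "gstep N p (tens N x y) = tens N (pj N p x) (pj N p y)"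
proof (intro ext)
  fix i j
  have r: "rp N p (tens N x y) = tens N x (pj N p y)"
  proof (intro ext)
    fix i j
    have e: "(\<Sum>b=1..N. x i * y b / real N * p b) = x i * (\<Sum>b=1..N. y b * p b) / real N"
      by (simp add: sum_distrib_left sum_divide_distrib mult_ac)
    show "rp N p (tens N x y) i j = tens N x (pj N p y) i j"
      unfolding rp_def tens_def pj_def ip_def e by (simp add: diff_divide_distrib right_diff_distrib mult_ac)
  qed
  have l: "lp N p (tens N x y) = tens N (pj N p x) y" for y
  proof (intro ext)
    fix i j
    have e: "(\<Sum>a=1..N. p a * (x a * y j / real N)) = (\<Sum>a=1..N. x a * p a) * y j / real N"
      by (simp add: sum_distrib_left sum_distrib_right sum_divide_distrib mult_ac)
    show "lp N p (tens N x y) i j = tens N (pj N p x) y i j"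
      unfolding lp_def tens_def pj_def ip_def e by (simp add: diff_divide_distrib left_diff_distrib right_diff_distrib mult_ac)
  qed
  show "gstep N p (tens N x y) i j = tens N (pj N p x) (pj N p y) i j"
    by (simp add: gstep_def r l)
qed

primrec mproj :: "nat \<Rightarrow> (nat \<Rightarrow> vect) \<Rightarrow> nat \<Rightarrow> matr \<Rightarrow> matr" where
  "mproj N ph 0 A = A"
| "mproj N ph (Suc k) A = gstep N (ph (Suc k)) (mproj N ph k A)"

lemma mproj_add: "mproj N ph k (\<lambda>i j. A i j + B i j) = (\<lambda>i j. mproj N ph k A i j + mproj N ph k B i j)"
  by (induction k) (auto simp: gstep_add)

lemma mproj_scale: "mproj N ph k (\<lambda>i j. c * A i j) = (\<lambda>i j. c * mproj N ph k A i j)"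
  by (induction k) (auto simp: gstep_scale)

lemma mproj_cong: "(\<And>s. s \<in> {1..k} \<Longrightarrow> ph s = ph' s) \<Longrightarrow> mproj N ph k A = mproj N ph' k A"
  by (induction k) auto

text \<open>The recursion subtracts terms that depend on \<xi> and \<eta>, yet with the vectors
  \<phi> held fixed the remaining disorder is a linear image of \<open>G\<close>.\<close>

lemma gmat_mproj: "gmat \<beta> h N G (Suc k) = mproj N (phi \<beta> h N G) k G"
proof (induction k)
  case 0
  show ?case by (simp add: gmat.simps)
next
  case (Suc k)
  have "gmat \<beta> h N G (Suc (Suc k)) = gstep N (phi \<beta> h N G (Suc k)) (gmat \<beta> h N G (Suc k))"
    unfolding gmat.simps(3) Let_def gstep_alt by (simp add: xi.simps eta.simps)
  then show ?case by (simp add: Suc)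
qed

text \<open>Unit vectors, or the zero vector that the recursion produces from a vanishing denominator.\<close>

definition ok :: "nat \<Rightarrow> vect \<Rightarrow> bool" where
  "ok N p \<longleftrightarrow> ip N p p = 1 \<or> p = (\<lambda>_. 0)"

definition orth :: "nat \<Rightarrow> (nat \<Rightarrow> vect) \<Rightarrow> nat \<Rightarrow> bool" where
  "orth N ph k \<longleftrightarrow> (\<forall>s\<in>{1..k}. ok N (ph s)) \<and> (\<forall>s\<in>{1..k}. \<forall>t\<in>{1..k}. s \<noteq> t \<longrightarrow> ip N (ph s) (ph t) = 0)"

text \<open>True for a unit vector and for the zero vector alike, so the Gram-Schmidt identities
  survive a vanishing denominator without a case distinction.\<close>

lemma ok_absorb: "ok N p \<Longrightarrow> ip N x p * ip N p p = ip N x p"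
  by (auto simp: ok_def)

lemma orth_mono: "orth N ph k \<Longrightarrow> j \<le> k \<Longrightarrow> orth N ph j"
  by (auto simp: orth_def)

lemma orthD: "orth N ph k \<Longrightarrow> s \<in> {1..k} \<Longrightarrow> t \<in> {1..k} \<Longrightarrow> s \<noteq> t \<Longrightarrow> ip N (ph s) (ph t) = 0"
  by (simp add: orth_def)

lemma orth_ok: "orth N ph k \<Longrightarrow> s \<in> {1..k} \<Longrightarrow> ok N (ph s)"
  by (simp add: orth_def)

text \<open>All components are taken from the original \<open>x\<close> and subtracted at once; for
  an orthogonal system this agrees with successive uses of \<open>pj\<close>, by
  \<open>pj_pjx\<close>.\<close>

definition pjx :: "nat \<Rightarrow> (nat \<Rightarrow> vect) \<Rightarrow> nat \<Rightarrow> vect \<Rightarrow> vect" where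
  "pjx N ph k x = (\<lambda>i. x i - (\<Sum>s=1..k. ip N x (ph s) * ph s i))"

lemma pjx_ip:
  "ip N (pjx N ph k x) y = ip N x y - (\<Sum>s=1..k. ip N x (ph s) * ip N (ph s) y)"
  by (simp add: pjx_def ip_diff_left ip_sum_left ip_scale_left)

lemma pjx_orth:
  assumes "\<And>s. s \<in> {1..k} \<Longrightarrow> ip N (ph s) q = 0"
  shows "ip N (pjx N ph k x) q = ip N x q"
  using assms by (simp add: pjx_ip)

lemma orth_sum_delta:
  assumes "orth N ph k" "t \<in> {1..k}"
  shows "(\<Sum>s=1..k. f s * ip N (ph s) (ph t)) = f t * ip N (ph t) (ph t)"
proof -
  have "(\<Sum>s=1..k. f s * ip N (ph s) (ph t)) = (\<Sum>s=1..k. if s = t then f t * ip N (ph t) (ph t) else 0)"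
    using assms by (intro sum.cong) (auto simp: orth_def)
  then show ?thesis using assms(2) by simp
qed

lemma pjx_self_orth:
  assumes o: "orth N ph k" and t: "t \<in> {1..k}"
  shows "ip N (pjx N ph k x) (ph t) = 0"
  using orth_sum_delta[OF o t, of "\<lambda>s. ip N x (ph s)"] ok_absorb[OF orth_ok[OF o t], of x]
  by (simp add: pjx_ip)

lemma pjx_norm:
  assumes o: "orth N ph k"
  shows "ip N (pjx N ph k x) (pjx N ph k y) = ip N x y - (\<Sum>s=1..k. ip N x (ph s) * ip N y (ph s))"
proof -
  have "ip N z (pjx N ph k y) = ip N z y - (\<Sum>s=1..k. ip N y (ph s) * ip N z (ph s))" for z
    by (simp add: pjx_def ip_diff_right ip_sum_right ip_scale_right)
  then have "ip N (pjx N ph k x) (pjx N ph k y) = ip N (pjx N ph k x) y"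
    by (simp add: pjx_self_orth[OF o])
  also have "\<dots> = ip N x y - (\<Sum>s=1..k. ip N x (ph s) * ip N (ph s) y)" by (rule pjx_ip)
  also have "(\<Sum>s=1..k. ip N x (ph s) * ip N (ph s) y) = (\<Sum>s=1..k. ip N x (ph s) * ip N y (ph s))"
    by (intro sum.cong refl) (simp add: ip_commute)
  finally show ?thesis .
qed

lemma bessel:
  assumes "orth N ph k" shows "(\<Sum>s=1..k. (ip N x (ph s))\<^sup>2) \<le> ip N x x"
  using pjx_norm[OF assms, of x x] ip_self_nonneg[of N "pjx N ph k x"] by (simp add: power2_eq_square)

lemma pj_pjx:
  assumes "orth N ph (Suc k)"
  shows "pj N (ph (Suc k)) (pjx N ph k x) = pjx N ph (Suc k) x"
proof -
  have "ip N (ph s) (ph (Suc k)) = 0" if "s \<in> {1..k}" for s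
    using that by (intro orthD[OF assms]) auto
  then have e: "ip N (pjx N ph k x) (ph (Suc k)) = ip N x (ph (Suc k))"
    by (rule pjx_orth)
  show ?thesis
    unfolding pj_def e by (simp add: pjx_def algebra_simps)
qed

lemma mproj_tens:
  assumes "orth N ph k"
  shows "mproj N ph k (tens N x y) = tens N (pjx N ph k x) (pjx N ph k y)"
  using assms
proof (induction k)
  case 0
  then show ?case by (simp add: pjx_def)
next
  case (Suc k)
  then show ?case using orth_mono[OF Suc.prems, of k] by (simp add: gstep_tens pj_pjx)
qed

lemma pjx_id:
  assumes "\<And>s. s \<in> {1..k} \<Longrightarrow> ip N p (ph s) = 0"
  shows "pjx N ph k p = p"
  using assms by (simp add: pjx_def)

lemma mproj_gstep_commute:
  assumes "\<And>s. s \<in> {1..k} \<Longrightarrow> ip N p (ph s) = 0"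
  shows "mproj N ph k (gstep N p A) = gstep N p (mproj N ph k A)"
  using assms
proof (induction k)
  case (Suc k)
  then show ?case using gstep_commute[of N p "ph (Suc k)" "mproj N ph k A"] by simp
qed simp

lemma mat_vec_rp:
  "mat_vec N (rp N p A) q = (\<lambda>i. mat_vec N A q i - mat_vec N A p i * ip N p q)"
  by (intro ext) (simp add: mat_vec_def rp_def ip_def left_diff_distrib sum_subtractf sum_distrib_left sum_divide_distrib mult.assoc)

lemma mat_vec_lp:
  "mat_vec N (lp N p A) q = (\<lambda>i. mat_vec N A q i - p i * ip N p (mat_vec N A q))"
proof
  fix i
  have "mat_vec N (lp N p A) q i = (\<Sum>j=1..N. A i j * q j) - p i * (\<Sum>j=1..N. (\<Sum>a=1..N. p a * A a j) * q j) / real N"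
    unfolding mat_vec_def lp_def by (rule sum_sub_left)
  then show "mat_vec N (lp N p A) q i = mat_vec N A q i - p i * ip N p (mat_vec N A q)"
    unfolding sum_mat_swap[symmetric] by (simp add: mat_vec_def ip_def)
qed

lemma tr_gstep: "tr (gstep N p A) = gstep N p (tr A)"
proof -
  have 1: "tr (lp N p A) = rp N p (tr A)" for A by (simp add: rp_def lp_def tr_def mult.commute)
  have 2: "tr (rp N p A) = lp N p (tr A)" for A by (simp add: rp_def lp_def tr_def mult.commute)
  show ?thesis unfolding gstep_def 1 2 by (rule lp_rp_commute[symmetric])
qed

lemma tr_mproj: "tr (mproj N ph k A) = mproj N ph k (tr A)"
  by (induction k) (auto simp: tr_gstep)

lemma gstep_kill: "ok N p \<Longrightarrow> mat_vec N (gstep N p A) p = (\<lambda>_. 0)"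
  unfolding gstep_def lp_rp_commute mat_vec_rp by (auto simp: ok_def mat_vec_def)

lemma gstep_kill_other:
  "ip N p q = 0 \<Longrightarrow> mat_vec N A q = (\<lambda>_. 0) \<Longrightarrow> mat_vec N (gstep N p A) q = (\<lambda>_. 0)"
  unfolding gstep_def mat_vec_lp mat_vec_rp by simp

lemma mproj_kill:
  assumes "orth N ph k" "s \<in> {1..k}"
  shows "mat_vec N (mproj N ph k A) (ph s) = (\<lambda>_. 0)"
  using assms
proof (induction k)
  case (Suc k)
  show ?case
  proof (cases "s = Suc k")
    case True
    then show ?thesis using orth_ok[OF Suc.prems] by (simp add: gstep_kill)
  next
    case False
    then have "s \<in> {1..k}" using Suc.prems(2) by auto
    then show ?thesis
      using Suc.IH[OF orth_mono[OF Suc.prems(1)]] orthD[OF Suc.prems(1), of "Suc k" s] False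
      by (simp add: gstep_kill_other)
  qed
qed simp

lemma mproj_kill_tr:
  assumes "orth N ph k" "s \<in> {1..k}"
  shows "mat_vec N (tr (mproj N ph k A)) (ph s) = (\<lambda>_. 0)"
  unfolding tr_mproj by (rule mproj_kill[OF assms])

lemma quad_lp:
  "(\<Sum>i=1..N. \<Sum>j=1..N. x i * y j * lp N p A i j) = (\<Sum>i=1..N. \<Sum>j=1..N. pj N p x i * y j * A i j)"
proof -
  have l: "(\<Sum>i=1..N. \<Sum>j=1..N. x i * y j * lp N p A i j)
     = (\<Sum>i=1..N. \<Sum>j=1..N. x i * y j * A i j) - (\<Sum>j=1..N. y j * (ip N x p * (\<Sum>a=1..N. p a * A a j)))"
  proof -
    have "(\<Sum>i=1..N. \<Sum>j=1..N. x i * y j * lp N p A i j)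
       = (\<Sum>i=1..N. \<Sum>j=1..N. x i * y j * A i j) - (\<Sum>j=1..N. \<Sum>i=1..N. x i * y j * (p i * (\<Sum>a=1..N. p a * A a j) / real N))"
      by (subst (3) sum.swap) (simp add: lp_def right_diff_distrib sum_subtractf)
    also have "(\<Sum>j=1..N. \<Sum>i=1..N. x i * y j * (p i * (\<Sum>a=1..N. p a * A a j) / real N))
       = (\<Sum>j=1..N. y j * (ip N x p * (\<Sum>a=1..N. p a * A a j)))"
      by (rule sum.cong) (auto simp: ip_def sum_distrib_right sum_distrib_left sum_divide_distrib mult_ac)
    finally show ?thesis .
  qed
  have r: "(\<Sum>i=1..N. \<Sum>j=1..N. pj N p x i * y j * A i j)
     = (\<Sum>i=1..N. \<Sum>j=1..N. x i * y j * A i j) - (\<Sum>j=1..N. \<Sum>i=1..N. ip N x p * p i * y j * A i j)"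
    by (subst (3) sum.swap) (simp add: pj_def left_diff_distrib sum_subtractf)
  have "(\<Sum>j=1..N. \<Sum>i=1..N. ip N x p * p i * y j * A i j) = (\<Sum>j=1..N. y j * (ip N x p * (\<Sum>a=1..N. p a * A a j)))"
    by (rule sum.cong) (auto simp: sum_distrib_left mult_ac)
  then show ?thesis unfolding l r by simp
qed

lemma quad_rp:
  "(\<Sum>i=1..N. \<Sum>j=1..N. x i * y j * rp N p A i j) = (\<Sum>i=1..N. \<Sum>j=1..N. x i * pj N p y j * A i j)"
proof -
  have *: "rp N p A i j = lp N p (tr A) j i" for i j
    by (simp add: rp_def lp_def tr_def mult.commute)
  have "(\<Sum>i=1..N. \<Sum>j=1..N. x i * y j * rp N p A i j) = (\<Sum>j=1..N. \<Sum>i=1..N. y j * x i * lp N p (tr A) j i)"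
    by (subst sum.swap) (simp add: * mult_ac)
  also have "\<dots> = (\<Sum>j=1..N. \<Sum>i=1..N. pj N p y j * x i * A i j)"
    by (subst quad_lp) (simp add: tr_def)
  also have "\<dots> = (\<Sum>i=1..N. \<Sum>j=1..N. x i * pj N p y j * A i j)"
    by (subst sum.swap) (simp add: mult_ac)
  finally show ?thesis .
qed

lemma quad_gstep:
  "(\<Sum>i=1..N. \<Sum>j=1..N. x i * y j * gstep N p A i j) = (\<Sum>i=1..N. \<Sum>j=1..N. pj N p x i * pj N p y j * A i j)"
  unfolding gstep_def quad_lp quad_rp ..

lemma pjx_pj:
  assumes "orth N ph (Suc k)"
  shows "pjx N ph k (pj N (ph (Suc k)) x) = pjx N ph (Suc k) x"
proof -
  have "ip N (ph (Suc k)) (ph s) = 0" if "s \<in> {1..k}" for s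
    using that by (intro orthD[OF assms]) auto
  then have "ip N (pj N (ph (Suc k)) x) (ph s) = ip N x (ph s)" if "s \<in> {1..k}" for s
    using that by (simp add: pj_def ip_diff_left ip_scale_left)
  then show ?thesis by (simp add: pjx_def pj_def algebra_simps)
qed

text \<open>The projections are self-adjoint and pass from the matrix to the vectors: the energy of
  the unrevealed disorder sees a configuration only through its component orthogonal to the vectors
  \<phi> used so far.\<close>

lemma quad_mproj:
  assumes "orth N ph k"
  shows "(\<Sum>i=1..N. \<Sum>j=1..N. x i * y j * mproj N ph k A i j)
       = (\<Sum>i=1..N. \<Sum>j=1..N. pjx N ph k x i * pjx N ph k y j * A i j)"
  using assms
proof (induction k arbitrary: x y)
  case 0
  show ?case by (simp add: pjx_def)
next
  case (Suc k)
  show ?case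
    unfolding mproj.simps quad_gstep Suc.IH[OF orth_mono[OF Suc.prems le_SucI[OF order_refl]]] pjx_pj[OF Suc.prems] ..
qed

section \<open>Orthogonality of \<phi>, and the data on which the recursion depends\<close>

lemma phi_orth:
  assumes N: "N \<ge> 1"
  shows "orth N (phi \<beta> h N G) k"
proof (induction k)
  case 0
  show ?case by (simp add: orth_def)
next
  case (Suc k)
  let ?p = "phi \<beta> h N G"
  have "ok N (?p (Suc k)) \<and> (\<forall>s\<in>{1..k}. ip N (?p (Suc k)) (?p s) = 0)"
  proof (cases k)
    case 0
    then show ?thesis using N by (simp add: ok_def phi.simps ip_def)
  next
    case (Suc l)
    define r where "r = pjx N ?p k (vm \<beta> h N G (Suc k))"
    have p: "?p (Suc k) = (\<lambda>i. r i / nrm N r)"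
      unfolding Suc phi.simps(3) Let_def r_def pjx_def ..
    have "ok N (?p (Suc k))"
    proof (cases "nrm N r = 0")
      case True
      then show ?thesis by (simp add: p ok_def)
    next
      case False
      then show ?thesis
        using nrm_sq[of N r]
        by (auto simp: p ok_def ip_divide_left ip_divide_right power2_eq_square)
    qed
    moreover have "ip N (?p (Suc k)) (?p s) = 0" if "s \<in> {1..k}" for s
      using pjx_self_orth[OF Suc.IH that] by (simp add: p ip_divide_left r_def)
    ultimately show ?thesis by blast
  qed
  then show ?case
    using Suc.IH unfolding orth_def
    by (auto simp: atLeastAtMostSuc_conv ip_commute)
qed

lemma phi_norm_le: "N \<ge> 1 \<Longrightarrow> s \<ge> 1 \<Longrightarrow> ip N (phi \<beta> h N G s) (phi \<beta> h N G s) \<le> 1"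
  using orth_ok[OF phi_orth[of N \<beta> h G s], of s] by (auto simp: ok_def)

lemma vm_cong_zeta:
  assumes "\<And>s i. s \<in> {1..k} \<Longrightarrow> i \<in> I \<Longrightarrow> zeta \<beta> h N G s i = zeta \<beta> h N G' s i"
    and "s \<le> Suc k" "i \<in> I"
  shows "vm \<beta> h N G s i = vm \<beta> h N G' s i"
proof (cases s)
  case 0
  then show ?thesis by (simp add: vm.simps)
next
  case (Suc t)
  show ?thesis
  proof (cases t)
    case 0
    then show ?thesis using Suc by (simp add: vm.simps)
  next
    case (Suc l)
    have "(\<Sum>r=1..Suc l-1. gam \<beta> h r * zeta \<beta> h N G r i) = (\<Sum>r=1..Suc l-1. gam \<beta> h r * zeta \<beta> h N G' r i)"
      using assms \<open>s = Suc t\<close> Suc by (intro sum.cong) auto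
    then have "vh \<beta> h N G s i = vh \<beta> h N G' s i"
      using assms \<open>s = Suc t\<close> Suc by (simp add: vh.simps)
    then show ?thesis using \<open>s = Suc t\<close> Suc by (simp add: vm.simps)
  qed
qed

lemma nrm_cong: "(\<And>i. i \<in> {1..N} \<Longrightarrow> x i = x' i) \<Longrightarrow> nrm N x = nrm N x'"
  unfolding nrm_def by (intro arg_cong[of _ _ sqrt] ip_cong)

text \<open>The matrix enters m, and hence \<phi>, only through the earlier vectors \<zeta>. The
  index set \<open>I\<close> serves two uses: all indices in \<open>data_stable\<close>, and those
  in \<open>{1..N}\<close> in \<open>data_in_range\<close>.\<close>

lemma phi_cong_zeta:
  assumes I: "{1..N} \<subseteq> I"
    and z: "\<And>s i. s \<in> {1..k} \<Longrightarrow> i \<in> I \<Longrightarrow> zeta \<beta> h N G s i = zeta \<beta> h N G' s i"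
    and "s \<le> Suc k" "i \<in> I"
  shows "phi \<beta> h N G s i = phi \<beta> h N G' s i"
  using assms(3,4)
proof (induction s arbitrary: i rule: less_induct)
  case (less s)
  consider "s = 0" | "s = 1" | l where "s = Suc (Suc l)" by (metis One_nat_def not0_implies_Suc)
  then show ?case
  proof cases
    case 3
    let ?r = "\<lambda>G. pjx N (phi \<beta> h N G) (Suc l) (vm \<beta> h N G s)"
    have p: "phi \<beta> h N G s = (\<lambda>i. ?r G i / nrm N (?r G))" for G
      unfolding 3 phi.simps(3) Let_def pjx_def ..
    have m: "vm \<beta> h N G s i = vm \<beta> h N G' s i" if "i \<in> I" for i
      by (rule vm_cong_zeta[OF z less.prems(1) that])
    have IH: "phi \<beta> h N G t i = phi \<beta> h N G' t i" if "t \<in> {1..Suc l}" "i \<in> I" for t i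
      using less.IH[of t i] less.prems that 3 by auto
    have "ip N (vm \<beta> h N G s) (phi \<beta> h N G t) = ip N (vm \<beta> h N G' s) (phi \<beta> h N G' t)" if "t \<in> {1..Suc l}" for t
      using m IH[OF that] I by (intro ip_cong) auto
    then have r: "?r G i = ?r G' i" if "i \<in> I" for i
      using m[OF that] IH[OF _ that] by (simp add: pjx_def)
    have "nrm N (?r G) = nrm N (?r G')" using I by (intro nrm_cong r) auto
    then show ?thesis using r[OF less.prems(2)] by (simp add: p)
  qed (simp_all add: phi.simps)
qed

lemma mat_vec_cong:
  "(\<And>j. j \<in> {1..N} \<Longrightarrow> A i j = A' i j) \<Longrightarrow> (\<And>j. j \<in> {1..N} \<Longrightarrow> x j = x' j) \<Longrightarrow> mat_vec N A x i = mat_vec N A' x' i"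
  unfolding mat_vec_def by (intro sum.cong) auto

lemma mat_vec_add: "mat_vec N (\<lambda>i j. A i j + B i j) x = (\<lambda>i. mat_vec N A x i + mat_vec N B x i)"
  by (simp add: mat_vec_def distrib_right sum.distrib)

text \<open>A matrix \<open>D\<close> that annihilates the first k vectors \<phi> from both sides is
  invisible to the first k steps: by induction it is carried along in \<open>gmat\<close> but
  contributes nothing to \<xi> and \<eta>, hence nothing to the next \<phi>. Every matrix projected
  by \<open>mproj\<close> is of this kind.\<close>

lemma data_stable:
  assumes D: "\<And>s. s \<in> {1..k} \<Longrightarrow> mat_vec N D (phi \<beta> h N G s) = (\<lambda>_. 0)"
    and Dt: "\<And>s. s \<in> {1..k} \<Longrightarrow> mat_vec N (tr D) (phi \<beta> h N G s) = (\<lambda>_. 0)"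
  defines "G' \<equiv> \<lambda>i j. G i j + D i j"
  shows "s \<le> k \<Longrightarrow> gmat \<beta> h N G' (Suc s) = (\<lambda>i j. gmat \<beta> h N G (Suc s) i j + D i j)"
    and "s \<le> k \<Longrightarrow> phi \<beta> h N G' (Suc s) = phi \<beta> h N G (Suc s)"
    and "s \<in> {1..k} \<Longrightarrow> xi \<beta> h N G' s = xi \<beta> h N G s"
    and "s \<in> {1..k} \<Longrightarrow> eta \<beta> h N G' s = eta \<beta> h N G s"
proof -
  have main: "gmat \<beta> h N G' (Suc s) = (\<lambda>i j. gmat \<beta> h N G (Suc s) i j + D i j) \<and>
      phi \<beta> h N G' (Suc s) = phi \<beta> h N G (Suc s) \<and> (\<forall>t\<in>{1..s}. xi \<beta> h N G' t = xi \<beta> h N G t \<and> eta \<beta> h N G' t = eta \<beta> h N G t)"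
    if "s \<le> k" for s
    using that
  proof (induction s)
    case 0
    show ?case by (simp add: G'_def gmat.simps phi.simps)
  next
    case (Suc s)
    then have IH: "gmat \<beta> h N G' (Suc s) = (\<lambda>i j. gmat \<beta> h N G (Suc s) i j + D i j)"
      "phi \<beta> h N G' (Suc s) = phi \<beta> h N G (Suc s)"
      "\<forall>t\<in>{1..s}. xi \<beta> h N G' t = xi \<beta> h N G t \<and> eta \<beta> h N G' t = eta \<beta> h N G t" by auto
    have s: "Suc s \<in> {1..k}" using Suc.prems by auto
    have x: "xi \<beta> h N G' (Suc s) = xi \<beta> h N G (Suc s)"
      unfolding xi.simps IH(1,2) mat_vec_add D[OF s] by simp
    have t: "tr (\<lambda>i j. gmat \<beta> h N G (Suc s) i j + D i j) = (\<lambda>i j. tr (gmat \<beta> h N G (Suc s)) i j + tr D i j)"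
      by (simp add: tr_def)
    have e: "eta \<beta> h N G' (Suc s) = eta \<beta> h N G (Suc s)"
      unfolding eta.simps IH(1,2) t mat_vec_add Dt[OF s] by simp
    have xe: "\<forall>t\<in>{1..Suc s}. xi \<beta> h N G' t = xi \<beta> h N G t \<and> eta \<beta> h N G' t = eta \<beta> h N G t"
      using IH(3) x e by (auto simp: atLeastAtMostSuc_conv)
    then have "zeta \<beta> h N G' t i = zeta \<beta> h N G t i" if "t \<in> {1..Suc s}" for t i
      using that by (simp add: zeta.simps)
    then have p: "phi \<beta> h N G' (Suc (Suc s)) = phi \<beta> h N G (Suc (Suc s))"
      by (intro ext phi_cong_zeta[of N UNIV "Suc s"]) auto
    have "gmat \<beta> h N G' (Suc (Suc s)) = (\<lambda>i j. gmat \<beta> h N G (Suc (Suc s)) i j + D i j)"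
      unfolding gmat.simps(3)[of \<beta> h N G'] gmat.simps(3)[of \<beta> h N G] Let_def x e IH(1,2) by (simp add: algebra_simps)
    then show ?case using p xe by blast
  qed
  show "s \<le> k \<Longrightarrow> gmat \<beta> h N G' (Suc s) = (\<lambda>i j. gmat \<beta> h N G (Suc s) i j + D i j)"
    "s \<le> k \<Longrightarrow> phi \<beta> h N G' (Suc s) = phi \<beta> h N G (Suc s)"
    using main by auto
  show "s \<in> {1..k} \<Longrightarrow> xi \<beta> h N G' s = xi \<beta> h N G s" "s \<in> {1..k} \<Longrightarrow> eta \<beta> h N G' s = eta \<beta> h N G s"
    using main[of k] by auto
qed

text \<open>A matrix has entries at all indices, whereas the passage to a Gaussian family and back
  preserves only those in \<open>{1..N}\<close>.\<close>

lemma data_in_range: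
  assumes G: "\<And>i j. i \<in> {1..N} \<Longrightarrow> j \<in> {1..N} \<Longrightarrow> G i j = G' i j"
  shows "i \<in> {1..N} \<Longrightarrow> j \<in> {1..N} \<Longrightarrow> gmat \<beta> h N G s i j = gmat \<beta> h N G' s i j"
    and "i \<in> {1..N} \<Longrightarrow> phi \<beta> h N G s i = phi \<beta> h N G' s i"
    and "i \<in> {1..N} \<Longrightarrow> xi \<beta> h N G s i = xi \<beta> h N G' s i"
    and "i \<in> {1..N} \<Longrightarrow> eta \<beta> h N G s i = eta \<beta> h N G' s i"
proof -
  define P where "P s \<longleftrightarrow> (\<forall>i\<in>{1..N}. \<forall>j\<in>{1..N}. gmat \<beta> h N G s i j = gmat \<beta> h N G' s i j) \<and>
     (\<forall>i\<in>{1..N}. phi \<beta> h N G s i = phi \<beta> h N G' s i)" for s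
  have xe: "xi \<beta> h N G s i = xi \<beta> h N G' s i \<and> eta \<beta> h N G s i = eta \<beta> h N G' s i" if "P s" "i \<in> {1..N}" for s i
    using that unfolding xi.simps eta.simps P_def by (intro conjI mat_vec_cong) (auto simp: tr_def)
  have P: "P s" for s
  proof (induction s rule: less_induct)
    case (less s)
    consider "s = 0" | "s = 1" | l where "s = Suc (Suc l)" by (metis One_nat_def not0_implies_Suc)
    then show ?case
    proof cases
      case 3
      have z: "zeta \<beta> h N G t i = zeta \<beta> h N G' t i" if "t \<in> {1..Suc l}" "i \<in> {1..N}" for t i
        using xe[OF less.IH[of t] that(2)] that 3 by (simp add: zeta.simps)
      have p: "\<forall>i\<in>{1..N}. phi \<beta> h N G s i = phi \<beta> h N G' s i"
        using phi_cong_zeta[OF order_refl z] 3 by blast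
      have Pl: "P (Suc l)" using less.IH[of "Suc l"] 3 by simp
      have "ip N (phi \<beta> h N G (Suc l)) (xi \<beta> h N G (Suc l)) = ip N (phi \<beta> h N G' (Suc l)) (xi \<beta> h N G' (Suc l))"
        using Pl xe[OF Pl] by (intro ip_cong) (auto simp: P_def)
      then have "\<forall>i\<in>{1..N}. \<forall>j\<in>{1..N}. gmat \<beta> h N G s i j = gmat \<beta> h N G' s i j"
        using Pl xe[OF Pl] unfolding 3 gmat.simps(3) Let_def by (auto simp: P_def tens_def)
      then show ?thesis using p by (simp add: P_def)
    qed (auto simp: P_def gmat.simps phi.simps G)
  qed
  show "i \<in> {1..N} \<Longrightarrow> j \<in> {1..N} \<Longrightarrow> gmat \<beta> h N G s i j = gmat \<beta> h N G' s i j"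
    "i \<in> {1..N} \<Longrightarrow> phi \<beta> h N G s i = phi \<beta> h N G' s i"
    "i \<in> {1..N} \<Longrightarrow> xi \<beta> h N G s i = xi \<beta> h N G' s i"
    "i \<in> {1..N} \<Longrightarrow> eta \<beta> h N G s i = eta \<beta> h N G' s i"
    using P[of s] xe[OF P[of s]] by (auto simp: P_def)
qed

lemma sum_tens:
  "(\<Sum>i=1..N. \<Sum>j=1..N. tens N x y i j * s i * s j) = real N * ip N s x * ip N s y"
proof -
  have "(\<Sum>i=1..N. \<Sum>j=1..N. tens N x y i j * s i * s j) = (\<Sum>i=1..N. \<Sum>j=1..N. (s i * x i) * (s j * y j)) / real N"
    unfolding sum_divide_distrib by (intro sum.cong refl) (simp add: tens_def)
  also have "(\<Sum>i=1..N. \<Sum>j=1..N. (s i * x i) * (s j * y j)) = (\<Sum>i=1..N. s i * x i) * (\<Sum>j=1..N. s j * y j)"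
    by (rule sum_product[symmetric])
  finally show ?thesis by (simp add: ip_def)
qed

lemma ip_phi_xi: "ip N (phi \<beta> h N G s) (xi \<beta> h N G s) = ip N (phi \<beta> h N G s) (eta \<beta> h N G s)"
  unfolding ip_def xi.simps eta.simps mat_vec_def tr_def sum_distrib_left
  by (subst sum.swap) (simp add: mult_ac)

text \<open>The revealed energy is a function of \<zeta> and \<phi> alone: a quadratic form
  symmetrises \<xi> and \<eta>, and by \<open>ip_phi_xi\<close> the correction along the diagonal is
  expressed by \<zeta> as well.\<close>

lemma quad_increment:
  "(\<Sum>i=1..N. \<Sum>j=1..N. (G i j - gmat \<beta> h N G (Suc k) i j) * x i * x j)
   = real N * (\<Sum>s=1..k. sqrt 2 * ip N x (zeta \<beta> h N G s) * ip N x (phi \<beta> h N G s)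
        - ip N (phi \<beta> h N G s) (zeta \<beta> h N G s) / sqrt 2 * (ip N x (phi \<beta> h N G s))\<^sup>2)"
proof (induction k)
  case 0
  show ?case by (simp add: gmat.simps)
next
  case (Suc k)
  let ?p = "phi \<beta> h N G (Suc k)" and ?x = "xi \<beta> h N G (Suc k)" and ?e = "eta \<beta> h N G (Suc k)" and ?z = "zeta \<beta> h N G (Suc k)"
  have z: "ip N y ?z = (ip N y ?x + ip N y ?e) / sqrt 2" for y
    by (simp add: zeta.simps ip_divide_right ip_add_right)
  have "(\<Sum>i=1..N. \<Sum>j=1..N. (G i j - gmat \<beta> h N G (Suc (Suc k)) i j) * x i * x j)
     = (\<Sum>i=1..N. \<Sum>j=1..N. (G i j - gmat \<beta> h N G (Suc k) i j) * x i * x j)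
      + (\<Sum>i=1..N. \<Sum>j=1..N. tens N ?x ?p i j * x i * x j) + (\<Sum>i=1..N. \<Sum>j=1..N. tens N ?p ?e i j * x i * x j)
      - ip N ?p ?x * (\<Sum>i=1..N. \<Sum>j=1..N. tens N ?p ?p i j * x i * x j)"
    unfolding gmat.simps(3) Let_def
    by (simp add: sum_distrib_left flip: sum.distrib sum_subtractf) (simp add: algebra_simps)
  also have "\<dots> = (\<Sum>i=1..N. \<Sum>j=1..N. (G i j - gmat \<beta> h N G (Suc k) i j) * x i * x j)
     + real N * (sqrt 2 * ip N x ?z * ip N x ?p - ip N ?p ?z / sqrt 2 * (ip N x ?p)\<^sup>2)"
  proof -
    have 1: "sqrt 2 * ip N x ?z = ip N x ?x + ip N x ?e" by (simp add: z)
    have 2: "ip N ?p ?z / sqrt 2 = ip N ?p ?x" by (simp add: z ip_phi_xi[symmetric])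
    show ?thesis unfolding sum_tens 1 2 by (simp add: algebra_simps power2_eq_square)
  qed
  finally have F: "(\<Sum>i=1..N. \<Sum>j=1..N. (G i j - gmat \<beta> h N G (Suc (Suc k)) i j) * x i * x j)
     = (\<Sum>i=1..N. \<Sum>j=1..N. (G i j - gmat \<beta> h N G (Suc k) i j) * x i * x j)
     + real N * (sqrt 2 * ip N x ?z * ip N x ?p - ip N ?p ?z / sqrt 2 * (ip N x ?p)\<^sup>2)" .
  show ?case unfolding F Suc.IH by (simp add: distrib_left)
qed

section \<open>Building the disorder from fresh Gaussian vectors\<close>

text \<open>\<open>v s\<close> holds \<open>2 N\<close> fresh Gaussians for step \<open>s\<close>. The rotation by \<open>1 / sqrt 2\<close> makes \<open>\<zeta>\<^sup>s\<close> depend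
  only on the first \<open>N\<close> of them and on one linear form in the others.\<close>

definition ymat :: "nat \<Rightarrow> vect \<Rightarrow> vect \<Rightarrow> matr" where
  "ymat N p u = (let z = (\<lambda>i. (u i + u (N + i)) / sqrt 2); w = (\<lambda>i. (u i - u (N + i)) / sqrt 2) in
     (\<lambda>i j. tens N z p i j + tens N p w i j - ip N w p * tens N p p i j))"

text \<open>Each step adds a fresh matrix supported on the row and column of the newest \<phi>,
  projected off the earlier directions. That \<phi> is read off from the part already built, so the
  definition follows the order in which the disorder is revealed.\<close>

primrec dmat :: "real \<Rightarrow> real \<Rightarrow> nat \<Rightarrow> (nat \<Rightarrow> vect) \<Rightarrow> nat \<Rightarrow> matr" where
  "dmat \<beta> h N v 0 = (\<lambda>i j. 0)"
| "dmat \<beta> h N v (Suc k) = (\<lambda>i j. dmat \<beta> h N v k i j +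
     mproj N (phi \<beta> h N (dmat \<beta> h N v k)) k (ymat N (phi \<beta> h N (dmat \<beta> h N v k) (Suc k)) (v (Suc k))) i j)"

lemma dmat_cong: "(\<And>s. s \<in> {1..k} \<Longrightarrow> v s = v' s) \<Longrightarrow> dmat \<beta> h N v k = dmat \<beta> h N v' k"
  by (induction k) auto

lemma gstep_ymat: "ok N p \<Longrightarrow> gstep N p (ymat N p u) = (\<lambda>i j. 0)"
proof -
  assume p: "ok N p"
  then have pp: "pj N p p = (\<lambda>_. 0)" by (auto simp: pj_def ok_def)
  have y: "ymat N p u = (\<lambda>i j. (tens N (\<lambda>i. (u i + u (N + i)) / sqrt 2) p i j + tens N p (\<lambda>i. (u i - u (N + i)) / sqrt 2) i j)
      + (- ip N (\<lambda>i. (u i - u (N + i)) / sqrt 2) p) * tens N p p i j)"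
    by (simp add: ymat_def Let_def)
  show ?thesis
    unfolding y gstep_add gstep_scale gstep_tens pp by (simp add: tens_def)
qed

context
  fixes \<beta> h :: real and N :: nat
  assumes N: "N \<ge> 1"
begin

lemma stable_mproj:
  fixes G A :: matr and k :: nat
  defines "G' \<equiv> \<lambda>i j. G i j + mproj N (phi \<beta> h N G) k A i j"
  shows "s \<le> k \<Longrightarrow> gmat \<beta> h N G' (Suc s) = (\<lambda>i j. gmat \<beta> h N G (Suc s) i j + mproj N (phi \<beta> h N G) k A i j)"
    and "s \<le> k \<Longrightarrow> phi \<beta> h N G' (Suc s) = phi \<beta> h N G (Suc s)"
    and "s \<in> {1..k} \<Longrightarrow> xi \<beta> h N G' s = xi \<beta> h N G s"
    and "s \<in> {1..k} \<Longrightarrow> eta \<beta> h N G' s = eta \<beta> h N G s"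
    and "s \<in> {1..k} \<Longrightarrow> zeta \<beta> h N G' s = zeta \<beta> h N G s"
proof -
  note st = data_stable[of k N "mproj N (phi \<beta> h N G) k A" \<beta> h G, OF mproj_kill[OF phi_orth[OF N]] mproj_kill_tr[OF phi_orth[OF N]]]
  show "s \<le> k \<Longrightarrow> gmat \<beta> h N G' (Suc s) = (\<lambda>i j. gmat \<beta> h N G (Suc s) i j + mproj N (phi \<beta> h N G) k A i j)"
    "s \<le> k \<Longrightarrow> phi \<beta> h N G' (Suc s) = phi \<beta> h N G (Suc s)"
    "s \<in> {1..k} \<Longrightarrow> xi \<beta> h N G' s = xi \<beta> h N G s"
    "s \<in> {1..k} \<Longrightarrow> eta \<beta> h N G' s = eta \<beta> h N G s"
    "s \<in> {1..k} \<Longrightarrow> zeta \<beta> h N G' s = zeta \<beta> h N G s"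
    using st unfolding G'_def by (auto simp: zeta.simps)
qed

lemma stable_mproj_phi_le:
  "s \<le> Suc k \<Longrightarrow> phi \<beta> h N (\<lambda>i j. G i j + mproj N (phi \<beta> h N G) k A i j) s = phi \<beta> h N G s"
  using stable_mproj(2)[of "s - 1" k G A] by (cases s) (auto simp: phi.simps)

lemma dmat_phi: "s \<le> Suc k \<Longrightarrow> k \<le> K \<Longrightarrow> phi \<beta> h N (dmat \<beta> h N v K) s = phi \<beta> h N (dmat \<beta> h N v k) s"
proof (induction K)
  case (Suc K)
  show ?case
  proof (cases "k = Suc K")
    case False
    then show ?thesis using Suc stable_mproj_phi_le[of s K] by simp
  qed simp
qed simp

lemma dmat_zeta: "s \<in> {1..k} \<Longrightarrow> k \<le> K \<Longrightarrow> zeta \<beta> h N (dmat \<beta> h N v K) s = zeta \<beta> h N (dmat \<beta> h N v k) s"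
proof (induction K)
  case (Suc K)
  show ?case
  proof (cases "k = Suc K")
    case False
    then show ?thesis using Suc stable_mproj(5)[of s K] by simp
  qed simp
qed simp

lemma phi_ip_zero: "s \<in> {1..k} \<Longrightarrow> ip N (phi \<beta> h N G (Suc k)) (phi \<beta> h N G s) = 0"
  by (rule orthD[OF phi_orth[OF N, of _ _ _ "Suc k"]]) auto

text \<open>Before its last step the residual of \<open>dmat\<close> is the newest projected
  \<open>ymat\<close>. The last projection commutes with the earlier ones and annihilates it. So
  \<open>dmat\<close> consists of revealed disorder only, and \<open>quad_increment\<close> gives
  its whole energy.\<close>

lemma dmat_gmat_zero: "gmat \<beta> h N (dmat \<beta> h N v k) (Suc k) = (\<lambda>i j. 0)"
proof (induction k)
  case 0
  show ?case by (simp add: gmat.simps)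
next
  case (Suc k)
  let ?D = "dmat \<beta> h N v k" and ?D' = "dmat \<beta> h N v (Suc k)"
  let ?Y = "ymat N (phi \<beta> h N ?D (Suc k)) (v (Suc k))"
  have "gmat \<beta> h N ?D' (Suc (Suc k)) = gstep N (phi \<beta> h N ?D' (Suc k)) (gmat \<beta> h N ?D' (Suc k))"
    by (simp add: gmat_mproj)
  also have "gmat \<beta> h N ?D' (Suc k) = mproj N (phi \<beta> h N ?D) k ?Y"
    using stable_mproj(1)[of k k ?D ?Y] Suc by simp
  also have "phi \<beta> h N ?D' (Suc k) = phi \<beta> h N ?D (Suc k)"
    by (rule dmat_phi) auto
  also have "gstep N (phi \<beta> h N ?D (Suc k)) (mproj N (phi \<beta> h N ?D) k ?Y)
     = mproj N (phi \<beta> h N ?D) k (gstep N (phi \<beta> h N ?D (Suc k)) ?Y)"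
    by (rule mproj_gstep_commute[symmetric]) (rule phi_ip_zero)
  also have "gstep N (phi \<beta> h N ?D (Suc k)) ?Y = (\<lambda>i j. 0)"
    by (rule gstep_ymat[OF orth_ok[OF phi_orth[OF N, of _ _ _ "Suc k"]]]) simp
  also have "mproj N (phi \<beta> h N ?D) k (\<lambda>i j. 0) = (\<lambda>i j. 0)"
    using mproj_scale[of N "phi \<beta> h N ?D" k 0 "\<lambda>i j. 0"] by simp
  finally show ?case .
qed

definition theta :: "(nat \<Rightarrow> vect) \<Rightarrow> nat \<Rightarrow> matr \<Rightarrow> matr" where
  "theta v k A = (\<lambda>i j. dmat \<beta> h N v k i j + mproj N (phi \<beta> h N (dmat \<beta> h N v k)) k A i j)"

text \<open>One step of revealing: when the independent matrix is replaced by a fresh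
  \<open>ymat\<close> plus a projected remainder, the former is absorbed into \<open>dmat\<close>.
  By \<open>one_step_law\<close> the replacement does not change the law.\<close>

lemma theta_Suc:
  "theta v k (\<lambda>i j. ymat N (phi \<beta> h N (dmat \<beta> h N v k) (Suc k)) (v (Suc k)) i j
      + gstep N (phi \<beta> h N (dmat \<beta> h N v k) (Suc k)) A i j) = theta v (Suc k) A"
proof -
  let ?D = "dmat \<beta> h N v k" and ?D' = "dmat \<beta> h N v (Suc k)"
  have "mproj N (phi \<beta> h N ?D) k (gstep N (phi \<beta> h N ?D (Suc k)) A) = mproj N (phi \<beta> h N ?D) (Suc k) A"
    unfolding mproj.simps by (rule mproj_gstep_commute) (rule phi_ip_zero)
  also have "\<dots> = mproj N (phi \<beta> h N ?D') (Suc k) A"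
    by (rule mproj_cong) (rule dmat_phi[symmetric], auto)
  finally show ?thesis
    unfolding theta_def mproj_add by (simp add: add.assoc)
qed

text \<open>The rotation undoes the sum of \<xi> and \<eta>: z + w is a multiple of
  \<open>a\<close>, and z - w of \<open>b\<close>. Unless the new \<phi> vanishes, \<zeta> is the
  fresh vector \<open>a\<close> up to corrections along the first k + 1 vectors \<phi>, whose
  coefficients will turn out to be small.\<close>

lemma dmat_zeta_Suc:
  fixes v k
  defines "p \<equiv> phi \<beta> h N (dmat \<beta> h N v k)"
  defines "a \<equiv> \<lambda>i. v (Suc k) i" and "b \<equiv> \<lambda>i. v (Suc k) (N + i)"
  shows "zeta \<beta> h N (dmat \<beta> h N v (Suc k)) (Suc k) =
    (if p (Suc k) = (\<lambda>_. 0) then (\<lambda>_. 0) else (\<lambda>i. pjx N p k a i + ip N b (p (Suc k)) * p (Suc k) i))"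
proof -
  let ?D = "dmat \<beta> h N v k" and ?D' = "dmat \<beta> h N v (Suc k)"
  define q where "q = p (Suc k)"
  define z where "z = (\<lambda>i. (a i + b i) / sqrt 2)"
  define w where "w = (\<lambda>i. (a i - b i) / sqrt 2)"
  have o: "orth N p (Suc k)" unfolding p_def by (rule phi_orth[OF N])
  have ok: "orth N p k" by (rule orth_mono[OF o]) simp
  have q0: "ip N q (p s) = 0" if "s \<in> {1..k}" for s
    unfolding q_def p_def using that by (rule phi_ip_zero)
  have g: "gmat \<beta> h N ?D' (Suc k) = mproj N p k (ymat N q (v (Suc k)))"
    using stable_mproj(1)[of k k ?D] by (simp add: dmat_gmat_zero p_def q_def)
  have y: "ymat N q (v (Suc k)) = (\<lambda>i j. (tens N z q i j + tens N q w i j) + (- ip N w q) * tens N q q i j)"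
    by (simp add: ymat_def Let_def z_def w_def a_def b_def)
  have pq: "pjx N p k q = q" by (rule pjx_id) (rule q0)
  have g': "gmat \<beta> h N ?D' (Suc k) = (\<lambda>i j. (tens N (pjx N p k z) q i j + tens N q (pjx N p k w) i j) + (- ip N w q) * tens N q q i j)"
    unfolding g y mproj_add mproj_scale mproj_tens[OF ok] pq ..
  have mv: "mat_vec N (\<lambda>i j. (tens N x y i j + tens N x' y' i j) + c * tens N x'' y'' i j) r
      = (\<lambda>i. x i * ip N y r + x' i * ip N y' r + c * (x'' i * ip N y'' r))" for x y x' y' x'' y'' r c
    by (intro ext) (simp add: mat_vec_def tens_def ip_def sum_distrib_left sum_divide_distrib algebra_simps sum.distrib)
  have tt: "tr (\<lambda>i j. (tens N x y i j + tens N x' y' i j) + c * tens N x'' y'' i j)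
      = (\<lambda>i j. (tens N y x i j + tens N y' x' i j) + c * tens N y'' x'' i j)" for x y x' y' x'' y'' c
    by (intro ext) (simp add: tr_def tens_def mult.commute)
  have ph: "phi \<beta> h N ?D' (Suc k) = q" unfolding q_def p_def by (rule dmat_phi) auto
  have wq: "ip N (pjx N p k w) q = ip N w q" "ip N (pjx N p k z) q = ip N z q"
    by (rule pjx_orth, subst ip_commute, rule q0, assumption)+
  have x: "xi \<beta> h N ?D' (Suc k) = (\<lambda>i. pjx N p k z i * ip N q q + q i * ip N w q + (- ip N w q) * (q i * ip N q q))"
    unfolding xi.simps ph g' mv wq ..
  have e: "eta \<beta> h N ?D' (Suc k) = (\<lambda>i. q i * ip N z q + pjx N p k w i * ip N q q + (- ip N w q) * (q i * ip N q q))"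
    unfolding eta.simps ph g' tt mv wq ..
  have okq: "ok N q" unfolding q_def by (rule orth_ok[OF o]) simp
  show ?thesis
  proof (cases "q = (\<lambda>_. 0)")
    case True
    then show ?thesis unfolding zeta.simps x e by (simp add: q_def)
  next
    case False
    then have q1: "ip N q q = 1" using okq by (simp add: ok_def)
    have s2: "sqrt 2 * sqrt 2 = (2::real)" by simp
    have "pjx N p k z i + pjx N p k w i = sqrt 2 * pjx N p k a i" for i
    proof -
      have zw: "z i + w i = sqrt 2 * a i" for i
        using s2 by (simp add: z_def w_def field_simps)
      have zp: "ip N z (p s) + ip N w (p s) = sqrt 2 * ip N a (p s)" for s
        using zw by (simp flip: ip_add_left ip_scale_left)
      have "pjx N p k z i + pjx N p k w i = (z i + w i) - (\<Sum>s=1..k. (ip N z (p s) + ip N w (p s)) * p s i)"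
        by (simp add: pjx_def distrib_right sum.distrib)
      also have "\<dots> = sqrt 2 * pjx N p k a i"
        unfolding zw zp by (simp add: pjx_def right_diff_distrib sum_distrib_left mult.assoc)
      finally show ?thesis .
    qed
    moreover have "ip N z q - ip N w q = sqrt 2 * ip N b q"
    proof -
      have "z i - w i = sqrt 2 * b i" for i
        using s2 by (simp add: z_def w_def field_simps)
      then show ?thesis by (simp flip: ip_diff_left ip_scale_left)
    qed
    moreover have "xi \<beta> h N ?D' (Suc k) i + eta \<beta> h N ?D' (Suc k) i
       = (pjx N p k z i + pjx N p k w i) + (ip N z q - ip N w q) * q i" for i
      unfolding x e q1 by (simp add: algebra_simps)
    ultimately have "zeta \<beta> h N ?D' (Suc k) i = pjx N p k a i + ip N b q * q i" for i
      by (simp add: zeta.simps add_divide_distrib)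
    then show ?thesis using False by (auto simp: q_def)
  qed
qed

end

section \<open>Adjoints and norms of the projections\<close>

lemma sum_ivl_prod: "(\<Sum>ij\<in>{1..N}\<times>{1..N}. f (fst ij) (snd ij)) = (\<Sum>i=1..N. \<Sum>j=1..N. f i j)"
  by (simp add: sum.cartesian_product split_beta')

lemma lp_form:
  "(\<Sum>i=1..N. \<Sum>j=1..N. T i j * lp N p A i j)
   = (\<Sum>i=1..N. \<Sum>j=1..N. T i j * A i j) - (\<Sum>j=1..N. (\<Sum>a=1..N. p a * T a j) * (\<Sum>a=1..N. p a * A a j)) / real N"
proof -
  have "(\<Sum>i=1..N. \<Sum>j=1..N. T i j * lp N p A i j)
    = (\<Sum>i=1..N. \<Sum>j=1..N. T i j * A i j) - (\<Sum>j=1..N. \<Sum>i=1..N. T i j * (p i * (\<Sum>a=1..N. p a * A a j) / real N))"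
    by (subst (3) sum.swap) (simp add: lp_def right_diff_distrib sum_subtractf)
  also have "(\<Sum>j=1..N. \<Sum>i=1..N. T i j * (p i * (\<Sum>a=1..N. p a * A a j) / real N))
    = (\<Sum>j=1..N. (\<Sum>a=1..N. p a * T a j) * (\<Sum>a=1..N. p a * A a j)) / real N"
    unfolding sum_divide_distrib
  proof (rule sum.cong[OF refl])
    fix j
    show "(\<Sum>i=1..N. T i j * (p i * (\<Sum>a=1..N. p a * A a j) / real N))
      = (\<Sum>a=1..N. p a * T a j) * (\<Sum>a=1..N. p a * A a j) / real N"
      unfolding sum_distrib_right[of "\<lambda>a. p a * T a j"] sum_divide_distrib
      by (rule sum.cong[OF refl]) simp
  qed
  finally show ?thesis .
qed

lemma lp_adjoint:
  "(\<Sum>i=1..N. \<Sum>j=1..N. T i j * lp N p A i j) = (\<Sum>i=1..N. \<Sum>j=1..N. lp N p T i j * A i j)"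
proof -
  have "(\<Sum>i=1..N. \<Sum>j=1..N. lp N p T i j * A i j) = (\<Sum>i=1..N. \<Sum>j=1..N. A i j * lp N p T i j)"
    by (simp add: mult.commute)
  then show ?thesis unfolding lp_form by (simp add: mult.commute)
qed

lemma lp_norm:
  assumes "ip N p p = 1"
  shows "(\<Sum>i=1..N. \<Sum>j=1..N. (lp N p T i j)\<^sup>2) = (\<Sum>i=1..N. \<Sum>j=1..N. (T i j)\<^sup>2) - (\<Sum>j=1..N. (\<Sum>a=1..N. p a * T a j)\<^sup>2) / real N"
proof -
  have "(\<Sum>a=1..N. p a * lp N p T a j) = 0" for j
  proof -
    have "(\<Sum>a=1..N. p a * lp N p T a j) = (\<Sum>a=1..N. p a * T a j) - (\<Sum>a=1..N. p a * p a) * (\<Sum>a=1..N. p a * T a j) / real N"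
      unfolding lp_def by (rule sum_sub_right)
    then show ?thesis using assms by (simp add: ip_def)
  qed
  then have "(\<Sum>i=1..N. \<Sum>j=1..N. lp N p T i j * lp N p T i j) = (\<Sum>i=1..N. \<Sum>j=1..N. lp N p T i j * T i j)"
    using lp_form[where T="lp N p T" and A=T and N=N and p=p] by simp
  also have "\<dots> = (\<Sum>i=1..N. \<Sum>j=1..N. T i j * lp N p T i j)" by (simp add: mult.commute)
  also have "\<dots> = (\<Sum>i=1..N. \<Sum>j=1..N. T i j * T i j) - (\<Sum>j=1..N. (\<Sum>a=1..N. p a * T a j) * (\<Sum>a=1..N. p a * T a j)) / real N"
    by (rule lp_form)
  finally show ?thesis by (simp only: power2_eq_square)
qed

lemma rp_eq_tr: "rp N p A i j = lp N p (tr A) j i"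
  by (simp add: rp_def lp_def tr_def mult.commute)

lemma rp_adjoint:
  "(\<Sum>i=1..N. \<Sum>j=1..N. T i j * rp N p A i j) = (\<Sum>i=1..N. \<Sum>j=1..N. rp N p T i j * A i j)"
  unfolding rp_eq_tr using lp_adjoint[where N=N and T="tr T" and p=p and A="tr A"]
  by (subst (1 2) sum.swap) (simp add: tr_def)

lemma rp_norm:
  assumes "ip N p p = 1"
  shows "(\<Sum>i=1..N. \<Sum>j=1..N. (rp N p T i j)\<^sup>2) = (\<Sum>i=1..N. \<Sum>j=1..N. (T i j)\<^sup>2) - (\<Sum>i=1..N. (mat_vec N T p i)\<^sup>2) / real N"
proof -
  have "(\<Sum>i=1..N. \<Sum>j=1..N. (T i j)\<^sup>2) = (\<Sum>j=1..N. \<Sum>i=1..N. (T i j)\<^sup>2)" by (rule sum.swap)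
  moreover have "(\<Sum>i=1..N. \<Sum>j=1..N. (rp N p T i j)\<^sup>2) = (\<Sum>j=1..N. \<Sum>i=1..N. (rp N p T i j)\<^sup>2)" by (rule sum.swap)
  ultimately show ?thesis
    unfolding rp_eq_tr using lp_norm[OF assms, of "tr T"] by (simp add: tr_def mat_vec_def mult.commute)
qed

lemma gstep_adjoint:
  "(\<Sum>i=1..N. \<Sum>j=1..N. T i j * gstep N p A i j) = (\<Sum>i=1..N. \<Sum>j=1..N. gstep N p T i j * A i j)"
  unfolding gstep_def lp_adjoint rp_adjoint lp_rp_commute ..

text \<open>The row of \<open>T\<close> along \<open>p\<close>, taken after the right projection so
  that the component along the tensor square of \<open>p\<close> is counted once only, in
  \<open>mat_vec N T p\<close>.\<close>

definition ycol :: "nat \<Rightarrow> vect \<Rightarrow> matr \<Rightarrow> vect" where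
  "ycol N p T = (\<lambda>j. \<Sum>a=1..N. p a * rp N p T a j)"

text \<open>Pythagoras for the splitting of \<open>T\<close> into its projected part, its column
  along \<open>p\<close> and the rest of its row along \<open>p\<close>. In
  \<open>one_step_law\<close> it makes the variances add up.\<close>

lemma gstep_norm:
  assumes "ok N p"
  shows "(\<Sum>i=1..N. \<Sum>j=1..N. (gstep N p T i j)\<^sup>2) + ((\<Sum>i=1..N. (mat_vec N T p i)\<^sup>2) + (\<Sum>j=1..N. (ycol N p T j)\<^sup>2)) / real N
     = (\<Sum>i=1..N. \<Sum>j=1..N. (T i j)\<^sup>2)"
proof (cases "ip N p p = 1")
  case True
  then show ?thesis unfolding gstep_def lp_norm[OF True] rp_norm[OF True] ycol_def by (simp add: add_divide_distrib)
next
  case False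
  then have p: "p = (\<lambda>_. 0)" using assms by (simp add: ok_def)
  have "gstep N p T i j = T i j" "mat_vec N T p i = 0" "ycol N p T j = 0" for i j
    by (simp_all add: gstep_def lp_def rp_def p mat_vec_def ycol_def)
  then show ?thesis by simp
qed

lemma ymat_form:
  "(\<Sum>i=1..N. \<Sum>j=1..N. T i j * ymat N p u i j)
   = (\<Sum>i=1..N. ((mat_vec N T p i + ycol N p T i) * u i + (mat_vec N T p i - ycol N p T i) * u (N + i))) / (sqrt 2 * real N)"
proof -
  define z where "z = (\<lambda>i. (u i + u (N + i)) / sqrt 2)"
  define w where "w = (\<lambda>i. (u i - u (N + i)) / sqrt 2)"
  have y: "ymat N p u i j = tens N z p i j + tens N p w i j - ip N w p * tens N p p i j" for i j
    by (simp add: ymat_def z_def w_def Let_def)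
  have t: "(\<Sum>i=1..N. \<Sum>j=1..N. T i j * tens N x q i j) = (\<Sum>i=1..N. x i * mat_vec N T q i) / real N" for x q
    unfolding sum_divide_distrib mat_vec_def sum_distrib_left by (intro sum.cong refl) (simp add: tens_def)
  have yc: "ycol N p T j = (\<Sum>a=1..N. p a * T a j) - (\<Sum>a=1..N. p a * mat_vec N T p a) * p j / real N" for j
    unfolding ycol_def rp_def mat_vec_def by (rule sum_sub_right)
  have s: "(\<Sum>i=1..N. p i * mat_vec N T w i) = (\<Sum>j=1..N. (\<Sum>a=1..N. p a * T a j) * w j)"
    unfolding mat_vec_def by (rule sum_mat_swap)
  have wy: "(\<Sum>j=1..N. ycol N p T j * w j) = (\<Sum>j=1..N. (\<Sum>a=1..N. p a * T a j) * w j) - (\<Sum>a=1..N. p a * mat_vec N T p a) * (\<Sum>j=1..N. p j * w j) / real N"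
    unfolding yc by (rule sum_sub_left)
  have "(\<Sum>i=1..N. \<Sum>j=1..N. T i j * ymat N p u i j)
     = (\<Sum>i=1..N. \<Sum>j=1..N. T i j * tens N z p i j) + (\<Sum>i=1..N. \<Sum>j=1..N. T i j * tens N p w i j)
       - ip N w p * (\<Sum>i=1..N. \<Sum>j=1..N. T i j * tens N p p i j)"
    unfolding y sum_distrib_left sum.distrib[symmetric] sum_subtractf[symmetric]
    by (intro sum.cong refl) (simp add: algebra_simps)
  also have "\<dots> = ((\<Sum>i=1..N. z i * mat_vec N T p i) + (\<Sum>j=1..N. ycol N p T j * w j)) / real N"
    unfolding t s wy by (simp add: ip_def add_divide_distrib diff_divide_distrib mult_ac)
  also have "(\<Sum>i=1..N. z i * mat_vec N T p i) + (\<Sum>j=1..N. ycol N p T j * w j)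
     = (\<Sum>i=1..N. ((mat_vec N T p i + ycol N p T i) * u i + (mat_vec N T p i - ycol N p T i) * u (N + i))) / sqrt 2"
    unfolding sum_divide_distrib sum.distrib[symmetric]
    by (intro sum.cong refl) (simp add: z_def w_def add_divide_distrib diff_divide_distrib algebra_simps)
  finally show ?thesis by simp
qed

section \<open>Measurability of the recursion\<close>

text \<open>Only entries with indices in \<open>{1..N}\<close> are random variables of the model, so
  measurability is asked of these alone.\<close>

definition mv :: "nat \<Rightarrow> 'a measure \<Rightarrow> ('a \<Rightarrow> vect) \<Rightarrow> bool" where
  "mv N M x \<longleftrightarrow> (\<forall>i\<in>{1..N}. (\<lambda>\<omega>. x \<omega> i) \<in> borel_measurable M)"

definition mm :: "nat \<Rightarrow> 'a measure \<Rightarrow> ('a \<Rightarrow> matr) \<Rightarrow> bool" where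
  "mm N M A \<longleftrightarrow> (\<forall>i\<in>{1..N}. \<forall>j\<in>{1..N}. (\<lambda>\<omega>. A \<omega> i j) \<in> borel_measurable M)"

lemma mvI: "(\<And>i. i \<in> {1..N} \<Longrightarrow> (\<lambda>\<omega>. x \<omega> i) \<in> borel_measurable M) \<Longrightarrow> mv N M x"
  by (auto simp: mv_def)

lemma mvD: "mv N M x \<Longrightarrow> i \<in> {1..N} \<Longrightarrow> (\<lambda>\<omega>. x \<omega> i) \<in> borel_measurable M"
  by (auto simp: mv_def)

lemma mmI: "(\<And>i j. i \<in> {1..N} \<Longrightarrow> j \<in> {1..N} \<Longrightarrow> (\<lambda>\<omega>. A \<omega> i j) \<in> borel_measurable M) \<Longrightarrow> mm N M A"
  by (auto simp: mm_def)

lemma mmD: "mm N M A \<Longrightarrow> i \<in> {1..N} \<Longrightarrow> j \<in> {1..N} \<Longrightarrow> (\<lambda>\<omega>. A \<omega> i j) \<in> borel_measurable M"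
  by (auto simp: mm_def)

lemma borel_measurable_tanh [measurable (raw)]:
  assumes [measurable]: "f \<in> borel_measurable M"
  shows "(\<lambda>x. tanh (f x :: real)) \<in> borel_measurable M"
proof -
  have "(tanh :: real \<Rightarrow> real) \<in> borel_measurable borel"
    by (intro borel_measurable_continuous_onI continuous_intros) auto
  then show ?thesis using assms by (rule measurable_compose_rev)
qed

lemma mv_ip: "mv N M x \<Longrightarrow> mv N M y \<Longrightarrow> (\<lambda>\<omega>. ip N (x \<omega>) (y \<omega>)) \<in> borel_measurable M"
  unfolding ip_def
  by (intro borel_measurable_divide borel_measurable_sum borel_measurable_times borel_measurable_const) (auto intro: mvD)

lemma mv_mat_vec: "mm N M A \<Longrightarrow> mv N M x \<Longrightarrow> mv N M (\<lambda>\<omega>. mat_vec N (A \<omega>) (x \<omega>))"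
  unfolding mat_vec_def by (intro mvI borel_measurable_sum borel_measurable_times) (auto intro: mvD mmD)

lemma mm_tr: "mm N M A \<Longrightarrow> mm N M (\<lambda>\<omega>. tr (A \<omega>))"
  by (auto simp: mm_def tr_def)

lemma mm_tens: "mv N M x \<Longrightarrow> mv N M y \<Longrightarrow> mm N M (\<lambda>\<omega>. tens N (x \<omega>) (y \<omega>))"
  unfolding tens_def by (intro mmI borel_measurable_divide borel_measurable_times) (auto intro: mvD)

lemma mm_gstep: "mv N M p \<Longrightarrow> mm N M A \<Longrightarrow> mm N M (\<lambda>\<omega>. gstep N (p \<omega>) (A \<omega>))"
  unfolding gstep_alt
  by (intro mmI borel_measurable_diff borel_measurable_add borel_measurable_times mv_ip mv_mat_vec)
     (auto intro!: mmD[OF mm_tens] mv_mat_vec mm_tr mmD[of N M A])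

lemma mm_mproj:
  "(\<And>s. s \<in> {1..k} \<Longrightarrow> mv N M (\<lambda>\<omega>. p \<omega> s)) \<Longrightarrow> mm N M A \<Longrightarrow> mm N M (\<lambda>\<omega>. mproj N (p \<omega>) k (A \<omega>))"
  by (induction k) (auto intro!: mm_gstep)

lemma mv_pjx:
  assumes p: "\<And>s. s \<in> {1..k} \<Longrightarrow> mv N M (\<lambda>\<omega>. p \<omega> s)" and x: "mv N M x"
  shows "mv N M (\<lambda>\<omega>. pjx N (p \<omega>) k (x \<omega>))"
  unfolding pjx_def
  by (intro mvI borel_measurable_diff borel_measurable_sum borel_measurable_times mv_ip[OF x p] mvD[OF x] mvD[OF p])

lemma mv_vm:
  assumes z: "\<And>s. s \<in> {1..k} \<Longrightarrow> mv N M (\<lambda>\<omega>. zeta \<beta> h N (G \<omega>) s)" and "s \<le> Suc k"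
  shows "mv N M (\<lambda>\<omega>. vm \<beta> h N (G \<omega>) s)"
proof -
  consider "s = 0" | "s = 1" | l where "s = Suc (Suc l)" by (metis One_nat_def not0_implies_Suc)
  then show ?thesis
  proof cases
    case 3
    show ?thesis
      unfolding 3 vm.simps vh.simps using assms(2) 3
      by (intro mvI borel_measurable_tanh borel_measurable_add borel_measurable_times borel_measurable_sum borel_measurable_const mvD[OF z]) auto
  qed (auto simp: vm.simps mv_def)
qed

text \<open>The measure is arbitrary so that \<open>sigma_G\<close> can be used, for which
  measurability is available only for the data of the first k steps.\<close>

lemma mv_phi_zeta:
  assumes z: "\<And>s. s \<in> {1..k} \<Longrightarrow> mv N M (\<lambda>\<omega>. zeta \<beta> h N (G \<omega>) s)" and "s \<le> Suc k"
  shows "mv N M (\<lambda>\<omega>. phi \<beta> h N (G \<omega>) s)"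
  using assms(2)
proof (induction s rule: less_induct)
  case (less s)
  consider "s = 0" | "s = 1" | l where "s = Suc (Suc l)" by (metis One_nat_def not0_implies_Suc)
  then show ?case
  proof cases
    case 3
    let ?r = "\<lambda>\<omega>. pjx N (phi \<beta> h N (G \<omega>)) (Suc l) (vm \<beta> h N (G \<omega>) s)"
    have p: "phi \<beta> h N G s = (\<lambda>i. pjx N (phi \<beta> h N G) (Suc l) (vm \<beta> h N G s) i / nrm N (pjx N (phi \<beta> h N G) (Suc l) (vm \<beta> h N G s)))" for G
      unfolding 3 phi.simps(3) Let_def pjx_def ..
    have r: "mv N M ?r"
      using less 3 by (intro mv_pjx mv_vm[OF z] less.IH) auto
    show ?thesis
      unfolding p nrm_def
      by (intro mvI borel_measurable_divide mvD[OF r] mv_ip[OF r r] measurable_compose[OF _ borel_measurable_sqrt]) auto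
  qed (auto simp: phi.simps mv_def)
qed

lemma mv_data:
  assumes G: "mm N M G"
  shows "mv N M (\<lambda>\<omega>. phi \<beta> h N (G \<omega>) s)" "mv N M (\<lambda>\<omega>. xi \<beta> h N (G \<omega>) s)" "mv N M (\<lambda>\<omega>. eta \<beta> h N (G \<omega>) s)"
    "mv N M (\<lambda>\<omega>. zeta \<beta> h N (G \<omega>) s)"
proof -
  have P: "mv N M (\<lambda>\<omega>. phi \<beta> h N (G \<omega>) s) \<and> mm N M (\<lambda>\<omega>. gmat \<beta> h N (G \<omega>) s)" for s
  proof (induction s rule: less_induct)
    case (less s)
    have g: "mm N M (\<lambda>\<omega>. gmat \<beta> h N (G \<omega>) s)"
    proof (cases s)
      case 0
      then show ?thesis by (simp add: gmat.simps mm_def)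
    next
      case (Suc k)
      show ?thesis unfolding Suc gmat_mproj using less Suc by (intro mm_mproj G) auto
    qed
    have z: "mv N M (\<lambda>\<omega>. zeta \<beta> h N (G \<omega>) t)" if "t < s" for t
    proof -
      have p: "mv N M (\<lambda>\<omega>. phi \<beta> h N (G \<omega>) t)" and g: "mm N M (\<lambda>\<omega>. gmat \<beta> h N (G \<omega>) t)"
        using less that by auto
      show ?thesis unfolding zeta.simps xi.simps eta.simps
        by (intro mvI borel_measurable_divide borel_measurable_add borel_measurable_const
            mvD[OF mv_mat_vec[OF g p]] mvD[OF mv_mat_vec[OF mm_tr[OF g] p]])
    qed
    have "mv N M (\<lambda>\<omega>. phi \<beta> h N (G \<omega>) s)"
      by (rule mv_phi_zeta[of "s - 1"]) (auto intro: z)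
    then show ?case using g by simp
  qed
  then show p: "mv N M (\<lambda>\<omega>. phi \<beta> h N (G \<omega>) s)" by simp
  show x: "mv N M (\<lambda>\<omega>. xi \<beta> h N (G \<omega>) s)" unfolding xi.simps using P[of s] by (intro mv_mat_vec) auto
  show e: "mv N M (\<lambda>\<omega>. eta \<beta> h N (G \<omega>) s)" unfolding eta.simps using P[of s] by (intro mv_mat_vec mm_tr) auto
  show "mv N M (\<lambda>\<omega>. zeta \<beta> h N (G \<omega>) s)"
    unfolding zeta.simps by (intro mvI borel_measurable_divide borel_measurable_add borel_measurable_const mvD[OF x] mvD[OF e]) auto
qed

lemma mm_ymat:
  assumes p: "mv N M p" and u: "\<And>l. l \<in> {1..2*N} \<Longrightarrow> (\<lambda>\<omega>. u \<omega> l) \<in> borel_measurable M"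
  shows "mm N M (\<lambda>\<omega>. ymat N (p \<omega>) (u \<omega>))"
proof -
  have z: "mv N M (\<lambda>\<omega> i. (u \<omega> i + u \<omega> (N + i)) / sqrt 2)" and w: "mv N M (\<lambda>\<omega> i. (u \<omega> i - u \<omega> (N + i)) / sqrt 2)"
    by (intro mvI borel_measurable_divide borel_measurable_add borel_measurable_diff borel_measurable_const u; auto)+
  show ?thesis
    unfolding ymat_def Let_def
    by (intro mmI borel_measurable_diff borel_measurable_add borel_measurable_times mv_ip[OF w p]
        mmD[OF mm_tens[OF z p]] mmD[OF mm_tens[OF p w]] mmD[OF mm_tens[OF p p]])
qed

lemma mm_dmat:
  assumes v: "\<And>s l. s \<in> {1..k} \<Longrightarrow> l \<in> {1..2*N} \<Longrightarrow> (\<lambda>\<omega>. v \<omega> s l) \<in> borel_measurable M"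
  shows "mm N M (\<lambda>\<omega>. dmat \<beta> h N (v \<omega>) k)"
  using v
proof (induction k)
  case 0
  show ?case by (simp add: mm_def)
next
  case (Suc k)
  have D: "mm N M (\<lambda>\<omega>. dmat \<beta> h N (v \<omega>) k)" by (rule Suc.IH) (auto intro: Suc.prems)
  show ?case unfolding dmat.simps
    by (intro mmI borel_measurable_add mmD[OF D] mmD[OF mm_mproj[OF mv_data(1)[OF D] mm_ymat[OF mv_data(1)[OF D]]]] Suc.prems) auto
qed

section \<open>The law of the disorder\<close>

text \<open>\<open>mtx\<close> and \<open>vec\<close> translate between a disorder matrix with
  entries of variance 1/N and a standard Gaussian family. The restriction in \<open>vec\<close>
  places its values in the space of the product measure.\<close>

definition mtx :: "nat \<Rightarrow> (nat \<times> nat \<Rightarrow> real) \<Rightarrow> matr" where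
  "mtx N x = (\<lambda>i j. x (i, j) / sqrt (real N))"

definition vec :: "nat \<Rightarrow> matr \<Rightarrow> (nat \<times> nat \<Rightarrow> real)" where
  "vec N A = (\<lambda>ij\<in>{1..N}\<times>{1..N}. sqrt (real N) * A (fst ij) (snd ij))"

definition gm :: "nat \<Rightarrow> (nat \<times> nat \<Rightarrow> real) measure" where
  "gm N = gprod ({1..N}\<times>{1..N})"

definition UU :: "nat \<Rightarrow> (nat \<Rightarrow> real) measure" where
  "UU N = gprod {1..2*N}"

definition VV :: "nat \<Rightarrow> nat \<Rightarrow> (nat \<Rightarrow> nat \<Rightarrow> real) measure" where
  "VV N k = PiM {1..k} (\<lambda>_. UU N)"

lemma prob_space_gm: "prob_space (gm N)" and prob_space_UU: "prob_space (UU N)"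
  unfolding gm_def UU_def by (rule prob_space_gprod)+

lemma prob_space_VV: "prob_space (VV N k)"
  unfolding VV_def by (rule prob_space_PiM) (rule prob_space_UU)

lemma sets_gm [measurable_cong, simp]: "sets (gm N) = sets (PiM ({1..N}\<times>{1..N}) (\<lambda>_. borel))"
  by (simp add: gm_def)

lemma sets_UU [measurable_cong, simp]: "sets (UU N) = sets (PiM {1..2*N} (\<lambda>_. borel))"
  by (simp add: UU_def)

lemma sets_VV [measurable_cong]: "sets (VV N k) = sets (PiM {1..k} (\<lambda>_. PiM {1..2*N} (\<lambda>_. borel)))"
  unfolding VV_def by (rule sets_PiM_cong) auto

lemma measurable_UU_component: "l \<in> {1..2*N} \<Longrightarrow> (\<lambda>u. u l) \<in> borel_measurable (UU N)"
  unfolding UU_def by (rule measurable_gprod_component)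

lemma measurable_gm_component: "ij \<in> {1..N}\<times>{1..N} \<Longrightarrow> (\<lambda>u. u ij) \<in> borel_measurable (gm N)"
  unfolding gm_def by (rule measurable_gprod_component)

lemma measurable_VV_component: "s \<in> {1..k} \<Longrightarrow> l \<in> {1..2*N} \<Longrightarrow> (\<lambda>v. v s l) \<in> borel_measurable (VV N k)"
proof -
  assume s: "s \<in> {1..k}" and l: "l \<in> {1..2*N}"
  have "(\<lambda>v. v s) \<in> measurable (VV N k) (UU N)"
    unfolding VV_def by (rule measurable_component_singleton[OF s])
  then show ?thesis by (rule measurable_compose[OF _ measurable_UU_component[OF l]])
qed

lemma measurable_snd_gm: "snd \<in> measurable (A \<Otimes>\<^sub>M gm N) (PiM ({1..N}\<times>{1..N}) (\<lambda>_. borel))"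
  using measurable_snd[of A "gm N"] by (subst measurable_cong_sets[OF refl sets_gm[symmetric]])

lemma mtx_vec: "N \<ge> 1 \<Longrightarrow> i \<in> {1..N} \<Longrightarrow> j \<in> {1..N} \<Longrightarrow> mtx N (vec N A) i j = A i j"
  by (simp add: mtx_def vec_def)

lemma mm_mtx:
  assumes X: "X \<in> measurable M (PiM ({1..N}\<times>{1..N}) (\<lambda>_. borel))"
  shows "mm N M (\<lambda>\<omega>. mtx N (X \<omega>))"
proof (rule mmI)
  fix i j assume "i \<in> {1..N}" "j \<in> {1..N}"
  then have "(\<lambda>x. x (i, j)) \<in> borel_measurable (PiM ({1..N}\<times>{1..N}) (\<lambda>_. borel))"
    by (intro measurable_component_singleton) auto
  from measurable_compose[OF X this] show "(\<lambda>\<omega>. mtx N (X \<omega>) i j) \<in> borel_measurable M"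
    by (simp add: mtx_def)
qed

lemma mm_vec: "mm N M A \<Longrightarrow> (\<lambda>\<omega>. vec N (A \<omega>)) \<in> measurable M (PiM ({1..N}\<times>{1..N}) (\<lambda>_. borel))"
  unfolding vec_def by (intro measurable_restrict borel_measurable_times borel_measurable_const) (auto intro: mmD)

lemma mproj_in_range:
  assumes "\<And>i j. i \<in> {1..N} \<Longrightarrow> j \<in> {1..N} \<Longrightarrow> A i j = A' i j" "i \<in> {1..N}" "j \<in> {1..N}"
  shows "mproj N ph k A i j = mproj N ph k A' i j"
  using assms(2,3)
proof (induction k arbitrary: i j)
  case 0
  then show ?case using assms(1) by simp
next
  case (Suc k)
  have "lp N p B i j = lp N p B' i j" "rp N p B i j = rp N p B' i j"
    if "\<And>i j. i \<in> {1..N} \<Longrightarrow> j \<in> {1..N} \<Longrightarrow> B i j = B' i j" "i \<in> {1..N}" "j \<in> {1..N}" for p B B' i j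
    using that unfolding lp_def rp_def by auto
  then show ?case unfolding mproj.simps gstep_def using Suc by blast
qed

text \<open>Every linear form of the new matrix is a form in the fresh vector plus a form in the
  independent matrix. By \<open>gstep_norm\<close> the squared lengths of the two coefficient
  vectors add up to that of \<open>t\<close>, so the characteristic function is the standard
  Gaussian one.\<close>

lemma one_step_law:
  assumes N: "N \<ge> 1" and p: "ok N p"
  shows "distr (UU N \<Otimes>\<^sub>M gm N) (PiM ({1..N}\<times>{1..N}) (\<lambda>_. borel))
      (\<lambda>(u, x). vec N (\<lambda>i j. ymat N p u i j + gstep N p (mtx N x) i j)) = gm N"
proof -
  interpret U: prob_space "UU N" by (rule prob_space_UU)
  interpret G: prob_space "gm N" by (rule prob_space_gm)
  interpret P: pair_prob_space "UU N" "gm N" ..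
  let ?I = "{1..N}\<times>{1..N}"
  let ?F = "\<lambda>\<omega>. vec N (\<lambda>i j. ymat N p (fst \<omega>) i j + gstep N p (mtx N (snd \<omega>)) i j)"
  have pm: "mv N (UU N \<Otimes>\<^sub>M gm N) (\<lambda>_. p)" by (rule mvI) simp
  have F: "?F \<in> measurable (UU N \<Otimes>\<^sub>M gm N) (PiM ?I (\<lambda>_. borel))"
    by (intro mm_vec mmI borel_measurable_add mmD[OF mm_ymat[OF pm]] mmD[OF mm_gstep[OF pm mm_mtx[OF measurable_snd_gm]]]
        measurable_compose[OF measurable_fst measurable_UU_component])
  have "distr (UU N \<Otimes>\<^sub>M gm N) (PiM ?I (\<lambda>_. borel)) ?F = gprod ?I"
  proof (rule gaussian_law_gprod[OF _ P.prob_space_axioms F])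
    fix t :: "nat \<times> nat \<Rightarrow> real"
    define T where "T i j = t (i, j)" for i j
    \<comment> \<open>Coefficients of the 2N fresh Gaussians: by the rotation in
      \<open>ymat\<close>, the first half carries the sum of the column part and the row part, the
      second half their difference.\<close>
    define c where "c l = (if l \<le> N then mat_vec N T p l + ycol N p T l else mat_vec N T p (l - N) - ycol N p T (l - N)) / sqrt (2 * real N)" for l
    define e where "e ij = gstep N p T (fst ij) (snd ij)" for ij
    have sp: "(\<Sum>l=1..2*N. f l) = (\<Sum>i=1..N. f i + f (N + i))" for f :: "nat \<Rightarrow> real"
    proof -
      have "{1..2*N} = {1..N} \<union> {N+1..N+N}" by auto
      then have "(\<Sum>l=1..2*N. f l) = (\<Sum>l=1..N. f l) + (\<Sum>l=N+1..N+N. f l)"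
        by (simp add: sum.union_disjoint)
      also have "(\<Sum>l=N+1..N+N. f l) = (\<Sum>i=1..N. f (i + N))"
        using sum.shift_bounds_cl_nat_ivl[of f 1 N N] by (simp add: add.commute)
      finally show ?thesis by (simp add: sum.distrib add.commute)
    qed
    have sq: "sqrt (real N) / (sqrt 2 * real N) = 1 / sqrt (2 * real N)"
      using N by (simp add: real_sqrt_mult field_simps) 
    have lin: "(\<Sum>ij\<in>?I. t ij * ?F (u, x) ij) = (\<Sum>l\<in>{1..2*N}. c l * u l) + (\<Sum>ij\<in>?I. e ij * x ij)" for u x
    proof -
      have "(\<Sum>ij\<in>?I. t ij * ?F (u, x) ij)
          = (\<Sum>i=1..N. \<Sum>j=1..N. sqrt (real N) * (T i j * ymat N p u i j) + sqrt (real N) * (T i j * gstep N p (mtx N x) i j))"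
        unfolding sum_ivl_prod[symmetric] by (rule sum.cong) (auto simp: vec_def T_def algebra_simps)
      also have "\<dots> = sqrt (real N) * (\<Sum>i=1..N. \<Sum>j=1..N. T i j * ymat N p u i j)
          + sqrt (real N) * (\<Sum>i=1..N. \<Sum>j=1..N. gstep N p T i j * mtx N x i j)"
        unfolding gstep_adjoint[symmetric] by (simp add: sum.distrib sum_distrib_left)
      also have "sqrt (real N) * (\<Sum>i=1..N. \<Sum>j=1..N. gstep N p T i j * mtx N x i j) = (\<Sum>ij\<in>?I. e ij * x ij)"
      proof -
        have "sqrt (real N) * (\<Sum>i=1..N. \<Sum>j=1..N. gstep N p T i j * mtx N x i j) = (\<Sum>i=1..N. \<Sum>j=1..N. e (i, j) * x (i, j))"
          unfolding sum_distrib_left using N by (intro sum.cong refl) (simp add: e_def mtx_def)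
        also have "\<dots> = (\<Sum>ij\<in>?I. e ij * x ij)"
          using sum_ivl_prod[where N=N and f="\<lambda>i j. e (i, j) * x (i, j)"] by simp
        finally show ?thesis .
      qed
      also have "sqrt (real N) * (\<Sum>i=1..N. \<Sum>j=1..N. T i j * ymat N p u i j)
         = (\<Sum>i=1..N. ((mat_vec N T p i + ycol N p T i) * u i + (mat_vec N T p i - ycol N p T i) * u (N + i))) / sqrt (2 * real N)"
      proof -
        have "sqrt (real N) * (S / (sqrt 2 * real N)) = S / sqrt (2 * real N)" for S
        proof -
          have "sqrt (real N) * (S / (sqrt 2 * real N)) = S * (sqrt (real N) / (sqrt 2 * real N))" by simp
          then show ?thesis unfolding sq by simp
        qed
        then show ?thesis unfolding ymat_form .
      qed
      also have "\<dots> = (\<Sum>l\<in>{1..2*N}. c l * u l)"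
        unfolding sp sum_divide_distrib by (rule sum.cong) (auto simp: c_def add_divide_distrib[of "_ * _" "_ * _"])
      finally show ?thesis .
    qed
    have nrm: "(\<Sum>l\<in>{1..2*N}. (c l)\<^sup>2) + (\<Sum>ij\<in>?I. (e ij)\<^sup>2) = (\<Sum>ij\<in>?I. (t ij)\<^sup>2)"
    proof -
      have "(\<Sum>l\<in>{1..2*N}. (c l)\<^sup>2) = (\<Sum>i=1..N. ((mat_vec N T p i)\<^sup>2 + (ycol N p T i)\<^sup>2) / real N)"
        unfolding sp
      proof (rule sum.cong[OF refl])
        fix i assume "i \<in> {1..N}"
        then have "(c i)\<^sup>2 + (c (N + i))\<^sup>2 = (mat_vec N T p i + ycol N p T i)\<^sup>2 / (2 * real N) + (mat_vec N T p i - ycol N p T i)\<^sup>2 / (2 * real N)"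
          by (simp add: c_def power_divide)
        also have "\<dots> = ((mat_vec N T p i)\<^sup>2 + (ycol N p T i)\<^sup>2) / real N"
          using N by (simp add: field_simps power2_eq_square)
        finally show "(c i)\<^sup>2 + (c (N + i))\<^sup>2 = ((mat_vec N T p i)\<^sup>2 + (ycol N p T i)\<^sup>2) / real N" .
      qed
      moreover have "(\<Sum>ij\<in>?I. (e ij)\<^sup>2) = (\<Sum>i=1..N. \<Sum>j=1..N. (gstep N p T i j)\<^sup>2)"
        unfolding e_def by (rule sum_ivl_prod)
      moreover have "(\<Sum>ij\<in>?I. (t ij)\<^sup>2) = (\<Sum>i=1..N. \<Sum>j=1..N. (T i j)\<^sup>2)"
        unfolding sum_ivl_prod[symmetric] T_def by simp
      ultimately show ?thesis
        using gstep_norm[OF p, of T] by (simp add: sum.distrib sum_divide_distrib[symmetric])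
    qed
    have [measurable]: "(\<lambda>x. \<Sum>ij\<in>?I. e ij * x ij) \<in> borel_measurable (gm N)"
      by (intro borel_measurable_sum borel_measurable_times borel_measurable_const measurable_gm_component)
    have [measurable]: "(\<lambda>u. \<Sum>l\<in>{1..2*N}. c l * u l) \<in> borel_measurable (UU N)"
      by (intro borel_measurable_sum borel_measurable_times borel_measurable_const measurable_UU_component)
    have "(\<integral>\<omega>. cis (\<Sum>ij\<in>?I. t ij * ?F \<omega> ij) \<partial>(UU N \<Otimes>\<^sub>M gm N))
      = (\<integral>\<omega>. cis ((\<Sum>l\<in>{1..2*N}. c l * fst \<omega> l) + (\<Sum>ij\<in>?I. e ij * snd \<omega> ij)) \<partial>(UU N \<Otimes>\<^sub>M gm N))"
    proof (rule Bochner_Integration.integral_cong[OF refl])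
      fix \<omega> :: "(nat \<Rightarrow> real) \<times> (nat \<times> nat \<Rightarrow> real)"
      show "cis (\<Sum>ij\<in>?I. t ij * ?F \<omega> ij) = cis ((\<Sum>l\<in>{1..2*N}. c l * fst \<omega> l) + (\<Sum>ij\<in>?I. e ij * snd \<omega> ij))"
        using lin[of "fst \<omega>" "snd \<omega>"] by (simp only: prod.collapse)
    qed
    also have "\<dots> = (\<integral>u. (\<integral>x. cis ((\<Sum>l\<in>{1..2*N}. c l * u l) + (\<Sum>ij\<in>?I. e ij * x ij)) \<partial>gm N) \<partial>UU N)"
      using P.integral_fst'[of "\<lambda>\<omega>. cis ((\<Sum>l\<in>{1..2*N}. c l * fst \<omega> l) + (\<Sum>ij\<in>?I. e ij * snd \<omega> ij))"]
      by simp
    also have "\<dots> = (\<integral>u. cis (\<Sum>l\<in>{1..2*N}. c l * u l) \<partial>UU N) * (\<integral>x. cis (\<Sum>ij\<in>?I. e ij * x ij) \<partial>gm N)"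
      by (simp flip: cis_mult)
    also have "\<dots> = complex_of_real (exp (- (\<Sum>ij\<in>?I. (t ij)\<^sup>2) / 2))"
      unfolding UU_def gm_def gprod_cis[OF finite_atLeastAtMost] gprod_cis[OF finite_cartesian_product[OF finite_atLeastAtMost finite_atLeastAtMost]]
        nrm[symmetric] of_real_mult[symmetric] exp_add[symmetric]
      by (simp add: add_divide_distrib)
    finally show "(\<integral>\<omega>. cis (\<Sum>ij\<in>?I. t ij * ?F \<omega> ij) \<partial>(UU N \<Otimes>\<^sub>M gm N)) = complex_of_real (exp (- (\<Sum>ij\<in>?I. (t ij)\<^sup>2) / 2))" .
  qed simp
  then show ?thesis by (simp add: split_beta' gm_def)
qed

lemma measurable_theta:
  assumes N: "N \<ge> 1"
    and v: "\<And>s l. s \<in> {1..k} \<Longrightarrow> l \<in> {1..2*N} \<Longrightarrow> (\<lambda>\<omega>. v \<omega> s l) \<in> borel_measurable M"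
    and X: "X \<in> measurable M (PiM ({1..N}\<times>{1..N}) (\<lambda>_. borel))"
  shows "mm N M (\<lambda>\<omega>. theta \<beta> h N (v \<omega>) k (mtx N (X \<omega>)))"
  unfolding theta_def[OF N]
  by (intro mmI borel_measurable_add mmD[OF mm_dmat[OF v]] mmD[OF mm_mproj[OF mv_data(1)[OF mm_dmat[OF v]] mm_mtx[OF X]]])

lemma nn_integral_VV_Suc:
  assumes f: "f \<in> borel_measurable (VV N (Suc k))"
  shows "(\<integral>\<^sup>+v. f v \<partial>VV N (Suc k)) = (\<integral>\<^sup>+v. (\<integral>\<^sup>+u. f (v(Suc k := u)) \<partial>UU N) \<partial>VV N k)"
proof -
  interpret U: prob_space "UU N" by (rule prob_space_UU)
  interpret product_sigma_finite "\<lambda>_::nat. UU N" by standard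
  have i: "{1..Suc k} = insert (Suc k) {1..k}" by auto
  show ?thesis using f unfolding VV_def i by (intro product_nn_integral_insert) auto
qed

text \<open>The newest block and the matrix are integrated first, with the earlier blocks fixed. The
  next \<phi> depends on those earlier blocks only, so it is a deterministic direction at that
  moment and \<open>one_step_law\<close> applies.\<close>

theorem theta_law:
  assumes N: "N \<ge> 1" and H: "H \<in> borel_measurable (PiM ({1..N}\<times>{1..N}) (\<lambda>_. borel))"
  shows "(\<integral>\<^sup>+v. (\<integral>\<^sup>+x. H (vec N (theta \<beta> h N v k (mtx N x))) \<partial>gm N) \<partial>VV N k) = (\<integral>\<^sup>+x. H x \<partial>gm N)"
proof (induction k)
  case 0
  interpret V: prob_space "VV N 0" by (rule prob_space_VV)
  have "H (vec N (theta \<beta> h N v 0 (mtx N x))) = H x" if "x \<in> space (gm N)" for v x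
  proof -
    have "vec N (theta \<beta> h N v 0 (mtx N x)) = x"
      using that N by (auto simp: vec_def theta_def[OF N] mtx_def gm_def space_gprod PiE_def extensional_def fun_eq_iff)
    then show ?thesis by simp
  qed
  then have "(\<integral>\<^sup>+x. H (vec N (theta \<beta> h N v 0 (mtx N x))) \<partial>gm N) = (\<integral>\<^sup>+x. H x \<partial>gm N)" for v
    by (intro nn_integral_cong) auto
  then show ?case by (simp add: V.emeasure_space_1)
next
  case (Suc k)
  interpret G: prob_space "gm N" by (rule prob_space_gm)
  interpret U: prob_space "UU N" by (rule prob_space_UU)
  interpret P: pair_prob_space "UU N" "gm N" ..
  let ?I = "{1..N}\<times>{1..N}"
  let ?f = "\<lambda>v. \<integral>\<^sup>+x. H (vec N (theta \<beta> h N v (Suc k) (mtx N x))) \<partial>gm N"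
  have "(\<lambda>\<omega>. H (vec N (theta \<beta> h N (fst \<omega>) (Suc k) (mtx N (snd \<omega>))))) \<in> borel_measurable (VV N (Suc k) \<Otimes>\<^sub>M gm N)"
    by (intro measurable_compose[OF mm_vec H] measurable_theta[OF N] measurable_compose[OF measurable_fst measurable_VV_component] measurable_snd_gm)
  then have f: "?f \<in> borel_measurable (VV N (Suc k))"
    by (intro G.borel_measurable_nn_integral) (simp add: split_beta')
  have "(\<integral>\<^sup>+u. ?f (v(Suc k := u)) \<partial>UU N) = (\<integral>\<^sup>+x. H (vec N (theta \<beta> h N v k (mtx N x))) \<partial>gm N)" for v
  proof -
    define p where "p = phi \<beta> h N (dmat \<beta> h N v k) (Suc k)"
    have pok: "ok N p" unfolding p_def by (rule orth_ok[OF phi_orth[OF N, of _ _ _ "Suc k"]]) simp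
    let ?F = "\<lambda>\<omega>. vec N (\<lambda>i j. ymat N p (fst \<omega>) i j + gstep N p (mtx N (snd \<omega>)) i j)"
    define H' where "H' y = H (vec N (theta \<beta> h N v k (mtx N y)))" for y
    have H': "H' \<in> borel_measurable (PiM ?I (\<lambda>_. borel))"
      unfolding H'_def by (intro measurable_compose[OF mm_vec H] measurable_theta[OF N]) auto
    have pm: "mv N (UU N \<Otimes>\<^sub>M gm N) (\<lambda>_. p)" by (rule mvI) simp
    have F: "?F \<in> measurable (UU N \<Otimes>\<^sub>M gm N) (PiM ?I (\<lambda>_. borel))"
      by (intro mm_vec mmI borel_measurable_add mmD[OF mm_ymat[OF pm]] mmD[OF mm_gstep[OF pm mm_mtx[OF measurable_snd_gm]]]
          measurable_compose[OF measurable_fst measurable_UU_component])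
    have eq: "H (vec N (theta \<beta> h N (v(Suc k := u)) (Suc k) (mtx N x))) = H' (?F (u, x))" for u x
    proof -
      let ?v = "v(Suc k := u)"
      have d: "dmat \<beta> h N ?v k = dmat \<beta> h N v k" by (rule dmat_cong) auto
      have "theta \<beta> h N ?v (Suc k) (mtx N x) = theta \<beta> h N v k (\<lambda>i j. ymat N p u i j + gstep N p (mtx N x) i j)"
        unfolding theta_Suc[OF N, symmetric] by (simp add: theta_def[OF N] d p_def)
      moreover have "vec N (theta \<beta> h N v k (\<lambda>i j. ymat N p u i j + gstep N p (mtx N x) i j))
          = vec N (theta \<beta> h N v k (mtx N (?F (u, x))))"
      proof -
        have "mproj N ph k (\<lambda>i j. ymat N p u i j + gstep N p (mtx N x) i j) i j = mproj N ph k (mtx N (?F (u, x))) i j"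
          if "i \<in> {1..N}" "j \<in> {1..N}" for i j ph
          by (rule mproj_in_range[OF _ that]) (simp add: mtx_vec[OF N])
        then show ?thesis unfolding vec_def theta_def[OF N] by (intro restrict_ext) auto
      qed
      ultimately show ?thesis by (simp add: H'_def)
    qed
    have "(\<integral>\<^sup>+u. ?f (v(Suc k := u)) \<partial>UU N) = (\<integral>\<^sup>+u. (\<integral>\<^sup>+x. H' (?F (u, x)) \<partial>gm N) \<partial>UU N)"
      unfolding eq ..
    also have "\<dots> = (\<integral>\<^sup>+\<omega>. H' (?F \<omega>) \<partial>(UU N \<Otimes>\<^sub>M gm N))"
      by (rule G.nn_integral_fst) (rule measurable_compose[OF F H'])
    also have "\<dots> = (\<integral>\<^sup>+y. H' y \<partial>distr (UU N \<Otimes>\<^sub>M gm N) (PiM ?I (\<lambda>_. borel)) ?F)"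
      by (rule nn_integral_distr[symmetric, OF F]) (simp only: measurable_distr_eq1 H')
    also have "\<dots> = (\<integral>\<^sup>+y. H' y \<partial>gm N)"
      using one_step_law[OF N pok] by (simp add: split_beta')
    finally show ?thesis by (simp add: H'_def)
  qed
  then show ?case using Suc by (simp add: nn_integral_VV_Suc[OF f])
qed

lemma gaussian_disorder_law:
  assumes N: "N \<ge> 1" and g: "gaussian_disorder N M g"
  shows "distr M (PiM ({1..N}\<times>{1..N}) (\<lambda>_. borel)) (\<lambda>\<omega>. vec N (realise g \<omega>)) = gm N"
    and "mm N M (realise g)" and "prob_space M"
proof -
  show "prob_space M" using g by (simp add: gaussian_disorder_def)
  interpret prob_space M by fact
  let ?I = "{1..N}\<times>{1..N}"
  have ind: "indep_vars (\<lambda>_. borel) (\<lambda>(i, j). g i j) ?I"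
    and d: "\<And>i j. i \<in> {1..N} \<Longrightarrow> j \<in> {1..N} \<Longrightarrow> distributed M lborel (g i j) (normal_density 0 (sqrt (1 / real N)))"
    using g by (auto simp: gaussian_disorder_def)
  have gm: "g i j \<in> borel_measurable M" if "i \<in> {1..N}" "j \<in> {1..N}" for i j
    using distributed_measurable[OF d[OF that]] by simp
  then show "mm N M (realise g)" by (auto simp: mm_def realise_def)
  have sd: "distr M borel (\<lambda>\<omega>. sqrt (real N) * g i j \<omega>) = std_gauss" if "i \<in> {1..N}" "j \<in> {1..N}" for i j
  proof -
    have "distributed M lborel (\<lambda>\<omega>. (g i j \<omega> - 0) / sqrt (1 / real N)) std_normal_density"
      using d[OF that] N by (subst normal_standard_normal_convert[symmetric]) auto
    also have "(\<lambda>\<omega>. (g i j \<omega> - 0) / sqrt (1 / real N)) = (\<lambda>\<omega>. sqrt (real N) * g i j \<omega>)"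
      by (simp add: real_sqrt_divide mult.commute)
    finally have "distr M lborel (\<lambda>\<omega>. sqrt (real N) * g i j \<omega>) = std_gauss"
      unfolding std_gauss_def by (rule distributed_distr_eq_density)
    then show ?thesis by (metis distr_cong sets_lborel)
  qed
  have ne: "?I \<noteq> {}" using N by auto
  have rv: "(\<lambda>x. sqrt (real N) * x) \<circ> (\<lambda>(i, j). g i j) ij \<in> borel_measurable M" if "ij \<in> ?I" for ij
    using that gm[of "fst ij" "snd ij"] by (auto simp: comp_def split_beta')
  have "indep_vars (\<lambda>_. borel) (\<lambda>ij. (\<lambda>x. sqrt (real N) * x) \<circ> (\<lambda>(i, j). g i j) ij) ?I"
    using ind by (rule indep_vars_compose) auto
  moreover have "indep_vars (\<lambda>_. borel) (\<lambda>ij. (\<lambda>x. sqrt (real N) * x) \<circ> (\<lambda>(i, j). g i j) ij) ?I \<longleftrightarrow>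
    distr M (PiM ?I (\<lambda>_. borel)) (\<lambda>\<omega>. \<lambda>ij\<in>?I. ((\<lambda>x. sqrt (real N) * x) \<circ> (\<lambda>(i, j). g i j) ij) \<omega>)
     = PiM ?I (\<lambda>ij. distr M borel ((\<lambda>x. sqrt (real N) * x) \<circ> (\<lambda>(i, j). g i j) ij))"
    by (rule indep_vars_iff_distr_eq_PiM'[OF ne]) (rule rv)
  ultimately have "distr M (PiM ?I (\<lambda>_. borel)) (\<lambda>\<omega>. \<lambda>ij\<in>?I. ((\<lambda>x. sqrt (real N) * x) \<circ> (\<lambda>(i, j). g i j) ij) \<omega>)
     = PiM ?I (\<lambda>ij. distr M borel ((\<lambda>x. sqrt (real N) * x) \<circ> (\<lambda>(i, j). g i j) ij))" by blast
  also have "\<dots> = PiM ?I (\<lambda>_. std_gauss)"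
    by (rule PiM_cong) (auto simp: comp_def sd)
  also have "(\<lambda>\<omega>. \<lambda>ij\<in>?I. ((\<lambda>x. sqrt (real N) * x) \<circ> (\<lambda>(i, j). g i j) ij) \<omega>) = (\<lambda>\<omega>. vec N (realise g \<omega>))"
    by (auto simp: vec_def realise_def fun_eq_iff)
  finally show "distr M (PiM ?I (\<lambda>_. borel)) (\<lambda>\<omega>. vec N (realise g \<omega>)) = gm N"
    by (simp add: gm_def gprod_def)
qed

section \<open>The conditional second moment\<close>

abbreviation spins :: "nat \<Rightarrow> vect set" where
  "spins N \<equiv> {1..N} \<rightarrow>\<^sub>E {-1, 1}"

text \<open>The exponent per site of one configuration once the unrevealed disorder is averaged: the
  field, the energy of the revealed disorder, and half the variance of the unrevealed energy. The
  covariance for two configurations is the mixed term in \<open>Psi\<close>.\<close>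

definition SS :: "real \<Rightarrow> real \<Rightarrow> nat \<Rightarrow> (nat \<Rightarrow> vect) \<Rightarrow> (nat \<Rightarrow> vect) \<Rightarrow> nat \<Rightarrow> vect \<Rightarrow> real" where
  "SS \<beta> h N ph ze k \<sigma> = h * ip N \<sigma> (\<lambda>_. 1) + \<beta> * (\<Sum>s=1..k. ip N \<sigma> (ph s) * ip N \<sigma> (ze s))
     - \<beta> / 2 * (\<Sum>s=1..k. ip N (ph s) (ze s) * (ip N \<sigma> (ph s))\<^sup>2)
     + \<beta>\<^sup>2 / 4 * (ip N (pjx N ph k \<sigma>) (pjx N ph k \<sigma>))\<^sup>2"

definition Psi :: "real \<Rightarrow> real \<Rightarrow> nat \<Rightarrow> (nat \<Rightarrow> vect) \<Rightarrow> (nat \<Rightarrow> vect) \<Rightarrow> nat \<Rightarrow> real" where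
  "Psi \<beta> h N ph ze k = (\<Sum>\<sigma>\<in>spins N. \<Sum>\<tau>\<in>spins N.
     exp (real N * (SS \<beta> h N ph ze k \<sigma> + SS \<beta> h N ph ze k \<tau>
       + \<beta>\<^sup>2 / 2 * (ip N (pjx N ph k \<sigma>) (pjx N ph k \<tau>))\<^sup>2))) / 4 ^ N"

lemma Psi_nonneg: "Psi \<beta> h N ph ze k \<ge> 0"
  unfolding Psi_def by (intro divide_nonneg_nonneg sum_nonneg) auto

lemma sum_sq_tens:
  "(\<Sum>i=1..N. \<Sum>j=1..N. (x i * x j + y i * y j)\<^sup>2)
   = (real N)\<^sup>2 * ((ip N x x)\<^sup>2 + 2 * (ip N x y)\<^sup>2 + (ip N y y)\<^sup>2)"
proof (cases "N = 0")
  case False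
  then have i: "(\<Sum>i=1..N. a i * b i) = real N * ip N a b" for a b by (simp add: ip_def)
  have "(\<Sum>i=1..N. \<Sum>j=1..N. (x i * x j + y i * y j)\<^sup>2)
     = (\<Sum>i=1..N. \<Sum>j=1..N. (x i * x i) * (x j * x j)) + 2 * (\<Sum>i=1..N. \<Sum>j=1..N. (x i * y i) * (x j * y j))
       + (\<Sum>i=1..N. \<Sum>j=1..N. (y i * y i) * (y j * y j))"
    unfolding sum_distrib_left sum.distrib[symmetric]
    by (intro sum.cong refl) (simp add: power2_eq_square algebra_simps)
  also have "\<dots> = (real N * ip N x x) * (real N * ip N x x) + 2 * ((real N * ip N x y) * (real N * ip N x y))
       + (real N * ip N y y) * (real N * ip N y y)"
    unfolding sum_product[symmetric] unfolding i ..
  finally show ?thesis by (simp add: power2_eq_square algebra_simps)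
qed simp

lemma finite_spins [simp]: "finite (spins N)"
  by (rule finite_PiE) auto

lemma partition_fun_sq:
  "(partition_fun \<beta> h N G)\<^sup>2 = (\<Sum>\<sigma>\<in>spins N. \<Sum>\<tau>\<in>spins N.
      exp (\<beta> / sqrt 2 * (\<Sum>i=1..N. \<Sum>j=1..N. G i j * \<sigma> i * \<sigma> j) + h * (\<Sum>i=1..N. \<sigma> i)
         + (\<beta> / sqrt 2 * (\<Sum>i=1..N. \<Sum>j=1..N. G i j * \<tau> i * \<tau> j) + h * (\<Sum>i=1..N. \<tau> i)))) / 4 ^ N"
proof -
  have "(2 ^ N)\<^sup>2 = (4 :: real) ^ N" by (simp add: power2_eq_square flip: power_mult_distrib)
  then show ?thesis
    unfolding partition_fun_def power_divide power2_eq_square[of "sum _ _"] sum_product exp_add by simp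
qed

lemma ip_one: "N \<ge> 1 \<Longrightarrow> real N * ip N x (\<lambda>_. 1) = (\<Sum>i=1..N. x i)"
  by (simp add: ip_def)

text \<open>With \<open>v\<close> fixed the exponent is affine in the independent matrix. Its
  constant comes from \<open>quad_increment\<close>, since no residual of \<open>dmat\<close> is
  left, and the Gaussian moment generating function adds half the variance.\<close>

lemma inner_integral:
  fixes \<beta> h :: real and v k
  assumes N: "N \<ge> 1"
  defines "D \<equiv> dmat \<beta> h N v k"
  shows "(\<integral>\<^sup>+x. ennreal ((partition_fun \<beta> h N (theta \<beta> h N v k (mtx N x)))\<^sup>2) \<partial>gm N)
    = ennreal (Psi \<beta> h N (phi \<beta> h N D) (zeta \<beta> h N D) k)"
proof -
  let ?I = "{1..N} \<times> {1..N}"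
  define ph where "ph = phi \<beta> h N D"
  define ze where "ze = zeta \<beta> h N D"
  have o: "orth N ph k" unfolding ph_def by (rule phi_orth[OF N])
  define P where "P = pjx N ph k"
  define E where "E x \<sigma> = \<beta> / sqrt 2 * (\<Sum>i=1..N. \<Sum>j=1..N. theta \<beta> h N v k (mtx N x) i j * \<sigma> i * \<sigma> j) + h * (\<Sum>i=1..N. \<sigma> i)" for x and \<sigma> :: vect
  define c where "c \<sigma> = \<beta> / sqrt 2 * (\<Sum>i=1..N. \<Sum>j=1..N. D i j * \<sigma> i * \<sigma> j) + h * (\<Sum>i=1..N. \<sigma> i)" for \<sigma> :: vect
  define t where "t \<sigma> \<tau> ij = \<beta> / sqrt 2 / sqrt (real N) * (P \<sigma> (fst ij) * P \<sigma> (snd ij) + P \<tau> (fst ij) * P \<tau> (snd ij))" for \<sigma> \<tau> ij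
  have E: "E x \<sigma> = c \<sigma> + \<beta> / sqrt 2 * (\<Sum>i=1..N. \<Sum>j=1..N. P \<sigma> i * P \<sigma> j * mtx N x i j)" for x \<sigma>
  proof -
    have "(\<Sum>i=1..N. \<Sum>j=1..N. theta \<beta> h N v k (mtx N x) i j * \<sigma> i * \<sigma> j)
      = (\<Sum>i=1..N. \<Sum>j=1..N. D i j * \<sigma> i * \<sigma> j) + (\<Sum>i=1..N. \<Sum>j=1..N. \<sigma> i * \<sigma> j * mproj N ph k (mtx N x) i j)"
      unfolding theta_def[OF N] sum.distrib[symmetric]
      by (intro sum.cong refl) (simp add: D_def ph_def algebra_simps)
    then show ?thesis unfolding E_def c_def quad_mproj[OF o] P_def by (simp add: distrib_left)
  qed
  have EE: "E x \<sigma> + E x \<tau> = (c \<sigma> + c \<tau>) + (\<Sum>ij\<in>?I. t \<sigma> \<tau> ij * x ij)" for x \<sigma> \<tau>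
  proof -
    have "(\<Sum>ij\<in>?I. t \<sigma> \<tau> ij * x ij) = (\<Sum>i=1..N. \<Sum>j=1..N. t \<sigma> \<tau> (i, j) * x (i, j))"
      using sum_ivl_prod[where N=N and f="\<lambda>i j. t \<sigma> \<tau> (i, j) * x (i, j)"] by simp
    also have "\<dots> = \<beta> / sqrt 2 * (\<Sum>i=1..N. \<Sum>j=1..N. P \<sigma> i * P \<sigma> j * mtx N x i j) + \<beta> / sqrt 2 * (\<Sum>i=1..N. \<Sum>j=1..N. P \<tau> i * P \<tau> j * mtx N x i j)"
      unfolding sum_distrib_left sum.distrib[symmetric]
      by (intro sum.cong refl) (simp add: t_def mtx_def distrib_left distrib_right mult_ac add_divide_distrib)
    finally show ?thesis by (simp add: E)
  qed
  have tt: "(\<Sum>ij\<in>?I. (t \<sigma> \<tau> ij)\<^sup>2) / 2 = real N * (\<beta>\<^sup>2 / 4 * ((ip N (P \<sigma>) (P \<sigma>))\<^sup>2 + 2 * (ip N (P \<sigma>) (P \<tau>))\<^sup>2 + (ip N (P \<tau>) (P \<tau>))\<^sup>2))" for \<sigma> \<tau>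
  proof -
    have "(\<Sum>ij\<in>?I. (t \<sigma> \<tau> ij)\<^sup>2) = (\<Sum>i=1..N. \<Sum>j=1..N. (t \<sigma> \<tau> (i, j))\<^sup>2)"
      using sum_ivl_prod[where N=N and f="\<lambda>i j. (t \<sigma> \<tau> (i, j))\<^sup>2"] by simp
    also have "\<dots> = (\<beta>\<^sup>2 / (2 * real N)) * (\<Sum>i=1..N. \<Sum>j=1..N. (P \<sigma> i * P \<sigma> j + P \<tau> i * P \<tau> j)\<^sup>2)"
      unfolding sum_distrib_left by (intro sum.cong refl) (simp add: t_def power_mult_distrib power_divide)
    finally have F: "(\<Sum>ij\<in>?I. (t \<sigma> \<tau> ij)\<^sup>2) = (\<beta>\<^sup>2 / (2 * real N)) * (\<Sum>i=1..N. \<Sum>j=1..N. (P \<sigma> i * P \<sigma> j + P \<tau> i * P \<tau> j)\<^sup>2)" .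
    have "b / (2 * n) * (n\<^sup>2 * X) / 2 = n * (b / 4 * X)" if "n \<noteq> 0" for b n X :: real
      using that by (simp add: power2_eq_square)
    then show ?thesis unfolding F sum_sq_tens using N by simp
  qed
  have cS: "c \<sigma> + real N * (\<beta>\<^sup>2 / 4 * (ip N (P \<sigma>) (P \<sigma>))\<^sup>2) = real N * SS \<beta> h N ph ze k \<sigma>" for \<sigma>
  proof -
    have F: "(\<Sum>i=1..N. \<Sum>j=1..N. D i j * \<sigma> i * \<sigma> j)
      = real N * (\<Sum>s=1..k. sqrt 2 * ip N \<sigma> (ze s) * ip N \<sigma> (ph s) - ip N (ph s) (ze s) / sqrt 2 * (ip N \<sigma> (ph s))\<^sup>2)"
      using quad_increment[of D \<beta> h N k \<sigma>] by (simp add: D_def dmat_gmat_zero[OF N] ph_def ze_def)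
    have F1: "\<beta> / sqrt 2 * (\<Sum>i=1..N. \<Sum>j=1..N. D i j * \<sigma> i * \<sigma> j)
      = real N * (\<beta> * (\<Sum>s=1..k. ip N \<sigma> (ph s) * ip N \<sigma> (ze s)) - \<beta> / 2 * (\<Sum>s=1..k. ip N (ph s) (ze s) * (ip N \<sigma> (ph s))\<^sup>2))"
      unfolding F sum_distrib_left sum_subtractf[symmetric]
      by (intro sum.cong refl) (simp add: field_simps)
    have h1: "(\<Sum>i=1..N. \<sigma> i) = real N * ip N \<sigma> (\<lambda>_. 1)"
      using ip_one[OF N, of \<sigma>] by simp
    show ?thesis
      unfolding c_def SS_def P_def F1 h1 by (simp add: algebra_simps)
  qed
  have "(\<integral>\<^sup>+x. ennreal ((partition_fun \<beta> h N (theta \<beta> h N v k (mtx N x)))\<^sup>2) \<partial>gm N)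
     = (\<integral>\<^sup>+x. (\<Sum>\<sigma>\<in>spins N. \<Sum>\<tau>\<in>spins N. ennreal (exp (c \<sigma> + c \<tau>) / 4 ^ N) * ennreal (exp (\<Sum>ij\<in>?I. t \<sigma> \<tau> ij * x ij))) \<partial>gm N)"
  proof (rule nn_integral_cong)
    fix x
    have "(partition_fun \<beta> h N (theta \<beta> h N v k (mtx N x)))\<^sup>2 = (\<Sum>\<sigma>\<in>spins N. \<Sum>\<tau>\<in>spins N. exp (E x \<sigma> + E x \<tau>) / 4 ^ N)"
      unfolding partition_fun_sq E_def sum_divide_distrib ..
    also have "\<dots> = (\<Sum>\<sigma>\<in>spins N. \<Sum>\<tau>\<in>spins N. exp (c \<sigma> + c \<tau>) / 4 ^ N * exp (\<Sum>ij\<in>?I. t \<sigma> \<tau> ij * x ij))"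
      unfolding EE by (intro sum.cong refl) (simp add: exp_add)
    finally show "ennreal ((partition_fun \<beta> h N (theta \<beta> h N v k (mtx N x)))\<^sup>2)
      = (\<Sum>\<sigma>\<in>spins N. \<Sum>\<tau>\<in>spins N. ennreal (exp (c \<sigma> + c \<tau>) / 4 ^ N) * ennreal (exp (\<Sum>ij\<in>?I. t \<sigma> \<tau> ij * x ij)))"
      by (simp add: sum_nonneg flip: sum_ennreal ennreal_mult)
  qed
  also have "\<dots> = (\<Sum>\<sigma>\<in>spins N. \<Sum>\<tau>\<in>spins N. ennreal (exp (c \<sigma> + c \<tau>) / 4 ^ N) * ennreal (exp ((\<Sum>ij\<in>?I. (t \<sigma> \<tau> ij)\<^sup>2) / 2)))"
  proof -
    have [measurable]: "(\<lambda>x. \<Sum>ij\<in>?I. t \<sigma> \<tau> ij * x ij) \<in> borel_measurable (gm N)" for \<sigma> \<tau>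
      by (intro borel_measurable_sum borel_measurable_times borel_measurable_const measurable_gm_component)
    have 1: "(\<lambda>x. ennreal (exp (c \<sigma> + c \<tau>) / 4 ^ N) * ennreal (exp (\<Sum>ij\<in>?I. t \<sigma> \<tau> ij * x ij))) \<in> borel_measurable (gm N)" for \<sigma> \<tau>
      by measurable
    have 2: "(\<lambda>x. \<Sum>\<tau>\<in>spins N. ennreal (exp (c \<sigma> + c \<tau>) / 4 ^ N) * ennreal (exp (\<Sum>ij\<in>?I. t \<sigma> \<tau> ij * x ij))) \<in> borel_measurable (gm N)" for \<sigma>
      by (intro borel_measurable_sum 1)
    show ?thesis
      unfolding nn_integral_sum[OF 2] nn_integral_sum[OF 1]
    proof (intro sum.cong refl)
      fix \<sigma> \<tau>
      have m: "(\<lambda>x. ennreal (exp (\<Sum>ij\<in>?I. t \<sigma> \<tau> ij * x ij))) \<in> borel_measurable (gm N)" by measurable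
      show "(\<integral>\<^sup>+x. ennreal (exp (c \<sigma> + c \<tau>) / 4 ^ N) * ennreal (exp (\<Sum>ij\<in>?I. t \<sigma> \<tau> ij * x ij)) \<partial>gm N)
         = ennreal (exp (c \<sigma> + c \<tau>) / 4 ^ N) * ennreal (exp ((\<Sum>ij\<in>?I. (t \<sigma> \<tau> ij)\<^sup>2) / 2))"
        unfolding nn_integral_cmult[OF m] unfolding gm_def by (subst gprod_mgf) auto
    qed
  qed
  also have "\<dots> = ennreal (\<Sum>\<sigma>\<in>spins N. \<Sum>\<tau>\<in>spins N. exp (c \<sigma> + c \<tau>) / 4 ^ N * exp ((\<Sum>ij\<in>?I. (t \<sigma> \<tau> ij)\<^sup>2) / 2))"
    by (simp add: sum_nonneg flip: sum_ennreal ennreal_mult)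
  also have "(\<Sum>\<sigma>\<in>spins N. \<Sum>\<tau>\<in>spins N. exp (c \<sigma> + c \<tau>) / 4 ^ N * exp ((\<Sum>ij\<in>?I. (t \<sigma> \<tau> ij)\<^sup>2) / 2))
     = (\<Sum>\<sigma>\<in>spins N. \<Sum>\<tau>\<in>spins N. exp (real N * (SS \<beta> h N ph ze k \<sigma> + SS \<beta> h N ph ze k \<tau>
         + \<beta>\<^sup>2 / 2 * (ip N (pjx N ph k \<sigma>) (pjx N ph k \<tau>))\<^sup>2)) / 4 ^ N)"
  proof (intro sum.cong refl)
    fix \<sigma> \<tau>
    have "c \<sigma> + c \<tau> + (\<Sum>ij\<in>?I. (t \<sigma> \<tau> ij)\<^sup>2) / 2
       = (c \<sigma> + real N * (\<beta>\<^sup>2 / 4 * (ip N (P \<sigma>) (P \<sigma>))\<^sup>2)) + (c \<tau> + real N * (\<beta>\<^sup>2 / 4 * (ip N (P \<tau>) (P \<tau>))\<^sup>2))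
         + real N * (\<beta>\<^sup>2 / 2 * (ip N (P \<sigma>) (P \<tau>))\<^sup>2)"
      unfolding tt by (simp add: algebra_simps)
    also have "\<dots> = real N * (SS \<beta> h N ph ze k \<sigma> + SS \<beta> h N ph ze k \<tau> + \<beta>\<^sup>2 / 2 * (ip N (pjx N ph k \<sigma>) (pjx N ph k \<tau>))\<^sup>2)"
      unfolding cS by (simp add: P_def algebra_simps)
    finally show "exp (c \<sigma> + c \<tau>) / 4 ^ N * exp ((\<Sum>ij\<in>?I. (t \<sigma> \<tau> ij)\<^sup>2) / 2)
       = exp (real N * (SS \<beta> h N ph ze k \<sigma> + SS \<beta> h N ph ze k \<tau> + \<beta>\<^sup>2 / 2 * (ip N (pjx N ph k \<sigma>) (pjx N ph k \<tau>))\<^sup>2)) / 4 ^ N"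
      by (simp flip: exp_add)
  qed
  also have "\<dots> = Psi \<beta> h N ph ze k" unfolding Psi_def sum_divide_distrib ..
  finally show ?thesis by (simp add: ph_def ze_def)
qed

abbreviation PsiG :: "real \<Rightarrow> real \<Rightarrow> nat \<Rightarrow> nat \<Rightarrow> matr \<Rightarrow> real" where
  "PsiG \<beta> h N k G \<equiv> Psi \<beta> h N (phi \<beta> h N G) (zeta \<beta> h N G) k"

lemma Psi_cong:
  assumes "\<And>s i. s \<in> {1..k} \<Longrightarrow> i \<in> {1..N} \<Longrightarrow> ph s i = ph' s i" "\<And>s i. s \<in> {1..k} \<Longrightarrow> i \<in> {1..N} \<Longrightarrow> ze s i = ze' s i"
  shows "Psi \<beta> h N ph ze k = Psi \<beta> h N ph' ze' k"
proof -
  have 1: "ip N x (ph s) = ip N x (ph' s)" "ip N x (ze s) = ip N x (ze' s)" "ip N (ph s) (ze s) = ip N (ph' s) (ze' s)" if "s \<in> {1..k}" for s x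
    using assms that by (auto intro!: ip_cong)
  have 2: "pjx N ph k x i = pjx N ph' k x i" if "i \<in> {1..N}" for x i
    using assms(1) that 1(1) by (simp add: pjx_def)
  have 3: "ip N (pjx N ph k x) (pjx N ph k y) = ip N (pjx N ph' k x) (pjx N ph' k y)" for x y
    by (intro ip_cong 2)
  have "SS \<beta> h N ph ze k = SS \<beta> h N ph' ze' k"
    unfolding SS_def 3 using 1 by (intro ext) simp
  then show ?thesis unfolding Psi_def 3 by simp
qed

lemma PsiG_data:
  assumes "\<And>s i. s \<in> {1..k} \<Longrightarrow> i \<in> {1..N} \<Longrightarrow> zeta \<beta> h N G s i = zeta \<beta> h N G' s i"
  shows "PsiG \<beta> h N k G = PsiG \<beta> h N k G'"
proof (rule Psi_cong)
  fix s i assume "s \<in> {1..k}" "i \<in> {1..N}"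
  then show "phi \<beta> h N G s i = phi \<beta> h N G' s i"
    using phi_cong_zeta[OF order_refl assms, of k s i] by auto
qed (rule assms)

lemma zeta_in_range:
  assumes "\<And>i j. i \<in> {1..N} \<Longrightarrow> j \<in> {1..N} \<Longrightarrow> G i j = G' i j" "i \<in> {1..N}"
  shows "zeta \<beta> h N G s i = zeta \<beta> h N G' s i"
proof -
  have "xi \<beta> h N G s i = xi \<beta> h N G' s i" "eta \<beta> h N G s i = eta \<beta> h N G' s i"
    by (rule data_in_range(3)[OF assms], assumption+, rule data_in_range(4)[OF assms], assumption+)
  then show ?thesis by (simp add: zeta.simps)
qed

lemma partition_fun_in_range:
  assumes "\<And>i j. i \<in> {1..N} \<Longrightarrow> j \<in> {1..N} \<Longrightarrow> G i j = G' i j"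
  shows "partition_fun \<beta> h N G = partition_fun \<beta> h N G'"
proof -
  have "(\<Sum>i=1..N. \<Sum>j=1..N. G i j * \<sigma> i * \<sigma> j) = (\<Sum>i=1..N. \<Sum>j=1..N. G' i j * \<sigma> i * \<sigma> j)" for \<sigma>
    by (intro sum.cong refl) (simp add: assms)
  then show ?thesis unfolding partition_fun_def by simp
qed

lemma measurable_partition_fun:
  assumes G: "mm N M G"
  shows "(\<lambda>\<omega>. partition_fun \<beta> h N (G \<omega>)) \<in> borel_measurable M"
  unfolding partition_fun_def
  by (intro borel_measurable_divide borel_measurable_sum borel_measurable_const measurable_compose[OF _ borel_measurable_exp]
      borel_measurable_add borel_measurable_times mmD[OF G])

lemma measurable_Psi:
  assumes p: "\<And>s. s \<in> {1..k} \<Longrightarrow> mv N M (\<lambda>\<omega>. ph \<omega> s)" and z: "\<And>s. s \<in> {1..k} \<Longrightarrow> mv N M (\<lambda>\<omega>. ze \<omega> s)"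
  shows "(\<lambda>\<omega>. Psi \<beta> h N (ph \<omega>) (ze \<omega>) k) \<in> borel_measurable M"
proof -
  have c: "mv N M (\<lambda>_. x)" for x by (rule mvI) simp
  have P: "mv N M (\<lambda>\<omega>. pjx N (ph \<omega>) k x)" for x by (rule mv_pjx[OF p c])
  have S: "(\<lambda>\<omega>. SS \<beta> h N (ph \<omega>) (ze \<omega>) k \<sigma>) \<in> borel_measurable M" for \<sigma>
    unfolding SS_def
    by (intro borel_measurable_add borel_measurable_diff borel_measurable_times borel_measurable_sum borel_measurable_const
        borel_measurable_power mv_ip[OF c p] mv_ip[OF c z] mv_ip[OF p z] mv_ip[OF P P])
  show ?thesis unfolding Psi_def
    by (intro borel_measurable_divide borel_measurable_sum borel_measurable_const measurable_compose[OF _ borel_measurable_exp]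
        borel_measurable_add borel_measurable_times borel_measurable_power S mv_ip[OF P P])
qed

section \<open>The conditional expectation given the first k steps\<close>

context
  fixes \<beta> h :: real and N k :: nat and M :: "'a measure" and g :: "nat \<Rightarrow> nat \<Rightarrow> 'a \<Rightarrow> real"
  assumes N: "N \<ge> 1" and g: "gaussian_disorder N M g"
begin

interpretation prob_space M by (rule gaussian_disorder_law(3)[OF N g])

lemma disorder_integral:
  assumes f: "(\<lambda>x. f (mtx N x)) \<in> borel_measurable (PiM ({1..N}\<times>{1..N}) (\<lambda>_. borel))"
    and r: "\<And>G G'. (\<And>i j. i \<in> {1..N} \<Longrightarrow> j \<in> {1..N} \<Longrightarrow> G i j = G' i j) \<Longrightarrow> f G = f G'"
  shows "(\<integral>\<^sup>+\<omega>. f (realise g \<omega>) \<partial>M) = (\<integral>\<^sup>+v. (\<integral>\<^sup>+x. f (theta \<beta> h N v k (mtx N x)) \<partial>gm N) \<partial>VV N k)"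
proof -
  have v: "(\<lambda>\<omega>. vec N (realise g \<omega>)) \<in> measurable M (PiM ({1..N}\<times>{1..N}) (\<lambda>_. borel))"
    by (rule mm_vec[OF gaussian_disorder_law(2)[OF N g]])
  have mv: "f (mtx N (vec N G)) = f G" for G
    by (rule r) (simp add: mtx_vec[OF N])
  have "(\<integral>\<^sup>+\<omega>. f (realise g \<omega>) \<partial>M) = (\<integral>\<^sup>+\<omega>. f (mtx N (vec N (realise g \<omega>))) \<partial>M)"
    by (simp add: mv)
  also have "\<dots> = (\<integral>\<^sup>+x. f (mtx N x) \<partial>distr M (PiM ({1..N}\<times>{1..N}) (\<lambda>_. borel)) (\<lambda>\<omega>. vec N (realise g \<omega>)))"
    by (rule nn_integral_distr[symmetric, OF v]) (simp only: measurable_distr_eq1 f)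
  also have "\<dots> = (\<integral>\<^sup>+x. f (mtx N x) \<partial>gm N)"
    unfolding gaussian_disorder_law(1)[OF N g] ..
  also have "\<dots> = (\<integral>\<^sup>+v. (\<integral>\<^sup>+x. f (mtx N (vec N (theta \<beta> h N v k (mtx N x)))) \<partial>gm N) \<partial>VV N k)"
    by (rule theta_law[OF N f, symmetric])
  finally show ?thesis by (simp add: mv)
qed

lemma sigma_G_space: "space (sigma_G \<beta> h N M g k) = space M"
  by (simp add: sigma_G_def space_measure_of_conv)

lemma sets_sigma_G:
  "sets (sigma_G \<beta> h N M g k) = sigma_sets (space M)
    (\<Union>m\<in>{1..k}. \<Union>i\<in>{1..N}.
        {(\<lambda>\<omega>. xi \<beta> h N (realise g \<omega>) m i) -` A \<inter> space M | A. A \<in> sets borel} \<union>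
        {(\<lambda>\<omega>. eta \<beta> h N (realise g \<omega>) m i) -` A \<inter> space M | A. A \<in> sets borel})"
  unfolding sigma_G_def by (rule sets_measure_of) auto

lemma subalgebra_sigma_G: "subalgebra M (sigma_G \<beta> h N M g k)"
proof -
  note mv = mv_data[OF gaussian_disorder_law(2)[OF N g]]
  have "sets (sigma_G \<beta> h N M g k) \<subseteq> sets M"
    unfolding sets_sigma_G
    by (intro sets.sigma_sets_subset UN_least Un_least) (auto intro!: measurable_sets mvD[OF mv(2)] mvD[OF mv(3)])
  then show ?thesis by (auto simp: subalgebra_def sigma_G_space)
qed

lemma measurable_PsiG_sigma_G: "(\<lambda>\<omega>. PsiG \<beta> h N k (realise g \<omega>)) \<in> borel_measurable (sigma_G \<beta> h N M g k)"
proof -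
  let ?F = "sigma_G \<beta> h N M g k"
  have x: "(\<lambda>\<omega>. xi \<beta> h N (realise g \<omega>) s i) \<in> borel_measurable ?F" and e: "(\<lambda>\<omega>. eta \<beta> h N (realise g \<omega>) s i) \<in> borel_measurable ?F"
    if "s \<in> {1..k}" "i \<in> {1..N}" for s i
  proof -
    show "(\<lambda>\<omega>. xi \<beta> h N (realise g \<omega>) s i) \<in> borel_measurable ?F"
    proof (rule measurableI)
      fix A :: "real set" assume "A \<in> sets borel"
      then show "(\<lambda>\<omega>. xi \<beta> h N (realise g \<omega>) s i) -` A \<inter> space ?F \<in> sets ?F"
        unfolding sigma_G_space sets_sigma_G by (intro sigma_sets.Basic) (use that in blast)
    qed simp
    show "(\<lambda>\<omega>. eta \<beta> h N (realise g \<omega>) s i) \<in> borel_measurable ?F"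
    proof (rule measurableI)
      fix A :: "real set" assume "A \<in> sets borel"
      then show "(\<lambda>\<omega>. eta \<beta> h N (realise g \<omega>) s i) -` A \<inter> space ?F \<in> sets ?F"
        unfolding sigma_G_space sets_sigma_G by (intro sigma_sets.Basic) (use that in blast)
    qed simp
  qed
  have z: "mv N ?F (\<lambda>\<omega>. zeta \<beta> h N (realise g \<omega>) s)" if "s \<in> {1..k}" for s
    unfolding zeta.simps by (intro mvI borel_measurable_divide borel_measurable_add borel_measurable_const x e that)
  show ?thesis
    by (rule measurable_Psi[OF mv_phi_zeta[OF z] z]) auto
qed

definition same where
  "same G G' \<longleftrightarrow> (\<forall>s\<in>{1..k}. \<forall>i\<in>{1..N}. xi \<beta> h N G s i = xi \<beta> h N G' s i \<and> eta \<beta> h N G s i = eta \<beta> h N G' s i)"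

text \<open>Induction over the generated sigma-algebra. Invariance of \<open>B\<close> under
  \<open>same\<close> makes the event independent of the unrevealed matrix; measurability of
  \<open>B\<close> on matrices allows the change to the law of \<open>theta\<close>.\<close>

lemma sigma_G_set_data:
  assumes "A \<in> sets (sigma_G \<beta> h N M g k)"
  shows "\<exists>B. A = {\<omega>\<in>space M. realise g \<omega> \<in> B} \<and> (\<forall>G G'. same G G' \<longrightarrow> (G \<in> B \<longleftrightarrow> G' \<in> B)) \<and>
    {x \<in> space (PiM ({1..N}\<times>{1..N}) (\<lambda>_. borel)). mtx N x \<in> B} \<in> sets (PiM ({1..N}\<times>{1..N}) (\<lambda>_. borel))"
proof -
  let ?P = "PiM ({1..N}\<times>{1..N}) (\<lambda>_. borel :: real measure)"
  define Q where "Q A B \<longleftrightarrow> A = {\<omega>\<in>space M. realise g \<omega> \<in> B} \<and> (\<forall>G G'. same G G' \<longrightarrow> (G \<in> B \<longleftrightarrow> G' \<in> B)) \<and>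
     {x \<in> space ?P. mtx N x \<in> B} \<in> sets ?P" for A B
  have mtx: "mm N ?P (mtx N)" by (rule mm_mtx) simp
  have "\<exists>B. Q A B" using assms unfolding sets_sigma_G
  proof (induction rule: sigma_sets.induct)
    case (Basic a)
    then obtain s i C where si: "s \<in> {1..k}" "i \<in> {1..N}" and C: "C \<in> sets borel"
      and a: "a = (\<lambda>\<omega>. xi \<beta> h N (realise g \<omega>) s i) -` C \<inter> space M \<or> a = (\<lambda>\<omega>. eta \<beta> h N (realise g \<omega>) s i) -` C \<inter> space M" by blast
    from a show ?case
    proof
      assume a: "a = (\<lambda>\<omega>. xi \<beta> h N (realise g \<omega>) s i) -` C \<inter> space M"
      have "{x \<in> space ?P. mtx N x \<in> {G. xi \<beta> h N G s i \<in> C}} \<in> sets ?P"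
        using measurable_sets[OF mvD[OF mv_data(2)[OF mtx] si(2)] C, of \<beta> h s]
        by (simp add: vimage_def Int_def conj_commute)
      then show ?thesis unfolding Q_def using si a
        by (intro exI[of _ "{G. xi \<beta> h N G s i \<in> C}"]) (auto simp: same_def)
    next
      assume a: "a = (\<lambda>\<omega>. eta \<beta> h N (realise g \<omega>) s i) -` C \<inter> space M"
      have "{x \<in> space ?P. mtx N x \<in> {G. eta \<beta> h N G s i \<in> C}} \<in> sets ?P"
        using measurable_sets[OF mvD[OF mv_data(3)[OF mtx] si(2)] C, of \<beta> h s]
        by (simp add: vimage_def Int_def conj_commute)
      then show ?thesis unfolding Q_def using si a
        by (intro exI[of _ "{G. eta \<beta> h N G s i \<in> C}"]) (auto simp: same_def)
    qed
  next
    case Empty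
    then show ?case unfolding Q_def by (intro exI[of _ "{}"]) auto
  next
    case (Compl a)
    then obtain B where B: "a = {\<omega>\<in>space M. realise g \<omega> \<in> B}" "\<forall>G G'. same G G' \<longrightarrow> (G \<in> B \<longleftrightarrow> G' \<in> B)"
      "{x \<in> space ?P. mtx N x \<in> B} \<in> sets ?P" unfolding Q_def by blast
    have "{x \<in> space ?P. mtx N x \<in> - B} = space ?P - {x \<in> space ?P. mtx N x \<in> B}" by auto
    also have "\<dots> \<in> sets ?P" using B(3) by blast
    finally show ?case unfolding Q_def using B(1,2) by (intro exI[of _ "- B"]) auto
  next
    case (Union a)
    then obtain B where B: "\<And>n. Q (a n) (B n)" by metis
    have "{x \<in> space ?P. mtx N x \<in> (\<Union>n. B n)} = (\<Union>n. {x \<in> space ?P. mtx N x \<in> B n})" by auto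
    also have "\<dots> \<in> sets ?P" using B unfolding Q_def by blast
    finally show ?case using B unfolding Q_def by (intro exI[of _ "\<Union>n. B n"]) auto
  qed
  then show ?thesis unfolding Q_def .
qed

lemma same_data_theta:
  assumes "s \<in> {1..k}"
  shows "xi \<beta> h N (theta \<beta> h N v k A) s = xi \<beta> h N (dmat \<beta> h N v k) s"
    "eta \<beta> h N (theta \<beta> h N v k A) s = eta \<beta> h N (dmat \<beta> h N v k) s"
    "zeta \<beta> h N (theta \<beta> h N v k A) s = zeta \<beta> h N (dmat \<beta> h N v k) s"
  unfolding theta_def[OF N] using stable_mproj(3-5)[OF N assms] by simp_all

lemma PsiG_theta: "PsiG \<beta> h N k (theta \<beta> h N v k A) = PsiG \<beta> h N k (dmat \<beta> h N v k)"
  by (rule PsiG_data) (simp only: same_data_theta)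

text \<open>Both sides are compared on every event of \<open>sigma_G\<close>. In the representation
  by fresh blocks and an independent matrix, the indicator of the event depends on the blocks only
  and leaves the inner integral, which \<open>inner_integral\<close> evaluates.\<close>

theorem cond_second_moment_eq:
  "AE \<omega> in M. cond_second_moment \<beta> h N M g k \<omega> = PsiG \<beta> h N k (realise g \<omega>)"
proof -
  let ?F = "sigma_G \<beta> h N M g k"
  let ?P = "PiM ({1..N}\<times>{1..N}) (\<lambda>_. borel :: real measure)"
  interpret F: finite_measure_subalgebra M ?F by standard (rule subalgebra_sigma_G)
  let ?Z = "\<lambda>G. ennreal ((partition_fun \<beta> h N G)\<^sup>2)"
  let ?Q = "\<lambda>G. ennreal (PsiG \<beta> h N k G)"
  have mg: "mm N M (realise g)" by (rule gaussian_disorder_law(2)[OF N g])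
  have mtx: "mm N ?P (mtx N)" by (rule mm_mtx) simp
  have eq: "(\<integral>\<^sup>+\<omega>\<in>A. ?Z (realise g \<omega>) \<partial>M) = (\<integral>\<^sup>+\<omega>\<in>A. ?Q (realise g \<omega>) \<partial>M)" if A: "A \<in> sets ?F" for A
  proof -
    obtain B where B: "A = {\<omega>\<in>space M. realise g \<omega> \<in> B}"
      "\<And>G G'. same G G' \<Longrightarrow> G \<in> B \<longleftrightarrow> G' \<in> B"
      "{x \<in> space ?P. mtx N x \<in> B} \<in> sets ?P"
      using sigma_G_set_data[OF A] by blast
    have Bt: "theta \<beta> h N v k A \<in> B \<longleftrightarrow> dmat \<beta> h N v k \<in> B" for v A
      by (rule B(2)) (simp add: same_def same_data_theta)
    have indB: "(\<lambda>x. indicator B (mtx N x) :: ennreal) \<in> borel_measurable ?P"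
    proof -
      have "(\<lambda>x. indicator {x \<in> space ?P. mtx N x \<in> B} x :: ennreal) \<in> borel_measurable ?P"
        using B(3) by (rule borel_measurable_indicator)
      then show ?thesis by (rule measurable_cong[THEN iffD1, rotated]) (auto simp: indicator_def)
    qed
    have rB: "indicator B G = (indicator B G' :: ennreal)" if "\<And>i j. i \<in> {1..N} \<Longrightarrow> j \<in> {1..N} \<Longrightarrow> G i j = G' i j" for G G'
    proof -
      have "G \<in> B \<longleftrightarrow> G' \<in> B"
        using data_in_range(3,4)[OF that] by (intro B(2)) (simp add: same_def)
      then show ?thesis by (simp add: indicator_def)
    qed
    have key: "(\<integral>\<^sup>+\<omega>\<in>A. f (realise g \<omega>) \<partial>M) = (\<integral>\<^sup>+v. indicator B (dmat \<beta> h N v k) * (\<integral>\<^sup>+x. f (theta \<beta> h N v k (mtx N x)) \<partial>gm N) \<partial>VV N k)"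
      if f: "(\<lambda>x. f (mtx N x)) \<in> borel_measurable ?P"
        and r: "\<And>G G'. (\<And>i j. i \<in> {1..N} \<Longrightarrow> j \<in> {1..N} \<Longrightarrow> G i j = G' i j) \<Longrightarrow> f G = f G'"
        and th: "\<And>v. (\<lambda>x. f (theta \<beta> h N v k (mtx N x))) \<in> borel_measurable (gm N)" for f
    proof -
      have "(\<integral>\<^sup>+\<omega>\<in>A. f (realise g \<omega>) \<partial>M) = (\<integral>\<^sup>+\<omega>. indicator B (realise g \<omega>) * f (realise g \<omega>) \<partial>M)"
        by (intro nn_integral_cong) (auto simp: B(1) indicator_def)
      also have "\<dots> = (\<integral>\<^sup>+v. (\<integral>\<^sup>+x. indicator B (theta \<beta> h N v k (mtx N x)) * f (theta \<beta> h N v k (mtx N x)) \<partial>gm N) \<partial>VV N k)"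
      proof (rule disorder_integral)
        show "(\<lambda>x. indicator B (mtx N x) * f (mtx N x)) \<in> borel_measurable ?P"
          by (intro borel_measurable_times_ennreal indB f)
        show "indicator B G * f G = indicator B G' * f G'" if "\<And>i j. i \<in> {1..N} \<Longrightarrow> j \<in> {1..N} \<Longrightarrow> G i j = G' i j" for G G'
          using rB[OF that] r[OF that] by simp
      qed
      also have "\<dots> = (\<integral>\<^sup>+v. indicator B (dmat \<beta> h N v k) * (\<integral>\<^sup>+x. f (theta \<beta> h N v k (mtx N x)) \<partial>gm N) \<partial>VV N k)"
      proof (rule nn_integral_cong)
        fix v
        have "indicator B (theta \<beta> h N v k A) = (indicator B (dmat \<beta> h N v k) :: ennreal)" for A
          using Bt by (simp add: indicator_def)
        then show "(\<integral>\<^sup>+x. indicator B (theta \<beta> h N v k (mtx N x)) * f (theta \<beta> h N v k (mtx N x)) \<partial>gm N)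
           = indicator B (dmat \<beta> h N v k) * (\<integral>\<^sup>+x. f (theta \<beta> h N v k (mtx N x)) \<partial>gm N)"
          using nn_integral_cmult[OF th] by simp
      qed
      finally show ?thesis .
    qed
    have th: "mm N (gm N) (\<lambda>x. theta \<beta> h N v k (mtx N x))" for v
      by (rule measurable_theta[OF N]) (auto intro: measurable_ident_sets)
    interpret GM: prob_space "gm N" by (rule prob_space_gm)
    have Z: "(\<integral>\<^sup>+\<omega>\<in>A. ?Z (realise g \<omega>) \<partial>M) = (\<integral>\<^sup>+v. indicator B (dmat \<beta> h N v k) * ennreal (PsiG \<beta> h N k (dmat \<beta> h N v k)) \<partial>VV N k)"
      unfolding inner_integral[OF N, symmetric]
    proof (rule key)
      show "(\<lambda>x. ?Z (mtx N x)) \<in> borel_measurable ?P"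
        by (intro measurable_compose[OF _ measurable_ennreal] borel_measurable_power measurable_partition_fun mtx)
      show "?Z G = ?Z G'" if "\<And>i j. i \<in> {1..N} \<Longrightarrow> j \<in> {1..N} \<Longrightarrow> G i j = G' i j" for G G'
        using partition_fun_in_range[OF that] by simp
      show "(\<lambda>x. ?Z (theta \<beta> h N v k (mtx N x))) \<in> borel_measurable (gm N)" for v
        by (intro measurable_compose[OF _ measurable_ennreal] borel_measurable_power measurable_partition_fun th)
    qed
    have "(\<integral>\<^sup>+\<omega>\<in>A. ?Q (realise g \<omega>) \<partial>M) = (\<integral>\<^sup>+v. indicator B (dmat \<beta> h N v k) * (\<integral>\<^sup>+x. ?Q (theta \<beta> h N v k (mtx N x)) \<partial>gm N) \<partial>VV N k)"
    proof (rule key)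
      show "(\<lambda>x. ?Q (mtx N x)) \<in> borel_measurable ?P"
        by (intro measurable_compose[OF _ measurable_ennreal] measurable_Psi mv_data mtx)
      show "?Q G = ?Q G'" if "\<And>i j. i \<in> {1..N} \<Longrightarrow> j \<in> {1..N} \<Longrightarrow> G i j = G' i j" for G G'
        using PsiG_data[OF zeta_in_range[OF that]] by simp
      show "(\<lambda>x. ?Q (theta \<beta> h N v k (mtx N x))) \<in> borel_measurable (gm N)" for v
        by (simp add: PsiG_theta)
    qed
    then show ?thesis unfolding Z by (simp add: PsiG_theta GM.emeasure_space_1)
  qed
  have "AE \<omega> in M. ?Q (realise g \<omega>) = nn_cond_exp M ?F (\<lambda>\<omega>. ?Z (realise g \<omega>)) \<omega>"
  proof (rule F.nn_cond_exp_charact)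
    show "(\<lambda>\<omega>. ?Z (realise g \<omega>)) \<in> borel_measurable M"
      by (intro measurable_compose[OF _ measurable_ennreal] borel_measurable_power measurable_partition_fun mg)
    show "(\<lambda>\<omega>. ?Q (realise g \<omega>)) \<in> borel_measurable ?F"
      by (intro measurable_compose[OF measurable_PsiG_sigma_G measurable_ennreal])
  qed (rule eq)
  \<comment> \<open>\<open>real_cond_exp\<close> is a difference of two nonnegative conditional
    expectations; the one of the negative part vanishes.\<close>
  moreover have "AE \<omega> in M. 0 = nn_cond_exp M ?F (\<lambda>\<omega>. ennreal (- (partition_fun \<beta> h N (realise g \<omega>))\<^sup>2)) \<omega>"
    by (rule F.nn_cond_exp_charact) (auto simp: ennreal_neg)
  ultimately show ?thesis
  proof eventually_elim
    case (elim \<omega>)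
    then show ?case
      unfolding cond_second_moment_def real_cond_exp_def by (simp flip: elim add: Psi_nonneg)
  qed
qed

text \<open>From here on the given probability spaces are replaced by fresh blocks:
  \<open>PsiG\<close> takes the same value at \<open>theta\<close> and at \<open>dmat\<close>, so
  the independent matrix integrates out.\<close>

theorem disorder_to_fresh:
  assumes H: "H \<in> borel_measurable borel"
  shows "(\<integral>\<^sup>+\<omega>. H (cond_second_moment \<beta> h N M g k \<omega>) \<partial>M) = (\<integral>\<^sup>+v. H (PsiG \<beta> h N k (dmat \<beta> h N v k)) \<partial>VV N k)"
proof -
  interpret GM: prob_space "gm N" by (rule prob_space_gm)
  let ?P = "PiM ({1..N}\<times>{1..N}) (\<lambda>_. borel :: real measure)"
  have mtx: "mm N ?P (mtx N)" by (rule mm_mtx) simp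
  have "(\<integral>\<^sup>+\<omega>. H (cond_second_moment \<beta> h N M g k \<omega>) \<partial>M) = (\<integral>\<^sup>+\<omega>. H (PsiG \<beta> h N k (realise g \<omega>)) \<partial>M)"
    by (rule nn_integral_cong_AE) (use cond_second_moment_eq in eventually_elim, simp)
  also have "\<dots> = (\<integral>\<^sup>+v. (\<integral>\<^sup>+x. H (PsiG \<beta> h N k (theta \<beta> h N v k (mtx N x))) \<partial>gm N) \<partial>VV N k)"
  proof (rule disorder_integral)
    show "(\<lambda>x. H (PsiG \<beta> h N k (mtx N x))) \<in> borel_measurable ?P"
      by (intro measurable_compose[OF _ H] measurable_Psi mv_data mtx)
    show "H (PsiG \<beta> h N k G) = H (PsiG \<beta> h N k G')" if "\<And>i j. i \<in> {1..N} \<Longrightarrow> j \<in> {1..N} \<Longrightarrow> G i j = G' i j" for G G'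
      using PsiG_data[OF zeta_in_range[OF that]] by simp
  qed
  finally show ?thesis by (simp add: PsiG_theta GM.emeasure_space_1)
qed

end

section \<open>The deterministic sequences\<close>

lemma measure_std_gauss_UNIV [simp]: "measure std_gauss UNIV = 1"
  using sg.prob_space by simp

section \<open>Increments of Gaussian expectations in the variance\<close>

lemma sum_cis_pair: "(\<integral>\<omega>. cis (a * fst \<omega> + b * snd \<omega>) \<partial>(std_gauss \<Otimes>\<^sub>M std_gauss)) = complex_of_real (exp (- (a\<^sup>2 + b\<^sup>2) / 2))"
proof -
  interpret P: pair_prob_space std_gauss std_gauss ..
  have "(\<integral>\<omega>. cis (a * fst \<omega> + b * snd \<omega>) \<partial>(std_gauss \<Otimes>\<^sub>M std_gauss))
    = (\<integral>x. (\<integral>y. cis (a * x + b * y) \<partial>std_gauss) \<partial>std_gauss)"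
    by (subst P.integral_fst'[symmetric]) (auto intro!: P.integrable_cis)
  also have "\<dots> = (\<integral>x. cis (a * x) \<partial>std_gauss) * (\<integral>y. cis (b * y) \<partial>std_gauss)"
    by (simp flip: cis_mult)
  finally show ?thesis
    unfolding std_gauss_cis of_real_mult[symmetric] exp_add[symmetric] by (simp add: field_simps)
qed

lemma law_pair:
  assumes "p \<ge> 0" "r \<ge> 0"
  shows "distr (std_gauss \<Otimes>\<^sub>M std_gauss) borel (\<lambda>\<omega>. sqrt p * fst \<omega> + sqrt r * snd \<omega>)
       = distr std_gauss borel (\<lambda>z. sqrt (p + r) * z)"
proof (rule gaussian_law_real)
  interpret P: pair_prob_space std_gauss std_gauss ..
  show "prob_space (std_gauss \<Otimes>\<^sub>M std_gauss)" by (rule P.prob_space_axioms)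
  fix t
  have "(\<integral>\<omega>. cis (t * (sqrt p * fst \<omega> + sqrt r * snd \<omega>)) \<partial>(std_gauss \<Otimes>\<^sub>M std_gauss))
     = (\<integral>\<omega>. cis ((t * sqrt p) * fst \<omega> + (t * sqrt r) * snd \<omega>) \<partial>(std_gauss \<Otimes>\<^sub>M std_gauss))"
    by (simp add: algebra_simps)
  also have "\<dots> = complex_of_real (exp (- (sqrt (p + r) * t)\<^sup>2 / 2))"
    unfolding sum_cis_pair using assms by (simp add: power_mult_distrib algebra_simps)
  finally show "(\<integral>\<omega>. cis (t * (sqrt p * fst \<omega> + sqrt r * snd \<omega>)) \<partial>(std_gauss \<Otimes>\<^sub>M std_gauss))
     = complex_of_real (exp (- (sqrt (p + r) * t)\<^sup>2 / 2))" .
qed measurable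

text \<open>Variance p + r is reached from p by adding an independent Gaussian of variance r to the
  argument, so the odd Taylor terms integrate to 0, the quadratic one gives r, and the quartic
  remainder gives 3 r^2. This takes the place of differentiating in the variance, where the square
  root is singular at 0.\<close>

lemma gauss_increment:
  fixes F Ta Tb Tc :: "real \<Rightarrow> real"
  assumes m [measurable]: "F \<in> borel_measurable borel" "Ta \<in> borel_measurable borel" "Tb \<in> borel_measurable borel" "Tc \<in> borel_measurable borel"
    and b: "\<And>x. \<bar>Ta x\<bar> \<le> B" "\<And>x. \<bar>Tb x\<bar> \<le> B" "\<And>x. \<bar>Tc x\<bar> \<le> B"
    and i: "\<And>s. integrable std_gauss (\<lambda>z. F (s * z))"
    and T: "\<And>x y. \<bar>F (x + y) - F x - Ta x * y - Tb x * y\<^sup>2 - Tc x * y ^ 3\<bar> \<le> Ka * y\<^sup>2 + Kb * y ^ 4"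
    and p: "p \<ge> 0" "r \<ge> 0"
  shows "\<bar>(\<integral>z. F (sqrt (p + r) * z) \<partial>std_gauss) - (\<integral>z. F (sqrt p * z) \<partial>std_gauss) - r * (\<integral>z. Tb (sqrt p * z) \<partial>std_gauss)\<bar>
     \<le> Ka * r + 3 * Kb * r\<^sup>2"
proof -
  interpret P: pair_prob_space std_gauss std_gauss ..
  let ?W = "std_gauss \<Otimes>\<^sub>M std_gauss"
  have e1: "(\<integral>z. F (sqrt (p + r) * z) \<partial>std_gauss) = (\<integral>\<omega>. F (sqrt p * fst \<omega> + sqrt r * snd \<omega>) \<partial>?W)"
  proof -
    have "(\<integral>\<omega>. F (sqrt p * fst \<omega> + sqrt r * snd \<omega>) \<partial>?W) = (\<integral>y. F y \<partial>distr ?W borel (\<lambda>\<omega>. sqrt p * fst \<omega> + sqrt r * snd \<omega>))"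
      by (rule integral_distr[symmetric]) auto
    also have "\<dots> = (\<integral>z. F (sqrt (p + r) * z) \<partial>std_gauss)"
      unfolding law_pair[OF p] by (rule integral_distr) auto
    finally show ?thesis by simp
  qed
  have i1: "integrable ?W (\<lambda>\<omega>. F (sqrt p * fst \<omega> + sqrt r * snd \<omega>))"
  proof -
    have "integrable (distr ?W borel (\<lambda>\<omega>. sqrt p * fst \<omega> + sqrt r * snd \<omega>)) F"
      unfolding law_pair[OF p] by (subst integrable_distr_eq) (auto intro: i)
    then show ?thesis by (subst (asm) integrable_distr_eq) auto
  qed
  have prod: "integrable ?W (\<lambda>\<omega>. f (fst \<omega>) * g (snd \<omega>))" "(\<integral>\<omega>. f (fst \<omega>) * g (snd \<omega>) \<partial>?W) = (\<integral>x. f x \<partial>std_gauss) * (\<integral>y. g y \<partial>std_gauss)"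
    if [simp]: "integrable std_gauss f" "integrable std_gauss g" for f g :: "real \<Rightarrow> real"
  proof -
    show 1: "integrable ?W (\<lambda>\<omega>. f (fst \<omega>) * g (snd \<omega>))"
    proof (rule P.Fubini_integrable)
      have [measurable]: "f \<in> borel_measurable borel" "g \<in> borel_measurable borel"
        using borel_measurable_integrable[OF that(1)] borel_measurable_integrable[OF that(2)] by simp_all
      show "(\<lambda>\<omega>. f (fst \<omega>) * g (snd \<omega>)) \<in> borel_measurable ?W" by measurable
    qed (simp_all add: abs_mult)
    show "(\<integral>\<omega>. f (fst \<omega>) * g (snd \<omega>) \<partial>?W) = (\<integral>x. f x \<partial>std_gauss) * (\<integral>y. g y \<partial>std_gauss)"
      using P.integral_fst'[OF 1] by simp
  qed
  have bi: "integrable std_gauss (\<lambda>x. U (sqrt p * x))" if [measurable]: "U \<in> borel_measurable borel" and "\<And>x. \<bar>U x\<bar> \<le> B" for U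
    by (rule sg.integrable_const_bound[where B=B]) (auto simp: that)
  have pw: "integrable std_gauss (\<lambda>y. (sqrt r * y) ^ n)" for n
    using std_gauss_integrable_power[of n] by (simp add: power_mult_distrib)
  have s2: "(\<integral>y. (sqrt r * y)\<^sup>2 \<partial>std_gauss) = r" using p std_gauss_moment2 by (simp add: power_mult_distrib)
  have s4: "(\<integral>y. (sqrt r * y) ^ 4 \<partial>std_gauss) = 3 * r\<^sup>2"
  proof -
    have "sqrt r ^ 4 = (sqrt r ^ 2) ^ 2" by (simp flip: power_mult)
    then have "sqrt r ^ 4 = r\<^sup>2" using p by simp
    then show ?thesis using std_gauss_moment4 by (simp add: power_mult_distrib)
  qed
  have s1: "(\<integral>y. (sqrt r * y) ^ 1 \<partial>std_gauss) = 0" using std_gauss_moment1 by simp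
  have s3: "(\<integral>y. (sqrt r * y) ^ 3 \<partial>std_gauss) = 0" using std_gauss_moment3 by (simp add: power_mult_distrib)
  have F0: "integrable ?W (\<lambda>\<omega>. F (sqrt p * fst \<omega>) * 1)" "(\<integral>\<omega>. F (sqrt p * fst \<omega>) * 1 \<partial>?W) = (\<integral>x. F (sqrt p * x) \<partial>std_gauss)"
    using prod[OF i[of "sqrt p"], of "\<lambda>_. 1"] by (simp_all)
  note p1 = prod[OF bi[OF m(2) b(1)] pw[of 1], unfolded s1]
  note p2 = prod[OF bi[OF m(3) b(2)] pw[of 2], unfolded s2]
  note p3 = prod[OF bi[OF m(4) b(3)] pw[of 3], unfolded s3]
  let ?R = "\<lambda>\<omega>. F (sqrt p * fst \<omega> + sqrt r * snd \<omega>) - F (sqrt p * fst \<omega>) * 1 - Ta (sqrt p * fst \<omega>) * (sqrt r * snd \<omega>) ^ 1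
     - Tb (sqrt p * fst \<omega>) * (sqrt r * snd \<omega>) ^ 2 - Tc (sqrt p * fst \<omega>) * (sqrt r * snd \<omega>) ^ 3"
  have iR: "integrable ?W ?R"
    by (intro Bochner_Integration.integrable_diff i1 F0(1) p1(1) p2(1) p3(1))
  have "(\<integral>\<omega>. ?R \<omega> \<partial>?W) = (\<integral>\<omega>. F (sqrt p * fst \<omega> + sqrt r * snd \<omega>) \<partial>?W) - (\<integral>z. F (sqrt p * z) \<partial>std_gauss) - 0 - (\<integral>z. Tb (sqrt p * z) \<partial>std_gauss) * r - 0"
    using i1 F0 p1 p2 p3 by simp
  then have R: "(\<integral>\<omega>. ?R \<omega> \<partial>?W) = (\<integral>z. F (sqrt (p + r) * z) \<partial>std_gauss) - (\<integral>z. F (sqrt p * z) \<partial>std_gauss) - r * (\<integral>z. Tb (sqrt p * z) \<partial>std_gauss)"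
    using e1 mult.commute[of r "\<integral>z. Tb (sqrt p * z) \<partial>std_gauss"] by linarith
  have q: "integrable ?W (\<lambda>\<omega>. 1 * (sqrt r * snd \<omega>) ^ n)" "(\<integral>\<omega>. 1 * (sqrt r * snd \<omega>) ^ n \<partial>?W) = (\<integral>y. (sqrt r * y) ^ n \<partial>std_gauss)" for n
    using prod[OF _ pw[of n], of "\<lambda>_. 1"] by (simp_all)
  have iK: "integrable ?W (\<lambda>\<omega>. Ka * (1 * (sqrt r * snd \<omega>) ^ 2) + Kb * (1 * (sqrt r * snd \<omega>) ^ 4))"
    using q(1) by (intro Bochner_Integration.integrable_add integrable_mult_right) auto
  have "norm (\<integral>\<omega>. ?R \<omega> \<partial>?W) \<le> (\<integral>\<omega>. norm (?R \<omega>) \<partial>?W)"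
    by (rule integral_norm_bound)
  also have "\<dots> \<le> (\<integral>\<omega>. Ka * (1 * (sqrt r * snd \<omega>) ^ 2) + Kb * (1 * (sqrt r * snd \<omega>) ^ 4) \<partial>?W)"
  proof (rule integral_mono[OF integrable_norm[OF iR] iK])
    show "norm (?R \<omega>) \<le> Ka * (1 * (sqrt r * snd \<omega>) ^ 2) + Kb * (1 * (sqrt r * snd \<omega>) ^ 4)" for \<omega>
      using T[of "sqrt p * fst \<omega>" "sqrt r * snd \<omega>"] by simp
  qed
  also have "\<dots> = Ka * r + 3 * Kb * r\<^sup>2"
    using q(1)[of 2] q(1)[of 4] q(2)[of 2] q(2)[of 4] s2 s4 by simp
  finally show ?thesis unfolding R real_norm_def .
qed

section \<open>Taylor and Lipschitz bounds for tanh and log cosh\<close>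

abbreviation lncosh :: "real \<Rightarrow> real" where "lncosh x \<equiv> ln (cosh x)"

lemma DERIV_tanh_real: "(tanh has_real_derivative (1 - (tanh x)\<^sup>2)) (at x)" for x :: real
  by (auto intro!: derivative_eq_intros)

lemma DERIV_lncosh: "(lncosh has_real_derivative tanh x) (at x)"
  by (rule derivative_eq_intros refl | simp add: cosh_real_pos tanh_def)+

lemma abs_tanh_le [simp]: "\<bar>tanh (x::real)\<bar> \<le> 1"
  using tanh_real_lt_1[of x] tanh_real_gt_neg1[of x] by linarith

lemma tanh_sq_le [simp]: "(tanh (x::real))\<^sup>2 \<le> 1"
  by (simp add: abs_square_le_1)

lemma abs_one_minus_tanh_sq [simp]: "\<bar>1 - (tanh (x::real))\<^sup>2\<bar> \<le> 1"
  using tanh_sq_le[of x] zero_le_power2[of "tanh x"] unfolding abs_le_iff by linarith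

lemma taylor2:
  fixes f f1 f2 :: "real \<Rightarrow> real"
  assumes "\<And>x. (f has_real_derivative f1 x) (at x)" "\<And>x. (f1 has_real_derivative f2 x) (at x)"
  obtains t where "f (x + y) = f x + f1 x * y + f2 t / 2 * y\<^sup>2"
proof -
  define D where "D m = (\<lambda>y. (if m = 0 then f else if m = 1 then f1 else f2) (x + y))" for m :: nat
  have "\<forall>m t. m < 2 \<and> \<bar>t\<bar> \<le> \<bar>y\<bar> \<longrightarrow> DERIV (D m) t :> D (Suc m) t"
    using assms by (auto simp: D_def less_2_cases_iff add.commute[of x] DERIV_shift[symmetric])
  from Maclaurin_bi_le[of D "\<lambda>y. f (x + y)" 2 y, OF _ this] obtain t where
    "f (x + y) = (\<Sum>m<2. D m 0 / fact m * y ^ m) + D 2 t / fact 2 * y ^ 2" by (auto simp: D_def)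
  then have "f (x + y) = f x + f1 x * y + f2 (x + t) / 2 * y\<^sup>2" by (simp add: D_def numeral_2_eq_2)
  then show ?thesis by (rule that)
qed

lemma taylor4:
  fixes f f1 f2 f3 f4 :: "real \<Rightarrow> real"
  assumes "\<And>x. (f has_real_derivative f1 x) (at x)" "\<And>x. (f1 has_real_derivative f2 x) (at x)"
    "\<And>x. (f2 has_real_derivative f3 x) (at x)" "\<And>x. (f3 has_real_derivative f4 x) (at x)"
  obtains t where "f (x + y) = f x + f1 x * y + f2 x / 2 * y\<^sup>2 + f3 x / 6 * y ^ 3 + f4 t / 24 * y ^ 4"
proof -
  define D where "D m = (\<lambda>y. (if m = 0 then f else if m = 1 then f1 else if m = 2 then f2 else if m = 3 then f3 else f4) (x + y))" for m :: nat
  have "\<forall>m t. m < 4 \<and> \<bar>t\<bar> \<le> \<bar>y\<bar> \<longrightarrow> DERIV (D m) t :> D (Suc m) t"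
  proof (intro allI impI)
    fix m t assume "m < (4::nat) \<and> \<bar>t\<bar> \<le> \<bar>y\<bar>"
    then consider "m = 0" | "m = 1" | "m = 2" | "m = 3" by linarith
    then show "DERIV (D m) t :> D (Suc m) t"
      using assms by cases (auto simp: D_def add.commute[of x] DERIV_shift[symmetric])
  qed
  from Maclaurin_bi_le[of D "\<lambda>y. f (x + y)" 4 y, OF _ this] obtain t where
    "f (x + y) = (\<Sum>m<4. D m 0 / fact m * y ^ m) + D 4 t / fact 4 * y ^ 4" by (auto simp: D_def)
  moreover have "(\<Sum>m<4. D m 0 / fact m * y ^ m) = f x + f1 x * y + f2 x / 2 * y\<^sup>2 + f3 x / 6 * y ^ 3"
    by (simp add: eval_nat_numeral D_def)
  moreover have "D 4 t / fact 4 = f4 (x + t) / 24" by (simp add: D_def fact_numeral)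
  ultimately show ?thesis using that[of "x + t"] by simp
qed

text \<open>The second derivative of log cosh is at most 1. Exponentiated, this is the sub-Gaussian
  bound for one tilted spin in \<open>spin_wt_mgf\<close>.\<close>

lemma lncosh_increment_le: "lncosh (x + y) \<le> lncosh x + tanh x * y + y\<^sup>2 / 2"
proof -
  obtain t where t: "lncosh (x + y) = lncosh x + tanh x * y + (1 - (tanh t)\<^sup>2) / 2 * y\<^sup>2"
    using taylor2[OF DERIV_lncosh DERIV_tanh_real] by blast
  have "(1 - (tanh t)\<^sup>2) / 2 * y\<^sup>2 \<le> 1 / 2 * y\<^sup>2" by (intro mult_right_mono) auto
  then show ?thesis using t by simp
qed

lemma tanh_poly_bound: "\<bar>(1 - (tanh x)\<^sup>2) * (1 - 3 * (tanh x)\<^sup>2)\<bar> \<le> 2" for x :: real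
proof -
  have "\<bar>1 - (tanh x)\<^sup>2\<bar> * \<bar>1 - 3 * (tanh x)\<^sup>2\<bar> \<le> 1 * 2"
  proof (intro mult_mono)
    show "\<bar>1 - (tanh x)\<^sup>2\<bar> \<le> 1" "\<bar>1 - 3 * (tanh x)\<^sup>2\<bar> \<le> 2"
      using tanh_sq_le[of x] zero_le_power2[of "tanh x"] unfolding abs_le_iff by linarith+
  qed auto
  then show ?thesis by (simp add: abs_mult)
qed

lemma tanh_sq_taylor: "\<bar>(tanh (x + y))\<^sup>2 - (tanh x)\<^sup>2 - 2 * tanh x * (1 - (tanh x)\<^sup>2) * y\<bar> \<le> 2 * y\<^sup>2" for x y :: real
proof -
  have 1: "((\<lambda>x. (tanh x)\<^sup>2) has_real_derivative 2 * tanh x * (1 - (tanh x)\<^sup>2)) (at x)" for x :: real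
    by (auto intro!: derivative_eq_intros)
  have 2: "((\<lambda>x. 2 * tanh x * (1 - (tanh x)\<^sup>2)) has_real_derivative 2 * ((1 - (tanh x)\<^sup>2) * (1 - 3 * (tanh x)\<^sup>2))) (at x)" for x :: real
    by (rule derivative_eq_intros DERIV_tanh_real refl | simp)+ (simp add: algebra_simps power2_eq_square)
  obtain t where t: "(tanh (x + y))\<^sup>2 = (tanh x)\<^sup>2 + 2 * tanh x * (1 - (tanh x)\<^sup>2) * y + (2 * ((1 - (tanh t)\<^sup>2) * (1 - 3 * (tanh t)\<^sup>2))) / 2 * y\<^sup>2"
    by (rule taylor2[OF 1 2])
  have "\<bar>(1 - (tanh t)\<^sup>2) * (1 - 3 * (tanh t)\<^sup>2)\<bar> * y\<^sup>2 \<le> 2 * y\<^sup>2"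
    by (intro mult_right_mono tanh_poly_bound) auto
  then show ?thesis using t by (simp add: abs_mult)
qed

lemma lncosh_taylor:
  "\<bar>lncosh (x + y) - lncosh x - tanh x * y - (1 - (tanh x)\<^sup>2) / 2 * y\<^sup>2 - (- 2 * tanh x * (1 - (tanh x)\<^sup>2)) / 6 * y ^ 3\<bar> \<le> y ^ 4 / 6"
proof -
  have 2: "((\<lambda>x. 1 - (tanh x)\<^sup>2) has_real_derivative - 2 * tanh x * (1 - (tanh x)\<^sup>2)) (at x)" for x :: real
    by (auto intro!: derivative_eq_intros)
  have 3: "((\<lambda>x. - 2 * tanh x * (1 - (tanh x)\<^sup>2)) has_real_derivative - 2 * ((1 - (tanh x)\<^sup>2) * (1 - 3 * (tanh x)\<^sup>2))) (at x)" for x :: real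
    by (rule derivative_eq_intros DERIV_tanh_real refl | simp)+ (simp add: algebra_simps power2_eq_square)
  obtain t where t: "lncosh (x + y) = lncosh x + tanh x * y + (1 - (tanh x)\<^sup>2) / 2 * y\<^sup>2 + (- 2 * tanh x * (1 - (tanh x)\<^sup>2)) / 6 * y ^ 3
      + (- 2 * ((1 - (tanh t)\<^sup>2) * (1 - 3 * (tanh t)\<^sup>2))) / 24 * y ^ 4"
    by (rule taylor4[OF DERIV_lncosh DERIV_tanh_real 2 3])
  have "\<bar>(1 - (tanh t)\<^sup>2) * (1 - 3 * (tanh t)\<^sup>2)\<bar> * y ^ 4 \<le> 2 * y ^ 4"
    by (intro mult_right_mono tanh_poly_bound) auto
  then have "\<bar>(- 2 * ((1 - (tanh t)\<^sup>2) * (1 - 3 * (tanh t)\<^sup>2))) / 24 * y ^ 4\<bar> \<le> y ^ 4 / 6"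
    by (simp add: abs_mult mult.commute)
  then show ?thesis using t by simp
qed

lemma lncosh_nonneg: "0 \<le> lncosh x"
  by (simp add: cosh_real_ge_1)

lemma lncosh_lipschitz: "\<bar>lncosh x - lncosh y\<bar> \<le> \<bar>x - y\<bar>"
proof -
  have "norm (lncosh x - lncosh y) \<le> 1 * norm (x - y)"
    by (rule field_differentiable_bound[of UNIV lncosh tanh]) (auto intro: has_field_derivative_at_within DERIV_lncosh)
  then show ?thesis by simp
qed

lemma tanh_lipschitz: "\<bar>tanh x - tanh y\<bar> \<le> \<bar>x - y\<bar>" for x y :: real
proof -
  have "norm (tanh x - tanh y) \<le> 1 * norm (x - y)"
  proof (rule field_differentiable_bound[of UNIV tanh "\<lambda>x. 1 - (tanh x)\<^sup>2"])
    show "norm (1 - (tanh z)\<^sup>2) \<le> 1" for z :: real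
      using tanh_sq_le[of z] by (auto simp: abs_le_iff)
  qed (auto intro: has_field_derivative_at_within DERIV_tanh_real)
  then show ?thesis by simp
qed

lemma lncosh_measurable [measurable (raw)]:
  assumes [measurable]: "f \<in> borel_measurable M"
  shows "(\<lambda>x. lncosh (f x)) \<in> borel_measurable M"
proof -
  have "continuous_on UNIV lncosh"
    using DERIV_lncosh by (intro DERIV_continuous_on) (auto intro: has_field_derivative_at_within)
  then have "lncosh \<in> borel_measurable borel" by (rule borel_measurable_continuous_onI)
  then show ?thesis using assms by (rule measurable_compose_rev)
qed

lemma lncosh_integrable: "integrable std_gauss (\<lambda>z. lncosh (h + \<beta> * (s * z)))"
proof (rule Bochner_Integration.integrable_bound)
  show "integrable std_gauss (\<lambda>z. lncosh h + \<bar>\<beta> * s\<bar> * \<bar>z\<bar>)" by auto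
  show "AE z in std_gauss. norm (lncosh (h + \<beta> * (s * z))) \<le> norm (lncosh h + \<bar>\<beta> * s\<bar> * \<bar>z\<bar>)"
  proof (rule AE_I2)
    fix z
    have "\<bar>lncosh (h + \<beta> * (s * z)) - lncosh h\<bar> \<le> \<bar>\<beta> * s\<bar> * \<bar>z\<bar>"
      using lncosh_lipschitz[of "h + \<beta> * (s * z)" h] by (simp add: abs_mult mult.assoc)
    then show "norm (lncosh (h + \<beta> * (s * z))) \<le> norm (lncosh h + \<bar>\<beta> * s\<bar> * \<bar>z\<bar>)"
      using lncosh_nonneg[of h] lncosh_nonneg[of "h + \<beta> * (s * z)"] mult_nonneg_nonneg[of "\<bar>\<beta> * s\<bar>" "\<bar>z\<bar>"]
      unfolding real_norm_def by linarith
  qed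
qed measurable

text \<open>On n + 1 equal pieces the total loss is at most C (b - a)^2 / (n + 1), which vanishes. A
  one-step lower bound with quadratic error thus gives monotonicity without differentiating
  \<open>H\<close>.\<close>

lemma subdivision_mono:
  fixes H :: "real \<Rightarrow> real"
  assumes ab: "a \<le> b" and H: "\<And>x y. a \<le> x \<Longrightarrow> x \<le> y \<Longrightarrow> y \<le> b \<Longrightarrow> H x - C * (y - x)\<^sup>2 \<le> H y"
  shows "H a \<le> H b"
proof -
  define d where "d = b - a"
  have n: "H a - H b \<le> C * d\<^sup>2 / real (Suc n)" for n
  proof -
    define x where "x i = a + real i * d / real (Suc n)" for i
    have st: "H (x i) - H (x (Suc i)) \<le> C * (d / real (Suc n))\<^sup>2" if "i < Suc n" for i
    proof -
      have d0: "d \<ge> 0" using ab by (simp add: d_def)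
      have e: "x (Suc i) - x i = d / real (Suc n)" by (simp add: x_def add_divide_distrib distrib_right)
      have "x (Suc i) \<le> b"
      proof -
        have "real (Suc i) * d / real (Suc n) \<le> real (Suc n) * d / real (Suc n)"
          using that d0 by (intro divide_right_mono mult_right_mono) auto
        then show ?thesis by (simp add: x_def d_def)
      qed
      moreover have "a \<le> x i" using d0 by (simp add: x_def)
      moreover have "0 \<le> d / real (Suc n)" using d0 by simp
      then have "x i \<le> x (Suc i)" using e by linarith
      ultimately show ?thesis using H[of "x i" "x (Suc i)"] e by simp
    qed
    have "H (x 0) - H (x (Suc n)) = (\<Sum>i<Suc n. H (x i) - H (x (Suc i)))"
      using sum_lessThan_telescope'[of "\<lambda>i. H (x i)" "Suc n"] by simp
    also have "\<dots> \<le> (\<Sum>i<Suc n. C * (d / real (Suc n))\<^sup>2)"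
      by (intro sum_mono st) auto
    also have "\<dots> = C * d\<^sup>2 / real (Suc n)"
      by (simp add: power_divide power2_eq_square del: of_nat_Suc)
    finally show ?thesis by (simp add: x_def d_def del: of_nat_Suc)
  qed
  have "(\<lambda>n. C * d\<^sup>2 / real (Suc n)) \<longlonglongrightarrow> 0"
    by (rule LIMSEQ_Suc[OF lim_const_over_n])
  then have "H a - H b \<le> 0"
    by (rule LIMSEQ_le_const) (use n in auto)
  then show ?thesis by simp
qed

section \<open>The fixed point q and the minimum in the formula for RS\<close>

definition Ef :: "real \<Rightarrow> real \<Rightarrow> real \<Rightarrow> real" where
  "Ef \<beta> h p = (\<integral>z. (tanh (h + \<beta> * sqrt p * z))\<^sup>2 \<partial>std_gauss)"

definition EL :: "real \<Rightarrow> real \<Rightarrow> real \<Rightarrow> real" where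
  "EL \<beta> h p = (\<integral>z. lncosh (h + \<beta> * sqrt p * z) \<partial>std_gauss)"

lemma Ef_bounds: "0 \<le> Ef \<beta> h p" "Ef \<beta> h p \<le> 1"
proof -
  show "0 \<le> Ef \<beta> h p" unfolding Ef_def by (rule Bochner_Integration.integral_nonneg) simp
  have i: "integrable std_gauss (\<lambda>z. (tanh (h + \<beta> * sqrt p * z))\<^sup>2)"
    by (rule sg.integrable_const_bound[where B=1]) auto
  have "Ef \<beta> h p \<le> (\<integral>z. 1 \<partial>std_gauss)" unfolding Ef_def
    by (rule integral_mono[OF i]) auto
  then show "Ef \<beta> h p \<le> 1" by simp
qed

text \<open>Only a Lipschitz bound is wanted, so the quadratic Taylor term is left in the remainder:
  \<open>gauss_increment\<close> is used with 0 in place of the quadratic coefficient.\<close>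

lemma Ef_increment:
  assumes "p \<ge> 0" "r \<ge> 0"
  shows "\<bar>Ef \<beta> h (p + r) - Ef \<beta> h p\<bar> \<le> 2 * \<beta>\<^sup>2 * r"
proof -
  have "\<bar>(\<integral>z. (tanh (h + \<beta> * (sqrt (p + r) * z)))\<^sup>2 \<partial>std_gauss) - (\<integral>z. (tanh (h + \<beta> * (sqrt p * z)))\<^sup>2 \<partial>std_gauss)
      - r * (\<integral>z. 0 \<partial>std_gauss)\<bar> \<le> (2 * \<beta>\<^sup>2) * r + 3 * 0 * r\<^sup>2"
  proof (rule gauss_increment[where Ta="\<lambda>x. 2 * tanh (h + \<beta> * x) * (1 - (tanh (h + \<beta> * x))\<^sup>2) * \<beta>" and Tc="\<lambda>_. 0" and B="2 * \<bar>\<beta>\<bar>"])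
    show "\<bar>2 * tanh (h + \<beta> * x) * (1 - (tanh (h + \<beta> * x))\<^sup>2) * \<beta>\<bar> \<le> 2 * \<bar>\<beta>\<bar>" for x
    proof -
      have "\<bar>tanh (h + \<beta> * x)\<bar> * \<bar>1 - (tanh (h + \<beta> * x))\<^sup>2\<bar> \<le> 1 * 1"
        by (intro mult_mono) auto
      then have "2 * (\<bar>tanh (h + \<beta> * x)\<bar> * \<bar>1 - (tanh (h + \<beta> * x))\<^sup>2\<bar>) * \<bar>\<beta>\<bar> \<le> 2 * 1 * \<bar>\<beta>\<bar>"
        by (intro mult_right_mono mult_left_mono) auto
      then show ?thesis by (simp add: abs_mult mult.assoc)
    qed
    show "integrable std_gauss (\<lambda>z. (tanh (h + \<beta> * (s * z)))\<^sup>2)" for s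
      by (rule sg.integrable_const_bound[where B=1]) auto
    show "\<bar>(tanh (h + \<beta> * (x + y)))\<^sup>2 - (tanh (h + \<beta> * x))\<^sup>2 - 2 * tanh (h + \<beta> * x) * (1 - (tanh (h + \<beta> * x))\<^sup>2) * \<beta> * y - 0 * y\<^sup>2 - 0 * y ^ 3\<bar>
       \<le> 2 * \<beta>\<^sup>2 * y\<^sup>2 + 0 * y ^ 4" for x y
      using tanh_sq_taylor[of "h + \<beta> * x" "\<beta> * y"] by (simp add: algebra_simps power_mult_distrib)
  qed (use assms in auto)
  then show ?thesis by (simp add: Ef_def mult.assoc)
qed

lemma Ef_lipschitz:
  assumes "p \<ge> 0" "p' \<ge> 0"
  shows "\<bar>Ef \<beta> h p' - Ef \<beta> h p\<bar> \<le> 2 * \<beta>\<^sup>2 * \<bar>p' - p\<bar>"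
proof (cases "p \<le> p'")
  case True
  then show ?thesis using Ef_increment[of p "p' - p" \<beta> h] assms by simp
next
  case False
  then show ?thesis using Ef_increment[of p' "p - p'" \<beta> h] assms by (simp add: abs_minus_commute)
qed

lemma EL_increment:
  assumes p: "p \<ge> 0" "r \<ge> 0"
  shows "\<bar>EL \<beta> h (p + r) - EL \<beta> h p - \<beta>\<^sup>2 / 2 * (1 - Ef \<beta> h p) * r\<bar> \<le> \<beta> ^ 4 / 2 * r\<^sup>2"
proof -
  have A: "\<bar>(\<integral>z. lncosh (h + \<beta> * (sqrt (p + r) * z)) \<partial>std_gauss) - (\<integral>z. lncosh (h + \<beta> * (sqrt p * z)) \<partial>std_gauss)
      - r * (\<integral>z. (1 - (tanh (h + \<beta> * (sqrt p * z)))\<^sup>2) / 2 * \<beta>\<^sup>2 \<partial>std_gauss)\<bar> \<le> 0 * r + 3 * (\<beta> ^ 4 / 6) * r\<^sup>2"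
  proof (rule gauss_increment[where F="\<lambda>x. lncosh (h + \<beta> * x)" and Ta="\<lambda>x. tanh (h + \<beta> * x) * \<beta>" and Tb="\<lambda>x. (1 - (tanh (h + \<beta> * x))\<^sup>2) / 2 * \<beta>\<^sup>2"
        and Tc="\<lambda>x. (- 2 * tanh (h + \<beta> * x) * (1 - (tanh (h + \<beta> * x))\<^sup>2)) / 6 * \<beta> ^ 3" and B="\<bar>\<beta>\<bar> + \<beta>\<^sup>2 + \<bar>\<beta> ^ 3\<bar>"])
    have b1: "\<bar>u * \<beta>'\<bar> \<le> \<bar>\<beta>'\<bar>" if "\<bar>u\<bar> \<le> 1" for u \<beta>' :: real
      using mult_right_mono[OF that, of "\<bar>\<beta>'\<bar>"] by (simp add: abs_mult)
    have half: "\<bar>u / 2\<bar> \<le> 1" if "\<bar>u\<bar> \<le> 1" for u :: real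
      using that by simp
    have pos: "0 \<le> \<bar>\<beta>\<bar>" "0 \<le> \<beta>\<^sup>2" "0 \<le> \<bar>\<beta> ^ 3\<bar>" by simp_all
    show "\<bar>tanh (h + \<beta> * x) * \<beta>\<bar> \<le> \<bar>\<beta>\<bar> + \<beta>\<^sup>2 + \<bar>\<beta> ^ 3\<bar>" for x
      using b1[OF abs_tanh_le, of "h + \<beta> * x" \<beta>] pos by linarith
    show "\<bar>(1 - (tanh (h + \<beta> * x))\<^sup>2) / 2 * \<beta>\<^sup>2\<bar> \<le> \<bar>\<beta>\<bar> + \<beta>\<^sup>2 + \<bar>\<beta> ^ 3\<bar>" for x
    proof -
      have "\<bar>(1 - (tanh (h + \<beta> * x))\<^sup>2) / 2\<bar> \<le> 1"
        by (rule half) (rule abs_one_minus_tanh_sq)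
      from b1[OF this, of "\<beta>\<^sup>2"] show ?thesis using pos by (simp only: abs_power2)
    qed
    show "\<bar>(- 2 * tanh (h + \<beta> * x) * (1 - (tanh (h + \<beta> * x))\<^sup>2)) / 6 * \<beta> ^ 3\<bar> \<le> \<bar>\<beta>\<bar> + \<beta>\<^sup>2 + \<bar>\<beta> ^ 3\<bar>" for x
    proof -
      have "\<bar>tanh (h + \<beta> * x)\<bar> * \<bar>1 - (tanh (h + \<beta> * x))\<^sup>2\<bar> \<le> 1 * 1" by (intro mult_mono) auto
      moreover have "\<bar>(- 2 * t * u) / 6\<bar> = (\<bar>t\<bar> * \<bar>u\<bar>) / 3" for t u :: real by (simp add: abs_mult)
      ultimately have "\<bar>(- 2 * tanh (h + \<beta> * x) * (1 - (tanh (h + \<beta> * x))\<^sup>2)) / 6\<bar> \<le> 1" by simp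
      from b1[OF this, of "\<beta> ^ 3"] show ?thesis using pos by linarith
    qed
    show "\<bar>lncosh (h + \<beta> * (x + y)) - lncosh (h + \<beta> * x) - tanh (h + \<beta> * x) * \<beta> * y - (1 - (tanh (h + \<beta> * x))\<^sup>2) / 2 * \<beta>\<^sup>2 * y\<^sup>2
       - (- 2 * tanh (h + \<beta> * x) * (1 - (tanh (h + \<beta> * x))\<^sup>2)) / 6 * \<beta> ^ 3 * y ^ 3\<bar> \<le> 0 * y\<^sup>2 + \<beta> ^ 4 / 6 * y ^ 4" for x y
      using lncosh_taylor[of "h + \<beta> * x" "\<beta> * y"] by (simp add: power_mult_distrib distrib_left add.assoc mult.assoc)
  qed (use p lncosh_integrable in auto)
  have B: "(\<integral>z. (1 - (tanh (h + \<beta> * (sqrt p * z)))\<^sup>2) / 2 * \<beta>\<^sup>2 \<partial>std_gauss) = \<beta>\<^sup>2 / 2 * (1 - Ef \<beta> h p)"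
  proof -
    have "integrable std_gauss (\<lambda>z. (tanh (h + \<beta> * (sqrt p * z)))\<^sup>2)"
      by (rule sg.integrable_const_bound[where B=1]) auto
    then show ?thesis by (simp add: Ef_def mult.assoc)
  qed
  have C: "(\<integral>z. lncosh (h + \<beta> * (sqrt p * z)) \<partial>std_gauss) = EL \<beta> h p" for p
    by (simp add: EL_def mult.assoc)
  have "r * (\<beta>\<^sup>2 / 2 * (1 - Ef \<beta> h p)) = \<beta>\<^sup>2 / 2 * (1 - Ef \<beta> h p) * r" "0 * r + 3 * (\<beta> ^ 4 / 6) * r\<^sup>2 = \<beta> ^ 4 / 2 * r\<^sup>2"
    by simp_all
  then show ?thesis using A unfolding B C by (simp only:)
qed

text \<open>The bound 1/100 makes \<open>Ef\<close> a contraction and ensures 9 \<beta> \<le> 3/8 in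
  \<open>spin_wt_quadratic\<close>, where the exponential moments of the quadratic forms are
  controlled. It is a convenient value, not a sharp one.\<close>

locale hightemp =
  fixes \<beta> h :: real
  assumes beta_pos: "\<beta> > 0" and beta_le: "\<beta> \<le> 1 / 100" and h_pos: "h > 0"
begin

abbreviation q where "q \<equiv> sk_q \<beta> h"

lemma beta_sq: "\<beta>\<^sup>2 \<le> 1 / 10000"
  using power_mono[OF beta_le, of 2] beta_pos by (simp add: power_divide)

text \<open>\<open>Ef\<close> is Lipschitz with constant 2 \<beta>^2 < 1, which gives uniqueness.
  For existence, x - \<open>Ef \<beta> h x\<close> is negative at 0 because h > 0, and nonnegative
  at 1.\<close>

lemma q_unique: "\<exists>!q. q > 0 \<and> q = Ef \<beta> h q"
proof (rule ex_ex1I)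
  have lip: "\<bar>Ef \<beta> h p' - Ef \<beta> h p\<bar> \<le> 1 * \<bar>p' - p\<bar>" if "p \<ge> 0" "p' \<ge> 0" for p p'
  proof -
    have "2 * \<beta>\<^sup>2 * \<bar>p' - p\<bar> \<le> 1 * \<bar>p' - p\<bar>" using beta_sq by (intro mult_right_mono) auto
    then show ?thesis using Ef_lipschitz[OF that, of \<beta> h] by linarith
  qed
  have cont: "continuous_on {0..1} (\<lambda>x. x - Ef \<beta> h x)"
  proof (intro continuous_intros)
    have "1-lipschitz_on {0..1} (Ef \<beta> h)"
      by (rule lipschitz_onI) (auto simp: dist_real_def intro: order_trans[OF lip])
    then show "continuous_on {0..1} (Ef \<beta> h)" by (rule lipschitz_on_continuous_on)
  qed
  have f0: "Ef \<beta> h 0 = (tanh h)\<^sup>2" by (simp add: Ef_def)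
  have "0 < Ef \<beta> h 0" using h_pos by (simp add: f0)
  then have "\<exists>x\<ge>0. x \<le> 1 \<and> x - Ef \<beta> h x = 0"
    using Ef_bounds[of \<beta> h 1] by (intro IVT'[of "\<lambda>x. x - Ef \<beta> h x" 0 0 1, OF _ _ _ cont]) simp_all
  then obtain x where x: "0 \<le> x" "x - Ef \<beta> h x = 0" by blast
  have "x \<noteq> 0"
  proof
    assume "x = 0"
    then show False using x(2) \<open>0 < Ef \<beta> h 0\<close> by simp
  qed
  then have "x > 0 \<and> x = Ef \<beta> h x" using x by linarith
  then show "\<exists>q. q > 0 \<and> q = Ef \<beta> h q" by blast
next
  fix x y assume x: "x > 0 \<and> x = Ef \<beta> h x" and y: "y > 0 \<and> y = Ef \<beta> h y"
  have "\<bar>Ef \<beta> h y - Ef \<beta> h x\<bar> \<le> 2 * \<beta>\<^sup>2 * \<bar>y - x\<bar>"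
    using x y by (intro Ef_lipschitz) linarith+
  then have "\<bar>y - x\<bar> \<le> 2 * \<beta>\<^sup>2 * \<bar>y - x\<bar>"
    using x y by (simp only: x[THEN conjunct2, symmetric] y[THEN conjunct2, symmetric])
  also have "\<dots> \<le> 1 / 2 * \<bar>y - x\<bar>" using beta_sq by (intro mult_right_mono) auto
  finally show "x = y" by simp
qed

lemma q_pos: "q > 0" and q_fix: "q = Ef \<beta> h q"
proof -
  have "q = (THE q. q > 0 \<and> q = Ef \<beta> h q)" unfolding sk_q_def Ef_def ..
  then have "q > 0 \<and> q = Ef \<beta> h q" using theI'[OF q_unique] by simp
  then show "q > 0" "q = Ef \<beta> h q" by blast+
qed

lemma q_le_1: "q \<le> 1"
  using q_fix Ef_bounds(2)[of \<beta> h q] by linarith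

text \<open>By Gaussian integration by parts the derivative of the bracket in \<open>RS\<close> at \<open>p\<close> is
  \<open>\<beta>\<^sup>2 / 2 * (p - Ef \<beta> h p)\<close>, which changes sign at \<open>q\<close>.\<close>

lemma RS_eq: "RS \<beta> h = EL \<beta> h q + \<beta>\<^sup>2 * (1 - q)\<^sup>2 / 4"
proof -
  define H where "H p = EL \<beta> h p + \<beta>\<^sup>2 * (1 - p)\<^sup>2 / 4" for p
  define C where "C = \<beta> ^ 4 / 2 + \<beta>\<^sup>2 / 4"
  have H: "\<bar>H y - H x - \<beta>\<^sup>2 / 2 * (x - Ef \<beta> h x) * (y - x)\<bar> \<le> C * (y - x)\<^sup>2" if "0 \<le> x" "x \<le> y" for x y
  proof -
    have e: "\<bar>EL \<beta> h y - EL \<beta> h x - \<beta>\<^sup>2 / 2 * (1 - Ef \<beta> h x) * (y - x)\<bar> \<le> \<beta> ^ 4 / 2 * (y - x)\<^sup>2"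
      using EL_increment[of x "y - x" \<beta> h] that by simp
    have id: "H y - H x - \<beta>\<^sup>2 / 2 * (x - Ef \<beta> h x) * (y - x)
       = (EL \<beta> h y - EL \<beta> h x - \<beta>\<^sup>2 / 2 * (1 - Ef \<beta> h x) * (y - x)) + \<beta>\<^sup>2 / 4 * (y - x)\<^sup>2"
      by (simp add: H_def power2_eq_square field_simps)
    have "\<bar>\<beta>\<^sup>2 / 4 * (y - x)\<^sup>2\<bar> = \<beta>\<^sup>2 / 4 * (y - x)\<^sup>2" by simp
    then show ?thesis unfolding id C_def distrib_right
      using e abs_triangle_ineq[of "EL \<beta> h y - EL \<beta> h x - \<beta>\<^sup>2 / 2 * (1 - Ef \<beta> h x) * (y - x)" "\<beta>\<^sup>2 / 4 * (y - x)\<^sup>2"] by linarith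
  qed
  \<comment> \<open>\<open>Ef\<close> fixes q and does not increase distances, so
    \<open>Ef \<beta> h x\<close> is no farther from q than x is, and x -
    \<open>Ef \<beta> h x\<close> has the sign of x - q.\<close>
  have sgn: "(x - q) * (x - Ef \<beta> h x) \<ge> 0" if "0 \<le> x" for x
  proof -
    have "\<bar>Ef \<beta> h x - q\<bar> \<le> 2 * \<beta>\<^sup>2 * \<bar>x - q\<bar>"
      using Ef_lipschitz[of q x \<beta> h] q_pos that by (simp only: q_fix[symmetric] less_imp_le)
    also have "\<dots> \<le> 1 * \<bar>x - q\<bar>" using beta_sq by (intro mult_right_mono) auto
    finally have "\<bar>Ef \<beta> h x - q\<bar> \<le> \<bar>x - q\<bar>" by simp
    then show ?thesis by (cases "x \<ge> q") (auto simp: mult_nonneg_nonneg mult_nonpos_nonpos)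
  qed
  have min: "H q \<le> H p" if "0 \<le> p" for p
  proof (cases "q \<le> p")
    case True
    show ?thesis
    proof (rule subdivision_mono[OF True])
      fix x y assume xy: "q \<le> x" "x \<le> y" "y \<le> p"
      have "x - Ef \<beta> h x \<ge> 0"
      proof (cases "x = q")
        case True
        then show ?thesis using q_fix by simp
      next
        case False
        then show ?thesis using sgn[of x] q_pos xy by (simp add: zero_le_mult_iff)
      qed
      then have "\<beta>\<^sup>2 / 2 * (x - Ef \<beta> h x) * (y - x) \<ge> 0" using xy by auto
      then show "H x - C * (y - x)\<^sup>2 \<le> H y" using H[of x y] xy q_pos by linarith
    qed
  next
    case False
    have "- H p \<le> - H q"
    proof (rule subdivision_mono[of p q "\<lambda>x. - H x"])
      fix x y assume xy: "p \<le> x" "x \<le> y" "y \<le> q"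
      have "x - Ef \<beta> h x \<le> 0"
      proof (cases "x = q")
        case True
        then show ?thesis using q_fix by simp
      next
        case False
        then show ?thesis using sgn[of x] that xy by (simp add: zero_le_mult_iff)
      qed
      then have "\<beta>\<^sup>2 / 2 * (x - Ef \<beta> h x) * (y - x) \<le> 0" using xy
        by (intro mult_nonpos_nonneg mult_nonneg_nonpos) auto
      then show "- H x - C * (y - x)\<^sup>2 \<le> - H y" using H[of x y] xy that by linarith
    qed (use False in simp)
    then show ?thesis by simp
  qed
  have "RS \<beta> h = (INF p\<in>{0..}. H p)" by (simp add: RS_def H_def EL_def)
  also have "\<dots> = H q"
    using q_pos min by (intro cInf_eq_minimum) auto
  finally show ?thesis by (simp add: H_def)
qed

end

section \<open>The function psi and the sequences \<rho>, \<gamma> and \<Gamma>\<close>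

abbreviation W3 :: "(real \<times> real \<times> real) measure" where
  "W3 \<equiv> std_gauss \<Otimes>\<^sub>M (std_gauss \<Otimes>\<^sub>M std_gauss)"

lemma prob_space_W3: "prob_space W3"
proof -
  interpret P: pair_prob_space std_gauss std_gauss ..
  interpret Q: pair_prob_space std_gauss "std_gauss \<Otimes>\<^sub>M std_gauss" ..
  show ?thesis by (rule Q.prob_space_axioms)
qed

lemma W3_cis: "(\<integral>\<omega>. cis (a * fst \<omega> + (b * fst (snd \<omega>) + c * snd (snd \<omega>))) \<partial>W3) = complex_of_real (exp (- (a\<^sup>2 + b\<^sup>2 + c\<^sup>2) / 2))"
proof -
  interpret P: pair_prob_space std_gauss std_gauss ..
  interpret Q: pair_prob_space std_gauss "std_gauss \<Otimes>\<^sub>M std_gauss" ..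
  have "(\<integral>\<omega>. cis (a * fst \<omega> + (b * fst (snd \<omega>) + c * snd (snd \<omega>))) \<partial>W3)
    = (\<integral>x. (\<integral>y. cis (a * x + (b * fst y + c * snd y)) \<partial>(std_gauss \<Otimes>\<^sub>M std_gauss)) \<partial>std_gauss)"
    by (subst Q.integral_fst'[symmetric]) (auto intro!: Q.integrable_cis)
  also have "\<dots> = (\<integral>x. cis (a * x) \<partial>std_gauss) * (\<integral>y. cis (b * fst y + c * snd y) \<partial>(std_gauss \<Otimes>\<^sub>M std_gauss))"
    by (simp flip: cis_mult)
  finally show ?thesis
    unfolding std_gauss_cis sum_cis_pair of_real_mult[symmetric] exp_add[symmetric] by (simp add: field_simps)
qed

context hightemp
begin

text \<open>For t between 0 and q, \<open>pX t\<close> and \<open>pY t\<close> are jointly Gaussian,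
  each of variance q, with covariance t. They are the two arguments in the definition of
  \<open>psi\<close>.\<close>

definition pX :: "real \<Rightarrow> real \<times> real \<times> real \<Rightarrow> real" where
  "pX t \<omega> = sqrt t * fst \<omega> + sqrt (q - t) * fst (snd \<omega>)"

definition pY :: "real \<Rightarrow> real \<times> real \<times> real \<Rightarrow> real" where
  "pY t \<omega> = sqrt t * fst \<omega> + sqrt (q - t) * snd (snd \<omega>)"

lemma pXY_measurable [measurable]: "pX t \<in> borel_measurable W3" "pY t \<in> borel_measurable W3"
  unfolding pX_def pY_def by measurable

lemma pXY_cis:
  assumes "0 \<le> t" "t \<le> q"
  shows "(\<integral>\<omega>. cis (s * pX t \<omega> + u * pY t \<omega>) \<partial>W3) = complex_of_real (exp (- (q * s\<^sup>2 + 2 * t * s * u + q * u\<^sup>2) / 2))"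
proof -
  have "(\<integral>\<omega>. cis (s * pX t \<omega> + u * pY t \<omega>) \<partial>W3)
     = (\<integral>\<omega>. cis (((s + u) * sqrt t) * fst \<omega> + ((s * sqrt (q - t)) * fst (snd \<omega>) + (u * sqrt (q - t)) * snd (snd \<omega>))) \<partial>W3)"
    by (simp add: pX_def pY_def algebra_simps)
  also have "\<dots> = complex_of_real (exp (- (q * s\<^sup>2 + 2 * t * s * u + q * u\<^sup>2) / 2))"
    unfolding W3_cis using assms by (simp add: power_mult_distrib power2_eq_square algebra_simps)
  finally show ?thesis .
qed

lemma bivariate_law:
  assumes "prob_space M" and [measurable]: "X \<in> borel_measurable M" "Y \<in> borel_measurable M"
    and t: "0 \<le> t" "t \<le> q"
    and c: "\<And>s u. (\<integral>\<omega>. cis (s * X \<omega> + u * Y \<omega>) \<partial>M) = complex_of_real (exp (- (q * s\<^sup>2 + 2 * t * s * u + q * u\<^sup>2) / 2))"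
    and F [measurable]: "F \<in> borel_measurable (borel \<Otimes>\<^sub>M borel)"
  shows "(\<integral>\<omega>. F (X \<omega>, Y \<omega>) \<partial>M) = (\<integral>\<omega>. (F (pX t \<omega>, pY t \<omega>) :: real) \<partial>W3)"
proof -
  let ?I = "{0, 1 :: nat}"
  let ?B = "PiM ?I (\<lambda>_. borel :: real measure)"
  let ?v = "\<lambda>X Y \<omega>. \<lambda>i\<in>?I. if i = 0 then X \<omega> else (Y \<omega> :: real)"
  have XY: "?v X Y \<in> measurable M ?B" by (intro measurable_restrict) auto
  have pXY: "?v (pX t) (pY t) \<in> measurable W3 ?B" by (intro measurable_restrict) auto
  have "distr M ?B (?v X Y) = distr W3 ?B (?v (pX t) (pY t))"
    by (rule charfun_unique[OF _ assms(1) prob_space_W3 XY pXY]) (simp_all add: c pXY_cis[OF t])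
  moreover have G [measurable]: "(\<lambda>x. F (x 0, x 1)) \<in> borel_measurable ?B"
    by (rule measurable_compose[OF _ F]) (intro measurable_Pair measurable_component_singleton, auto)
  ultimately have "(\<integral>x. F (x 0, x 1) \<partial>distr M ?B (?v X Y)) = (\<integral>x. F (x 0, x 1) \<partial>distr W3 ?B (?v (pX t) (pY t)))"
    by simp
  then show ?thesis
    unfolding integral_distr[OF XY G] integral_distr[OF pXY G] by simp
qed

lemma univariate_law:
  assumes "prob_space M" and [measurable]: "X \<in> borel_measurable M"
    and c: "\<And>s. (\<integral>\<omega>. cis (s * X \<omega>) \<partial>M) = complex_of_real (exp (- (q * s\<^sup>2) / 2))"
    and F [measurable]: "F \<in> borel_measurable borel"
  shows "(\<integral>\<omega>. F (X \<omega>) \<partial>M) = (\<integral>z. (F (sqrt q * z) :: real) \<partial>std_gauss)"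
proof -
  have "distr M borel X = distr std_gauss borel (\<lambda>z. sqrt q * z)"
    by (rule gaussian_law_real[OF assms(1,2)]) (use q_pos c in \<open>simp add: power_mult_distrib\<close>)
  then have "(\<integral>x. F x \<partial>distr M borel X) = (\<integral>x. F x \<partial>distr std_gauss borel (\<lambda>z. sqrt q * z))" by simp
  then show ?thesis by (subst (asm) (1 2) integral_distr) auto
qed

lemma Th_meas [measurable]: "Th \<beta> h \<in> borel_measurable borel"
  unfolding Th_def by measurable

lemma Th_bound [simp]: "\<bar>Th \<beta> h x\<bar> \<le> 1"
  by (simp add: Th_def)

lemma psi_eq: "psi \<beta> h t = (\<integral>\<omega>. Th \<beta> h (pX t \<omega>) * Th \<beta> h (pY t \<omega>) \<partial>W3)"
  unfolding psi_def pX_def pY_def by (simp add: case_prod_unfold)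

lemma Th_prod_integrable:
  assumes "prob_space M" and [measurable]: "X \<in> borel_measurable M" "Y \<in> borel_measurable M"
  shows "integrable M (\<lambda>\<omega>. Th \<beta> h (X \<omega>) * Th \<beta> h (Y \<omega>))"
proof -
  interpret prob_space M by fact
  have "\<bar>Th \<beta> h x\<bar> * \<bar>Th \<beta> h y\<bar> \<le> 1 * 1" for x y by (intro mult_mono) auto
  then show ?thesis by (intro integrable_const_bound[where B=1]) (auto simp: abs_mult)
qed

lemma Th_sq_q:
  assumes "0 \<le> t" "t \<le> q"
  shows "(\<integral>\<omega>. Th \<beta> h (pX t \<omega>) * Th \<beta> h (pX t \<omega>) \<partial>W3) = q" "(\<integral>\<omega>. Th \<beta> h (pY t \<omega>) * Th \<beta> h (pY t \<omega>) \<partial>W3) = q"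
proof -
  have e: "(\<integral>z. Th \<beta> h (sqrt q * z) * Th \<beta> h (sqrt q * z) \<partial>std_gauss) = q"
    by (subst (3) q_fix) (simp add: Ef_def Th_def power2_eq_square mult.assoc)
  have "(\<integral>\<omega>. cis (s * pX t \<omega>) \<partial>W3) = complex_of_real (exp (- (q * s\<^sup>2) / 2))" for s
    using pXY_cis[OF assms, of s 0] by simp
  then show "(\<integral>\<omega>. Th \<beta> h (pX t \<omega>) * Th \<beta> h (pX t \<omega>) \<partial>W3) = q"
    using univariate_law[OF prob_space_W3 pXY_measurable(1), of t "\<lambda>x. Th \<beta> h x * Th \<beta> h x"] e by simp
  have "(\<integral>\<omega>. cis (s * pY t \<omega>) \<partial>W3) = complex_of_real (exp (- (q * s\<^sup>2) / 2))" for s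
    using pXY_cis[OF assms, of 0 s] by simp
  then show "(\<integral>\<omega>. Th \<beta> h (pY t \<omega>) * Th \<beta> h (pY t \<omega>) \<partial>W3) = q"
    using univariate_law[OF prob_space_W3 pXY_measurable(2), of t "\<lambda>x. Th \<beta> h x * Th \<beta> h x"] e by simp
qed

lemma W3_diff_sq:
  shows "integrable W3 (\<lambda>\<omega>. (fst (snd \<omega>) - snd (snd \<omega>))\<^sup>2)" "(\<integral>\<omega>. (fst (snd \<omega>) - snd (snd \<omega>))\<^sup>2 \<partial>W3) = 2"
proof -
  have "distr W3 borel (\<lambda>\<omega>. fst (snd \<omega>) - snd (snd \<omega>)) = distr std_gauss borel (\<lambda>z. sqrt 2 * z)"
  proof (rule gaussian_law_real[OF prob_space_W3])
    show "(\<integral>\<omega>. cis (t * (fst (snd \<omega>) - snd (snd \<omega>))) \<partial>W3) = complex_of_real (exp (- (sqrt 2 * t)\<^sup>2 / 2))" for t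
      using W3_cis[of 0 t "- t"] by (simp add: power_mult_distrib algebra_simps)
  qed measurable
  note d = this
  have "integrable (distr W3 borel (\<lambda>\<omega>. fst (snd \<omega>) - snd (snd \<omega>))) (\<lambda>x::real. x\<^sup>2)"
    unfolding d by (subst integrable_distr_eq) (auto simp: power_mult_distrib std_gauss_integrable_power)
  then show "integrable W3 (\<lambda>\<omega>. (fst (snd \<omega>) - snd (snd \<omega>))\<^sup>2)"
    by (subst (asm) integrable_distr_eq) auto
  have "(\<integral>x. x\<^sup>2 \<partial>distr W3 borel (\<lambda>\<omega>. fst (snd \<omega>) - snd (snd \<omega>))) = (2 :: real)"
    unfolding d by (subst integral_distr) (auto simp: power_mult_distrib std_gauss_moment2)
  then show "(\<integral>\<omega>. (fst (snd \<omega>) - snd (snd \<omega>))\<^sup>2 \<partial>W3) = 2"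
    by (subst (asm) integral_distr) auto
qed

text \<open>The gap is half the second moment of Th(X) - Th(Y), since both squares have mean q. As X
  - Y is sqrt(q - t) times Z' - Z'', the Lipschitz constant \<beta> gives the upper bound, and
  injectivity of Th gives strict positivity.\<close>

lemma psi_gap:
  assumes t: "0 \<le> t" "t < q"
  shows "0 < q - psi \<beta> h t" "q - psi \<beta> h t \<le> \<beta>\<^sup>2 * (q - t)"
proof -
  interpret W: prob_space W3 by (rule prob_space_W3)
  let ?X = "\<lambda>\<omega>. Th \<beta> h (pX t \<omega>)" and ?Y = "\<lambda>\<omega>. Th \<beta> h (pY t \<omega>)"
  have t': "t \<le> q" using t by simp
  note i = Th_prod_integrable[OF prob_space_W3 pXY_measurable(1) pXY_measurable(1), of t t]
    Th_prod_integrable[OF prob_space_W3 pXY_measurable(1) pXY_measurable(2), of t t]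
    Th_prod_integrable[OF prob_space_W3 pXY_measurable(2) pXY_measurable(2), of t t]
  have eq: "(?X \<omega> - ?Y \<omega>)\<^sup>2 = ?X \<omega> * ?X \<omega> - 2 * (?X \<omega> * ?Y \<omega>) + ?Y \<omega> * ?Y \<omega>" for \<omega>
    by (simp add: power2_eq_square algebra_simps)
  have iD: "integrable W3 (\<lambda>\<omega>. (?X \<omega> - ?Y \<omega>)\<^sup>2)" unfolding eq using i by auto
  have D: "(\<integral>\<omega>. (?X \<omega> - ?Y \<omega>)\<^sup>2 \<partial>W3) = 2 * (q - psi \<beta> h t)"
    unfolding eq psi_eq using i by (simp add: Th_sq_q[OF t(1) t'])
  have diff: "pX t \<omega> - pY t \<omega> = sqrt (q - t) * (fst (snd \<omega>) - snd (snd \<omega>))" for \<omega>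
    by (simp add: pX_def pY_def right_diff_distrib)
  have "(\<integral>\<omega>. (?X \<omega> - ?Y \<omega>)\<^sup>2 \<partial>W3) \<le> (\<integral>\<omega>. \<beta>\<^sup>2 * (q - t) * (fst (snd \<omega>) - snd (snd \<omega>))\<^sup>2 \<partial>W3)"
  proof (rule integral_mono[OF iD])
    show "integrable W3 (\<lambda>\<omega>. \<beta>\<^sup>2 * (q - t) * (fst (snd \<omega>) - snd (snd \<omega>))\<^sup>2)" using W3_diff_sq(1) by auto
    fix \<omega>
    have "\<bar>?X \<omega> - ?Y \<omega>\<bar> \<le> \<bar>\<beta> * (pX t \<omega> - pY t \<omega>)\<bar>"
      using tanh_lipschitz[of "h + \<beta> * pX t \<omega>" "h + \<beta> * pY t \<omega>"] by (simp add: Th_def right_diff_distrib)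
    then have "(?X \<omega> - ?Y \<omega>)\<^sup>2 \<le> (\<beta> * (pX t \<omega> - pY t \<omega>))\<^sup>2" by (rule abs_le_square_iff[THEN iffD1])
    then show "(?X \<omega> - ?Y \<omega>)\<^sup>2 \<le> \<beta>\<^sup>2 * (q - t) * (fst (snd \<omega>) - snd (snd \<omega>))\<^sup>2"
      unfolding diff using t by (simp add: power_mult_distrib mult.assoc)
  qed
  then show "q - psi \<beta> h t \<le> \<beta>\<^sup>2 * (q - t)"
    unfolding D by (simp add: W3_diff_sq(2))
  have "(\<integral>\<omega>. (?X \<omega> - ?Y \<omega>)\<^sup>2 \<partial>W3) \<noteq> 0"
  proof
    assume "(\<integral>\<omega>. (?X \<omega> - ?Y \<omega>)\<^sup>2 \<partial>W3) = 0"
    then have "AE \<omega> in W3. (?X \<omega> - ?Y \<omega>)\<^sup>2 = 0"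
      by (subst (asm) integral_nonneg_eq_0_iff_AE[OF iD]) auto
    then have "AE \<omega> in W3. (fst (snd \<omega>) - snd (snd \<omega>))\<^sup>2 = 0"
    proof eventually_elim
      case (elim \<omega>)
      then have "pX t \<omega> = pY t \<omega>" using beta_pos by (simp add: Th_def)
      then show ?case using diff[of \<omega>] t by simp
    qed
    then have "(\<integral>\<omega>. (fst (snd \<omega>) - snd (snd \<omega>))\<^sup>2 \<partial>W3) = 0"
      by (subst integral_nonneg_eq_0_iff_AE[OF W3_diff_sq(1)]) auto
    then show False by (simp add: W3_diff_sq(2))
  qed
  moreover have "(\<integral>\<omega>. (?X \<omega> - ?Y \<omega>)\<^sup>2 \<partial>W3) \<ge> 0" by (rule Bochner_Integration.integral_nonneg) simp
  ultimately show "0 < q - psi \<beta> h t" unfolding D by simp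
qed

text \<open>Averaging over z and -z leaves tanh(h + x) + tanh(h - x), which is nonnegative because h
  > 0.\<close>

lemma gamma1_nonneg: "gamma1 \<beta> h \<ge> 0"
proof -
  let ?T = "\<lambda>z. tanh (h + \<beta> * sqrt q * z)"
  have i: "integrable std_gauss (\<lambda>z. tanh (h + c * z))" for c
    by (rule sg.integrable_const_bound[where B=1]) auto
  have sym: "distr std_gauss borel (\<lambda>z. (-1) * z) = distr std_gauss borel (\<lambda>z. 1 * z)"
    by (rule gaussian_law_real[OF prob_space_std_gauss]) (use std_gauss_cis[of "- t" for t] in auto)
  have "(\<integral>z. ?T ((-1) * z) \<partial>std_gauss) = (\<integral>z. ?T z \<partial>distr std_gauss borel (\<lambda>z. (-1) * z))"
    by (rule integral_distr[symmetric]) auto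
  also have "\<dots> = (\<integral>z. ?T (1 * z) \<partial>std_gauss)"
    unfolding sym by (rule integral_distr) auto
  finally have e: "(\<integral>z. ?T ((-1) * z) \<partial>std_gauss) = (\<integral>z. ?T z \<partial>std_gauss)" by simp
  have "0 \<le> (\<integral>z. ?T z + ?T ((-1) * z) \<partial>std_gauss)"
  proof (rule Bochner_Integration.integral_nonneg)
    fix z
    have "tanh (- (h - \<beta> * sqrt q * z)) \<le> ?T z" using h_pos by (subst tanh_real_le_iff) simp
    then show "0 \<le> ?T z + ?T ((-1) * z)" unfolding tanh_minus by simp
  qed
  also have "\<dots> = 2 * (\<integral>z. ?T z \<partial>std_gauss)"
    using i[of "\<beta> * sqrt q"] i[of "- (\<beta> * sqrt q)"] e by (subst Bochner_Integration.integral_add) auto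
  finally show ?thesis by (simp add: gamma1_def)
qed

lemma psi_0: "psi \<beta> h 0 = (gamma1 \<beta> h)\<^sup>2"
proof -
  interpret P: pair_prob_space std_gauss std_gauss ..
  interpret Q: pair_prob_space std_gauss "std_gauss \<Otimes>\<^sub>M std_gauss" ..
  let ?T = "\<lambda>z. Th \<beta> h (sqrt q * z)"
  have i: "integrable (std_gauss \<Otimes>\<^sub>M std_gauss) (\<lambda>y. ?T (fst y) * ?T (snd y))"
    by (rule Th_prod_integrable[OF P.prob_space_axioms]) auto
  have iW: "integrable W3 (\<lambda>\<omega>. ?T (fst (snd \<omega>)) * ?T (snd (snd \<omega>)))"
    by (rule Th_prod_integrable[OF prob_space_W3]) auto
  have "psi \<beta> h 0 = (\<integral>\<omega>. ?T (fst (snd \<omega>)) * ?T (snd (snd \<omega>)) \<partial>W3)"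
    by (simp add: psi_eq pX_def pY_def)
  also have "\<dots> = (\<integral>y. ?T (fst y) * ?T (snd y) \<partial>(std_gauss \<Otimes>\<^sub>M std_gauss))"
    using Q.integral_fst'[OF iW] by simp
  also have "\<dots> = (\<integral>x. ?T x \<partial>std_gauss) * (\<integral>y. ?T y \<partial>std_gauss)"
    using P.integral_fst'[OF i] by simp
  finally show ?thesis by (simp add: gamma1_def Th_def power2_eq_square mult.assoc)
qed

lemma gamma1_less: "gamma1 \<beta> h < sqrt q"
proof -
  have "(gamma1 \<beta> h)\<^sup>2 < q" using psi_gap(1)[of 0] q_pos by (simp add: psi_0)
  then show ?thesis by (rule real_less_rsqrt)
qed

abbreviation \<rho> where "\<rho> \<equiv> rho \<beta> h"
abbreviation \<gamma> where "\<gamma> \<equiv> gam \<beta> h"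
abbreviation G2 where "G2 \<equiv> Gam2 \<beta> h"

text \<open>Induction with both parts of \<open>psi_gap\<close> at t = \<rho>_k: the gap q -
  \<rho>_k stays positive and shrinks at least by the factor \<beta>^2 at each step.\<close>

lemma rho_bounds: "0 \<le> \<rho> (Suc k)" "\<rho> (Suc k) < q" "\<rho> (Suc k) \<le> \<rho> (Suc (Suc k))"
  "q - \<rho> (Suc (Suc k)) \<le> \<beta>\<^sup>2 * (q - \<rho> (Suc k))"
proof -
  have b: "0 \<le> \<rho> (Suc k) \<and> \<rho> (Suc k) < q" for k
  proof (induction k)
    case 0
    have "sqrt q * gamma1 \<beta> h < sqrt q * sqrt q" using gamma1_less q_pos by (intro mult_strict_left_mono) auto
    then show ?case using gamma1_nonneg q_pos by simp
  next
    case (Suc k)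
    have "q - \<rho> (Suc (Suc k)) \<le> \<beta>\<^sup>2 * (q - \<rho> (Suc k))" using psi_gap(2)[of "\<rho> (Suc k)"] Suc by simp
    also have "\<dots> \<le> 1 * (q - \<rho> (Suc k))" using beta_sq Suc by (intro mult_right_mono) auto
    finally show ?case using psi_gap(1)[of "\<rho> (Suc k)"] Suc by simp
  qed
  show "0 \<le> \<rho> (Suc k)" "\<rho> (Suc k) < q" using b by auto
  show g: "q - \<rho> (Suc (Suc k)) \<le> \<beta>\<^sup>2 * (q - \<rho> (Suc k))" using psi_gap(2)[of "\<rho> (Suc k)"] b[of k] by simp
  have "\<beta>\<^sup>2 * (q - \<rho> (Suc k)) \<le> 1 * (q - \<rho> (Suc k))" using beta_sq b[of k] by (intro mult_right_mono) auto
  then show "\<rho> (Suc k) \<le> \<rho> (Suc (Suc k))" using g by simp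
qed

lemma G2_0 [simp]: "G2 0 = 0" by (simp add: Gam2_def)

lemma G2_Suc: "G2 (Suc k) = G2 k + (\<gamma> (Suc k))\<^sup>2" by (simp add: Gam2_def)

lemma gam_Suc_Suc: "\<gamma> (Suc (Suc k)) = (\<rho> (Suc (Suc k)) - G2 (Suc k)) / sqrt (q - G2 (Suc k))"
  by (simp add: Gam2_def)

declare gam.simps(3) [simp del] rho.simps(3) [simp del]

text \<open>In the induction step \<gamma>^2 is \<rho> - \<Gamma>^2 times a ratio that is at most 1
  because \<rho> < q; thus adding \<gamma>^2 to \<Gamma>^2 does not pass \<rho>.\<close>

lemma G2_bounds: "0 \<le> G2 k" "G2 k < q" "G2 k \<le> \<rho> (Suc k)" "G2 (Suc k) \<le> \<rho> (Suc k)"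
proof -
  show p: "0 \<le> G2 k" for k by (simp add: Gam2_def sum_nonneg)
  have S: "G2 (Suc k) \<le> \<rho> (Suc k)" for k
  proof (induction k)
    case 0
    have "gamma1 \<beta> h * gamma1 \<beta> h \<le> sqrt q * gamma1 \<beta> h"
      using gamma1_less gamma1_nonneg by (intro mult_right_mono) auto
    then show ?case by (simp add: G2_Suc power2_eq_square)
  next
    case (Suc k)
    let ?G = "G2 (Suc k)" and ?r = "\<rho> (Suc (Suc k))"
    have G: "?G \<le> ?r" "?r < q" using Suc rho_bounds(3)[of k] rho_bounds(2)[of "Suc k"] by linarith+
    have "(\<gamma> (Suc (Suc k)))\<^sup>2 = (?r - ?G) * ((?r - ?G) / (q - ?G))"
      unfolding gam_Suc_Suc using G by (simp add: power_divide power2_eq_square)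
    also have "\<dots> \<le> (?r - ?G) * 1" using G by (intro mult_left_mono) (auto simp: divide_le_eq_1)
    finally show ?case by (simp add: G2_Suc[of "Suc k"])
  qed
  then show "G2 (Suc k) \<le> \<rho> (Suc k)" by simp
  show "G2 k \<le> \<rho> (Suc k)"
  proof (cases k)
    case 0
    then show ?thesis using rho_bounds(1)[of 0] by simp
  next
    case (Suc l)
    then show ?thesis using S[of l] rho_bounds(3)[of l] by simp
  qed
  then show "G2 k < q" using rho_bounds(2)[of k] by simp
qed

text \<open>At k = 0 this is the definition of \<rho>_1, so the recursive formula for \<gamma>
  covers the first index too.\<close>

lemma gam_mult: "\<gamma> (Suc k) * sqrt (q - G2 k) = \<rho> (Suc k) - G2 k"
proof (cases k)
  case 0
  then show ?thesis by simp
next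
  case (Suc l)
  then show ?thesis using G2_bounds(2)[of k] by (simp add: gam_Suc_Suc)
qed

lemma gam_div: "\<gamma> (Suc k) = (\<rho> (Suc k) - G2 k) / sqrt (q - G2 k)"
  using gam_mult[of k] G2_bounds(2)[of k] by (simp add: field_simps)

lemma rho_tendsto: "(\<lambda>k. \<rho> (Suc k)) \<longlonglongrightarrow> q"
proof -
  have b: "q - \<rho> (Suc k) \<le> (1/2) ^ k * q" for k
  proof (induction k)
    case 0
    then show ?case using rho_bounds(1)[of 0] by simp
  next
    case (Suc k)
    have "q - \<rho> (Suc (Suc k)) \<le> \<beta>\<^sup>2 * (q - \<rho> (Suc k))" by (rule rho_bounds(4))
    also have "\<dots> \<le> 1/2 * (q - \<rho> (Suc k))" using beta_sq rho_bounds(2)[of k] by (intro mult_right_mono) auto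
    also have "\<dots> \<le> 1/2 * ((1/2) ^ k * q)" using Suc by (intro mult_left_mono) auto
    finally show ?case by simp
  qed
  have "(\<lambda>k. (1/2) ^ k * q) \<longlonglongrightarrow> 0 * q" by (intro tendsto_intros LIMSEQ_power_zero) auto
  then have "(\<lambda>k. q - \<rho> (Suc k)) \<longlonglongrightarrow> 0"
    using b rho_bounds(2)
    by (intro tendsto_sandwich[of "\<lambda>_. 0" "\<lambda>k. q - \<rho> (Suc k)" sequentially "\<lambda>k. (1/2) ^ k * q" 0])
       (auto intro!: always_eventually less_imp_le)
  then have "(\<lambda>k. q - (q - \<rho> (Suc k))) \<longlonglongrightarrow> q - 0" by (intro tendsto_intros)
  then show ?thesis by simp
qed

text \<open>\<Gamma>_k^2 increases below q, hence converges, and its increments \<gamma>_k^2 tend to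
  0. Then \<open>gam_mult\<close> forces \<rho> - \<Gamma>^2 to 0, and \<rho> tends to q.\<close>

lemma G2_tendsto: "G2 \<longlonglongrightarrow> q"
proof -
  have inc: "incseq G2" by (rule incseq_SucI) (simp add: G2_Suc)
  have "convergent G2"
    by (rule incseq_convergent[OF inc, of q]) (use G2_bounds(2) in \<open>auto intro: less_imp_le convergentI\<close>)
  then obtain L where L: "G2 \<longlonglongrightarrow> L" by (auto simp: convergent_def)
  have "(\<lambda>k. G2 (Suc k) - G2 k) \<longlonglongrightarrow> L - L" by (intro tendsto_intros LIMSEQ_Suc L)
  then have g: "(\<lambda>k. (\<gamma> (Suc k))\<^sup>2) \<longlonglongrightarrow> 0" by (simp add: G2_Suc)
  have "(\<lambda>k. (\<gamma> (Suc k))\<^sup>2 * (q - G2 k)) \<longlonglongrightarrow> 0 * (q - L)" by (intro tendsto_intros g L)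
  moreover have "(\<gamma> (Suc k))\<^sup>2 * (q - G2 k) = (\<rho> (Suc k) - G2 k)\<^sup>2" for k
    unfolding gam_mult[symmetric] using G2_bounds(2)[of k] by (simp add: power_mult_distrib)
  ultimately have "(\<lambda>k. (\<rho> (Suc k) - G2 k)\<^sup>2) \<longlonglongrightarrow> 0" by simp
  moreover have "(\<lambda>k. (\<rho> (Suc k) - G2 k)\<^sup>2) \<longlonglongrightarrow> (q - L)\<^sup>2" by (intro tendsto_intros rho_tendsto L)
  ultimately have "(q - L)\<^sup>2 = 0" using LIMSEQ_unique by blast
  then show ?thesis using L by simp
qed

end

section \<open>Convergence in probability\<close>

text \<open>An exceptional set is used because \<open>P N\<close> need not be measurable.\<close>

definition whp :: "(nat \<Rightarrow> 'a measure) \<Rightarrow> (nat \<Rightarrow> 'a \<Rightarrow> bool) \<Rightarrow> bool" where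
  "whp M P \<longleftrightarrow> (\<forall>e>0. \<forall>\<^sub>F N in sequentially. \<exists>B\<in>sets (M N). emeasure (M N) B \<le> ennreal e \<and> (\<forall>\<omega>\<in>space (M N) - B. P N \<omega>))"

definition cip :: "(nat \<Rightarrow> 'a measure) \<Rightarrow> (nat \<Rightarrow> 'a \<Rightarrow> real) \<Rightarrow> real \<Rightarrow> bool" where
  "cip M Y c \<longleftrightarrow> (\<forall>e>0. whp M (\<lambda>N \<omega>. \<bar>Y N \<omega> - c\<bar> \<le> e))"

lemma whp_mono:
  assumes "whp M P" "\<forall>\<^sub>F N in sequentially. \<forall>\<omega>\<in>space (M N). P N \<omega> \<longrightarrow> Q N \<omega>"
  shows "whp M Q"
  unfolding whp_def
proof (intro allI impI)
  fix e :: real assume "e > 0"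
  then have "\<forall>\<^sub>F N in sequentially. \<exists>B\<in>sets (M N). emeasure (M N) B \<le> ennreal e \<and> (\<forall>\<omega>\<in>space (M N) - B. P N \<omega>)"
    using assms(1) by (auto simp: whp_def)
  with assms(2) show "\<forall>\<^sub>F N in sequentially. \<exists>B\<in>sets (M N). emeasure (M N) B \<le> ennreal e \<and> (\<forall>\<omega>\<in>space (M N) - B. Q N \<omega>)"
    by eventually_elim blast
qed

lemma whp_mono': "whp M P \<Longrightarrow> (\<And>N \<omega>. P N \<omega> \<Longrightarrow> Q N \<omega>) \<Longrightarrow> whp M Q"
  by (rule whp_mono) auto

lemma whp_conj:
  assumes "whp M P" "whp M Q" shows "whp M (\<lambda>N \<omega>. P N \<omega> \<and> Q N \<omega>)"
  unfolding whp_def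
proof (intro allI impI)
  fix e :: real assume e: "e > 0"
  have "\<forall>\<^sub>F N in sequentially. \<exists>B\<in>sets (M N). emeasure (M N) B \<le> ennreal (e/2) \<and> (\<forall>\<omega>\<in>space (M N) - B. P N \<omega>)"
    "\<forall>\<^sub>F N in sequentially. \<exists>B\<in>sets (M N). emeasure (M N) B \<le> ennreal (e/2) \<and> (\<forall>\<omega>\<in>space (M N) - B. Q N \<omega>)"
    using assms e by (auto simp: whp_def)
  then show "\<forall>\<^sub>F N in sequentially. \<exists>B\<in>sets (M N). emeasure (M N) B \<le> ennreal e \<and> (\<forall>\<omega>\<in>space (M N) - B. P N \<omega> \<and> Q N \<omega>)"
  proof eventually_elim
    case (elim N)
    then obtain B C where B: "B \<in> sets (M N)" "emeasure (M N) B \<le> ennreal (e/2)" "\<forall>\<omega>\<in>space (M N) - B. P N \<omega>"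
      and C: "C \<in> sets (M N)" "emeasure (M N) C \<le> ennreal (e/2)" "\<forall>\<omega>\<in>space (M N) - C. Q N \<omega>" by blast
    have "emeasure (M N) (B \<union> C) \<le> emeasure (M N) B + emeasure (M N) C"
      by (rule emeasure_subadditive[OF B(1) C(1)])
    also have "\<dots> \<le> ennreal (e/2) + ennreal (e/2)" by (rule add_mono[OF B(2) C(2)])
    also have "\<dots> = ennreal e" using e by (simp flip: ennreal_plus)
    finally show ?case using B C by (intro bexI[of _ "B \<union> C"]) auto
  qed
qed

lemma whp_true: "(\<And>N \<omega>. P N \<omega>) \<Longrightarrow> whp M P"
  unfolding whp_def by (auto intro!: always_eventually bexI[of _ "{}"])

lemma whp_ball: "finite S \<Longrightarrow> (\<And>s. s \<in> S \<Longrightarrow> whp M (P s)) \<Longrightarrow> whp M (\<lambda>N \<omega>. \<forall>s\<in>S. P s N \<omega>)"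
proof (induction S rule: finite_induct)
  case (insert s S)
  then have "whp M (\<lambda>N \<omega>. P s N \<omega> \<and> (\<forall>s\<in>S. P s N \<omega>))" by (intro whp_conj) auto
  then show ?case by (rule whp_mono') auto
qed (simp add: whp_true)

lemma cip_cont2:
  assumes "cip M X a" "cip M Y b" and f: "isCont (\<lambda>p. f (fst p) (snd p)) (a, b)"
  shows "cip M (\<lambda>N \<omega>. f (X N \<omega>) (Y N \<omega>)) (f a b)"
  unfolding cip_def
proof (intro allI impI)
  fix e :: real assume e: "e > 0"
  obtain d where d: "d > 0" "\<And>p. dist p (a, b) < d \<Longrightarrow> dist (f (fst p) (snd p)) (f a b) < e"
    using f e unfolding continuous_at_eps_delta by force
  have d3: "d / 3 > 0" using d(1) by simp
  then have "whp M (\<lambda>N \<omega>. \<bar>X N \<omega> - a\<bar> \<le> d/3 \<and> \<bar>Y N \<omega> - b\<bar> \<le> d/3)"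
    using assms(1,2) unfolding cip_def by (intro whp_conj) blast+
  then show "whp M (\<lambda>N \<omega>. \<bar>f (X N \<omega>) (Y N \<omega>) - f a b\<bar> \<le> e)"
  proof (rule whp_mono')
    fix N \<omega> assume h: "\<bar>X N \<omega> - a\<bar> \<le> d/3 \<and> \<bar>Y N \<omega> - b\<bar> \<le> d/3"
    have "dist (X N \<omega>, Y N \<omega>) (a, b) \<le> \<bar>X N \<omega> - a\<bar> + \<bar>Y N \<omega> - b\<bar>"
      by (simp add: dist_prod_def dist_real_def sqrt_sum_squares_le_sum_abs)
    also have "\<dots> < d" using h d(1) by linarith
    finally have "dist (f (X N \<omega>) (Y N \<omega>)) (f a b) < e" using d(2)[of "(X N \<omega>, Y N \<omega>)"] by simp
    then show "\<bar>f (X N \<omega>) (Y N \<omega>) - f a b\<bar> \<le> e" by (simp add: dist_real_def)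
  qed
qed

lemma cip_const: "cip M (\<lambda>_ _. c) c"
  by (simp add: cip_def whp_true)

lemma cip_cont: "cip M X a \<Longrightarrow> isCont f a \<Longrightarrow> cip M (\<lambda>N \<omega>. f (X N \<omega>)) (f a)"
proof -
  assume X: "cip M X a" and f: "isCont f a"
  have "isCont (\<lambda>p. f (fst p)) (a, a)"
    by (rule isCont_o2[where g=f]) (auto intro: f continuous_intros)
  then show ?thesis using cip_cont2[OF X X, of "\<lambda>x y. f x"] by simp
qed

lemma cip_add: "cip M X a \<Longrightarrow> cip M Y b \<Longrightarrow> cip M (\<lambda>N \<omega>. X N \<omega> + Y N \<omega>) (a + b)"
  by (rule cip_cont2) (auto intro!: continuous_intros)

lemma cip_diff: "cip M X a \<Longrightarrow> cip M Y b \<Longrightarrow> cip M (\<lambda>N \<omega>. X N \<omega> - Y N \<omega>) (a - b)"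
  by (rule cip_cont2[where f="\<lambda>x y. x - y"]) (auto intro!: continuous_intros)

lemma cip_mult: "cip M X a \<Longrightarrow> cip M Y b \<Longrightarrow> cip M (\<lambda>N \<omega>. X N \<omega> * Y N \<omega>) (a * b)"
  by (rule cip_cont2[where f="\<lambda>x y. x * y"]) (auto intro!: continuous_intros)

lemma cip_divide: "cip M X a \<Longrightarrow> cip M Y b \<Longrightarrow> b \<noteq> 0 \<Longrightarrow> cip M (\<lambda>N \<omega>. X N \<omega> / Y N \<omega>) (a / b)"
  by (rule cip_cont2[where f="\<lambda>x y. x / y"]) (auto intro!: continuous_intros)

lemma cip_sqrt: "cip M X a \<Longrightarrow> cip M (\<lambda>N \<omega>. sqrt (X N \<omega>)) (sqrt a)"
  by (rule cip_cont) (auto intro!: continuous_intros)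

lemma cip_abs: "cip M X a \<Longrightarrow> cip M (\<lambda>N \<omega>. \<bar>X N \<omega>\<bar>) \<bar>a\<bar>"
  by (rule cip_cont) (auto intro!: continuous_intros)

lemma cip_power: "cip M X a \<Longrightarrow> cip M (\<lambda>N \<omega>. (X N \<omega>) ^ n) (a ^ n)"
  by (rule cip_cont) (auto intro!: continuous_intros)

lemma cip_sum: "(\<And>s. s \<in> S \<Longrightarrow> cip M (X s) (a s)) \<Longrightarrow> cip M (\<lambda>N \<omega>. \<Sum>s\<in>S. X s N \<omega>) (\<Sum>s\<in>S. a s)"
  by (induction S rule: infinite_finite_induct) (auto intro: cip_add cip_const)

lemma cip_whp_bound:
  assumes "whp M (\<lambda>N \<omega>. \<bar>X N \<omega> - a\<bar> \<le> Y N \<omega>)" "cip M Y 0"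
  shows "cip M X a"
  unfolding cip_def
proof (intro allI impI)
  fix e :: real assume "e > 0"
  then have "whp M (\<lambda>N \<omega>. \<bar>X N \<omega> - a\<bar> \<le> Y N \<omega> \<and> \<bar>Y N \<omega> - 0\<bar> \<le> e)"
    using assms by (intro whp_conj) (auto simp: cip_def)
  then show "whp M (\<lambda>N \<omega>. \<bar>X N \<omega> - a\<bar> \<le> e)" by (rule whp_mono') auto
qed

lemma cip_cong: "cip M X a \<Longrightarrow> a = b \<Longrightarrow> (\<And>N \<omega>. X N \<omega> = Y N \<omega>) \<Longrightarrow> cip M Y b"
  by (simp add: cip_def)

lemma cip_eventually_cong:
  assumes "cip M X a" "\<forall>\<^sub>F N in sequentially. \<forall>\<omega>\<in>space (M N). Y N \<omega> = X N \<omega>"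
  shows "cip M Y a"
  unfolding cip_def
proof (intro allI impI)
  fix e :: real assume "e > 0"
  then have "whp M (\<lambda>N \<omega>. \<bar>X N \<omega> - a\<bar> \<le> e)" using assms(1) by (simp add: cip_def)
  then show "whp M (\<lambda>N \<omega>. \<bar>Y N \<omega> - a\<bar> \<le> e)"
    by (rule whp_mono) (use assms(2) in eventually_elim, auto)
qed

lemma cip_pos_whp: "cip M X a \<Longrightarrow> a > 0 \<Longrightarrow> whp M (\<lambda>N \<omega>. X N \<omega> > 0)"
proof -
  assume a: "cip M X a" "a > 0"
  then have "a / 2 > 0" by simp
  then have "whp M (\<lambda>N \<omega>. \<bar>X N \<omega> - a\<bar> \<le> a / 2)" using a(1) unfolding cip_def by blast
  then show ?thesis by (rule whp_mono') (use \<open>a > 0\<close> in linarith)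
qed

text \<open>Chebyshev's inequality for a second moment of order 1/N.\<close>

lemma cip_L2:
  assumes m: "\<And>N. N \<ge> 1 \<Longrightarrow> Y N \<in> borel_measurable (M N)"
    and b: "\<And>N. N \<ge> 1 \<Longrightarrow> (\<integral>\<^sup>+\<omega>. ennreal ((Y N \<omega> - c)\<^sup>2) \<partial>M N) \<le> ennreal (C / real N)"
  shows "cip M Y c"
  unfolding cip_def whp_def
proof (intro allI impI)
  fix d e :: real assume d: "d > 0" and e: "e > 0"
  have "(\<lambda>N. C / real N / d\<^sup>2) \<longlonglongrightarrow> 0 / d\<^sup>2" by (intro tendsto_divide lim_const_over_n tendsto_const) (use d in auto)
  then have "\<forall>\<^sub>F N in sequentially. C / real N / d\<^sup>2 < e" using e by (intro order_tendstoD) auto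
  moreover have "\<forall>\<^sub>F N in sequentially. N \<ge> (1::nat)" by (rule eventually_ge_at_top)
  ultimately show "\<forall>\<^sub>F N in sequentially. \<exists>B\<in>sets (M N). emeasure (M N) B \<le> ennreal e \<and> (\<forall>\<omega>\<in>space (M N) - B. \<bar>Y N \<omega> - c\<bar> \<le> d)"
  proof eventually_elim
    case (elim N)
    let ?u = "\<lambda>\<omega>. ennreal ((Y N \<omega> - c)\<^sup>2)"
    let ?B = "{\<omega>\<in>space (M N). 1 \<le> ennreal (1 / d\<^sup>2) * ?u \<omega>}"
    have [measurable]: "Y N \<in> borel_measurable (M N)" by (rule m) fact
    have "emeasure (M N) ?B \<le> ennreal (1 / d\<^sup>2) * (\<integral>\<^sup>+\<omega>. ?u \<omega> * indicator (space (M N)) \<omega> \<partial>M N)"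
      using nn_integral_Markov_inequality[of ?u "space (M N)" "M N" "ennreal (1 / d\<^sup>2)"] by (simp add: Int_def)
    also have "(\<integral>\<^sup>+\<omega>. ?u \<omega> * indicator (space (M N)) \<omega> \<partial>M N) = (\<integral>\<^sup>+\<omega>. ?u \<omega> \<partial>M N)"
      by (intro nn_integral_cong) (simp add: indicator_def)
    also have "ennreal (1 / d\<^sup>2) * (\<integral>\<^sup>+\<omega>. ?u \<omega> \<partial>M N) \<le> ennreal (1 / d\<^sup>2) * ennreal (C / real N)"
      by (intro mult_left_mono b elim) auto
    also have "\<dots> = ennreal (1 / d\<^sup>2 * (C / real N))" by (rule ennreal_mult'[symmetric]) simp
    also have "\<dots> \<le> ennreal e" using elim(1) by (intro ennreal_leI) (simp add: field_simps)
    finally have B: "emeasure (M N) ?B \<le> ennreal e" .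
    have "\<bar>Y N \<omega> - c\<bar> \<le> d" if "\<omega> \<in> space (M N) - ?B" for \<omega>
    proof -
      have "ennreal (1 / d\<^sup>2) * ennreal ((Y N \<omega> - c)\<^sup>2) = ennreal (1 / d\<^sup>2 * (Y N \<omega> - c)\<^sup>2)"
        by (rule ennreal_mult[symmetric]) auto
      then have "\<not> 1 \<le> ennreal (1 / d\<^sup>2 * (Y N \<omega> - c)\<^sup>2)" using that by (metis (no_types, lifting) DiffE mem_Collect_eq)
      then have "1 / d\<^sup>2 * (Y N \<omega> - c)\<^sup>2 < 1" by (simp add: not_le ennreal_less_one_iff)
      then have "(Y N \<omega> - c)\<^sup>2 < d\<^sup>2" using d by (simp add: field_simps)
      then show ?thesis using d abs_le_square_iff[of "Y N \<omega> - c" d] by simp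
    qed
    then show ?case using B by (intro bexI[of _ ?B]) auto
  qed
qed

section \<open>Linear forms in independent Gaussians\<close>

lemma gprod_lin_law:
  assumes [simp]: "finite J"
  shows "distr (gprod J) borel (\<lambda>x. \<Sum>j\<in>J. c j * x j) = distr std_gauss borel (\<lambda>z. sqrt (\<Sum>j\<in>J. (c j)\<^sup>2) * z)"
proof (rule gaussian_law_real[OF prob_space_gprod])
  show "(\<lambda>x. \<Sum>j\<in>J. c j * x j) \<in> borel_measurable (gprod J)"
    by (intro borel_measurable_sum borel_measurable_times borel_measurable_const measurable_gprod_component)
  fix t
  have "(\<integral>x. cis (t * (\<Sum>j\<in>J. c j * x j)) \<partial>gprod J) = (\<integral>x. cis (\<Sum>j\<in>J. (t * c j) * x j) \<partial>gprod J)"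
    by (simp add: sum_distrib_left mult.assoc)
  also have "\<dots> = complex_of_real (exp (- (sqrt (\<Sum>j\<in>J. (c j)\<^sup>2) * t)\<^sup>2 / 2))"
    by (subst gprod_cis) (simp_all add: power_mult_distrib sum_nonneg sum_distrib_left mult.commute)
  finally show "(\<integral>x. cis (t * (\<Sum>j\<in>J. c j * x j)) \<partial>gprod J) = complex_of_real (exp (- (sqrt (\<Sum>j\<in>J. (c j)\<^sup>2) * t)\<^sup>2 / 2))" .
qed

lemma lin_meas [measurable]: "(\<lambda>x. \<Sum>j\<in>J. c j * x j) \<in> borel_measurable (gprod J)"
  by (intro borel_measurable_sum borel_measurable_times borel_measurable_const measurable_gprod_component)

lemma gprod_lin_power:
  assumes "finite J"
  shows "integrable (gprod J) (\<lambda>x. (\<Sum>j\<in>J. c j * x j) ^ n)"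
proof -
  have "integrable (distr (gprod J) borel (\<lambda>x. \<Sum>j\<in>J. c j * x j)) (\<lambda>y. y ^ n)"
    unfolding gprod_lin_law[OF assms] by (subst integrable_distr_eq) (auto simp: power_mult_distrib std_gauss_integrable_power)
  then show ?thesis by (subst (asm) integrable_distr_eq) auto
qed

lemma gprod_lin_sq:
  assumes "finite J"
  shows "(\<integral>x. (\<Sum>j\<in>J. c j * x j)\<^sup>2 \<partial>gprod J) = (\<Sum>j\<in>J. (c j)\<^sup>2)"
proof -
  have "(\<integral>x. (\<Sum>j\<in>J. c j * x j)\<^sup>2 \<partial>gprod J) = (\<integral>y. y\<^sup>2 \<partial>distr (gprod J) borel (\<lambda>x. \<Sum>j\<in>J. c j * x j))"
    by (rule integral_distr[symmetric]) auto
  also have "\<dots> = (\<integral>z. (sqrt (\<Sum>j\<in>J. (c j)\<^sup>2) * z)\<^sup>2 \<partial>std_gauss)"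
    unfolding gprod_lin_law[OF assms] by (rule integral_distr) auto
  finally show ?thesis by (simp add: power_mult_distrib std_gauss_moment2 sum_nonneg)
qed

lemma gprod_lin_nn_sq:
  assumes "finite J"
  shows "(\<integral>\<^sup>+x. ennreal ((\<Sum>j\<in>J. c j * x j)\<^sup>2) \<partial>gprod J) = ennreal (\<Sum>j\<in>J. (c j)\<^sup>2)"
  by (subst nn_integral_eq_integral[OF gprod_lin_power[OF assms]]) (auto simp: gprod_lin_sq[OF assms])

lemma sum_sub_index:
  fixes c :: "'i \<Rightarrow> real"
  assumes g: "inj_on g I" "g ` I \<subseteq> J" and [simp]: "finite J"
  defines "c' \<equiv> \<lambda>j. if j \<in> g ` I then c (the_inv_into I g j) else (0::real)"
  shows "(\<Sum>i\<in>I. c i * x (g i)) = (\<Sum>j\<in>J. c' j * x j)" "(\<Sum>i\<in>I. (c i)\<^sup>2) = (\<Sum>j\<in>J. (c' j)\<^sup>2)"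
proof -
  have "(\<Sum>j\<in>J. c' j * x j) = (\<Sum>j\<in>g ` I. c' j * x j)" "(\<Sum>j\<in>J. (c' j)\<^sup>2) = (\<Sum>j\<in>g ` I. (c' j)\<^sup>2)"
    using g by (intro sum.mono_neutral_right; auto simp: c'_def)+
  then show "(\<Sum>i\<in>I. c i * x (g i)) = (\<Sum>j\<in>J. c' j * x j)" "(\<Sum>i\<in>I. (c i)\<^sup>2) = (\<Sum>j\<in>J. (c' j)\<^sup>2)"
    by (auto simp: sum.reindex[OF g(1)] c'_def the_inv_into_f_f[OF g(1)] intro!: sum.cong)
qed

lemma gprod_sub_nn_sq:
  assumes g: "inj_on g I" "g ` I \<subseteq> J" "finite J"
  shows "(\<integral>\<^sup>+x. ennreal ((\<Sum>i\<in>I. c i * x (g i))\<^sup>2) \<partial>gprod J) = ennreal (\<Sum>i\<in>I. (c i)\<^sup>2)"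
  unfolding sum_sub_index[OF g] by (rule gprod_lin_nn_sq[OF g(3)])

lemma gprod_sub_cis:
  assumes g: "inj_on g I" "g ` I \<subseteq> J" "finite J"
  shows "(\<integral>x. cis (\<Sum>i\<in>I. c i * x (g i)) \<partial>gprod J) = complex_of_real (exp (- (\<Sum>i\<in>I. (c i)\<^sup>2) / 2))"
  unfolding sum_sub_index[OF g] by (rule gprod_cis[OF g(3)])

lemma gprod_two_cis:
  assumes [simp]: "finite J"
  shows "(\<integral>x. cis (s * (\<Sum>j\<in>J. c j * x j) + u * (\<Sum>j\<in>J. d j * x j)) \<partial>gprod J)
    = complex_of_real (exp (- ((\<Sum>j\<in>J. (c j)\<^sup>2) * s\<^sup>2 + 2 * (\<Sum>j\<in>J. c j * d j) * s * u + (\<Sum>j\<in>J. (d j)\<^sup>2) * u\<^sup>2) / 2))"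
proof -
  have "s * (\<Sum>j\<in>J. c j * x j) + u * (\<Sum>j\<in>J. d j * x j) = (\<Sum>j\<in>J. (s * c j + u * d j) * x j)" for x
    by (simp add: sum_distrib_left sum.distrib distrib_right mult.assoc)
  moreover have "(\<Sum>j\<in>J. (s * c j + u * d j)\<^sup>2) = (\<Sum>j\<in>J. (c j)\<^sup>2) * s\<^sup>2 + 2 * (\<Sum>j\<in>J. c j * d j) * s * u + (\<Sum>j\<in>J. (d j)\<^sup>2) * u\<^sup>2"
    unfolding sum_distrib_left sum_distrib_right sum.distrib[symmetric]
    by (intro sum.cong refl) (simp add: power2_eq_square algebra_simps)
  ultimately show ?thesis by (simp only: gprod_cis[OF assms])
qed

section \<open>The law of large numbers\<close>

definition col :: "nat \<Rightarrow> (nat \<Rightarrow> nat \<Rightarrow> real) \<Rightarrow> nat \<Rightarrow> (nat \<Rightarrow> real)" where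
  "col K v i = (\<lambda>s\<in>{1..K}. v s i)"

text \<open>The map \<open>g\<close> picks the coordinates of a block that are used: the first N of
  2N when blocks are steps, all K of them when blocks are sites.\<close>

lemma nested_cis:
  assumes [simp]: "finite A" "finite B" and g: "inj_on g I" "g ` I \<subseteq> B"
  shows "(\<integral>w. cis (\<Sum>a\<in>A. \<Sum>i\<in>I. t a i * w a (g i)) \<partial>PiM A (\<lambda>_. gprod B))
     = complex_of_real (exp (- (\<Sum>a\<in>A. \<Sum>i\<in>I. (t a i)\<^sup>2) / 2))"
proof -
  interpret B: prob_space "gprod B" by (rule prob_space_gprod)
  interpret product_sigma_finite "\<lambda>_ :: 'a. gprod B" by standard
  have m: "(\<lambda>x. \<Sum>i\<in>I. t a i * x (g i)) \<in> borel_measurable (gprod B)" for a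
    unfolding sum_sub_index[OF g assms(2)] by measurable
  have "(\<integral>w. cis (\<Sum>a\<in>A. \<Sum>i\<in>I. t a i * w a (g i)) \<partial>PiM A (\<lambda>_. gprod B))
     = (\<integral>w. (\<Prod>a\<in>A. cis (\<Sum>i\<in>I. t a i * w a (g i))) \<partial>PiM A (\<lambda>_. gprod B))"
    by (simp add: cis_sum)
  also have "\<dots> = (\<Prod>a\<in>A. \<integral>x. cis (\<Sum>i\<in>I. t a i * x (g i)) \<partial>gprod B)"
    by (rule product_integral_prod) (auto intro: B.integrable_cis m)
  also have "\<dots> = (\<Prod>a\<in>A. complex_of_real (exp (- (\<Sum>i\<in>I. (t a i)\<^sup>2) / 2)))"
    by (intro prod.cong refl gprod_sub_cis g) simp
  also have "\<dots> = complex_of_real (exp (\<Sum>a\<in>A. - (\<Sum>i\<in>I. (t a i)\<^sup>2) / 2))"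
    by (simp add: exp_sum)
  finally show ?thesis by (simp add: sum_divide_distrib sum_negf)
qed

text \<open>\<open>VV\<close> is a product over steps, whereas the law of large numbers needs a
  product over sites. As flat arrays both are the same standard Gaussian family.\<close>

lemma nn_integral_transpose:
  fixes N K :: nat
  assumes h: "h \<in> borel_measurable (PiM ({1..K}\<times>{1..N}) (\<lambda>_. borel :: real measure))"
  shows "(\<integral>\<^sup>+v. h (\<lambda>(s, i)\<in>{1..K}\<times>{1..N}. v s i) \<partial>VV N K)
       = (\<integral>\<^sup>+w. h (\<lambda>(s, i)\<in>{1..K}\<times>{1..N}. w i s) \<partial>PiM {1..N} (\<lambda>_. gprod {1..K}))"
proof -
  let ?I = "{1..K}\<times>{1..N}" and ?T = "PiM {1..N} (\<lambda>_. gprod {1..K})"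
  let ?F = "\<lambda>v. \<lambda>(s, i)\<in>?I. v s i" and ?G = "\<lambda>w. \<lambda>(s, i)\<in>?I. w i s"
  have T: "prob_space ?T" by (intro prob_space_PiM prob_space_gprod)
  have F: "?F \<in> measurable (VV N K) (PiM ?I (\<lambda>_. borel))"
    by (intro measurable_restrict) (auto simp: split_beta' intro!: measurable_VV_component)
  have G: "?G \<in> measurable ?T (PiM ?I (\<lambda>_. borel))"
  proof (intro measurable_restrict)
    fix p :: "nat \<times> nat" assume p: "p \<in> ?I"
    have "(\<lambda>w. w (snd p)) \<in> measurable ?T (gprod {1..K})" using p by (intro measurable_component_singleton) auto
    moreover have "(\<lambda>x. x (fst p)) \<in> borel_measurable (gprod {1..K})" using p by (intro measurable_gprod_component) auto
    ultimately show "(\<lambda>w. case p of (s, i) \<Rightarrow> w i s) \<in> borel_measurable ?T"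
      unfolding split_beta' by (rule measurable_compose)
  qed
  have flat: "(\<Sum>si\<in>?I. t si * ?F v si) = (\<Sum>s=1..K. \<Sum>i=1..N. t (s, i) * v s (id i))"
    "(\<Sum>si\<in>?I. t si * ?G w si) = (\<Sum>i=1..N. \<Sum>s=1..K. t (s, i) * w i (id s))" for t v w
  proof -
    show "(\<Sum>si\<in>?I. t si * ?F v si) = (\<Sum>s=1..K. \<Sum>i=1..N. t (s, i) * v s (id i))"
      unfolding sum.cartesian_product by (rule sum.cong) auto
    show "(\<Sum>si\<in>?I. t si * ?G w si) = (\<Sum>i=1..N. \<Sum>s=1..K. t (s, i) * w i (id s))"
      by (subst sum.swap) (unfold sum.cartesian_product, rule sum.cong, auto)
  qed
  have sq: "(\<Sum>si\<in>?I. (t si)\<^sup>2) = (\<Sum>s=1..K. \<Sum>i=1..N. (t (s, i))\<^sup>2)" for t :: "nat \<times> nat \<Rightarrow> real"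
    unfolding sum.cartesian_product by (rule sum.cong) auto
  have dF: "distr (VV N K) (PiM ?I (\<lambda>_. borel)) ?F = gprod ?I"
  proof (rule gaussian_law_gprod[OF _ prob_space_VV F])
    fix t :: "nat \<times> nat \<Rightarrow> real"
    have "(\<integral>v. cis (\<Sum>s=1..K. \<Sum>i=1..N. t (s, i) * v s (id i)) \<partial>VV N K) = complex_of_real (exp (- (\<Sum>s=1..K. \<Sum>i=1..N. (t (s, i))\<^sup>2) / 2))"
      unfolding VV_def UU_def by (rule nested_cis) auto
    then show "(\<integral>v. cis (\<Sum>si\<in>?I. t si * ?F v si) \<partial>VV N K) = complex_of_real (exp (- (\<Sum>si\<in>?I. (t si)\<^sup>2) / 2))"
      unfolding flat sq .
  qed simp
  have dG: "distr ?T (PiM ?I (\<lambda>_. borel)) ?G = gprod ?I"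
  proof (rule gaussian_law_gprod[OF _ T G])
    fix t :: "nat \<times> nat \<Rightarrow> real"
    have "(\<integral>w. cis (\<Sum>i=1..N. \<Sum>s=1..K. t (s, i) * w i (id s)) \<partial>?T) = complex_of_real (exp (- (\<Sum>i=1..N. \<Sum>s=1..K. (t (s, i))\<^sup>2) / 2))"
      by (rule nested_cis) auto
    then show "(\<integral>w. cis (\<Sum>si\<in>?I. t si * ?G w si) \<partial>?T) = complex_of_real (exp (- (\<Sum>si\<in>?I. (t si)\<^sup>2) / 2))"
      unfolding flat(2) sq by (simp only: sum.swap[of "\<lambda>i s. (t (s, i))\<^sup>2" "{1..K}" "{1..N}"])
  qed simp
  have "(\<integral>\<^sup>+v. h (?F v) \<partial>VV N K) = (\<integral>\<^sup>+x. h x \<partial>gprod ?I)"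
    unfolding dF[symmetric] by (rule nn_integral_distr[OF F, symmetric]) (simp only: measurable_distr_eq1 h)
  also have "\<dots> = (\<integral>\<^sup>+w. h (?G w) \<partial>?T)"
    unfolding dG[symmetric] by (rule nn_integral_distr[OF G]) (simp only: measurable_distr_eq1 h)
  finally show ?thesis .
qed

lemma iid_mean_variance:
  fixes f :: "'b \<Rightarrow> real"
  assumes "prob_space P" and f [measurable]: "f \<in> borel_measurable P" and f2: "integrable P (\<lambda>x. (f x)\<^sup>2)" and N: "N \<ge> (1::nat)"
  shows "(\<integral>\<^sup>+w. ennreal (((\<Sum>i=1..N. f (w i)) / real N - (\<integral>x. f x \<partial>P))\<^sup>2) \<partial>PiM {1..N} (\<lambda>_. P))
    = ennreal ((\<integral>x. (f x - (\<integral>x. f x \<partial>P))\<^sup>2 \<partial>P) / real N)"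
proof -
  interpret P: prob_space P by fact
  interpret product_sigma_finite "\<lambda>_ :: nat. P" by standard
  let ?T = "PiM {1..N} (\<lambda>_. P)"
  define Y where "Y x = f x - (\<integral>x. f x \<partial>P)" for x
  have f1: "integrable P f" using P.square_integrable_imp_integrable[OF f f2] .
  have Ym [measurable]: "Y \<in> borel_measurable P" unfolding Y_def by measurable
  have Y1: "integrable P Y" "(\<integral>x. Y x \<partial>P) = 0" unfolding Y_def using f1 by (auto simp: P.prob_space)
  have Y2: "integrable P (\<lambda>x. (Y x)\<^sup>2)"
  proof -
    have "(Y x)\<^sup>2 = (f x)\<^sup>2 - 2 * (\<integral>x. f x \<partial>P) * f x + (\<integral>x. f x \<partial>P)\<^sup>2" for x
      by (simp add: Y_def power2_eq_square algebra_simps)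
    then show ?thesis using f1 f2 by auto
  qed
  define s2 where "s2 = (\<integral>x. (Y x)\<^sup>2 \<partial>P)"
  have pr: "integrable ?T (\<lambda>w. Y (w i) * Y (w j)) \<and> (\<integral>w. Y (w i) * Y (w j) \<partial>?T) = (if i = j then s2 else 0)"
    if ij: "i \<in> {1..N}" "j \<in> {1..N}" for i j
  proof -
    \<comment> \<open>Writes a two-site product as a product over all sites, with factor 1
      elsewhere, so that the integral over the product measure factors.\<close>
    define g where "g l x = (if l = i then (if l = j then (Y x)\<^sup>2 else Y x) else if l = j then Y x else 1)" for l x
    have gi: "integrable P (g l)" for l
      unfolding g_def using Y1 Y2 by (cases "l = i"; cases "l = j") auto
    have e: "(\<Prod>l\<in>{1..N}. g l (w l)) = Y (w i) * Y (w j)" for w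
    proof (cases "i = j")
      case True
      have "(\<Prod>l\<in>{1..N}. g l (w l)) = g i (w i) * (\<Prod>l\<in>{1..N} - {i}. g l (w l))"
        using ij by (intro prod.remove) auto
      also have "(\<Prod>l\<in>{1..N} - {i}. g l (w l)) = 1" using True by (intro prod.neutral) (auto simp: g_def)
      finally show ?thesis using True by (simp add: g_def power2_eq_square)
    next
      case False
      have "(\<Prod>l\<in>{1..N}. g l (w l)) = g i (w i) * (\<Prod>l\<in>{1..N} - {i}. g l (w l))"
        using ij by (intro prod.remove) auto
      also have "(\<Prod>l\<in>{1..N} - {i}. g l (w l)) = g j (w j) * (\<Prod>l\<in>{1..N} - {i} - {j}. g l (w l))"
        using ij False by (intro prod.remove) auto
      also have "(\<Prod>l\<in>{1..N} - {i} - {j}. g l (w l)) = 1" by (intro prod.neutral) (auto simp: g_def)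
      finally show ?thesis using False by (simp add: g_def)
    qed
    have i: "integrable ?T (\<lambda>w. \<Prod>l\<in>{1..N}. g l (w l))" by (rule product_integrable_prod) (auto intro: gi)
    have "(\<integral>w. (\<Prod>l\<in>{1..N}. g l (w l)) \<partial>?T) = (\<Prod>l\<in>{1..N}. \<integral>x. g l x \<partial>P)" by (rule product_integral_prod) (auto intro: gi)
    also have "\<dots> = (if i = j then s2 else 0)"
    proof (cases "i = j")
      case True
      have "(\<Prod>l\<in>{1..N}. \<integral>x. g l x \<partial>P) = (\<integral>x. g i x \<partial>P) * (\<Prod>l\<in>{1..N} - {i}. \<integral>x. g l x \<partial>P)"
        using ij by (intro prod.remove) auto
      also have "(\<Prod>l\<in>{1..N} - {i}. \<integral>x. g l x \<partial>P) = 1" using True by (intro prod.neutral) (auto simp: g_def P.prob_space)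
      finally show ?thesis using True by (simp add: g_def s2_def)
    next
      case False
      have "(\<integral>x. g i x \<partial>P) = 0" using False Y1(2) by (simp add: g_def)
      then have "(\<Prod>l\<in>{1..N}. \<integral>x. g l x \<partial>P) = 0" using ij by (intro prod_zero) auto
      then show ?thesis using False by simp
    qed
    finally show ?thesis using i unfolding e by simp
  qed
  have sq: "((\<Sum>i=1..N. f (w i)) / real N - (\<integral>x. f x \<partial>P))\<^sup>2 = (\<Sum>i=1..N. \<Sum>j=1..N. Y (w i) * Y (w j)) / (real N)\<^sup>2" for w
  proof -
    have "(\<Sum>i=1..N. f (w i)) / real N - (\<integral>x. f x \<partial>P) = (\<Sum>i=1..N. Y (w i)) / real N"
      using N by (simp add: Y_def sum_subtractf diff_divide_distrib)
    then show ?thesis by (simp add: power_divide power2_eq_square sum_product)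
  qed
  have int: "integrable ?T (\<lambda>w. (\<Sum>i=1..N. \<Sum>j=1..N. Y (w i) * Y (w j)) / (real N)\<^sup>2)"
    using pr by (intro integrable_divide Bochner_Integration.integrable_sum) auto
  have "(\<integral>w. (\<Sum>i=1..N. \<Sum>j=1..N. Y (w i) * Y (w j)) / (real N)\<^sup>2 \<partial>?T) = (\<Sum>i=1..N. \<Sum>j=1..N. if i = j then s2 else 0) / (real N)\<^sup>2"
  proof -
    have "(\<integral>w. (\<Sum>i=1..N. \<Sum>j=1..N. Y (w i) * Y (w j)) \<partial>?T) = (\<Sum>i=1..N. \<integral>w. (\<Sum>j=1..N. Y (w i) * Y (w j)) \<partial>?T)"
      using pr by (intro Bochner_Integration.integral_sum Bochner_Integration.integrable_sum) blast+
    also have "\<dots> = (\<Sum>i=1..N. \<Sum>j=1..N. \<integral>w. Y (w i) * Y (w j) \<partial>?T)"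
      using pr by (intro sum.cong refl Bochner_Integration.integral_sum) blast
    also have "\<dots> = (\<Sum>i=1..N. \<Sum>j=1..N. if i = j then s2 else 0)"
      using pr by (intro sum.cong refl) blast
    finally show ?thesis by (simp only: integral_divide_zero)
  qed
  also have "\<dots> = s2 / real N" using N by (simp add: power2_eq_square)
  finally show ?thesis
    unfolding sq by (subst nn_integral_eq_integral[OF int]) (auto simp: sum_product[symmetric] s2_def Y_def)
qed

lemma lln:
  fixes f :: "(nat \<Rightarrow> real) \<Rightarrow> real"
  assumes f [measurable]: "f \<in> borel_measurable (PiM {1..K} (\<lambda>_. borel))" and f2: "integrable (gprod {1..K}) (\<lambda>x. (f x)\<^sup>2)"
  shows "cip (\<lambda>N. VV N K) (\<lambda>N v. (\<Sum>i=1..N. f (col K v i)) / real N) (\<integral>x. f x \<partial>gprod {1..K})"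
proof (rule cip_L2)
  fix N :: nat assume N: "N \<ge> 1"
  let ?m = "\<integral>x. f x \<partial>gprod {1..K}"
  have colm: "(\<lambda>v. col K v i) \<in> measurable (VV N K) (PiM {1..K} (\<lambda>_. borel))" if "i \<in> {1..N}" for i
    unfolding col_def using that by (intro measurable_restrict measurable_VV_component) auto
  show "(\<lambda>v. (\<Sum>i=1..N. f (col K v i)) / real N) \<in> borel_measurable (VV N K)"
    by (intro borel_measurable_divide borel_measurable_sum borel_measurable_const measurable_compose[OF colm f])
  define h where "h x = ennreal (((\<Sum>i=1..N. f (\<lambda>s\<in>{1..K}. x (s, i))) / real N - ?m)\<^sup>2)" for x :: "nat \<times> nat \<Rightarrow> real"
  have cm: "(\<lambda>x. \<lambda>s\<in>{1..K}. x (s, i)) \<in> measurable (PiM ({1..K}\<times>{1..N}) (\<lambda>_. borel :: real measure)) (PiM {1..K} (\<lambda>_. borel))" if "i \<in> {1..N}" for i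
    using that by (intro measurable_restrict measurable_component_singleton) auto
  have h: "h \<in> borel_measurable (PiM ({1..K}\<times>{1..N}) (\<lambda>_. borel))"
    unfolding h_def
    by (intro measurable_compose[OF _ measurable_ennreal] borel_measurable_power borel_measurable_diff borel_measurable_divide
        borel_measurable_sum borel_measurable_const measurable_compose[OF cm f])
  have "(\<integral>\<^sup>+v. ennreal (((\<Sum>i=1..N. f (col K v i)) / real N - ?m)\<^sup>2) \<partial>VV N K)
      = (\<integral>\<^sup>+v. h (\<lambda>(s, i)\<in>{1..K}\<times>{1..N}. v s i) \<partial>VV N K)"
  proof (rule nn_integral_cong)
    fix v :: "nat \<Rightarrow> nat \<Rightarrow> real"
    have "(\<lambda>s\<in>{1..K}. (\<lambda>(s, i)\<in>{1..K}\<times>{1..N}. v s i) (s, i)) = col K v i" if "i \<in> {1..N}" for i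
      using that by (auto simp: fun_eq_iff col_def)
    then have "(\<Sum>i=1..N. f (\<lambda>s\<in>{1..K}. (\<lambda>(s, i)\<in>{1..K}\<times>{1..N}. v s i) (s, i))) = (\<Sum>i=1..N. f (col K v i))"
      by (intro sum.cong refl arg_cong[where f=f])
    then show "ennreal (((\<Sum>i=1..N. f (col K v i)) / real N - ?m)\<^sup>2) = h (\<lambda>(s, i)\<in>{1..K}\<times>{1..N}. v s i)"
      unfolding h_def by (simp only:)
  qed
  also have "\<dots> = (\<integral>\<^sup>+w. h (\<lambda>(s, i)\<in>{1..K}\<times>{1..N}. w i s) \<partial>PiM {1..N} (\<lambda>_. gprod {1..K}))"
    by (rule nn_integral_transpose[OF h])
  also have "\<dots> = (\<integral>\<^sup>+w. ennreal (((\<Sum>i=1..N. f (w i)) / real N - ?m)\<^sup>2) \<partial>PiM {1..N} (\<lambda>_. gprod {1..K}))"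
  proof (rule nn_integral_cong)
    fix w assume w: "w \<in> space (PiM {1..N} (\<lambda>_. gprod {1..K}))"
    have "(\<lambda>s\<in>{1..K}. (\<lambda>(s, i)\<in>{1..K}\<times>{1..N}. w i s) (s, i)) = w i" if "i \<in> {1..N}" for i
    proof -
      have "w i \<in> space (gprod {1..K})" using w that by (auto simp: space_PiM PiE_def)
      then show ?thesis using that by (auto simp: space_gprod PiE_def extensional_def fun_eq_iff)
    qed
    then show "h (\<lambda>(s, i)\<in>{1..K}\<times>{1..N}. w i s) = ennreal (((\<Sum>i=1..N. f (w i)) / real N - ?m)\<^sup>2)"
      by (simp add: h_def)
  qed
  also have "\<dots> = ennreal ((\<integral>x. (f x - ?m)\<^sup>2 \<partial>gprod {1..K}) / real N)"
    by (rule iid_mean_variance[OF prob_space_gprod _ f2 N]) measurable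
  finally show "(\<integral>\<^sup>+v. ennreal (((\<Sum>i=1..N. f (col K v i)) / real N - ?m)\<^sup>2) \<partial>VV N K)
     \<le> ennreal ((\<integral>x. (f x - ?m)\<^sup>2 \<partial>gprod {1..K}) / real N)" by simp
qed

definition lip :: "(real \<Rightarrow> real) \<Rightarrow> bool" where
  "lip F \<longleftrightarrow> (\<exists>L\<ge>0. \<forall>x y. \<bar>F x - F y\<bar> \<le> L * \<bar>x - y\<bar>)"

lemma lip_measurable: "lip F \<Longrightarrow> F \<in> borel_measurable borel"
proof -
  assume "lip F"
  then obtain L where L: "L \<ge> 0" "\<And>x y. \<bar>F x - F y\<bar> \<le> L * \<bar>x - y\<bar>" by (auto simp: lip_def)
  then have "L-lipschitz_on UNIV F" by (intro lipschitz_onI) (auto simp: dist_real_def)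
  then show ?thesis by (intro borel_measurable_continuous_onI lipschitz_on_continuous_on)
qed

text \<open>Fourth moments are needed because \<open>lln\<close> is applied to products of two
  Lipschitz functions and asks for square integrability.\<close>

lemma lip_pow4_integrable:
  assumes F: "lip F" and [simp]: "finite J"
  shows "integrable (gprod J) (\<lambda>x. (F (\<Sum>j\<in>J. c j * x j)) ^ 4)"
proof -
  obtain L where L: "L \<ge> 0" "\<And>x y. \<bar>F x - F y\<bar> \<le> L * \<bar>x - y\<bar>" using F by (auto simp: lip_def)
  have [measurable]: "F \<in> borel_measurable borel" by (rule lip_measurable[OF F])
  have b: "(F y) ^ 4 \<le> 8 * ((F 0) ^ 4 + L ^ 4 * y ^ 4)" for y
  proof -
    have "\<bar>F y\<bar> \<le> \<bar>F 0\<bar> + L * \<bar>y\<bar>" using L(2)[of y 0] by simp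
    then have "\<bar>F y\<bar> ^ 4 \<le> (\<bar>F 0\<bar> + L * \<bar>y\<bar>) ^ 4" by (rule power_mono) simp
    also have "(\<bar>F 0\<bar> + L * \<bar>y\<bar>) ^ 4 = ((\<bar>F 0\<bar> + L * \<bar>y\<bar>)\<^sup>2)\<^sup>2" by (simp flip: power_mult)
    also have "\<dots> \<le> (2 * (\<bar>F 0\<bar>\<^sup>2 + (L * \<bar>y\<bar>)\<^sup>2))\<^sup>2"
      by (rule power_mono) (use sum_squares_bound[of "\<bar>F 0\<bar>" "L * \<bar>y\<bar>"] in \<open>auto simp: power2_sum intro!: add_nonneg_nonneg mult_nonneg_nonneg L(1)\<close>)
    also have "\<dots> = 4 * (\<bar>F 0\<bar>\<^sup>2 + (L * \<bar>y\<bar>)\<^sup>2)\<^sup>2" unfolding power_mult_distrib[of 2] by simp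
    also have "\<dots> \<le> 4 * (2 * ((\<bar>F 0\<bar>\<^sup>2)\<^sup>2 + ((L * \<bar>y\<bar>)\<^sup>2)\<^sup>2))"
      by (rule mult_left_mono) (use sum_squares_bound[of "\<bar>F 0\<bar>\<^sup>2" "(L * \<bar>y\<bar>)\<^sup>2"] in \<open>auto simp: power2_sum\<close>)
    also have "\<dots> = 8 * ((F 0) ^ 4 + L ^ 4 * y ^ 4)"
      by (simp add: power_mult_distrib flip: power_mult)
    finally show ?thesis by simp
  qed
  interpret prob_space "gprod J" by (rule prob_space_gprod)
  show ?thesis
  proof (rule Bochner_Integration.integrable_bound)
    show "integrable (gprod J) (\<lambda>x. 8 * ((F 0) ^ 4 + L ^ 4 * (\<Sum>j\<in>J. c j * x j) ^ 4))"
      by (intro integrable_mult_right Bochner_Integration.integrable_add gprod_lin_power integrable_const) auto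
    show "AE x in gprod J. norm ((F (\<Sum>j\<in>J. c j * x j)) ^ 4) \<le> norm (8 * ((F 0) ^ 4 + L ^ 4 * (\<Sum>j\<in>J. c j * x j) ^ 4))"
      using b by (intro AE_I2) (force intro: order_trans[OF _ abs_ge_self])
  qed measurable
qed

lemma lip_prod_sq_integrable:
  assumes F: "lip F" and G: "lip G" and [simp]: "finite J"
  shows "integrable (gprod J) (\<lambda>x. (F (\<Sum>j\<in>J. c j * x j) * G (\<Sum>j\<in>J. d j * x j))\<^sup>2)"
proof (rule Bochner_Integration.integrable_bound)
  have [measurable]: "F \<in> borel_measurable borel" "G \<in> borel_measurable borel" by (rule lip_measurable, fact)+
  show "integrable (gprod J) (\<lambda>x. (F (\<Sum>j\<in>J. c j * x j)) ^ 4 + (G (\<Sum>j\<in>J. d j * x j)) ^ 4)"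
    by (intro Bochner_Integration.integrable_add lip_pow4_integrable F G) simp_all
  have "(x * y)\<^sup>2 \<le> x ^ 4 + y ^ 4" for x y :: real
    using sum_squares_bound[of "x\<^sup>2" "y\<^sup>2"] mult_nonneg_nonneg[of "x\<^sup>2" "y\<^sup>2"]
    by (simp add: power_mult_distrib del: mult_nonneg_nonneg zero_le_mult_iff flip: power_mult)
  then show "AE x in gprod J. norm ((F (\<Sum>j\<in>J. c j * x j) * G (\<Sum>j\<in>J. d j * x j))\<^sup>2)
      \<le> norm ((F (\<Sum>j\<in>J. c j * x j)) ^ 4 + (G (\<Sum>j\<in>J. d j * x j)) ^ 4)"
    by (intro AE_I2) (auto intro: order_trans[OF _ abs_ge_self])
  show "(\<lambda>x. (F (\<Sum>j\<in>J. c j * x j) * G (\<Sum>j\<in>J. d j * x j))\<^sup>2) \<in> borel_measurable (gprod J)" by measurable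
qed

lemma lln_lip:
  assumes F: "lip F" and G: "lip G"
  shows "cip (\<lambda>N. VV N K) (\<lambda>N v. ip N (\<lambda>i. F (\<Sum>s=1..K. c s * v s i)) (\<lambda>i. G (\<Sum>s=1..K. d s * v s i)))
     (\<integral>x. F (\<Sum>s=1..K. c s * x s) * G (\<Sum>s=1..K. d s * x s) \<partial>gprod {1..K})"
proof -
  have [measurable]: "F \<in> borel_measurable borel" "G \<in> borel_measurable borel" by (rule lip_measurable, fact)+
  have lm [measurable]: "(\<lambda>x. \<Sum>s=1..K. c s * x s) \<in> borel_measurable (PiM {1..K} (\<lambda>_. borel))" for c :: "nat \<Rightarrow> real"
    by (intro borel_measurable_sum borel_measurable_times borel_measurable_const measurable_component_singleton)
  have m: "(\<lambda>x. F (\<Sum>s=1..K. c s * x s) * G (\<Sum>s=1..K. d s * x s)) \<in> borel_measurable (PiM {1..K} (\<lambda>_. borel))" by measurable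
  show ?thesis
    by (rule cip_cong[OF lln[OF m lip_prod_sq_integrable[OF F G]]]) (simp_all add: ip_def col_def)
qed

section \<open>State evolution\<close>

lemma nrm_lip:
  assumes "\<And>x y. \<bar>F x - F y\<bar> \<le> L * \<bar>x - y\<bar>" "L \<ge> 0"
  shows "nrm N (\<lambda>i. F (x i) - F (y i)) \<le> L * nrm N (\<lambda>i. x i - y i)"
proof -
  have "(F u - F w) * (F u - F w) \<le> L\<^sup>2 * ((u - w) * (u - w))" for u w
  proof -
    have "\<bar>F u - F w\<bar>\<^sup>2 \<le> (L * \<bar>u - w\<bar>)\<^sup>2" by (rule power_mono[OF assms(1)]) simp
    then show ?thesis unfolding power_mult_distrib power2_abs by (simp only: power2_eq_square)
  qed
  then have "ip N (\<lambda>i. F (x i) - F (y i)) (\<lambda>i. F (x i) - F (y i)) \<le> ip N (\<lambda>i. L * (x i - y i)) (\<lambda>i. L * (x i - y i))"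
    unfolding ip_def by (intro divide_right_mono sum_mono) (simp_all add: power2_eq_square mult_ac)
  then have "nrm N (\<lambda>i. F (x i) - F (y i)) \<le> nrm N (\<lambda>i. L * (x i - y i))"
    unfolding nrm_def by (rule real_sqrt_le_mono)
  then show ?thesis using assms(2) by (simp add: nrm_scale)
qed

lemma nrm_le_add_diff: "nrm N y \<le> nrm N y' + nrm N (\<lambda>i. y i - y' i)"
  using nrm_triangle[of N y' "\<lambda>i. y i - y' i"] by simp

lemma ip_perturb:
  "\<bar>ip N x y - ip N x' y'\<bar> \<le> nrm N (\<lambda>i. x i - x' i) * (nrm N y' + nrm N (\<lambda>i. y i - y' i)) + nrm N x' * nrm N (\<lambda>i. y i - y' i)"
proof -
  have "ip N x y - ip N x' y' = ip N (\<lambda>i. x i - x' i) y + ip N x' (\<lambda>i. y i - y' i)"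
    by (simp add: ip_diff_left ip_diff_right)
  also have "\<bar>\<dots>\<bar> \<le> nrm N (\<lambda>i. x i - x' i) * nrm N y + nrm N x' * nrm N (\<lambda>i. y i - y' i)"
    by (rule order_trans[OF abs_triangle_ineq add_mono[OF abs_ip_le abs_ip_le]])
  also have "nrm N (\<lambda>i. x i - x' i) * nrm N y \<le> nrm N (\<lambda>i. x i - x' i) * (nrm N y' + nrm N (\<lambda>i. y i - y' i))"
    by (rule mult_left_mono[OF nrm_le_add_diff nrm_nonneg])
  finally show ?thesis by simp
qed

lemma lip_const: "lip (\<lambda>_. c)" by (auto simp: lip_def intro!: exI[of _ 0])

lemma lip_id: "lip (\<lambda>x. x)" by (auto simp: lip_def intro!: exI[of _ 1])

lemma lip_affine: 
  assumes "\<And>x y. \<bar>F x - F y\<bar> \<le> \<bar>x - y\<bar>" shows "lip (\<lambda>x. F (h + \<beta> * x))"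
  unfolding lip_def
proof (intro exI[of _ "\<bar>\<beta>\<bar>"] conjI allI)
  fix x y :: real
  show "\<bar>F (h + \<beta> * x) - F (h + \<beta> * y)\<bar> \<le> \<bar>\<beta>\<bar> * \<bar>x - y\<bar>"
    using assms[of "h + \<beta> * x" "h + \<beta> * y"] by (simp flip: right_diff_distrib abs_mult)
qed simp

lemma gprod_lin_prod:
  assumes "finite J"
  shows "(\<integral>x. (\<Sum>j\<in>J. c j * x j) * (\<Sum>j\<in>J. d j * x j) \<partial>gprod J) = (\<Sum>j\<in>J. c j * d j)"
proof -
  have e: "(\<Sum>j\<in>J. c j * x j) * (\<Sum>j\<in>J. d j * x j) = ((\<Sum>j\<in>J. (c j + d j) * x j)\<^sup>2 - (\<Sum>j\<in>J. (c j - d j) * x j)\<^sup>2) / 4" for x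
    by (simp add: distrib_right left_diff_distrib sum.distrib sum_subtractf power2_eq_square algebra_simps)
  have "(\<integral>x. (\<Sum>j\<in>J. c j * x j) * (\<Sum>j\<in>J. d j * x j) \<partial>gprod J) = ((\<Sum>j\<in>J. (c j + d j)\<^sup>2) - (\<Sum>j\<in>J. (c j - d j)\<^sup>2)) / 4"
    unfolding e using gprod_lin_power[OF assms, of _ 2] by (simp add: gprod_lin_sq[OF assms])
  also have "\<dots> = (\<Sum>j\<in>J. c j * d j)"
    by (simp add: sum_subtractf[symmetric] sum_divide_distrib power2_eq_square algebra_simps)
  finally show ?thesis .
qed

lemma sum_single:
  fixes f :: "nat \<Rightarrow> real"
  shows "s \<in> {1..K} \<Longrightarrow> (\<Sum>t=1..K. of_bool (t = s) * f t) = f s"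
proof -
  assume s: "s \<in> {1..K}"
  have "(\<Sum>t=1..K. of_bool (t = s) * f t) = (\<Sum>t=1..K. if t = s then f s else 0)" by (intro sum.cong) auto
  then show ?thesis using s by simp
qed

lemma nn_gauss_ip:
  assumes "N \<ge> 1" "o' + N \<le> 2 * N"
  shows "(\<integral>\<^sup>+u. ennreal ((ip N (\<lambda>i. u (o' + i)) p)\<^sup>2) \<partial>UU N) = ennreal (ip N p p / real N)"
proof -
  have e: "ip N (\<lambda>i. u (o' + i)) p = (\<Sum>i\<in>{1..N}. (p i / real N) * u (o' + i))" for u
    by (simp add: ip_def sum_divide_distrib mult.commute)
  have "(\<integral>\<^sup>+u. ennreal ((ip N (\<lambda>i. u (o' + i)) p)\<^sup>2) \<partial>UU N) = ennreal (\<Sum>i\<in>{1..N}. (p i / real N)\<^sup>2)"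
    unfolding e UU_def by (rule gprod_sub_nn_sq) (use assms in \<open>auto simp: inj_on_def\<close>)
  also have "(\<Sum>i\<in>{1..N}. (p i / real N)\<^sup>2) = ip N p p / real N"
    by (simp add: ip_def sum_divide_distrib power2_eq_square)
  finally show ?thesis .
qed

context hightemp
begin

text \<open>The coefficients of \<open>\<zeta>\<^sup>s\<close> in \<open>(h\<^sup>(\<^sup>k\<^sup>+\<^sup>1\<^sup>) - h) / \<beta>\<close>.\<close>

definition cc :: "nat \<Rightarrow> nat \<Rightarrow> real" where
  "cc k s = (if s < k then \<gamma> s else if s = k then sqrt (q - G2 (k - 1)) else 0)"

lemma sum_cc:
  assumes "1 \<le> k" "k \<le> K"
  shows "(\<Sum>s=1..K. cc k s * f s) = (\<Sum>s=1..k-1. \<gamma> s * f s) + sqrt (q - G2 (k - 1)) * f k"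
proof -
  have "(\<Sum>s=1..K. cc k s * f s) = (\<Sum>s\<in>{1..k}. cc k s * f s)"
    using assms by (intro sum.mono_neutral_right) (auto simp: cc_def)
  also have "{1..k} = insert k {1..k-1}" using assms by auto
  also have "(\<Sum>s\<in>insert k {1..k-1}. cc k s * f s) = cc k k * f k + (\<Sum>s=1..k-1. cc k s * f s)"
    using assms by (intro sum.insert) auto
  also have "(\<Sum>s=1..k-1. cc k s * f s) = (\<Sum>s=1..k-1. \<gamma> s * f s)"
    using assms by (intro sum.cong) (auto simp: cc_def)
  finally show ?thesis by (simp add: cc_def)
qed

text \<open>The coefficients \<gamma> contribute \<Gamma>^2, which the square of the last
  coefficient completes to q: the square root in the recursion for h is there to keep the variance
  at q.\<close>

lemma cc_norm: "1 \<le> k \<Longrightarrow> k \<le> K \<Longrightarrow> (\<Sum>s=1..K. (cc k s)\<^sup>2) = q"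
proof -
  assume k: "1 \<le> k" "k \<le> K"
  have "(\<Sum>s=1..K. (cc k s)\<^sup>2) = (\<Sum>s=1..K. cc k s * cc k s)" by (simp add: power2_eq_square)
  also have "\<dots> = (\<Sum>s=1..k-1. \<gamma> s * cc k s) + sqrt (q - G2 (k - 1)) * cc k k" by (rule sum_cc[OF k])
  also have "(\<Sum>s=1..k-1. \<gamma> s * cc k s) = G2 (k - 1)"
    unfolding Gam2_def using k by (intro sum.cong) (auto simp: cc_def power2_eq_square)
  finally show ?thesis using G2_bounds(2)[of "k - 1"] by (simp add: cc_def)
qed

text \<open>Before j the two coefficient sequences agree and give \<open>G2 (j - 1)\<close>; at j
  they give sqrt(q - \<open>G2 (j - 1)\<close>) times \<gamma>_j. The definition of \<gamma> is made
  for this sum to be \<rho>_j.\<close>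

lemma cc_inner: "1 \<le> j \<Longrightarrow> j < k \<Longrightarrow> k \<le> K \<Longrightarrow> (\<Sum>s=1..K. cc j s * cc k s) = \<rho> j"
proof -
  assume k: "1 \<le> j" "j < k" "k \<le> K"
  have "(\<Sum>s=1..K. cc j s * cc k s) = (\<Sum>s=1..j-1. \<gamma> s * cc k s) + sqrt (q - G2 (j - 1)) * cc k j" by (rule sum_cc) (use k in auto)
  also have "(\<Sum>s=1..j-1. \<gamma> s * cc k s) = G2 (j - 1)"
    unfolding Gam2_def using k by (intro sum.cong) (auto simp: cc_def power2_eq_square)
  finally show ?thesis using gam_mult[of "j - 1"] k by (simp add: cc_def mult.commute)
qed

subsection \<open>Gaussian expectations\<close>

lemma lin_cis:
  assumes "1 \<le> k" "k \<le> K"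
  shows "(\<integral>x. cis (s * (\<Sum>t=1..K. cc k t * x t)) \<partial>gprod {1..K}) = complex_of_real (exp (- (q * s\<^sup>2) / 2))"
  using gprod_two_cis[of "{1..K}" s "cc k" 0 "cc k"] unfolding cc_norm[OF assms] by simp

lemma E_univ:
  assumes "1 \<le> k" "k \<le> K" "F \<in> borel_measurable borel"
  shows "(\<integral>x. F (\<Sum>t=1..K. cc k t * x t) \<partial>gprod {1..K}) = (\<integral>z. (F (sqrt q * z) :: real) \<partial>std_gauss)"
  by (rule univariate_law[OF prob_space_gprod lin_meas lin_cis[OF assms(1,2)] assms(3)])

lemma E_Th: "1 \<le> k \<Longrightarrow> k \<le> K \<Longrightarrow> (\<integral>x. tanh (h + \<beta> * (\<Sum>t=1..K. cc k t * x t)) \<partial>gprod {1..K}) = \<gamma> 1"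
  by (subst E_univ[where F="\<lambda>x. tanh (h + \<beta> * x)"]) (auto simp: gamma1_def mult.assoc)

lemma E_Th_sq: "1 \<le> k \<Longrightarrow> k \<le> K \<Longrightarrow> (\<integral>x. (tanh (h + \<beta> * (\<Sum>t=1..K. cc k t * x t)))\<^sup>2 \<partial>gprod {1..K}) = q"
  by (subst E_univ[where F="\<lambda>x. (tanh (h + \<beta> * x))\<^sup>2"]) (use q_fix in \<open>auto simp: Ef_def mult.assoc\<close>)

lemma E_lncosh: "1 \<le> k \<Longrightarrow> k \<le> K \<Longrightarrow> (\<integral>x. lncosh (h + \<beta> * (\<Sum>t=1..K. cc k t * x t)) \<partial>gprod {1..K}) = EL \<beta> h q"
  by (subst E_univ[where F="\<lambda>x. lncosh (h + \<beta> * x)"]) (auto simp: EL_def mult.assoc)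

text \<open>By \<open>cc_norm\<close> and \<open>cc_inner\<close> the two arguments have variance q
  and covariance \<rho>_j, so the expectation is \<open>psi\<close> at \<rho>_j. This is the origin
  of the recursion for \<rho>.\<close>

lemma E_Th_Th:
  assumes "1 \<le> j" "j < k" "k \<le> K"
  shows "(\<integral>x. tanh (h + \<beta> * (\<Sum>t=1..K. cc k t * x t)) * tanh (h + \<beta> * (\<Sum>t=1..K. cc j t * x t)) \<partial>gprod {1..K}) = \<rho> (Suc j)"
proof -
  obtain l where j: "j = Suc l" using assms by (cases j) auto
  have r: "0 \<le> \<rho> j" "\<rho> j \<le> q" using rho_bounds(1,2)[of l] j by auto
  have "(\<integral>x. (\<lambda>p. Th \<beta> h (fst p) * Th \<beta> h (snd p)) (\<Sum>t=1..K. cc k t * x t, \<Sum>t=1..K. cc j t * x t) \<partial>gprod {1..K})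
    = (\<integral>\<omega>. (\<lambda>p. Th \<beta> h (fst p) * Th \<beta> h (snd p)) (pX (\<rho> j) \<omega>, pY (\<rho> j) \<omega>) \<partial>W3)"
  proof (rule bivariate_law[OF prob_space_gprod lin_meas lin_meas r])
    fix s u
    have "(\<Sum>t=1..K. cc k t * cc j t) = \<rho> j"
      using cc_inner[OF assms] by (simp add: mult.commute)
    then show "(\<integral>x. cis (s * (\<Sum>t=1..K. cc k t * x t) + u * (\<Sum>t=1..K. cc j t * x t)) \<partial>gprod {1..K})
      = complex_of_real (exp (- (q * s\<^sup>2 + 2 * \<rho> j * s * u + q * u\<^sup>2) / 2))"
      using assms by (subst gprod_two_cis) (simp_all only: cc_norm finite_atLeastAtMost)
  qed measurable
  then have "(\<integral>x. Th \<beta> h (\<Sum>t=1..K. cc k t * x t) * Th \<beta> h (\<Sum>t=1..K. cc j t * x t) \<partial>gprod {1..K}) = psi \<beta> h (\<rho> j)"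
    unfolding psi_eq by simp
  then show ?thesis unfolding j by (simp add: Th_def rho.simps(3))
qed

text \<open>Integration by parts in the coordinate \<open>x s\<close>, with the others fixed,
  produces the factor \<beta> \<open>cc k s\<close> and leaves the mean of 1 - tanh^2.\<close>

lemma E_Th_x:
  assumes k: "1 \<le> k" "k \<le> K" and s: "s \<in> {1..K}"
  shows "(\<integral>x. tanh (h + \<beta> * (\<Sum>t=1..K. cc k t * x t)) * x s \<partial>gprod {1..K}) = \<beta> * (1 - q) * cc k s"
proof -
  interpret G: prob_space "gprod {1..K}" by (rule prob_space_gprod)
  define J where "J = {1..K} - {s}"
  have J: "insert s J = {1..K}" "finite J" "s \<notin> J" using s by (auto simp: J_def)
  have xs [measurable]: "(\<lambda>x. x s) \<in> borel_measurable (gprod {1..K})" by (rule measurable_gprod_component[OF s])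
  let ?l = "\<lambda>x. h + \<beta> * (\<Sum>t=1..K. cc k t * x t)"
  have split: "(\<integral>x. f x \<partial>gprod {1..K}) = (\<integral>x. (\<integral>y. f (x(s := y)) \<partial>std_gauss) \<partial>gprod J)"
    if "integrable (gprod {1..K}) f" for f :: "(nat \<Rightarrow> real) \<Rightarrow> real"
    using sgp.product_integral_insert[OF J(2,3), of f] that unfolding J(1) gprod_def by simp
  have upd: "?l (x(s := y)) = (h + \<beta> * (\<Sum>t\<in>J. cc k t * x t)) + (\<beta> * cc k s) * y" for x y
  proof -
    have "(\<Sum>t=1..K. cc k t * (x(s := y)) t) = cc k s * y + (\<Sum>t\<in>J. cc k t * (x(s := y)) t)"
      unfolding J(1)[symmetric] using J by (subst sum.insert) auto
    also have "(\<Sum>t\<in>J. cc k t * (x(s := y)) t) = (\<Sum>t\<in>J. cc k t * x t)"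
      using J by (intro sum.cong) auto
    finally show ?thesis by (simp add: distrib_left mult.assoc)
  qed
  have i2: "integrable (gprod {1..K}) (\<lambda>x. 1 - (tanh (?l x))\<^sup>2)"
    by (rule G.integrable_const_bound[where B=1]) (auto intro!: AE_I2)
  have i1: "integrable (gprod {1..K}) (\<lambda>x. tanh (?l x) * x s)"
  proof (rule Bochner_Integration.integrable_bound)
    have "integrable (gprod {1..K}) (\<lambda>x. (\<Sum>t=1..K. of_bool (t = s) * x t) ^ 1)" by (rule gprod_lin_power) simp
    then show "integrable (gprod {1..K}) (\<lambda>x. x s)" unfolding sum_single[OF s] by simp
    show "AE x in gprod {1..K}. norm (tanh (?l x) * x s) \<le> norm (x s)"
      by (intro AE_I2) (simp add: abs_mult mult_left_le_one_le)
  qed measurable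
  have "(\<integral>x. tanh (?l x) * x s \<partial>gprod {1..K})
      = (\<integral>x. (\<integral>y. y * tanh ((h + \<beta> * (\<Sum>t\<in>J. cc k t * x t)) + (\<beta> * cc k s) * y) \<partial>std_gauss) \<partial>gprod J)"
    unfolding split[OF i1] upd by (simp add: mult.commute)
  also have "\<dots> = \<beta> * cc k s * (\<integral>x. (\<integral>y. 1 - (tanh ((h + \<beta> * (\<Sum>t\<in>J. cc k t * x t)) + (\<beta> * cc k s) * y))\<^sup>2 \<partial>std_gauss) \<partial>gprod J)"
    unfolding std_gauss_ibp_tanh by simp
  also have "(\<integral>x. (\<integral>y. 1 - (tanh ((h + \<beta> * (\<Sum>t\<in>J. cc k t * x t)) + (\<beta> * cc k s) * y))\<^sup>2 \<partial>std_gauss) \<partial>gprod J)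
     = (\<integral>x. 1 - (tanh (?l x))\<^sup>2 \<partial>gprod {1..K})"
    unfolding split[OF i2] upd ..
  also have "(\<integral>x. 1 - (tanh (?l x))\<^sup>2 \<partial>gprod {1..K}) = 1 - q"
  proof -
    have "integrable (gprod {1..K}) (\<lambda>x. (tanh (?l x))\<^sup>2)"
      by (rule G.integrable_const_bound[where B=1]) (auto intro!: AE_I2)
    from Bochner_Integration.integral_diff[OF G.integrable_const this, of 1] show ?thesis
      unfolding E_Th_sq[OF k] using G.prob_space by simp
  qed
  finally show ?thesis by simp
qed


subsection \<open>The first vectors are nearly fresh Gaussian vectors\<close>

context
  fixes K :: nat
begin

text \<open>All steps up to K are read off from one matrix; \<open>dmat_phi\<close> and
  \<open>dmat_zeta\<close> identify their data with those of the shorter constructions.\<close>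

abbreviation DD where "DD N v \<equiv> dmat \<beta> h N v K"
abbreviation PP where "PP N v s \<equiv> phi \<beta> h N (DD N v) s"
abbreviation ZZ where "ZZ N v s \<equiv> zeta \<beta> h N (DD N v) s"
abbreviation MM where "MM N v s \<equiv> vm \<beta> h N (DD N v) s"

lemma mv_PP: "mv N (VV N K) (\<lambda>v. PP N v s)" and mv_ZZ: "mv N (VV N K) (\<lambda>v. ZZ N v s)"
  by (rule mv_data[OF mm_dmat], rule measurable_VV_component, assumption+)+

lemma mv_fresh: "s \<in> {1..K} \<Longrightarrow> o' \<le> N \<Longrightarrow> mv N (VV N K) (\<lambda>v i. v s (o' + i))"
  by (intro mvI measurable_VV_component) auto

text \<open>The vector \<phi> of step t is determined by the blocks before t, so the case t = s is
  included. Integrating block s with the others fixed meets a deterministic vector of norm at most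
  1.\<close>

lemma fresh_ip_sq:
  assumes N: "N \<ge> 1" and s: "s \<in> {1..K}" and t: "1 \<le> t" "t \<le> s" and o: "o' \<le> N"
  shows "(\<integral>\<^sup>+v. ennreal ((ip N (\<lambda>i. v s (o' + i)) (PP N v t))\<^sup>2) \<partial>VV N K) \<le> ennreal (1 / real N)"
proof -
  interpret U: prob_space "UU N" by (rule prob_space_UU)
  interpret product_sigma_finite "\<lambda>_ :: nat. UU N" by standard
  define J where "J = {1..K} - {s}"
  have J: "insert s J = {1..K}" "finite J" "s \<notin> J" using s by (auto simp: J_def)
  interpret J: prob_space "PiM J (\<lambda>_. UU N)" by (intro prob_space_PiM prob_space_UU)
  have p: "PP N v t = phi \<beta> h N (dmat \<beta> h N v (s - 1)) t" for v
    using dmat_phi[OF N, of t "s - 1" K] t s by auto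
  let ?f = "\<lambda>v. ennreal ((ip N (\<lambda>i. v s (o' + i)) (PP N v t))\<^sup>2)"
  have m: "?f \<in> borel_measurable (PiM (insert s J) (\<lambda>_. UU N))"
    unfolding J(1) VV_def[symmetric]
    by (intro measurable_compose[OF _ measurable_ennreal] borel_measurable_power mv_ip mv_fresh mv_PP s o)
  have "(\<integral>\<^sup>+v. ?f v \<partial>VV N K) = (\<integral>\<^sup>+x. (\<integral>\<^sup>+u. ?f (x(s := u)) \<partial>UU N) \<partial>PiM J (\<lambda>_. UU N))"
    unfolding VV_def J(1)[symmetric] by (rule product_nn_integral_insert[OF J(2,3) m])
  also have "\<dots> \<le> (\<integral>\<^sup>+x. ennreal (1 / real N) \<partial>PiM J (\<lambda>_. UU N))"
  proof (rule nn_integral_mono)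
    fix x
    have d: "dmat \<beta> h N (x(s := u)) (s - 1) = dmat \<beta> h N x (s - 1)" for u
      by (rule dmat_cong) (use s in auto)
    let ?p = "phi \<beta> h N (dmat \<beta> h N x (s - 1)) t"
    have "(\<integral>\<^sup>+u. ?f (x(s := u)) \<partial>UU N) = (\<integral>\<^sup>+u. ennreal ((ip N (\<lambda>i. u (o' + i)) ?p)\<^sup>2) \<partial>UU N)"
      unfolding p d by simp
    also have "\<dots> = ennreal (ip N ?p ?p / real N)" by (rule nn_gauss_ip[OF N]) (use o in simp)
    also have "\<dots> \<le> ennreal (1 / real N)"
      by (intro ennreal_leI divide_right_mono phi_norm_le N t) simp
    finally show "(\<integral>\<^sup>+u. ?f (x(s := u)) \<partial>UU N) \<le> ennreal (1 / real N)" .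
  qed
  also have "\<dots> = ennreal (1 / real N)" by (simp add: J.emeasure_space_1)
  finally show ?thesis .
qed

lemma fresh_ip:
  assumes s: "s \<in> {1..K}" and t: "1 \<le> t" "t \<le> s"
  shows "cip (\<lambda>N. VV N K) (\<lambda>N v. \<bar>ip N (\<lambda>i. v s i) (PP N v t)\<bar>) 0"
    "cip (\<lambda>N. VV N K) (\<lambda>N v. \<bar>ip N (\<lambda>i. v s (N + i)) (PP N v t)\<bar>) 0"
proof -
  have "cip (\<lambda>N. VV N K) (\<lambda>N v. ip N (\<lambda>i. v s (g N + i)) (PP N v t)) 0" if g: "\<And>N. g N \<le> N" for g
  proof (rule cip_L2)
    fix N :: nat assume N: "N \<ge> 1"
    show "(\<lambda>v. ip N (\<lambda>i. v s (g N + i)) (PP N v t)) \<in> borel_measurable (VV N K)"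
      by (intro mv_ip mv_fresh mv_PP s g)
    show "(\<integral>\<^sup>+v. ennreal ((ip N (\<lambda>i. v s (g N + i)) (PP N v t) - 0)\<^sup>2) \<partial>VV N K) \<le> ennreal (1 / real N)"
      using fresh_ip_sq[OF N s t g] by simp
  qed
  from cip_abs[OF this[of "\<lambda>_. 0"]] cip_abs[OF this[of "\<lambda>N. N"]]
  show "cip (\<lambda>N. VV N K) (\<lambda>N v. \<bar>ip N (\<lambda>i. v s i) (PP N v t)\<bar>) 0"
    "cip (\<lambda>N. VV N K) (\<lambda>N v. \<bar>ip N (\<lambda>i. v s (N + i)) (PP N v t)\<bar>) 0" by simp_all
qed

text \<open>Supplies the second-moment hypothesis of \<open>limsup_mean_le\<close>, by which the
  exceptional set is controlled.\<close>

lemma fresh_norm_sq: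
  assumes s: "s \<in> {1..K}" and N: "N \<ge> 1" and o: "o' \<le> N"
  shows "(\<integral>\<^sup>+v. ennreal ((nrm N (\<lambda>i. v s (o' + i)))\<^sup>2) \<partial>VV N K) = 1"
proof -
  interpret U: prob_space "UU N" by (rule prob_space_UU)
  interpret P: prob_space "VV N K" by (rule prob_space_VV)
  have c: "(\<integral>\<^sup>+v. ennreal ((v s l)\<^sup>2) \<partial>VV N K) = 1" if l: "l \<in> {1..2*N}" for l
  proof -
    have "(\<integral>\<^sup>+v. ennreal ((v s l)\<^sup>2) \<partial>VV N K) = (\<integral>\<^sup>+u. ennreal ((u l)\<^sup>2) \<partial>distr (VV N K) (UU N) (\<lambda>v. v s))"
      by (rule nn_integral_distr[symmetric])
         (use s l in \<open>auto simp: VV_def intro!: measurable_component_singleton measurable_compose[OF _ measurable_ennreal] borel_measurable_power measurable_UU_component\<close>)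
    also have "distr (VV N K) (UU N) (\<lambda>v. v s) = UU N"
      unfolding VV_def by (rule distr_PiM_component[OF _ s]) (rule prob_space_UU)
    also have "(\<integral>\<^sup>+u. ennreal ((u l)\<^sup>2) \<partial>UU N) = ennreal (\<Sum>j=1..2*N. (of_bool (j = l))\<^sup>2)"
      unfolding UU_def using gprod_lin_nn_sq[of "{1..2*N}" "\<lambda>j. of_bool (j = l)"] unfolding sum_single[OF l] by simp
    also have "(\<Sum>j=1..2*N. (of_bool (j = l))\<^sup>2) = (1::real)"
      using sum_single[OF l, of "\<lambda>_. 1"] by (simp add: power2_eq_square)
    finally show ?thesis by simp
  qed
  have "(\<integral>\<^sup>+v. ennreal ((nrm N (\<lambda>i. v s (o' + i)))\<^sup>2) \<partial>VV N K)
     = (\<integral>\<^sup>+v. ennreal (1 / real N) * (\<Sum>i=1..N. ennreal ((v s (o' + i))\<^sup>2)) \<partial>VV N K)"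
  proof (rule nn_integral_cong)
    fix v :: "nat \<Rightarrow> nat \<Rightarrow> real"
    have "(nrm N (\<lambda>i. v s (o' + i)))\<^sup>2 = 1 / real N * (\<Sum>i=1..N. (v s (o' + i))\<^sup>2)"
      unfolding nrm_sq ip_def by (simp add: power2_eq_square)
    then have "ennreal ((nrm N (\<lambda>i. v s (o' + i)))\<^sup>2) = ennreal (1 / real N * (\<Sum>i=1..N. (v s (o' + i))\<^sup>2))" by (simp only:)
    also have "\<dots> = ennreal (1 / real N) * ennreal (\<Sum>i=1..N. (v s (o' + i))\<^sup>2)"
      by (rule ennreal_mult) (simp_all add: sum_nonneg)
    also have "ennreal (\<Sum>i=1..N. (v s (o' + i))\<^sup>2) = (\<Sum>i=1..N. ennreal ((v s (o' + i))\<^sup>2))"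
      by (rule sum_ennreal[symmetric]) simp
    finally show "ennreal ((nrm N (\<lambda>i. v s (o' + i)))\<^sup>2) = ennreal (1 / real N) * (\<Sum>i=1..N. ennreal ((v s (o' + i))\<^sup>2))" .
  qed
  also have "\<dots> = ennreal (1 / real N) * (\<integral>\<^sup>+v. (\<Sum>i=1..N. ennreal ((v s (o' + i))\<^sup>2)) \<partial>VV N K)"
    by (rule nn_integral_cmult)
       (use s o in \<open>auto intro!: borel_measurable_sum measurable_compose[OF _ measurable_ennreal] borel_measurable_power measurable_VV_component\<close>)
  also have "(\<integral>\<^sup>+v. (\<Sum>i=1..N. ennreal ((v s (o' + i))\<^sup>2)) \<partial>VV N K) = (\<Sum>i=1..N. \<integral>\<^sup>+v. ennreal ((v s (o' + i))\<^sup>2) \<partial>VV N K)"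
    by (rule nn_integral_sum)
       (use s o in \<open>auto intro!: measurable_compose[OF _ measurable_ennreal] borel_measurable_power measurable_VV_component\<close>)
  also have "\<dots> = (\<Sum>i=1..N. 1)" by (rule sum.cong[OF refl]) (use c o in auto)
  also have "ennreal (1 / real N) * (\<Sum>i=1..N. 1) = 1"
    using N by (simp add: ennreal_of_nat_eq_real_of_nat flip: ennreal_mult')
  finally show ?thesis .
qed

lemma ZZ_form:
  assumes N: "N \<ge> 1" and s: "s \<in> {1..K}"
  shows "ZZ N v s = (if PP N v s = (\<lambda>_. 0) then (\<lambda>_. 0)
    else (\<lambda>i. pjx N (PP N v) (s - 1) (\<lambda>i. v s i) i + ip N (\<lambda>i. v s (N + i)) (PP N v s) * PP N v s i))"
proof -
  obtain m where m: "s = Suc m" using s by (cases s) auto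
  have p: "phi \<beta> h N (dmat \<beta> h N v m) t = PP N v t" if "t \<le> s" for t
    using dmat_phi[OF N, of t m K] that m s by auto
  have pj: "pjx N (phi \<beta> h N (dmat \<beta> h N v m)) m x = pjx N (PP N v) m x" for x
    unfolding pjx_def using p m by (intro ext arg_cong2[where f="(-)"] refl sum.cong) simp
  have "ZZ N v s = zeta \<beta> h N (dmat \<beta> h N v (Suc m)) (Suc m)"
    using dmat_zeta[OF N, of s s K] s m by auto
  then show ?thesis
    unfolding dmat_zeta_Suc[OF N] pj using p[of "Suc m"] m by simp
qed

lemma PP_norm: "N \<ge> 1 \<Longrightarrow> s \<ge> 1 \<Longrightarrow> nrm N (PP N v s) \<le> 1"
  using phi_norm_le[of N s] by (simp add: nrm_def)

text \<open>Holds for every realisation, as the crude bound on the integrand requires; the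
  projections in \<open>ZZ_form\<close> do not increase the norm.\<close>

lemma ZZ_norm:
  assumes N: "N \<ge> 1" and s: "s \<in> {1..K}"
  shows "nrm N (ZZ N v s) \<le> nrm N (\<lambda>i. v s i) + nrm N (\<lambda>i. v s (N + i))"
proof (cases "PP N v s = (\<lambda>_. 0)")
  case True
  then have "nrm N (ZZ N v s) = 0" unfolding ZZ_form[OF N s] by (simp add: nrm_def)
  then show ?thesis by simp
next
  case False
  let ?a = "\<lambda>i. v s i" and ?b = "\<lambda>i. v s (N + i)" and ?P = "PP N v"
  have "nrm N (ZZ N v s) \<le> nrm N (pjx N ?P (s - 1) ?a) + nrm N (\<lambda>i. ip N ?b (?P s) * ?P s i)"
    unfolding ZZ_form[OF N s] using False by (simp add: nrm_triangle)
  also have "nrm N (pjx N ?P (s - 1) ?a) \<le> nrm N ?a"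
    unfolding nrm_def pjx_norm[OF phi_orth[OF N]]
    by (intro real_sqrt_le_mono) (simp add: sum_nonneg)
  also have "nrm N (\<lambda>i. ip N ?b (?P s) * ?P s i) \<le> nrm N ?b"
  proof -
    have n1: "nrm N (?P s) \<le> 1" by (rule PP_norm[OF N]) (use s in auto)
    have "nrm N (\<lambda>i. ip N ?b (?P s) * ?P s i) \<le> (nrm N ?b * nrm N (?P s)) * nrm N (?P s)"
      unfolding nrm_scale by (rule mult_right_mono[OF abs_ip_le nrm_nonneg])
    also have "\<dots> \<le> nrm N ?b * 1 * 1"
      by (intro mult_mono n1 order_refl mult_nonneg_nonneg nrm_nonneg) auto
    finally show ?thesis by simp
  qed
  finally show ?thesis by simp
qed

lemma PP_ZZ:
  assumes N: "N \<ge> 1" and s: "s \<in> {1..K}"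
  shows "\<bar>ip N (PP N v s) (ZZ N v s)\<bar> \<le> \<bar>ip N (\<lambda>i. v s i) (PP N v s)\<bar> + \<bar>ip N (\<lambda>i. v s (N + i)) (PP N v s)\<bar>"
proof (cases "PP N v s = (\<lambda>_. 0)")
  case True
  then show ?thesis by simp
next
  case False
  let ?a = "\<lambda>i. v s i" and ?b = "\<lambda>i. v s (N + i)" and ?P = "PP N v"
  have o: "orth N ?P s" by (rule phi_orth[OF N])
  have "ip N (?P t) (?P s) = 0" if "t \<in> {1..s-1}" for t
    by (rule orthD[OF o]) (use that in auto)
  then have "ip N (pjx N ?P (s - 1) ?a) (?P s) = ip N ?a (?P s)" by (rule pjx_orth)
  moreover have "ip N ?b (?P s) * ip N (?P s) (?P s) = ip N ?b (?P s)"
    by (rule ok_absorb, rule orth_ok[OF o]) (use s in auto)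
  ultimately have "ip N (ZZ N v s) (?P s) = ip N ?a (?P s) + ip N ?b (?P s)"
    unfolding ZZ_form[OF N s] using False by (simp add: ip_add_left ip_scale_left)
  then show ?thesis by (simp add: ip_commute[of N "?P s"])
qed

lemma ZZ_close_bound:
  assumes N: "N \<ge> 1" and s: "s \<in> {1..K}" and nz: "PP N v s \<noteq> (\<lambda>_. 0)"
  shows "nrm N (\<lambda>i. ZZ N v s i - v s i)
     \<le> (\<Sum>t=1..s-1. \<bar>ip N (\<lambda>i. v s i) (PP N v t)\<bar>) + \<bar>ip N (\<lambda>i. v s (N + i)) (PP N v s)\<bar>"
proof -
  let ?a = "\<lambda>i. v s i" and ?b = "\<lambda>i. v s (N + i)" and ?P = "PP N v"
  have n1: "\<bar>c\<bar> * nrm N (?P t) \<le> \<bar>c\<bar>" if "t \<ge> 1" for c t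
    using mult_left_mono[OF PP_norm[OF N that, of v] abs_ge_zero[of c]] by simp
  have "(\<lambda>i. ZZ N v s i - v s i) = (\<lambda>i. (\<Sum>t=1..s-1. (- ip N ?a (?P t)) * ?P t i) + ip N ?b (?P s) * ?P s i)"
    unfolding ZZ_form[OF N s] using nz by (intro ext) (simp add: pjx_def sum_negf)
  then have "nrm N (\<lambda>i. ZZ N v s i - v s i)
     \<le> nrm N (\<lambda>i. \<Sum>t=1..s-1. (- ip N ?a (?P t)) * ?P t i) + nrm N (\<lambda>i. ip N ?b (?P s) * ?P s i)"
    by (simp only: nrm_triangle)
  also have "nrm N (\<lambda>i. \<Sum>t=1..s-1. (- ip N ?a (?P t)) * ?P t i) \<le> (\<Sum>t=1..s-1. nrm N (\<lambda>i. (- ip N ?a (?P t)) * ?P t i))"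
    by (rule nrm_sum)
  also have "\<dots> \<le> (\<Sum>t=1..s-1. \<bar>ip N ?a (?P t)\<bar>)"
    unfolding nrm_scale abs_minus_cancel by (intro sum_mono n1) auto
  also have "nrm N (\<lambda>i. ip N ?b (?P s) * ?P s i) \<le> \<bar>ip N ?b (?P s)\<bar>"
    unfolding nrm_scale by (rule n1) (use s in auto)
  finally show ?thesis by simp
qed

definition close :: "nat \<Rightarrow> bool" where
  "close s \<longleftrightarrow> cip (\<lambda>N. VV N K) (\<lambda>N v. nrm N (\<lambda>i. ZZ N v s i - v s i)) 0"

text \<open>Where \<phi> vanishes, so does \<zeta>, and it is then not near the fresh vector. Hence
  nondegeneracy has to be known first; elsewhere the corrections are finitely many and small by
  \<open>fresh_ip\<close>.\<close>

lemma close_if_nonzero: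
  assumes s: "s \<in> {1..K}" and w: "whp (\<lambda>N. VV N K) (\<lambda>N v. PP N v s \<noteq> (\<lambda>_. 0))"
  shows "close s"
  unfolding close_def
proof (rule cip_whp_bound)
  show "cip (\<lambda>N. VV N K) (\<lambda>N v. (\<Sum>t=1..s-1. \<bar>ip N (\<lambda>i. v s i) (PP N v t)\<bar>) + \<bar>ip N (\<lambda>i. v s (N + i)) (PP N v s)\<bar>) 0"
  proof (rule cip_cong[OF cip_add[OF cip_sum]])
    show "cip (\<lambda>N. VV N K) (\<lambda>N v. \<bar>ip N (\<lambda>i. v s i) (PP N v t)\<bar>) 0" if "t \<in> {1..s-1}" for t
      by (rule fresh_ip(1)[OF s]) (use that in auto)
    show "cip (\<lambda>N. VV N K) (\<lambda>N v. \<bar>ip N (\<lambda>i. v s (N + i)) (PP N v s)\<bar>) 0"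
      by (rule fresh_ip(2)[OF s]) (use s in auto)
  qed auto
  show "whp (\<lambda>N. VV N K) (\<lambda>N v. \<bar>nrm N (\<lambda>i. ZZ N v s i - v s i) - 0\<bar>
     \<le> (\<Sum>t=1..s-1. \<bar>ip N (\<lambda>i. v s i) (PP N v t)\<bar>) + \<bar>ip N (\<lambda>i. v s (N + i)) (PP N v s)\<bar>)"
    by (rule whp_mono[OF w], rule eventually_mono[OF eventually_ge_at_top[of 1]])
       (use ZZ_close_bound[OF _ s] in auto)
qed

text \<open>By the Lipschitz property, replacing \<zeta> by the fresh vectors costs little in
  normalised norm, and the law of large numbers applies to the latter. Closeness is asked only where
  a coefficient is nonzero, because within the induction of \<open>all_close\<close> it is known for
  the first m steps only.\<close>

lemma state_evolution:
  assumes F: "lip F" and G: "lip G"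
    and c: "\<And>s. s \<in> {1..K} \<Longrightarrow> c s \<noteq> 0 \<Longrightarrow> close s" and d: "\<And>s. s \<in> {1..K} \<Longrightarrow> d s \<noteq> 0 \<Longrightarrow> close s"
  shows "cip (\<lambda>N. VV N K) (\<lambda>N v. ip N (\<lambda>i. F (\<Sum>s=1..K. c s * ZZ N v s i)) (\<lambda>i. G (\<Sum>s=1..K. d s * ZZ N v s i)))
     (\<integral>x. F (\<Sum>s=1..K. c s * x s) * G (\<Sum>s=1..K. d s * x s) \<partial>gprod {1..K})"
proof -
  define x where "x F c N v = (\<lambda>i. F (\<Sum>s=1..K. c s * ZZ N v s i) :: real)" for F c N v
  define x' where "x' F c v = (\<lambda>i. F (\<Sum>s=1..K. c s * v s i) :: real)" for F c and v :: "nat \<Rightarrow> nat \<Rightarrow> real"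
  define I where "I F c G d = (\<integral>x. (F (\<Sum>s=1..K. c s * x s) :: real) * G (\<Sum>s=1..K. d s * x s) \<partial>gprod {1..K})" for F c G d
  have n': "cip (\<lambda>N. VV N K) (\<lambda>N v. nrm N (x' F c v)) (sqrt (I F c F c))" if "lip F" for F c
    unfolding nrm_def x'_def I_def by (rule cip_sqrt[OF lln_lip[OF that that]])
  have df: "cip (\<lambda>N. VV N K) (\<lambda>N v. nrm N (\<lambda>i. x F c N v i - x' F c v i)) 0"
    if F: "lip F" and c: "\<And>s. s \<in> {1..K} \<Longrightarrow> c s \<noteq> 0 \<Longrightarrow> close s" for F c
  proof -
    obtain L where L: "L \<ge> 0" "\<And>x y. \<bar>F x - F y\<bar> \<le> L * \<bar>x - y\<bar>" using F by (auto simp: lip_def)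
    have b: "nrm N (\<lambda>i. x F c N v i - x' F c v i) \<le> L * (\<Sum>s=1..K. \<bar>c s\<bar> * nrm N (\<lambda>i. ZZ N v s i - v s i))" for N v
    proof -
      have "nrm N (\<lambda>i. x F c N v i - x' F c v i) \<le> L * nrm N (\<lambda>i. (\<Sum>s=1..K. c s * ZZ N v s i) - (\<Sum>s=1..K. c s * v s i))"
        unfolding x_def x'_def by (rule nrm_lip[OF L(2,1)])
      also have "(\<lambda>i. (\<Sum>s=1..K. c s * ZZ N v s i) - (\<Sum>s=1..K. c s * v s i)) = (\<lambda>i. \<Sum>s=1..K. c s * (ZZ N v s i - v s i))"
        by (simp only: sum_subtractf right_diff_distrib)
      also have "L * nrm N \<dots> \<le> L * (\<Sum>s=1..K. nrm N (\<lambda>i. c s * (ZZ N v s i - v s i)))"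
        by (rule mult_left_mono[OF nrm_sum L(1)])
      finally show ?thesis by (simp only: nrm_scale)
    qed
    have t: "cip (\<lambda>N. VV N K) (\<lambda>N v. \<bar>c s\<bar> * nrm N (\<lambda>i. ZZ N v s i - v s i)) 0" if "s \<in> {1..K}" for s
    proof (cases "c s = 0")
      case True
      then show ?thesis by (simp add: cip_const)
    next
      case False
      from cip_mult[OF cip_const[of _ "\<bar>c s\<bar>"] c[OF that False, unfolded close_def]] show ?thesis by simp
    qed
    show ?thesis
    proof (rule cip_whp_bound[OF whp_true])
      show "\<bar>nrm N (\<lambda>i. x F c N v i - x' F c v i) - 0\<bar> \<le> L * (\<Sum>s=1..K. \<bar>c s\<bar> * nrm N (\<lambda>i. ZZ N v s i - v s i))" for N v
        using b[of N v] by simp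
      show "cip (\<lambda>N. VV N K) (\<lambda>N v. L * (\<Sum>s=1..K. \<bar>c s\<bar> * nrm N (\<lambda>i. ZZ N v s i - v s i))) 0"
      proof -
        have "cip (\<lambda>N. VV N K) (\<lambda>N v. L * (\<Sum>s=1..K. \<bar>c s\<bar> * nrm N (\<lambda>i. ZZ N v s i - v s i))) (L * (\<Sum>s=1..K. 0))"
          by (intro cip_mult cip_const cip_sum t)
        then show ?thesis by simp
      qed
    qed
  qed
  have main: "cip (\<lambda>N. VV N K) (\<lambda>N v. ip N (x' F c v) (x' G d v)) (I F c G d)"
    unfolding x'_def I_def by (rule lln_lip[OF F G])
  have diff: "cip (\<lambda>N. VV N K) (\<lambda>N v. ip N (x F c N v) (x G d N v) - ip N (x' F c v) (x' G d v)) 0"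
  proof (rule cip_whp_bound[OF whp_true])
    show "\<bar>ip N (x F c N v) (x G d N v) - ip N (x' F c v) (x' G d v) - 0\<bar>
       \<le> nrm N (\<lambda>i. x F c N v i - x' F c v i) * (nrm N (x' G d v) + nrm N (\<lambda>i. x G d N v i - x' G d v i))
         + nrm N (x' F c v) * nrm N (\<lambda>i. x G d N v i - x' G d v i)" for N v
      using ip_perturb by simp
    show "cip (\<lambda>N. VV N K) (\<lambda>N v. nrm N (\<lambda>i. x F c N v i - x' F c v i) * (nrm N (x' G d v) + nrm N (\<lambda>i. x G d N v i - x' G d v i))
         + nrm N (x' F c v) * nrm N (\<lambda>i. x G d N v i - x' G d v i)) 0"
      by (rule cip_cong[OF cip_add[OF cip_mult[OF df[OF F c] cip_add[OF n'[OF G] df[OF G d]]] cip_mult[OF n'[OF F] df[OF G d]]]]) auto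
  qed
  show ?thesis
    using cip_add[OF main diff] unfolding x_def I_def by simp
qed

lemma MM_form:
  assumes "1 \<le> k" "k \<le> K"
  shows "MM N v (Suc k) = (\<lambda>i. tanh (h + \<beta> * (\<Sum>s=1..K. cc k s * ZZ N v s i)))"
proof -
  obtain l where k: "k = Suc l" using assms by (cases k) auto
  show ?thesis
    unfolding sum_cc[OF assms] unfolding k vm.simps(3) vh.simps by (simp add: distrib_left mult.assoc add.assoc)
qed

lemma lip_Th: "lip (\<lambda>x. tanh (h + \<beta> * x))" and lip_lncosh: "lip (\<lambda>x. lncosh (h + \<beta> * x))"
  by (rule lip_affine, rule tanh_lipschitz lncosh_lipschitz)+

lemma cc_close: "\<forall>s\<in>{1..m}. close s \<Longrightarrow> k \<le> m \<Longrightarrow> s \<in> {1..K} \<Longrightarrow> cc k s \<noteq> 0 \<Longrightarrow> close s"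
  by (auto simp: cc_def split: if_splits)

lemma MM_MM:
  assumes m: "\<forall>s\<in>{1..m}. close s" and k: "1 \<le> k" "k \<le> m" "m \<le> K"
  shows "cip (\<lambda>N. VV N K) (\<lambda>N v. ip N (MM N v (Suc k)) (MM N v (Suc k))) q"
    and "1 \<le> j \<Longrightarrow> j < k \<Longrightarrow> cip (\<lambda>N. VV N K) (\<lambda>N v. ip N (MM N v (Suc k)) (MM N v (Suc j))) (\<rho> (Suc j))"
    and "cip (\<lambda>N. VV N K) (\<lambda>N v. ip N (MM N v (Suc k)) (\<lambda>_. 1)) (\<gamma> 1)"
proof -
  have kK: "k \<le> K" using k by simp
  have cl: "close s" if "i \<le> m" "s \<in> {1..K}" "cc i s \<noteq> 0" for i s by (rule cc_close[OF m that])
  have a: "cip (\<lambda>N. VV N K) (\<lambda>N v. ip N (MM N v (Suc k)) (MM N v (Suc j)))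
     (\<integral>x. tanh (h + \<beta> * (\<Sum>t=1..K. cc k t * x t)) * tanh (h + \<beta> * (\<Sum>t=1..K. cc j t * x t)) \<partial>gprod {1..K})"
    if j: "1 \<le> j" "j \<le> k" for j
  proof -
    have jK: "j \<le> K" using j k by simp
    show ?thesis
      unfolding MM_form[OF k(1) kK] MM_form[OF j(1) jK]
      by (rule state_evolution[OF lip_Th lip_Th cl[OF k(2)] cl[OF order_trans[OF j(2) k(2)]]])
  qed
  show "cip (\<lambda>N. VV N K) (\<lambda>N v. ip N (MM N v (Suc k)) (MM N v (Suc k))) q"
    using a[OF k(1) order_refl] unfolding power2_eq_square[symmetric] E_Th_sq[OF k(1) kK] .
  show "1 \<le> j \<Longrightarrow> j < k \<Longrightarrow> cip (\<lambda>N. VV N K) (\<lambda>N v. ip N (MM N v (Suc k)) (MM N v (Suc j))) (\<rho> (Suc j))"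
    using a[of j] E_Th_Th[of j k K] kK by simp
  have "cip (\<lambda>N. VV N K) (\<lambda>N v. ip N (MM N v (Suc k)) (\<lambda>_. 1)) (\<integral>x. tanh (h + \<beta> * (\<Sum>t=1..K. cc k t * x t)) * 1 \<partial>gprod {1..K})"
    unfolding MM_form[OF k(1) kK]
    by (rule state_evolution[OF lip_Th lip_const cl[OF k(2)], where d="\<lambda>_. 0"]) auto
  then show "cip (\<lambda>N. VV N K) (\<lambda>N v. ip N (MM N v (Suc k)) (\<lambda>_. 1)) (\<gamma> 1)"
    unfolding mult_1_right E_Th[OF k(1) kK] .
qed

lemma PP_1: "PP N v (Suc 0) = (\<lambda>_. 1)" by (simp add: phi.simps)

lemma PP_Suc_Suc: "PP N v (Suc (Suc j)) = (\<lambda>i. pjx N (PP N v) (Suc j) (MM N v (Suc (Suc j))) i / nrm N (pjx N (PP N v) (Suc j) (MM N v (Suc (Suc j)))))"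
  unfolding phi.simps(3) Let_def pjx_def ..

text \<open>Pythagoras in the limit. That q - \<Gamma>_j^2 is positive keeps the denominators of the
  recursion away from 0.\<close>

lemma residual_norm:
  assumes m: "\<forall>s\<in>{1..m}. close s" and j: "1 \<le> j" "j \<le> m" "m \<le> K"
    and P: "\<And>t. t \<in> {1..j} \<Longrightarrow> cip (\<lambda>N. VV N K) (\<lambda>N v. ip N (MM N v (Suc j)) (PP N v t)) (\<gamma> t)"
  shows "cip (\<lambda>N. VV N K) (\<lambda>N v. ip N (pjx N (PP N v) j (MM N v (Suc j))) (pjx N (PP N v) j (MM N v (Suc j)))) (q - G2 j)"
proof (rule cip_eventually_cong)
  show "cip (\<lambda>N. VV N K) (\<lambda>N v. ip N (MM N v (Suc j)) (MM N v (Suc j)) - (\<Sum>t=1..j. (ip N (MM N v (Suc j)) (PP N v t))\<^sup>2)) (q - G2 j)"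
    unfolding Gam2_def by (intro cip_diff MM_MM(1)[OF m j] cip_sum cip_power P)
  show "\<forall>\<^sub>F N in sequentially. \<forall>v\<in>space (VV N K).
     ip N (pjx N (PP N v) j (MM N v (Suc j))) (pjx N (PP N v) j (MM N v (Suc j)))
     = ip N (MM N v (Suc j)) (MM N v (Suc j)) - (\<Sum>t=1..j. (ip N (MM N v (Suc j)) (PP N v t))\<^sup>2)"
    by (rule eventually_mono[OF eventually_ge_at_top[of 1]]) (simp add: pjx_norm[OF phi_orth] power2_eq_square)
qed

text \<open>Strong induction on t, for all later j at once. The vector \<phi> of step t is the
  normalised residual of m at step t, and the inner product of that residual with a later m involves
  \<phi> of steps before t only. The quotient of the limits is the formula for \<gamma> in
  \<open>gam_div\<close>.\<close>

lemma MM_PP: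
  assumes m: "\<forall>s\<in>{1..m}. close s" "m \<le> K"
  shows "1 \<le> t \<Longrightarrow> t \<le> j \<Longrightarrow> j \<le> m \<Longrightarrow> cip (\<lambda>N. VV N K) (\<lambda>N v. ip N (MM N v (Suc j)) (PP N v t)) (\<gamma> t)"
proof (induction t arbitrary: j rule: less_induct)
  case (less t)
  show ?case
  proof (cases "t = 1")
    case True
    then show ?thesis using MM_MM(3)[OF m(1), of j] less.prems m(2) by (simp add: PP_1)
  next
    case False
    then obtain l where t: "t = Suc (Suc l)" using less.prems by (metis One_nat_def not0_implies_Suc not_one_le_zero)
    let ?l = "Suc l"
    define r where "r N v = pjx N (PP N v) ?l (MM N v (Suc ?l))" for N v
    have IH: "cip (\<lambda>N. VV N K) (\<lambda>N v. ip N (MM N v (Suc i)) (PP N v s)) (\<gamma> s)" if "s \<in> {1..?l}" "?l \<le> i" "i \<le> m" for s i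
      by (rule less.IH) (use that t less.prems in auto)
    have rr: "cip (\<lambda>N. VV N K) (\<lambda>N v. ip N (r N v) (r N v)) (q - G2 ?l)"
      unfolding r_def by (rule residual_norm[OF m(1)]) (use IH t less.prems m(2) in auto)
    have Mr: "cip (\<lambda>N. VV N K) (\<lambda>N v. ip N (MM N v (Suc j)) (r N v)) (\<rho> (Suc ?l) - G2 ?l)"
    proof (rule cip_cong)
      show "cip (\<lambda>N. VV N K) (\<lambda>N v. ip N (MM N v (Suc j)) (MM N v (Suc ?l))
           - (\<Sum>s=1..?l. ip N (MM N v (Suc ?l)) (PP N v s) * ip N (MM N v (Suc j)) (PP N v s))) (\<rho> (Suc ?l) - (\<Sum>s=1..?l. \<gamma> s * \<gamma> s))"
        by (intro cip_diff cip_sum cip_mult IH MM_MM(2)[OF m(1)]) (use t less.prems m(2) in auto)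
      show "\<rho> (Suc ?l) - (\<Sum>s=1..?l. \<gamma> s * \<gamma> s) = \<rho> (Suc ?l) - G2 ?l"
        by (simp add: Gam2_def power2_eq_square)
      show "ip N (MM N v (Suc j)) (MM N v (Suc ?l)) - (\<Sum>s=1..?l. ip N (MM N v (Suc ?l)) (PP N v s) * ip N (MM N v (Suc j)) (PP N v s))
         = ip N (MM N v (Suc j)) (r N v)" for N v
        by (simp only: r_def pjx_def ip_diff_right ip_sum_right ip_scale_right)
    qed
    have "cip (\<lambda>N. VV N K) (\<lambda>N v. ip N (MM N v (Suc j)) (r N v) / nrm N (r N v)) ((\<rho> (Suc ?l) - G2 ?l) / sqrt (q - G2 ?l))"
      unfolding nrm_def by (intro cip_divide Mr cip_sqrt rr) (use G2_bounds(2)[of ?l] in simp)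
    then show ?thesis
      unfolding t PP_Suc_Suc ip_divide_right gam_div[of ?l] r_def .
  qed
qed

lemma PP_nonzero:
  assumes m: "\<forall>s\<in>{1..m}. close s" "m \<le> K"
  shows "whp (\<lambda>N. VV N K) (\<lambda>N v. PP N v (Suc m) \<noteq> (\<lambda>_. 0))"
proof (cases m)
  case 0
  then show ?thesis by (intro whp_true) (simp add: PP_1 fun_eq_iff)
next
  case (Suc l)
  let ?r = "\<lambda>N v. pjx N (PP N v) m (MM N v (Suc m))"
  have "cip (\<lambda>N. VV N K) (\<lambda>N v. ip N (?r N v) (?r N v)) (q - G2 m)"
    by (rule residual_norm[OF m(1) _ order_refl m(2)]) (use Suc MM_PP[OF m] in auto)
  then have "whp (\<lambda>N. VV N K) (\<lambda>N v. ip N (?r N v) (?r N v) > 0)"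
    by (rule cip_pos_whp) (use G2_bounds(2)[of m] in simp)
  then show ?thesis
  proof (rule whp_mono')
    fix N v assume r: "ip N (?r N v) (?r N v) > 0"
    show "PP N v (Suc m) \<noteq> (\<lambda>_. 0)"
    proof
      assume eq: "PP N v (Suc m) = (\<lambda>_. 0)"
      have nz: "nrm N (?r N v) \<noteq> 0" using r by (simp add: nrm_def)
      have "?r N v i = 0" for i
        using fun_cong[OF eq[unfolded Suc PP_Suc_Suc], of i] nz unfolding Suc by simp
      then have "?r N v = (\<lambda>_. 0)" by (simp add: fun_eq_iff)
      then have "ip N (?r N v) (?r N v) = 0" by simp
      then show False using r by simp
    qed
  qed
qed

text \<open>Here the two halves are joined: closeness of the first m steps makes the next residual
  nonzero with high probability, and a nonzero \<phi> makes the next step close.\<close>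

lemma all_close: "m \<le> K \<Longrightarrow> \<forall>s\<in>{1..m}. close s"
proof (induction m)
  case (Suc m)
  then have c: "\<forall>s\<in>{1..m}. close s" by simp
  have "close (Suc m)" by (rule close_if_nonzero[OF _ PP_nonzero[OF c]]) (use Suc.prems in auto)
  then show ?case using c by (auto simp: atLeastAtMostSuc_conv)
qed simp

lemma limits:
  assumes K: "1 \<le> K"
  shows lim_MP: "s \<in> {1..K} \<Longrightarrow> cip (\<lambda>N. VV N K) (\<lambda>N v. ip N (MM N v (Suc K)) (PP N v s)) (\<gamma> s)"
    and lim_MZ: "s \<in> {1..K} \<Longrightarrow> cip (\<lambda>N. VV N K) (\<lambda>N v. ip N (MM N v (Suc K)) (ZZ N v s)) (\<beta> * (1 - q) * cc K s)"
    and lim_MM: "cip (\<lambda>N. VV N K) (\<lambda>N v. ip N (MM N v (Suc K)) (MM N v (Suc K))) q"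
    and lim_lncosh: "cip (\<lambda>N. VV N K) (\<lambda>N v. ip N (\<lambda>i. lncosh (h + \<beta> * (\<Sum>s=1..K. cc K s * ZZ N v s i))) (\<lambda>_. 1)) (EL \<beta> h q)"
    and lim_ZZ: "s \<in> {1..K} \<Longrightarrow> t \<in> {1..K} \<Longrightarrow> cip (\<lambda>N. VV N K) (\<lambda>N v. ip N (ZZ N v s) (ZZ N v t)) (of_bool (s = t))"
    and lim_PZ: "s \<in> {1..K} \<Longrightarrow> cip (\<lambda>N. VV N K) (\<lambda>N v. ip N (PP N v s) (ZZ N v s)) 0"
proof -
  have cl: "\<forall>s\<in>{1..K}. close s" by (rule all_close) simp
  have zs: "(\<lambda>i. \<Sum>t=1..K. of_bool (t = s) * ZZ N v t i) = ZZ N v s" if "s \<in> {1..K}" for s N v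
    using sum_single[OF that, of "\<lambda>t. ZZ N v t i" for i] by (simp add: fun_eq_iff)
  show "s \<in> {1..K} \<Longrightarrow> cip (\<lambda>N. VV N K) (\<lambda>N v. ip N (MM N v (Suc K)) (PP N v s)) (\<gamma> s)"
    by (rule MM_PP[OF cl]) auto
  show "cip (\<lambda>N. VV N K) (\<lambda>N v. ip N (MM N v (Suc K)) (MM N v (Suc K))) q"
    by (rule MM_MM(1)[OF cl K order_refl order_refl])
  show "cip (\<lambda>N. VV N K) (\<lambda>N v. ip N (MM N v (Suc K)) (ZZ N v s)) (\<beta> * (1 - q) * cc K s)" if s: "s \<in> {1..K}"
  proof -
    have "cip (\<lambda>N. VV N K) (\<lambda>N v. ip N (MM N v (Suc K)) (\<lambda>i. \<Sum>t=1..K. of_bool (t = s) * ZZ N v t i))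
      (\<integral>x. tanh (h + \<beta> * (\<Sum>t=1..K. cc K t * x t)) * (\<Sum>t=1..K. of_bool (t = s) * x t) \<partial>gprod {1..K})"
      unfolding MM_form[OF K order_refl] by (rule state_evolution[OF lip_Th lip_id]) (use cl in auto)
    then show ?thesis unfolding zs[OF s] sum_single[OF s] E_Th_x[OF K order_refl s] .
  qed
  have "cip (\<lambda>N. VV N K) (\<lambda>N v. ip N (\<lambda>i. lncosh (h + \<beta> * (\<Sum>s=1..K. cc K s * ZZ N v s i))) (\<lambda>_. 1))
      (\<integral>x. lncosh (h + \<beta> * (\<Sum>t=1..K. cc K t * x t)) * 1 \<partial>gprod {1..K})"
    by (rule state_evolution[OF lip_lncosh lip_const, of "cc K" "\<lambda>_. 0"]) (use cl in auto)
  then show "cip (\<lambda>N. VV N K) (\<lambda>N v. ip N (\<lambda>i. lncosh (h + \<beta> * (\<Sum>s=1..K. cc K s * ZZ N v s i))) (\<lambda>_. 1)) (EL \<beta> h q)"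
    unfolding mult_1_right E_lncosh[OF K order_refl] .
  show "cip (\<lambda>N. VV N K) (\<lambda>N v. ip N (ZZ N v s) (ZZ N v t)) (of_bool (s = t))" if s: "s \<in> {1..K}" and t: "t \<in> {1..K}"
  proof -
    have "cip (\<lambda>N. VV N K) (\<lambda>N v. ip N (\<lambda>i. \<Sum>r=1..K. of_bool (r = s) * ZZ N v r i) (\<lambda>i. \<Sum>r=1..K. of_bool (r = t) * ZZ N v r i))
      (\<integral>x. (\<Sum>r=1..K. of_bool (r = s) * x r) * (\<Sum>r=1..K. of_bool (r = t) * x r) \<partial>gprod {1..K})"
      by (rule state_evolution[OF lip_id lip_id]) (use cl in auto)
    then show ?thesis unfolding zs[OF s] zs[OF t] gprod_lin_prod[OF finite_atLeastAtMost] unfolding sum_single[OF s] .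
  qed
  show "cip (\<lambda>N. VV N K) (\<lambda>N v. ip N (PP N v s) (ZZ N v s)) 0" if s: "s \<in> {1..K}"
  proof (rule cip_whp_bound[OF whp_mono[OF whp_true[OF TrueI]]])
    show "cip (\<lambda>N. VV N K) (\<lambda>N v. \<bar>ip N (\<lambda>i. v s i) (PP N v s)\<bar> + \<bar>ip N (\<lambda>i. v s (N + i)) (PP N v s)\<bar>) 0"
      by (rule cip_cong[OF cip_add[OF fresh_ip(1)[OF s] fresh_ip(2)[OF s]]]) (use s in auto)
    show "\<forall>\<^sub>F N in sequentially. \<forall>v\<in>space (VV N K). True \<longrightarrow>
       \<bar>ip N (PP N v s) (ZZ N v s) - 0\<bar> \<le> \<bar>ip N (\<lambda>i. v s i) (PP N v s)\<bar> + \<bar>ip N (\<lambda>i. v s (N + i)) (PP N v s)\<bar>"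
      by (rule eventually_mono[OF eventually_ge_at_top[of 1]]) (use PP_ZZ[OF _ s] in auto)
  qed
qed

end

end

section \<open>Tilted spins\<close>

text \<open>The law of independent spins with means tanh of the local fields
  \<open>hv\<close>.\<close>

definition spin_wt :: "nat \<Rightarrow> vect \<Rightarrow> vect \<Rightarrow> real" where
  "spin_wt N hv \<sigma> = (\<Prod>i=1..N. exp (\<sigma> i * hv i) / (2 * cosh (hv i)))"

lemma spin_wt_nonneg: "spin_wt N hv \<sigma> \<ge> 0"
  unfolding spin_wt_def by (intro prod_nonneg) (auto simp: cosh_real_pos less_imp_le)

lemma spin_prod_sum:
  "(\<Sum>\<sigma>\<in>spins N. \<Prod>i=1..N. (f i (\<sigma> i) :: real)) = (\<Prod>i=1..N. f i (-1) + f i 1)"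
  by (subst prod_sum_PiE[symmetric]) auto

text \<open>The sum factors over sites, and each factor is the exponential of a second-order
  remainder of log cosh, which \<open>lncosh_increment_le\<close> bounds.\<close>

lemma spin_wt_mgf:
  "(\<Sum>\<sigma>\<in>spins N. spin_wt N hv \<sigma> * exp (\<Sum>i=1..N. (\<sigma> i - tanh (hv i)) * x i)) \<le> exp ((\<Sum>i=1..N. (x i)\<^sup>2) / 2)"
proof -
  have "(\<Sum>\<sigma>\<in>spins N. spin_wt N hv \<sigma> * exp (\<Sum>i=1..N. (\<sigma> i - tanh (hv i)) * x i))
      = (\<Sum>\<sigma>\<in>spins N. \<Prod>i=1..N. exp (\<sigma> i * hv i) / (2 * cosh (hv i)) * exp ((\<sigma> i - tanh (hv i)) * x i))"
    by (simp only: spin_wt_def exp_sum[OF finite_atLeastAtMost] prod.distrib)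
  also have "\<dots> = (\<Prod>i=1..N. exp (- hv i) / (2 * cosh (hv i)) * exp ((- 1 - tanh (hv i)) * x i)
      + exp (hv i) / (2 * cosh (hv i)) * exp ((1 - tanh (hv i)) * x i))"
    by (subst spin_prod_sum) simp
  also have "\<dots> \<le> (\<Prod>i=1..N. exp ((x i)\<^sup>2 / 2))"
  proof (rule prod_mono, intro conjI)
    fix i
    let ?c = "cosh (hv i)"
    have c: "?c > 0" by (rule cosh_real_pos)
    have "exp (- hv i) / (2 * ?c) * exp ((- 1 - tanh (hv i)) * x i) + exp (hv i) / (2 * ?c) * exp ((1 - tanh (hv i)) * x i)
       = (exp (hv i + x i) + exp (- (hv i + x i))) / 2 / ?c * exp (- (tanh (hv i) * x i))"
      using c by (simp add: field_simps flip: exp_add)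
    also have "\<dots> = exp (lncosh (hv i + x i) - lncosh (hv i) - tanh (hv i) * x i)"
    proof -
      have "exp (lncosh (hv i + x i) - lncosh (hv i) - tanh (hv i) * x i) = cosh (hv i + x i) / ?c * exp (- (tanh (hv i) * x i))"
        using c cosh_real_pos[of "hv i + x i"] by (simp add: exp_diff exp_minus divide_inverse)
      moreover have "(exp (hv i + x i) + exp (- (hv i + x i))) / 2 = cosh (hv i + x i)" by (simp add: cosh_def)
      ultimately show ?thesis by (simp only:)
    qed
    also have "\<dots> \<le> exp ((x i)\<^sup>2 / 2)" using lncosh_increment_le[of "hv i" "x i"] by simp
    finally show "exp (- hv i) / (2 * ?c) * exp ((- 1 - tanh (hv i)) * x i) + exp (hv i) / (2 * ?c) * exp ((1 - tanh (hv i)) * x i) \<le> exp ((x i)\<^sup>2 / 2)" .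
    show "0 \<le> exp (- hv i) / (2 * ?c) * exp ((- 1 - tanh (hv i)) * x i) + exp (hv i) / (2 * ?c) * exp ((1 - tanh (hv i)) * x i)"
      using c by simp
  qed
  also have "\<dots> = exp ((\<Sum>i=1..N. (x i)\<^sup>2) / 2)" by (simp add: exp_sum sum_divide_distrib)
  finally show ?thesis .
qed

lemma spin_wt_sum: "(\<Sum>\<sigma>\<in>spins N. spin_wt N hv \<sigma>) = 1"
proof -
  have "(\<Sum>\<sigma>\<in>spins N. spin_wt N hv \<sigma>) = (\<Prod>i=1..N. exp (- hv i) / (2 * cosh (hv i)) + exp (hv i) / (2 * cosh (hv i)))"
    unfolding spin_wt_def by (subst spin_prod_sum) simp
  also have "\<dots> = (\<Prod>i=1..N. 1)"
  proof (intro prod.cong refl)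
    fix i
    show "exp (- hv i) / (2 * cosh (hv i)) + exp (hv i) / (2 * cosh (hv i)) = 1"
    proof -
      have "exp (- hv i) + exp (hv i) = 2 * cosh (hv i)" by (simp add: cosh_def)
      then show ?thesis using cosh_real_pos[of "hv i"] by (simp flip: add_divide_distrib)
    qed
  qed
  finally show ?thesis by simp
qed

lemma exp_ip_spin_wt:
  assumes "N \<ge> 1"
  shows "exp (real N * ip N \<sigma> hv) = spin_wt N hv \<sigma> * (2 ^ N * exp (\<Sum>i=1..N. lncosh (hv i)))"
proof -
  have "exp (real N * ip N \<sigma> hv) = (\<Prod>i=1..N. exp (\<sigma> i * hv i))"
    using assms by (simp add: ip_def exp_sum)
  also have "\<dots> = (\<Prod>i=1..N. exp (\<sigma> i * hv i) / (2 * cosh (hv i)) * (2 * cosh (hv i)))"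
    by (intro prod.cong refl) (simp add: cosh_real_pos less_imp_neq[symmetric])
  also have "\<dots> = spin_wt N hv \<sigma> * (\<Prod>i=1..N. 2 * cosh (hv i))"
    unfolding spin_wt_def by (rule prod.distrib)
  also have "(\<Prod>i=1..N. 2 * cosh (hv i)) = 2 ^ N * exp (\<Sum>i=1..N. lncosh (hv i))"
    by (simp add: prod.distrib exp_sum cosh_real_pos)
  finally show ?thesis .
qed

text \<open>Gaussian linearisation of the squares reduces this to the moment generating function of the spins.\<close>

lemma spin_wt_exp_sq:
  assumes N: "N \<ge> 1" and [simp]: "finite J"
    and w: "\<And>a. ip N (\<lambda>i. \<Sum>j\<in>J. a j * w j i) (\<lambda>i. \<Sum>j\<in>J. a j * w j i) \<le> 3 / 8 * (\<Sum>j\<in>J. (a j)\<^sup>2)"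
  shows "(\<Sum>\<sigma>\<in>spins N. spin_wt N hv \<sigma> * exp (real N * (\<Sum>j\<in>J. (ip N (\<lambda>i. \<sigma> i - tanh (hv i)) (w j))\<^sup>2))) \<le> 2 ^ card J"
proof -
  \<comment> \<open>With this scaling, exp(N y^2) is the mean of exp(r y x) over a standard Gaussian
    x.\<close>
  define r where "r = sqrt (2 * real N)"
  have r2: "r * r = 2 * real N" by (simp add: r_def)
  define y where "y \<sigma> j = ip N (\<lambda>i. \<sigma> i - tanh (hv i)) (w j)" for \<sigma> j
  define l where "l \<sigma> x = exp (\<Sum>j\<in>J. (r * y \<sigma> j) * x j)" for \<sigma> x
  have lm [measurable]: "l \<sigma> \<in> borel_measurable (gprod J)" for \<sigma>
    unfolding l_def by (rule measurable_compose[OF lin_meas borel_measurable_exp])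
  have e: "ennreal (exp (real N * (\<Sum>j\<in>J. (y \<sigma> j)\<^sup>2))) = (\<integral>\<^sup>+x. ennreal (l \<sigma> x) \<partial>gprod J)" for \<sigma>
  proof -
    have "(\<Sum>j\<in>J. (r * y \<sigma> j)\<^sup>2) / 2 = real N * (\<Sum>j\<in>J. (y \<sigma> j)\<^sup>2)"
      unfolding power_mult_distrib power2_eq_square[of r] r2 by (simp flip: sum_distrib_left)
    then show ?thesis unfolding l_def by (subst gprod_mgf) simp_all
  qed
  have b: "(\<Sum>\<sigma>\<in>spins N. spin_wt N hv \<sigma> * l \<sigma> x) \<le> exp (3 / 8 * (\<Sum>j\<in>J. (x j)\<^sup>2))" for x
  proof -
    define X where "X i = (\<Sum>j\<in>J. x j * w j i)" for i
    have "(\<Sum>j\<in>J. (r * y \<sigma> j) * x j) = (\<Sum>i=1..N. (\<sigma> i - tanh (hv i)) * (r / real N * X i))" for \<sigma>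
    proof -
      have "(\<Sum>j\<in>J. (r * y \<sigma> j) * x j) = r * (\<Sum>j\<in>J. x j * y \<sigma> j)" by (simp add: sum_distrib_left mult_ac)
      also have "(\<Sum>j\<in>J. x j * y \<sigma> j) = ip N (\<lambda>i. \<sigma> i - tanh (hv i)) X"
        unfolding X_def y_def by (simp only: ip_sum_right ip_scale_right)
      finally show ?thesis by (simp add: ip_def sum_distrib_left sum_divide_distrib mult_ac)
    qed
    then have "(\<Sum>\<sigma>\<in>spins N. spin_wt N hv \<sigma> * l \<sigma> x) \<le> exp ((\<Sum>i=1..N. (r / real N * X i)\<^sup>2) / 2)"
      unfolding l_def using spin_wt_mgf[of N hv "\<lambda>i. r / real N * X i"] by simp
    also have "(\<Sum>i=1..N. (r / real N * X i)\<^sup>2) / 2 = ip N X X"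
      unfolding power_mult_distrib power_divide power2_eq_square[of r] r2 ip_def
      by (simp add: power2_eq_square sum_divide_distrib flip: sum_distrib_left)
    also have "exp (ip N X X) \<le> exp (3 / 8 * (\<Sum>j\<in>J. (x j)\<^sup>2))" using w[of x] unfolding X_def by simp
    finally show ?thesis by simp
  qed
  have "ennreal (\<Sum>\<sigma>\<in>spins N. spin_wt N hv \<sigma> * exp (real N * (\<Sum>j\<in>J. (y \<sigma> j)\<^sup>2)))
      = (\<Sum>\<sigma>\<in>spins N. ennreal (spin_wt N hv \<sigma>) * ennreal (exp (real N * (\<Sum>j\<in>J. (y \<sigma> j)\<^sup>2))))"
    by (subst sum_ennreal[symmetric]) (auto simp: spin_wt_nonneg ennreal_mult)
  also have "\<dots> = (\<Sum>\<sigma>\<in>spins N. \<integral>\<^sup>+x. ennreal (spin_wt N hv \<sigma>) * ennreal (l \<sigma> x) \<partial>gprod J)"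
    unfolding e by (intro sum.cong refl nn_integral_cmult[symmetric] measurable_compose[OF lm measurable_ennreal])
  also have "\<dots> = (\<integral>\<^sup>+x. (\<Sum>\<sigma>\<in>spins N. ennreal (spin_wt N hv \<sigma>) * ennreal (l \<sigma> x)) \<partial>gprod J)"
    by (rule nn_integral_sum[symmetric]) measurable
  also have "\<dots> = (\<integral>\<^sup>+x. ennreal (\<Sum>\<sigma>\<in>spins N. spin_wt N hv \<sigma> * l \<sigma> x) \<partial>gprod J)"
    by (intro nn_integral_cong) (subst sum_ennreal[symmetric], auto simp: spin_wt_nonneg ennreal_mult l_def)
  also have "\<dots> \<le> (\<integral>\<^sup>+x. ennreal (exp (3 / 8 * (\<Sum>j\<in>J. (x j)\<^sup>2))) \<partial>gprod J)"
    by (intro nn_integral_mono ennreal_leI b)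
  \<comment> \<open>The value 3/8 makes every auxiliary Gaussian contribute exactly the factor
    2.\<close>
  also have "\<dots> = ennreal ((1 / sqrt (1 - 2 * (3 / 8))) ^ card J)" by (rule gprod_exp_sq) auto
  also have "sqrt (1 - 2 * (3 / 8)) = (1 / 2 :: real)"
    by (rule real_sqrt_unique) (simp_all add: power2_eq_square)
  finally show ?thesis unfolding y_def by (subst (asm) ennreal_le_iff) auto
qed

lemma sum_split_three:
  fixes k :: nat
  shows "(\<Sum>j\<in>{0..2 * k}. f j) = f 0 + (\<Sum>s=1..k. f s) + (\<Sum>s=1..k. (f (k + s) :: 'a :: comm_monoid_add))"
proof -
  have "(\<Sum>j\<in>{0..2 * k}. f j) = f 0 + (\<Sum>j\<in>{1..k + k}. f j)"
    by (simp add: sum.atLeast_Suc_atMost mult_2)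
  also have "(\<Sum>j\<in>{1..k + k}. f j) = (\<Sum>s=1..k. f s) + (\<Sum>j\<in>{k + 1..k + k}. f j)"
    by (rule sum.ub_add_nat) simp
  also have "(\<Sum>j\<in>{k + 1..k + k}. f j) = (\<Sum>s=1..k. f (k + s))"
    using sum.shift_bounds_cl_nat_ivl[of f 1 k k] by (simp add: add.commute)
  finally show ?thesis by (simp add: add.assoc)
qed

lemma abs_sum_mult_le: "\<bar>\<Sum>s\<in>S. a s * b s\<bar> \<le> ((\<Sum>s\<in>S. (a s)\<^sup>2) + (\<Sum>s\<in>S. (b s)\<^sup>2)) / (2::real)"
proof -
  have ab: "\<bar>x * y\<bar> \<le> (x\<^sup>2 + y\<^sup>2) / 2" for x y :: real
    using sum_squares_bound[of "\<bar>x\<bar>" "\<bar>y\<bar>"] by (simp add: abs_mult)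
  have "\<bar>\<Sum>s\<in>S. a s * b s\<bar> \<le> (\<Sum>s\<in>S. ((a s)\<^sup>2 + (b s)\<^sup>2) / 2)"
    by (rule order_trans[OF sum_abs sum_mono]) (rule ab)
  then show ?thesis by (simp add: sum.distrib sum_divide_distrib add_divide_distrib)
qed

lemma sum_add_sq_le: "(\<Sum>s\<in>S. (a s + b s)\<^sup>2) \<le> 2 * (\<Sum>s\<in>S. (a s)\<^sup>2) + 2 * (\<Sum>s\<in>S. (b s :: real)\<^sup>2)"
proof -
  have "(x + y)\<^sup>2 \<le> 2 * x\<^sup>2 + 2 * y\<^sup>2" for x y :: real
    using sum_squares_bound[of x y] by (simp add: power2_sum)
  then have "(\<Sum>s\<in>S. (a s + b s)\<^sup>2) \<le> (\<Sum>s\<in>S. 2 * (a s)\<^sup>2 + 2 * (b s)\<^sup>2)" by (rule sum_mono)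
  then show ?thesis by (simp add: sum.distrib sum_distrib_left)
qed

lemma ip_spin: "N \<ge> 1 \<Longrightarrow> \<sigma> \<in> spins N \<Longrightarrow> ip N \<sigma> \<sigma> = 1"
proof -
  assume N: "N \<ge> 1" and s: "\<sigma> \<in> spins N"
  have "\<sigma> i * \<sigma> i = 1" if "i \<in> {1..N}" for i using PiE_mem[OF s that] by auto
  then have "(\<Sum>i=1..N. \<sigma> i * \<sigma> i) = (\<Sum>i=1..N. 1)" by (rule sum.cong[OF refl])
  then show ?thesis using N by (simp add: ip_def)
qed

lemma pjx_adjoint:
  assumes "orth N ph k" shows "ip N x (pjx N ph k y) = ip N (pjx N ph k x) (pjx N ph k y)"
proof -
  have "ip N x (pjx N ph k y) = ip N y x - (\<Sum>s=1..k. ip N y (ph s) * ip N (ph s) x)"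
    by (subst ip_commute) (rule pjx_ip)
  then show ?thesis
    unfolding pjx_norm[OF assms] by (simp add: ip_commute[of N y x] ip_commute[of N "ph _" x] mult.commute)
qed

text \<open>The identity part contributes 1, and in each row k entries with error at most 1/(2k) add
  at most 1/2.\<close>

lemma gram_bound:
  assumes k: "k \<ge> 1" and g: "\<And>s t. s \<in> {1..k} \<Longrightarrow> t \<in> {1..k} \<Longrightarrow> \<bar>ip N (ze s) (ze t) - of_bool (s = t)\<bar> \<le> 1 / (2 * real k)"
  shows "ip N (\<lambda>i. \<Sum>s=1..k. b s * ze s i) (\<lambda>i. \<Sum>s=1..k. b s * ze s i) \<le> 3 / 2 * (\<Sum>s=1..k. (b s)\<^sup>2)"
proof -
  have "ip N (\<lambda>i. \<Sum>s=1..k. b s * ze s i) (\<lambda>i. \<Sum>s=1..k. b s * ze s i) = (\<Sum>s=1..k. \<Sum>t=1..k. b s * (b t * ip N (ze s) (ze t)))"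
    by (simp only: ip_sum_left ip_sum_right ip_scale_left ip_scale_right sum_distrib_left)
  also have "\<dots> \<le> (\<Sum>s=1..k. \<Sum>t=1..k. of_bool (t = s) * (b s * b t) + ((b s)\<^sup>2 + (b t)\<^sup>2) / 2 * (1 / (2 * real k)))"
  proof (intro sum_mono)
    fix s t assume s: "s \<in> {1..k}" and t: "t \<in> {1..k}"
    have "b s * (b t * ip N (ze s) (ze t)) = of_bool (t = s) * (b s * b t) + (b s * b t) * (ip N (ze s) (ze t) - of_bool (s = t))"
      by (auto simp: algebra_simps)
    moreover have "(b s * b t) * (ip N (ze s) (ze t) - of_bool (s = t)) \<le> ((b s)\<^sup>2 + (b t)\<^sup>2) / 2 * (1 / (2 * real k))"
    proof (rule order_trans[OF abs_ge_self], unfold abs_mult, rule mult_mono)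
      show "\<bar>b s\<bar> * \<bar>b t\<bar> \<le> ((b s)\<^sup>2 + (b t)\<^sup>2) / 2"
        using sum_squares_bound[of "\<bar>b s\<bar>" "\<bar>b t\<bar>"] by simp
    qed (use g[OF s t] in auto)
    ultimately show "b s * (b t * ip N (ze s) (ze t)) \<le> of_bool (t = s) * (b s * b t) + ((b s)\<^sup>2 + (b t)\<^sup>2) / 2 * (1 / (2 * real k))"
      by linarith
  qed
  also have "\<dots> = (\<Sum>s=1..k. (b s)\<^sup>2) + (\<Sum>s=1..k. \<Sum>t=1..k. ((b s)\<^sup>2 + (b t)\<^sup>2)) / 2 * (1 / (2 * real k))"
  proof -
    have "(\<Sum>s=1..k. \<Sum>t=1..k. of_bool (t = s) * (b s * b t)) = (\<Sum>s=1..k. (b s)\<^sup>2)"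
      by (intro sum.cong refl) (simp only: sum_single power2_eq_square)
    moreover have "(\<Sum>s=1..k. \<Sum>t=1..k. ((b s)\<^sup>2 + (b t)\<^sup>2) / 2 * (1 / (2 * real k))) = (\<Sum>s=1..k. \<Sum>t=1..k. ((b s)\<^sup>2 + (b t)\<^sup>2)) / 2 * (1 / (2 * real k))"
      by (simp only: sum_divide_distrib sum_distrib_right)
    moreover have "(\<Sum>s=1..k. \<Sum>t=1..k. of_bool (t = s) * (b s * b t) + ((b s)\<^sup>2 + (b t)\<^sup>2) / 2 * (1 / (2 * real k)))
       = (\<Sum>s=1..k. \<Sum>t=1..k. of_bool (t = s) * (b s * b t)) + (\<Sum>s=1..k. \<Sum>t=1..k. ((b s)\<^sup>2 + (b t)\<^sup>2) / 2 * (1 / (2 * real k)))"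
      by (simp only: sum.distrib)
    ultimately show ?thesis by (simp only:)
  qed
  also have "(\<Sum>s=1..k. \<Sum>t=1..k. ((b s)\<^sup>2 + (b t)\<^sup>2)) = 2 * real k * (\<Sum>s=1..k. (b s)\<^sup>2)"
    by (simp add: sum.distrib sum_distrib_left mult.assoc)
  finally show ?thesis using k by (simp add: field_simps)
qed

section \<open>The exponent relative to the tilted spins\<close>

context hightemp
begin

context
  fixes N k :: nat and ph ze :: "nat \<Rightarrow> vect"
begin

abbreviation hv where "hv \<equiv> \<lambda>i. h + \<beta> * (\<Sum>s=1..k. cc k s * ze s i)"
abbreviation mt where "mt \<equiv> \<lambda>i. tanh (hv i)"
abbreviation Sg where "Sg \<equiv> SS \<beta> h N ph ze k"

text \<open>For the vectors of the recursion, \<open>Kap\<close> and \<open>PZ\<close> vanish as N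
  grows, but \<open>Del\<close> does not: the last entry of \<open>cc k\<close> is a square root,
  while the corresponding inner product tends to \<gamma>_k. Like \<open>Mres\<close>, whose limit
  is q - \<Gamma>_k^2, it becomes small only for large k.\<close>

definition Del where "Del = (\<Sum>s=1..k. (ip N mt (ph s) - cc k s)\<^sup>2)"
definition Kap where "Kap = (\<Sum>s=1..k. (ip N mt (ze s) - \<beta> * (1 - q) * cc k s)\<^sup>2)"
definition PZ where "PZ = (\<Sum>s=1..k. \<bar>ip N (ph s) (ze s)\<bar>)"
definition Mres where "Mres = ip N mt mt - (\<Sum>s=1..k. (ip N mt (ph s))\<^sup>2)"
text \<open>The factor 3 here and in \<open>Qs\<close> comes from \<open>SS_bound\<close>: squared
  deviations from \<open>cc k\<close> cost slightly more than \<beta> there, and they split, with a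
  factor 2, into a part random in \<sigma> and the part \<open>Del\<close>.\<close>

definition E0 where "E0 = 3 * \<beta> * Del + \<beta> * Kap + \<beta> * PZ"
definition Qs where "Qs \<sigma> = 3 * \<beta> * (\<Sum>s=1..k. (ip N (\<lambda>i. \<sigma> i - mt i) (ph s))\<^sup>2) + \<beta> * (\<Sum>s=1..k. (ip N (\<lambda>i. \<sigma> i - mt i) (ze s))\<^sup>2)"

context
  assumes N: "N \<ge> 1" and k: "k \<ge> 1" and o: "orth N ph k"
begin

text \<open>The terms linear in \<open>d\<close> cancel: this is the reason for centring \<open>\<langle>m, \<zeta>\<^sup>s\<rangle>\<close> at \<open>\<beta> (1 - q) c\<^sub>s\<close>.\<close>

lemma SS_bound:
  assumes s: "\<sigma> \<in> spins N"
  shows "\<bar>Sg \<sigma> - ip N \<sigma> hv - \<beta>\<^sup>2 * (1 - q)\<^sup>2 / 4\<bar> \<le> E0 + Qs \<sigma>"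
proof -
  define x where "x s = ip N \<sigma> (ph s)" for s
  define z where "z s = ip N \<sigma> (ze s)" for s
  define u where "u s = ip N (\<lambda>i. \<sigma> i - mt i) (ze s)" for s
  define y where "y s = ip N (\<lambda>i. \<sigma> i - mt i) (ph s)" for s
  define e where "e s = ip N mt (ph s) - cc k s" for s
  define f where "f s = ip N mt (ze s) - \<beta> * (1 - q) * cc k s" for s
  define d where "d s = x s - cc k s" for s
  define D where "D = (\<Sum>s=1..k. (d s)\<^sup>2)"
  define CD where "CD = (\<Sum>s=1..k. cc k s * d s)"
  define PX where "PX = (\<Sum>s=1..k. ip N (ph s) (ze s) * (x s)\<^sup>2)"
  have cq: "(\<Sum>s=1..k. (cc k s)\<^sup>2) = q" by (rule cc_norm) (use k in auto)
  have X2: "(\<Sum>s=1..k. (x s)\<^sup>2) \<le> 1"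
    using bessel[OF o, of \<sigma>] ip_spin[OF N s] by (simp add: x_def)
  have X2': "(\<Sum>s=1..k. (x s)\<^sup>2) = q + 2 * CD + D"
  proof -
    have "(\<Sum>s=1..k. (x s)\<^sup>2) = (\<Sum>s=1..k. (cc k s)\<^sup>2 + 2 * (cc k s * d s) + (d s)\<^sup>2)"
      by (intro sum.cong refl) (simp add: d_def power2_eq_square algebra_simps)
    then show ?thesis by (simp only: sum.distrib sum_distrib_left[symmetric] cq CD_def D_def)
  qed
  have pp: "ip N (pjx N ph k \<sigma>) (pjx N ph k \<sigma>) = 1 - (q + 2 * CD + D)"
    unfolding pjx_norm[OF o] ip_spin[OF N s] X2'[symmetric] x_def by (simp add: power2_eq_square)
  have "ip N \<sigma> hv = ip N \<sigma> (\<lambda>i. h * 1) + ip N \<sigma> (\<lambda>i. \<beta> * (\<Sum>s=1..k. cc k s * ze s i))"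
    by (simp only: ip_add_right mult_1_right)
  also have "\<dots> = h * ip N \<sigma> (\<lambda>_. 1) + \<beta> * (\<Sum>s=1..k. cc k s * z s)"
    unfolding z_def by (simp only: ip_scale_right ip_sum_right)
  finally have hz: "ip N \<sigma> hv = h * ip N \<sigma> (\<lambda>_. 1) + \<beta> * (\<Sum>s=1..k. cc k s * z s)" .
  have zz: "z s = u s + f s + \<beta> * (1 - q) * cc k s" for s
    by (simp add: z_def u_def f_def ip_diff_left)
  have xz: "(\<Sum>s=1..k. x s * z s) = (\<Sum>s=1..k. cc k s * z s) + ((\<Sum>s=1..k. d s * u s) + (\<Sum>s=1..k. d s * f s) + \<beta> * (1 - q) * CD)"
  proof -
    have "(\<Sum>s=1..k. x s * z s) = (\<Sum>s=1..k. cc k s * z s + (d s * u s + d s * f s + \<beta> * (1 - q) * (cc k s * d s)))"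
    proof (intro sum.cong refl)
      fix s
      have "x s * z s = cc k s * z s + d s * z s" by (simp add: d_def algebra_simps)
      also have "d s * z s = d s * u s + d s * f s + \<beta> * (1 - q) * (cc k s * d s)"
        unfolding zz by (simp only: distrib_left mult_ac)
      finally show "x s * z s = cc k s * z s + (d s * u s + d s * f s + \<beta> * (1 - q) * (cc k s * d s))" .
    qed
    then show ?thesis by (simp only: sum.distrib sum_distrib_left[symmetric] CD_def)
  qed
  define DU where "DU = (\<Sum>s=1..k. d s * u s)"
  define DF where "DF = (\<Sum>s=1..k. d s * f s)"
  define W where "W = 2 * CD + D"
  \<comment> \<open>The squared norm of the projected \<sigma> is 1 - q - \<open>W\<close>.
    Expanding its square yields the term -\<beta>^2 (1 - q) \<open>CD\<close>, which cancels the
    term with the opposite sign that the centring of \<open>z\<close> leaves in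
    \<open>xz\<close>.\<close>
  have id: "Sg \<sigma> - ip N \<sigma> hv - \<beta>\<^sup>2 * (1 - q)\<^sup>2 / 4
     = \<beta> * DU + \<beta> * DF - \<beta> / 2 * PX - \<beta>\<^sup>2 / 2 * (1 - q) * D + \<beta>\<^sup>2 / 4 * W\<^sup>2"
    unfolding SS_def pp hz x_def[symmetric] z_def[symmetric] PX_def[symmetric] xz DU_def[symmetric] DF_def[symmetric] W_def
    by (simp add: power2_eq_square field_simps)
  define U where "U = (\<Sum>s=1..k. (u s)\<^sup>2)"
  define Y where "Y = (\<Sum>s=1..k. (y s)\<^sup>2)"
  have D0: "D \<ge> 0" unfolding D_def by (simp add: sum_nonneg)
  have DU: "\<bar>DU\<bar> \<le> (D + U) / 2" unfolding DU_def D_def U_def by (rule abs_sum_mult_le)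
  have DF: "\<bar>DF\<bar> \<le> (D + Kap) / 2" unfolding DF_def D_def Kap_def f_def[symmetric] by (rule abs_sum_mult_le)
  have PX: "\<bar>PX\<bar> \<le> PZ"
    unfolding PX_def PZ_def
  proof (rule order_trans[OF sum_abs sum_mono])
    fix s assume s: "s \<in> {1..k}"
    have "(x s)\<^sup>2 \<le> (\<Sum>s=1..k. (x s)\<^sup>2)" by (rule member_le_sum[OF s]) auto
    then have "(x s)\<^sup>2 \<le> 1" using X2 by linarith
    from mult_left_mono[OF this abs_ge_zero[of "ip N (ph s) (ze s)"]]
    show "\<bar>ip N (ph s) (ze s) * (x s)\<^sup>2\<bar> \<le> \<bar>ip N (ph s) (ze s)\<bar>" by (simp add: abs_mult)
  qed
  have D4: "D \<le> 4"
  proof -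
    have "D \<le> 2 * (\<Sum>s=1..k. (x s)\<^sup>2) + 2 * (\<Sum>s=1..k. (- cc k s)\<^sup>2)"
      unfolding D_def d_def using sum_add_sq_le[of x "\<lambda>s. - cc k s" "{1..k}"] by simp
    then show ?thesis using X2 cq q_le_1 by simp
  qed
  \<comment> \<open>\<open>W\<close> contains the first-order term \<open>2 * CD\<close>, but its
    square is of second order: Cauchy-Schwarz with q \<le> 1 treats \<open>CD\<close>, and
    \<open>D4\<close> treats the square of \<open>D\<close>.\<close>
  have W: "W\<^sup>2 \<le> 16 * D"
  proof -
    have "CD\<^sup>2 \<le> q * D" unfolding CD_def D_def cq[symmetric] by (rule Cauchy_Schwarz_ineq_sum)
    also have "\<dots> \<le> 1 * D" by (rule mult_right_mono[OF q_le_1 D0])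
    finally have "CD\<^sup>2 \<le> D" by simp
    moreover have "D\<^sup>2 \<le> 4 * D" using mult_right_mono[OF D4 D0] by (simp add: power2_eq_square)
    moreover have "W\<^sup>2 \<le> 2 * (2 * CD)\<^sup>2 + 2 * D\<^sup>2"
      unfolding W_def using sum_squares_bound[of "2 * CD" D] by (simp add: power2_sum)
    ultimately show ?thesis by (simp add: power_mult_distrib)
  qed
  have DY: "D \<le> 2 * Y + 2 * Del"
  proof -
    have "d s = y s + e s" for s by (simp add: d_def y_def e_def x_def ip_diff_left)
    then show ?thesis unfolding D_def Y_def Del_def e_def[symmetric] by (simp only: sum_add_sq_le)
  qed
  have b2: "\<beta>\<^sup>2 \<le> \<beta> / 100" using mult_left_mono[OF beta_le, of \<beta>] beta_pos by (simp add: power2_eq_square)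
  have scale: "\<beta> * x \<le> \<beta> * y" "- (\<beta> * x) \<le> \<beta> * y" if "\<bar>x\<bar> \<le> y" for x y
    using that mult_left_mono[of x y \<beta>] mult_left_mono[of "- x" y \<beta>] beta_pos by auto
  have split: "\<beta> * ((D + U) / 2) = (\<beta> * D) / 2 + (\<beta> * U) / 2" "\<beta> * ((D + Kap) / 2) = (\<beta> * D) / 2 + (\<beta> * Kap) / 2"
    "\<beta> * (2 * Y + 2 * Del) = 2 * (\<beta> * Y) + 2 * (\<beta> * Del)" "\<beta> / 2 * PX = (\<beta> * PX) / 2"
    "3 * \<beta> * Del = 3 * (\<beta> * Del)" "\<beta> / 200 * D = (\<beta> * D) / 200" "\<beta> / 400 * (16 * D) = (\<beta> * D) / 25"
    by (simp_all add: algebra_simps add_divide_distrib)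
  note scale[OF DU, unfolded split] scale[OF DF, unfolded split] scale[OF PX]
  moreover have "0 \<le> \<beta>\<^sup>2 / 2 * (1 - q) * D" "\<beta>\<^sup>2 / 2 * (1 - q) * D \<le> \<beta> / 200 * D"
  proof -
    show "0 \<le> \<beta>\<^sup>2 / 2 * (1 - q) * D" using q_le_1 D0 by simp
    have "\<beta>\<^sup>2 / 2 * (1 - q) \<le> \<beta> / 200 * 1" by (rule mult_mono) (use b2 q_pos q_le_1 beta_pos in auto)
    then show "\<beta>\<^sup>2 / 2 * (1 - q) * D \<le> \<beta> / 200 * D" using D0 by (intro mult_right_mono) auto
  qed
  moreover have "0 \<le> \<beta>\<^sup>2 / 4 * W\<^sup>2" by simp
  moreover have "\<beta>\<^sup>2 / 4 * W\<^sup>2 \<le> \<beta> / 400 * (16 * D)"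
    by (rule mult_mono) (use b2 W beta_pos in auto)
  moreover have "\<beta> * D \<le> \<beta> * (2 * Y + 2 * Del)" using DY beta_pos by simp
  moreover have "0 \<le> \<beta> * Y" "0 \<le> \<beta> * Del" "0 \<le> \<beta> * U" "0 \<le> \<beta> * Kap" "0 \<le> \<beta> * PZ" "0 \<le> \<beta> * D"
    using beta_pos D0 by (auto intro!: mult_nonneg_nonneg sum_nonneg simp: Y_def Del_def U_def Kap_def PZ_def)
  moreover have "Qs \<sigma> = 3 * (\<beta> * Y) + \<beta> * U" by (simp add: Qs_def Y_def U_def y_def u_def)
  ultimately show ?thesis
    unfolding id E0_def split abs_le_iff by linarith
qed

text \<open>For fixed \<tau> the overlap is a linear form in \<sigma> - m, up to an error
  \<open>R\<close> due to the projection of m, whose squared norm is \<open>Mres\<close>. As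
  \<open>R\<close> is at most 3 times that norm, its square gives 9; the factor 2 from squaring a
  sum cancels the 1/2 in front.\<close>

lemma overlap_bound:
  assumes s: "\<sigma> \<in> spins N" and t: "\<tau> \<in> spins N"
  shows "\<beta>\<^sup>2 / 2 * (ip N (pjx N ph k \<sigma>) (pjx N ph k \<tau>))\<^sup>2
     \<le> (ip N (\<lambda>i. \<sigma> i - mt i) (\<lambda>i. \<beta> * pjx N ph k (\<lambda>i. \<tau> i - mt i) i))\<^sup>2 + 9 * \<beta>\<^sup>2 * Mres"
proof -
  let ?p = "pjx N ph k"
  let ?s = "\<lambda>i. \<sigma> i - mt i" and ?t = "\<lambda>i. \<tau> i - mt i"
  have pdiff: "?p (\<lambda>i. x i - y i) = (\<lambda>i. ?p x i - ?p y i)" for x y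
    by (simp add: pjx_def ip_diff_left left_diff_distrib sum_subtractf fun_eq_iff)
  have pn: "nrm N (?p x) \<le> nrm N x" for x
    unfolding nrm_def pjx_norm[OF o] by (intro real_sqrt_le_mono) (simp add: sum_nonneg)
  have sn: "nrm N x = 1" if "x \<in> spins N" for x using ip_spin[OF N that] by (simp add: nrm_def)
  have mn: "nrm N mt \<le> 1"
  proof -
    have "ip N mt mt \<le> (\<Sum>i=1..N. 1) / real N"
      unfolding ip_def by (intro divide_right_mono sum_mono) (auto simp flip: power2_eq_square)
    then show ?thesis using N by (simp add: nrm_def)
  qed
  have M: "nrm N (?p mt) * nrm N (?p mt) = Mres"
    using nrm_sq[of N "?p mt"] unfolding pjx_norm[OF o] by (simp add: Mres_def power2_eq_square)
  define R where "R = ip N (?p mt) (?p \<tau>) + ip N (?p ?s) (?p mt)"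
  have dec: "ip N (?p \<sigma>) (?p \<tau>) = ip N (?p ?s) (?p ?t) + R"
    unfolding R_def pdiff by (simp add: ip_diff_left ip_diff_right)
  have "\<bar>R\<bar> \<le> nrm N (?p mt) * 1 + 2 * nrm N (?p mt)"
  proof -
    have "nrm N (?p ?s) \<le> 2"
    proof -
      have "nrm N ?s \<le> nrm N \<sigma> + nrm N (\<lambda>i. - 1 * mt i)"
        using nrm_triangle[of N \<sigma> "\<lambda>i. - 1 * mt i"] by simp
      also have "nrm N (\<lambda>i. - 1 * mt i) = nrm N mt" by (subst nrm_scale) simp
      finally show ?thesis using sn[OF s] mn pn[of ?s] by linarith
    qed
    then have "\<bar>ip N (?p ?s) (?p mt)\<bar> \<le> 2 * nrm N (?p mt)"
      using abs_ip_le[of N "?p ?s" "?p mt"] mult_right_mono[of "nrm N (?p ?s)" 2 "nrm N (?p mt)"] by simp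
    moreover have "\<bar>ip N (?p mt) (?p \<tau>)\<bar> \<le> nrm N (?p mt) * 1"
      using abs_ip_le[of N "?p mt" "?p \<tau>"] mult_left_mono[of "nrm N (?p \<tau>)" 1 "nrm N (?p mt)"] pn[of \<tau>] sn[OF t] by simp
    ultimately show ?thesis unfolding R_def by linarith
  qed
  then have "\<bar>R\<bar> * \<bar>R\<bar> \<le> (3 * nrm N (?p mt)) * (3 * nrm N (?p mt))" by (intro mult_mono) auto
  then have R2: "R\<^sup>2 \<le> 9 * Mres" using M by (simp add: power2_eq_square)
  have "ip N ?s (?p ?t) = ip N (?p ?s) (?p ?t)"
    by (rule pjx_adjoint[OF o])
  moreover have "(ip N (?p \<sigma>) (?p \<tau>))\<^sup>2 \<le> 2 * (ip N (?p ?s) (?p ?t))\<^sup>2 + 2 * R\<^sup>2"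
    unfolding dec using sum_squares_bound[of "ip N (?p ?s) (?p ?t)" R] by (simp add: power2_sum)
  ultimately have "(ip N (?p \<sigma>) (?p \<tau>))\<^sup>2 \<le> 2 * (ip N ?s (?p ?t))\<^sup>2 + 18 * Mres" using R2 by simp
  from mult_left_mono[OF this, of "\<beta>\<^sup>2 / 2"] show ?thesis
    by (simp add: ip_scale_right power_mult_distrib algebra_simps)
qed

text \<open>This is \<open>spin_wt_exp_sq\<close> for 2k + 1 vectors: \<beta> v, and the vectors
  \<phi> and \<zeta> scaled by the square roots of their weights in \<open>Qs\<close>. Squaring a
  sum of three groups costs a factor 3, and smallness of \<beta> brings each group below
  3/8.\<close>

lemma spin_wt_quadratic:
  assumes gram: "\<And>b. ip N (\<lambda>i. \<Sum>s=1..k. b s * ze s i) (\<lambda>i. \<Sum>s=1..k. b s * ze s i) \<le> 3 / 2 * (\<Sum>s=1..k. (b s)\<^sup>2)"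
    and v: "nrm N v \<le> 2"
  shows "(\<Sum>\<sigma>\<in>spins N. spin_wt N hv \<sigma> * exp (real N * (Qs \<sigma> + (ip N (\<lambda>i. \<sigma> i - mt i) (\<lambda>i. \<beta> * v i))\<^sup>2))) \<le> 2 ^ (2 * k + 1)"
proof -
  define w where "w j i = (if j = 0 then \<beta> * v i else if j \<le> k then sqrt (3 * \<beta>) * ph j i else sqrt \<beta> * ze (j - k) i)" for j i
  have w1: "w 0 = (\<lambda>i. \<beta> * v i)" by (simp add: w_def fun_eq_iff)
  have w2: "w s = (\<lambda>i. sqrt (3 * \<beta>) * ph s i)" if "s \<in> {1..k}" for s using that by (simp add: w_def fun_eq_iff)
  have w3: "w (k + s) = (\<lambda>i. sqrt \<beta> * ze s i)" if "s \<in> {1..k}" for s using that by (simp add: w_def fun_eq_iff)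
  have "(\<Sum>\<sigma>\<in>spins N. spin_wt N hv \<sigma> * exp (real N * (\<Sum>j\<in>{0..2*k}. (ip N (\<lambda>i. \<sigma> i - tanh (hv i)) (w j))\<^sup>2))) \<le> 2 ^ card {0..2*k}"
  proof (rule spin_wt_exp_sq[OF N])
    fix a :: "nat \<Rightarrow> real"
    define A where "A = (\<Sum>s=1..k. (a s)\<^sup>2)"
    define B where "B = (\<Sum>s=1..k. (a (k + s))\<^sup>2)"
    define X where "X i = (\<Sum>s=1..k. a s * ph s i)" for i
    define Z where "Z i = (\<Sum>s=1..k. a (k + s) * ze s i)" for i
    have "(\<Sum>j\<in>{0..2*k}. a j * w j i) = (a 0 * \<beta>) * v i + (sqrt (3 * \<beta>) * X i + sqrt \<beta> * Z i)" for i
    proof -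
      have "(\<Sum>s=1..k. a s * w s i) = sqrt (3 * \<beta>) * X i"
        unfolding X_def sum_distrib_left by (intro sum.cong refl) (simp add: w2)
      moreover have "(\<Sum>s=1..k. a (k + s) * w (k + s) i) = sqrt \<beta> * Z i"
        unfolding Z_def sum_distrib_left by (intro sum.cong refl) (simp add: w3)
      ultimately show ?thesis unfolding sum_split_three by (simp add: w1)
    qed
    then have "nrm N (\<lambda>i. \<Sum>j\<in>{0..2*k}. a j * w j i) \<le> nrm N (\<lambda>i. (a 0 * \<beta>) * v i) + (nrm N (\<lambda>i. sqrt (3 * \<beta>) * X i) + nrm N (\<lambda>i. sqrt \<beta> * Z i))"
      by (simp only: order_trans[OF nrm_triangle add_left_mono[OF nrm_triangle]])
    also have "\<dots> \<le> 2 * \<beta> * \<bar>a 0\<bar> + (sqrt (3 * \<beta>) * nrm N X + sqrt \<beta> * nrm N Z)"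
    proof -
      have "\<bar>a 0\<bar> * \<beta> * nrm N v \<le> \<bar>a 0\<bar> * \<beta> * 2" by (rule mult_left_mono[OF v]) (use beta_pos in simp)
      then show ?thesis unfolding nrm_scale using beta_pos by (simp add: abs_mult mult_ac)
    qed
    finally have n: "nrm N (\<lambda>i. \<Sum>j\<in>{0..2*k}. a j * w j i) \<le> 2 * \<beta> * \<bar>a 0\<bar> + (sqrt (3 * \<beta>) * nrm N X + sqrt \<beta> * nrm N Z)" .
    have X: "(nrm N X)\<^sup>2 \<le> A"
    proof -
      have "ip N X X = (\<Sum>s=1..k. \<Sum>t=1..k. (a s * a t) * ip N (ph t) (ph s))"
        unfolding X_def by (simp only: ip_sum_left ip_sum_right ip_scale_left ip_scale_right sum_distrib_left mult.assoc ip_commute[of N "ph _" "ph _"])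
      also have "\<dots> = (\<Sum>s=1..k. (a s * a s) * ip N (ph s) (ph s))"
        by (intro sum.cong refl orth_sum_delta[OF o])
      also have "\<dots> \<le> (\<Sum>s=1..k. a s * a s * 1)"
      proof (intro sum_mono mult_left_mono)
        fix s assume "s \<in> {1..k}"
        from orth_ok[OF o this] show "ip N (ph s) (ph s) \<le> 1" unfolding ok_def by (elim disjE) simp_all
      qed simp
      finally show ?thesis unfolding nrm_sq A_def by (simp add: power2_eq_square)
    qed
    have Z: "(nrm N Z)\<^sup>2 \<le> 3 / 2 * B" unfolding nrm_sq B_def Z_def by (rule gram)
    have three: "(x + (y + z))\<^sup>2 \<le> 3 * (x\<^sup>2 + y\<^sup>2 + z\<^sup>2)" for x y z :: real
      using sum_squares_bound[of x y] sum_squares_bound[of x z] sum_squares_bound[of y z] by (simp add: power2_eq_square algebra_simps)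
    have "ip N (\<lambda>i. \<Sum>j\<in>{0..2*k}. a j * w j i) (\<lambda>i. \<Sum>j\<in>{0..2*k}. a j * w j i)
       \<le> (2 * \<beta> * \<bar>a 0\<bar> + (sqrt (3 * \<beta>) * nrm N X + sqrt \<beta> * nrm N Z))\<^sup>2"
      unfolding nrm_sq[symmetric] by (rule power_mono[OF n nrm_nonneg])
    also have "\<dots> \<le> 3 * ((2 * \<beta> * \<bar>a 0\<bar>)\<^sup>2 + (sqrt (3 * \<beta>) * nrm N X)\<^sup>2 + (sqrt \<beta> * nrm N Z)\<^sup>2)" by (rule three)
    also have "\<dots> = 12 * \<beta>\<^sup>2 * (a 0)\<^sup>2 + 9 * \<beta> * (nrm N X)\<^sup>2 + 3 * \<beta> * (nrm N Z)\<^sup>2"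
      using beta_pos by (simp add: power_mult_distrib)
    also have "\<dots> \<le> 3 / 8 * (a 0)\<^sup>2 + 3 / 8 * A + 3 / 8 * B"
    proof (intro add_mono)
      show "12 * \<beta>\<^sup>2 * (a 0)\<^sup>2 \<le> 3 / 8 * (a 0)\<^sup>2" using beta_sq by (intro mult_right_mono) auto
      have "9 * \<beta> * (nrm N X)\<^sup>2 \<le> 3 / 8 * (nrm N X)\<^sup>2" using beta_le by (intro mult_right_mono) auto
      then show "9 * \<beta> * (nrm N X)\<^sup>2 \<le> 3 / 8 * A" using X by linarith
      have "3 * \<beta> * (nrm N Z)\<^sup>2 \<le> 1 / 4 * (nrm N Z)\<^sup>2" using beta_le by (intro mult_right_mono) auto
      then show "3 * \<beta> * (nrm N Z)\<^sup>2 \<le> 3 / 8 * B" using Z by linarith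
    qed
    also have "\<dots> = 3 / 8 * (\<Sum>j\<in>{0..2*k}. (a j)\<^sup>2)" unfolding sum_split_three A_def B_def by simp
    finally show "ip N (\<lambda>i. \<Sum>j\<in>{0..2*k}. a j * w j i) (\<lambda>i. \<Sum>j\<in>{0..2*k}. a j * w j i) \<le> 3 / 8 * (\<Sum>j\<in>{0..2*k}. (a j)\<^sup>2)" .
  qed simp
  moreover have "(\<Sum>j\<in>{0..2*k}. (ip N (\<lambda>i. \<sigma> i - mt i) (w j))\<^sup>2) = Qs \<sigma> + (ip N (\<lambda>i. \<sigma> i - mt i) (\<lambda>i. \<beta> * v i))\<^sup>2" for \<sigma>
  proof -
    let ?x = "\<lambda>i. \<sigma> i - mt i"
    have "(\<Sum>s=1..k. (ip N ?x (w s))\<^sup>2) = 3 * \<beta> * (\<Sum>s=1..k. (ip N ?x (ph s))\<^sup>2)"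
      unfolding sum_distrib_left using beta_pos
      by (intro sum.cong refl) (simp only: w2 ip_scale_right power_mult_distrib real_sqrt_pow2 mult_nonneg_nonneg zero_le_numeral less_imp_le)
    moreover have "(\<Sum>s=1..k. (ip N ?x (w (k + s)))\<^sup>2) = \<beta> * (\<Sum>s=1..k. (ip N ?x (ze s))\<^sup>2)"
      unfolding sum_distrib_left using beta_pos
      by (intro sum.cong refl) (simp only: w3 ip_scale_right power_mult_distrib real_sqrt_pow2 less_imp_le)
    ultimately show ?thesis unfolding sum_split_three Qs_def w1 by simp
  qed
  ultimately show ?thesis by simp
qed

text \<open>Each configuration's field energy becomes a product weight, and the normalisations
  cancel 4^N. The prefactor already carries the limit 2 RS, so the remaining double sum only has to
  be trivial on the exponential scale up to small errors.\<close>

lemma Psi_factor: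
  "Psi \<beta> h N ph ze k = exp (2 * (\<Sum>i=1..N. lncosh (hv i)) + real N * (\<beta>\<^sup>2 * (1 - q)\<^sup>2 / 2))
     * (\<Sum>\<sigma>\<in>spins N. \<Sum>\<tau>\<in>spins N. spin_wt N hv \<sigma> * spin_wt N hv \<tau> *
         exp (real N * ((Sg \<sigma> - ip N \<sigma> hv - \<beta>\<^sup>2 * (1 - q)\<^sup>2 / 4) + (Sg \<tau> - ip N \<tau> hv - \<beta>\<^sup>2 * (1 - q)\<^sup>2 / 4)
           + \<beta>\<^sup>2 / 2 * (ip N (pjx N ph k \<sigma>) (pjx N ph k \<tau>))\<^sup>2)))"
proof -
  define L where "L = (\<Sum>i=1..N. lncosh (hv i))"
  define c where "c = \<beta>\<^sup>2 * (1 - q)\<^sup>2 / 4"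
  define R where "R \<sigma> = Sg \<sigma> - ip N \<sigma> hv - c" for \<sigma>
  define O2 where "O2 \<sigma> \<tau> = \<beta>\<^sup>2 / 2 * (ip N (pjx N ph k \<sigma>) (pjx N ph k \<tau>))\<^sup>2" for \<sigma> \<tau>
  have t: "exp (real N * (Sg \<sigma> + Sg \<tau> + O2 \<sigma> \<tau>)) / 4 ^ N
     = exp (2 * L + real N * (2 * c)) * (spin_wt N hv \<sigma> * spin_wt N hv \<tau> * exp (real N * (R \<sigma> + R \<tau> + O2 \<sigma> \<tau>)))" for \<sigma> \<tau>
  proof -
    have "real N * (Sg \<sigma> + Sg \<tau> + O2 \<sigma> \<tau>) = real N * ip N \<sigma> hv + real N * ip N \<tau> hv + real N * (2 * c) + real N * (R \<sigma> + R \<tau> + O2 \<sigma> \<tau>)"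
      by (simp add: R_def algebra_simps)
    then have e1: "exp (real N * (Sg \<sigma> + Sg \<tau> + O2 \<sigma> \<tau>))
      = (spin_wt N hv \<sigma> * (2 ^ N * exp L)) * (spin_wt N hv \<tau> * (2 ^ N * exp L)) * exp (real N * (2 * c)) * exp (real N * (R \<sigma> + R \<tau> + O2 \<sigma> \<tau>))"
      by (simp only: exp_add exp_ip_spin_wt[OF N, of _ hv] L_def)
    have e2: "4 ^ N = (2::real) ^ N * 2 ^ N" by (simp flip: power_mult_distrib)
    have regroup: "(a * (t * l)) * (b * (t * l)) * c * d = (t * t) * (l * l * c * (a * b * d))" for a b c d t l :: real
      by (simp only: mult_ac)
    have "exp (real N * (Sg \<sigma> + Sg \<tau> + O2 \<sigma> \<tau>))
      = 4 ^ N * (exp L * exp L * exp (real N * (2 * c)) * (spin_wt N hv \<sigma> * spin_wt N hv \<tau> * exp (real N * (R \<sigma> + R \<tau> + O2 \<sigma> \<tau>))))"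
      unfolding e1 e2 by (rule regroup)
    moreover have "exp (2 * L + real N * (2 * c)) = exp L * exp L * exp (real N * (2 * c))"
    proof -
      have "2 * L + real N * (2 * c) = L + L + real N * (2 * c)" by simp
      then show ?thesis by (simp only: exp_add)
    qed
    ultimately show ?thesis by simp
  qed
  have main: "Psi \<beta> h N ph ze k = exp (2 * L + real N * (2 * c)) * (\<Sum>\<sigma>\<in>spins N. \<Sum>\<tau>\<in>spins N. spin_wt N hv \<sigma> * spin_wt N hv \<tau> *
      exp (real N * (R \<sigma> + R \<tau> + O2 \<sigma> \<tau>)))"
    unfolding Psi_def sum_divide_distrib O2_def[symmetric] t by (simp only: sum_distrib_left)
  have c2: "2 * (\<beta>\<^sup>2 * (1 - q)\<^sup>2 / 4) = \<beta>\<^sup>2 * (1 - q)\<^sup>2 / 2" by simp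
  show ?thesis using main unfolding L_def R_def O2_def c_def c2 .
qed

text \<open>For the upper bound, the sum over \<sigma> is taken first with \<tau> fixed, where the
  overlap acts as one more linear form, with a bound uniform in \<tau>; the sum over \<tau> then has
  no overlap left. For the lower bound the overlap term is dropped, and the double sum becomes a
  square.\<close>

lemma Psi_bounds:
  assumes gram: "\<And>b. ip N (\<lambda>i. \<Sum>s=1..k. b s * ze s i) (\<lambda>i. \<Sum>s=1..k. b s * ze s i) \<le> 3 / 2 * (\<Sum>s=1..k. (b s)\<^sup>2)"
  shows "\<bar>1 / real N * ln (Psi \<beta> h N ph ze k) - 2 * ip N (\<lambda>i. lncosh (hv i)) (\<lambda>_. 1) - \<beta>\<^sup>2 * (1 - q)\<^sup>2 / 2\<bar>
    \<le> 2 * E0 + 9 * \<beta>\<^sup>2 * Mres + (4 * real k + 2) * ln 2 / real N"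
proof -
  define L where "L = (\<Sum>i=1..N. lncosh (hv i))"
  define R where "R \<sigma> = Sg \<sigma> - ip N \<sigma> hv - \<beta>\<^sup>2 * (1 - q)\<^sup>2 / 4" for \<sigma>
  define O2 where "O2 \<sigma> \<tau> = \<beta>\<^sup>2 / 2 * (ip N (pjx N ph k \<sigma>) (pjx N ph k \<tau>))\<^sup>2" for \<sigma> \<tau>
  define p where "p = spin_wt N hv"
  define F where "F = (\<Sum>\<sigma>\<in>spins N. \<Sum>\<tau>\<in>spins N. p \<sigma> * p \<tau> * exp (real N * (R \<sigma> + R \<tau> + O2 \<sigma> \<tau>)))"
  define A :: real where "A = 2 ^ (2 * k + 1)"
  have A: "A > 0" by (simp add: A_def)
  have p0: "p \<sigma> \<ge> 0" for \<sigma> by (simp add: p_def spin_wt_nonneg)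
  have p1: "(\<Sum>\<sigma>\<in>spins N. p \<sigma>) = 1" unfolding p_def by (rule spin_wt_sum)
  have R: "\<bar>R \<sigma>\<bar> \<le> E0 + Qs \<sigma>" if "\<sigma> \<in> spins N" for \<sigma> unfolding R_def by (rule SS_bound[OF that])
  have Mres: "Mres \<ge> 0" unfolding Mres_def using bessel[OF o, of mt] by simp
  have HS: "(\<Sum>\<sigma>\<in>spins N. p \<sigma> * exp (real N * (Qs \<sigma> + (ip N (\<lambda>i. \<sigma> i - mt i) (\<lambda>i. \<beta> * v i))\<^sup>2))) \<le> A" if "nrm N v \<le> 2" for v
    unfolding p_def A_def by (rule spin_wt_quadratic[OF gram that])
  have HS0: "(\<Sum>\<sigma>\<in>spins N. p \<sigma> * exp (real N * Qs \<sigma>)) \<le> A"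
    using HS[of "\<lambda>_. 0"] by (simp add: nrm_def)
  have vn: "nrm N (pjx N ph k (\<lambda>i. \<tau> i - mt i)) \<le> 2" if t: "\<tau> \<in> spins N" for \<tau>
  proof -
    have "nrm N (pjx N ph k (\<lambda>i. \<tau> i - mt i)) \<le> nrm N (\<lambda>i. \<tau> i - mt i)"
      unfolding nrm_def pjx_norm[OF o] by (intro real_sqrt_le_mono) (simp add: sum_nonneg)
    also have "nrm N (\<lambda>i. \<tau> i - mt i) \<le> nrm N \<tau> + nrm N (\<lambda>i. - 1 * mt i)"
      using nrm_triangle[of N \<tau> "\<lambda>i. - 1 * mt i"] by simp
    also have "nrm N (\<lambda>i. - 1 * mt i) = nrm N mt" by (subst nrm_scale) simp
    also have "nrm N mt \<le> 1"
    proof -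
      have "ip N mt mt \<le> (\<Sum>i=1..N. 1) / real N"
        unfolding ip_def by (intro divide_right_mono sum_mono) (auto simp flip: power2_eq_square)
      then show ?thesis using N by (simp add: nrm_def)
    qed
    also have "nrm N \<tau> = 1" using ip_spin[OF N t] by (simp add: nrm_def)
    finally show ?thesis by simp
  qed
  have up: "F \<le> exp (real N * (2 * E0 + 9 * \<beta>\<^sup>2 * Mres)) * (A * A)"
  proof -
    define B where "B = exp (real N * (2 * E0 + 9 * \<beta>\<^sup>2 * Mres))"
    define G where "G \<sigma> \<tau> = exp (real N * (Qs \<sigma> + (ip N (\<lambda>i. \<sigma> i - mt i) (\<lambda>i. \<beta> * pjx N ph k (\<lambda>i. \<tau> i - mt i) i))\<^sup>2))" for \<sigma> \<tau>
    have "F \<le> (\<Sum>\<sigma>\<in>spins N. \<Sum>\<tau>\<in>spins N. B * ((p \<tau> * exp (real N * Qs \<tau>)) * (p \<sigma> * G \<sigma> \<tau>)))"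
      unfolding F_def
    proof (intro sum_mono)
      fix \<sigma> \<tau> assume s: "\<sigma> \<in> spins N" and t: "\<tau> \<in> spins N"
      have "R \<sigma> + R \<tau> + O2 \<sigma> \<tau> \<le> (2 * E0 + 9 * \<beta>\<^sup>2 * Mres) + Qs \<tau>
          + (Qs \<sigma> + (ip N (\<lambda>i. \<sigma> i - mt i) (\<lambda>i. \<beta> * pjx N ph k (\<lambda>i. \<tau> i - mt i) i))\<^sup>2)"
        using R[OF s] R[OF t] overlap_bound[OF s t] unfolding O2_def by (simp only: abs_le_iff) linarith
      from mult_left_mono[OF this, of "real N"]
      have "exp (real N * (R \<sigma> + R \<tau> + O2 \<sigma> \<tau>)) \<le> B * exp (real N * Qs \<tau>) * G \<sigma> \<tau>"
        unfolding B_def G_def by (simp only: exp_add[symmetric] distrib_left[symmetric] exp_le_cancel_iff of_nat_0_le_iff)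
      from mult_left_mono[OF this, of "p \<sigma> * p \<tau>"]
      show "p \<sigma> * p \<tau> * exp (real N * (R \<sigma> + R \<tau> + O2 \<sigma> \<tau>)) \<le> B * ((p \<tau> * exp (real N * Qs \<tau>)) * (p \<sigma> * G \<sigma> \<tau>))"
        using p0 by (simp add: mult_ac)
    qed
    also have "\<dots> = (\<Sum>\<tau>\<in>spins N. \<Sum>\<sigma>\<in>spins N. B * ((p \<tau> * exp (real N * Qs \<tau>)) * (p \<sigma> * G \<sigma> \<tau>)))" by (rule sum.swap)
    also have "\<dots> = B * (\<Sum>\<tau>\<in>spins N. (p \<tau> * exp (real N * Qs \<tau>)) * (\<Sum>\<sigma>\<in>spins N. p \<sigma> * G \<sigma> \<tau>))"
      by (simp only: sum_distrib_left)
    also have "\<dots> \<le> B * (\<Sum>\<tau>\<in>spins N. (p \<tau> * exp (real N * Qs \<tau>)) * A)"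
      unfolding G_def by (intro mult_left_mono sum_mono HS vn) (auto simp: p0 B_def)
    also have "\<dots> = B * ((\<Sum>\<tau>\<in>spins N. p \<tau> * exp (real N * Qs \<tau>)) * A)" by (simp only: sum_distrib_right)
    also have "\<dots> \<le> B * (A * A)"
      using HS0 A by (intro mult_left_mono mult_right_mono) (auto simp: B_def)
    finally show ?thesis unfolding B_def .
  qed
  have lo: "F \<ge> exp (- (real N * (2 * E0 + 9 * \<beta>\<^sup>2 * Mres))) / (A * A)"
  proof -
    define T where "T = (\<Sum>\<sigma>\<in>spins N. p \<sigma> * exp (real N * R \<sigma>))"
    have T: "T \<ge> exp (- (real N * E0)) * (1 / A)"
    proof -
      \<comment> \<open>The tangent to 1/y at y = A, with y = exp x. Averaged under weights for
        which the mean of exp x is at most A, it bounds the mean of exp(-x) below by 1/A, as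
        Jensen's inequality would.\<close>
      have "2 / A - exp x / A\<^sup>2 \<le> exp (- x)" for x
      proof -
        have a: "2 * (exp (x / 2) / A) * exp (- x / 2) \<le> (exp (x / 2) / A)\<^sup>2 + (exp (- x / 2))\<^sup>2" by (rule sum_squares_bound)
        have "exp (x / 2) * exp (- x / 2) = 1" by (simp flip: exp_add)
        then have b: "2 * (exp (x / 2) / A) * exp (- x / 2) = 2 / A" by simp
        have c: "(exp (x / 2))\<^sup>2 = exp x" "(exp (- x / 2))\<^sup>2 = exp (- x)" by (simp_all flip: exp_of_nat_mult)
        show ?thesis using a unfolding b power_divide c by simp
      qed
      then have "(\<Sum>\<sigma>\<in>spins N. p \<sigma> * (2 / A - exp (real N * Qs \<sigma>) / A\<^sup>2)) \<le> (\<Sum>\<sigma>\<in>spins N. p \<sigma> * exp (- (real N * Qs \<sigma>)))"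
        by (intro sum_mono mult_left_mono p0)
      moreover have "(\<Sum>\<sigma>\<in>spins N. p \<sigma> * (2 / A - exp (real N * Qs \<sigma>) / A\<^sup>2))
          = (\<Sum>\<sigma>\<in>spins N. p \<sigma>) * (2 / A) - (\<Sum>\<sigma>\<in>spins N. p \<sigma> * exp (real N * Qs \<sigma>)) / A\<^sup>2"
        by (simp only: right_diff_distrib sum_subtractf sum_distrib_right sum_divide_distrib times_divide_eq_right)
      moreover have "(\<Sum>\<sigma>\<in>spins N. p \<sigma> * exp (real N * Qs \<sigma>)) / A\<^sup>2 \<le> A / A\<^sup>2"
        by (rule divide_right_mono[OF HS0]) simp
      moreover have "A / A\<^sup>2 = 1 / A" using A by (simp add: power2_eq_square)
      ultimately have a: "1 / A \<le> (\<Sum>\<sigma>\<in>spins N. p \<sigma> * exp (- (real N * Qs \<sigma>)))" unfolding p1 by simp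
      have "exp (- (real N * E0)) * (1 / A) \<le> exp (- (real N * E0)) * (\<Sum>\<sigma>\<in>spins N. p \<sigma> * exp (- (real N * Qs \<sigma>)))"
        by (rule mult_left_mono[OF a]) simp
      also have "\<dots> = (\<Sum>\<sigma>\<in>spins N. p \<sigma> * exp (real N * - (E0 + Qs \<sigma>)))"
        unfolding sum_distrib_left by (intro sum.cong refl) (simp add: algebra_simps flip: exp_add)
      also have "\<dots> \<le> T"
        unfolding T_def
      proof (intro sum_mono mult_left_mono p0)
        fix \<sigma> assume "\<sigma> \<in> spins N"
        from R[OF this] have "- (E0 + Qs \<sigma>) \<le> R \<sigma>" by linarith
        then show "exp (real N * - (E0 + Qs \<sigma>)) \<le> exp (real N * R \<sigma>)" by (simp only: exp_le_cancel_iff mult_left_mono of_nat_0_le_iff)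
      qed
      finally show ?thesis .
    qed
    have "exp (- (real N * (2 * E0 + 9 * \<beta>\<^sup>2 * Mres))) / (A * A) \<le> exp (- (real N * E0) + - (real N * E0)) / (A * A)"
      using Mres A by (intro divide_right_mono) (auto simp: algebra_simps)
    also have "\<dots> = (exp (- (real N * E0)) * (1 / A)) * (exp (- (real N * E0)) * (1 / A))" by (simp only: exp_add) simp
    also have "\<dots> \<le> T * T" by (intro mult_mono T order_trans[OF _ T]) (use A in auto)
    also have "\<dots> = (\<Sum>\<sigma>\<in>spins N. \<Sum>\<tau>\<in>spins N. (p \<sigma> * exp (real N * R \<sigma>)) * (p \<tau> * exp (real N * R \<tau>)))"
      unfolding T_def by (rule sum_product)
    also have "\<dots> \<le> F"
      unfolding F_def
    proof (intro sum_mono)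
      fix \<sigma> \<tau> :: vect
      have "O2 \<sigma> \<tau> \<ge> 0" by (simp add: O2_def)
      then have "real N * R \<sigma> + real N * R \<tau> \<le> real N * (R \<sigma> + R \<tau> + O2 \<sigma> \<tau>)" by (simp add: distrib_left)
      then have "exp (real N * R \<sigma>) * exp (real N * R \<tau>) \<le> exp (real N * (R \<sigma> + R \<tau> + O2 \<sigma> \<tau>))" by (simp only: exp_add[symmetric] exp_le_cancel_iff)
      from mult_left_mono[OF this, of "p \<sigma> * p \<tau>"]
      show "(p \<sigma> * exp (real N * R \<sigma>)) * (p \<tau> * exp (real N * R \<tau>)) \<le> p \<sigma> * p \<tau> * exp (real N * (R \<sigma> + R \<tau> + O2 \<sigma> \<tau>))"
        using p0 by (simp add: mult_ac)
    qed
    finally show ?thesis .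
  qed
  have F0: "F > 0" by (rule less_le_trans[OF _ lo]) (use A in simp)
  have "Psi \<beta> h N ph ze k = exp (2 * L + real N * (\<beta>\<^sup>2 * (1 - q)\<^sup>2 / 2)) * F"
    unfolding F_def p_def R_def O2_def L_def by (rule Psi_factor)
  then have lnPsi: "ln (Psi \<beta> h N ph ze k) = 2 * L + real N * (\<beta>\<^sup>2 * (1 - q)\<^sup>2 / 2) + ln F"
    using F0 by (simp add: ln_mult)
  have lnAA: "ln (A * A) = (4 * real k + 2) * ln 2"
  proof -
    have "A * A = 2 ^ (4 * k + 2)" by (simp add: A_def flip: power_add)
    then show ?thesis by (simp only: ln_realpow of_nat_add of_nat_mult of_nat_numeral zero_less_numeral)
  qed
  have "ln F \<le> ln (exp (real N * (2 * E0 + 9 * \<beta>\<^sup>2 * Mres)) * (A * A))" using F0 up A by (subst ln_le_cancel_iff) auto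
  then have u: "ln F \<le> real N * (2 * E0 + 9 * \<beta>\<^sup>2 * Mres) + (4 * real k + 2) * ln 2"
    using A lnAA by (subst (asm) ln_mult_pos) auto
  have "ln (exp (- (real N * (2 * E0 + 9 * \<beta>\<^sup>2 * Mres))) / (A * A)) \<le> ln F" using F0 lo A by (subst ln_le_cancel_iff) auto
  then have l: "- (real N * (2 * E0 + 9 * \<beta>\<^sup>2 * Mres)) - (4 * real k + 2) * ln 2 \<le> ln F"
    using A lnAA by (subst (asm) ln_divide_pos) auto
  have ipL: "ip N (\<lambda>i. lncosh (hv i)) (\<lambda>_. 1) = L / real N" by (simp add: ip_def L_def)
  have "1 / real N * ln (Psi \<beta> h N ph ze k) - 2 * ip N (\<lambda>i. lncosh (hv i)) (\<lambda>_. 1) - \<beta>\<^sup>2 * (1 - q)\<^sup>2 / 2 = ln F / real N"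
    unfolding lnPsi ipL using N by (simp add: field_simps)
  also have "\<bar>\<dots>\<bar> \<le> (real N * (2 * E0 + 9 * \<beta>\<^sup>2 * Mres) + (4 * real k + 2) * ln 2) / real N"
    unfolding abs_divide abs_of_nat by (rule divide_right_mono) (use u l in \<open>auto simp: abs_le_iff\<close>)
  also have "\<dots> = 2 * E0 + 9 * \<beta>\<^sup>2 * Mres + (4 * real k + 2) * ln 2 / real N"
    using N by (simp add: add_divide_distrib)
  finally show ?thesis .
qed

text \<open>Free of the near-orthonormality of \<zeta> that \<open>Psi_bounds\<close> relies on, so
  it controls the integrand on the exceptional set as well.\<close>

lemma Psi_crude:
  assumes pn: "\<And>s. s \<in> {1..k} \<Longrightarrow> nrm N (ph s) \<le> 1"
  shows "\<bar>1 / real N * ln (Psi \<beta> h N ph ze k)\<bar> \<le> 2 * h + 3 + 4 * (\<Sum>s=1..k. nrm N (ze s))"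
proof -
  define S where "S = (\<Sum>s=1..k. nrm N (ze s))"
  have S0: "S \<ge> 0" unfolding S_def by (simp add: sum_nonneg)
  have sn: "nrm N x = 1" if "x \<in> spins N" for x using ip_spin[OF N that] by (simp add: nrm_def)
  have pjn: "nrm N (pjx N ph k x) \<le> nrm N x" for x
    unfolding nrm_def pjx_norm[OF o] by (intro real_sqrt_le_mono) (simp add: sum_nonneg)
  have pj1: "(ip N (pjx N ph k x) (pjx N ph k y))\<^sup>2 \<le> 1" if "x \<in> spins N" "y \<in> spins N" for x y
  proof -
    have "\<bar>ip N (pjx N ph k x) (pjx N ph k y)\<bar> \<le> nrm N (pjx N ph k x) * nrm N (pjx N ph k y)" by (rule abs_ip_le)
    also have "\<dots> \<le> 1 * 1" by (intro mult_mono) (use pjn[of x] pjn[of y] sn[OF that(1)] sn[OF that(2)] in auto)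
    finally show ?thesis by (simp add: abs_square_le_1)
  qed
  have Sg: "\<bar>Sg \<sigma>\<bar> \<le> h + 1 + 2 * S" if s: "\<sigma> \<in> spins N" for \<sigma>
  proof -
    have x1: "\<bar>ip N \<sigma> (ph s)\<bar> \<le> 1" if "s \<in> {1..k}" for s
      using abs_ip_le[of N \<sigma> "ph s"] pn[OF that] sn[OF s] by simp
    have one: "nrm N (\<lambda>_. 1) = 1" using N by (simp add: nrm_def ip_def)
    have "\<bar>ip N \<sigma> (\<lambda>_. 1)\<bar> \<le> 1" using abs_ip_le[of N \<sigma> "\<lambda>_. 1"] sn[OF s] one by simp
    then have a: "\<bar>h * ip N \<sigma> (\<lambda>_. 1)\<bar> \<le> h" using h_pos by (simp add: abs_mult)
    have "\<bar>\<Sum>s=1..k. ip N \<sigma> (ph s) * ip N \<sigma> (ze s)\<bar> \<le> S"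
      unfolding S_def
    proof (rule order_trans[OF sum_abs sum_mono])
      fix t assume t: "t \<in> {1..k}"
      have "\<bar>ip N \<sigma> (ph t)\<bar> * \<bar>ip N \<sigma> (ze t)\<bar> \<le> 1 * nrm N (ze t)"
        by (intro mult_mono x1 t) (use abs_ip_le[of N \<sigma> "ze t"] sn[OF s] in auto)
      then show "\<bar>ip N \<sigma> (ph t) * ip N \<sigma> (ze t)\<bar> \<le> nrm N (ze t)" by (simp add: abs_mult)
    qed
    then have "\<beta> * \<bar>\<Sum>s=1..k. ip N \<sigma> (ph s) * ip N \<sigma> (ze s)\<bar> \<le> 1 * S" using beta_pos beta_le by (intro mult_mono) auto
    then have b: "\<bar>\<beta> * (\<Sum>s=1..k. ip N \<sigma> (ph s) * ip N \<sigma> (ze s))\<bar> \<le> S" using beta_pos by (simp add: abs_mult)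
    have "\<bar>\<Sum>s=1..k. ip N (ph s) (ze s) * (ip N \<sigma> (ph s))\<^sup>2\<bar> \<le> S"
      unfolding S_def
    proof (rule order_trans[OF sum_abs sum_mono])
      fix t assume t: "t \<in> {1..k}"
      have "\<bar>ip N (ph t) (ze t)\<bar> \<le> nrm N (ze t)"
        using abs_ip_le[of N "ph t" "ze t"] mult_right_mono[OF pn[OF t] nrm_nonneg[of N "ze t"]] by simp
      then have "\<bar>ip N (ph t) (ze t)\<bar> * (ip N \<sigma> (ph t))\<^sup>2 \<le> nrm N (ze t) * 1"
        by (intro mult_mono) (use x1[OF t] in \<open>auto simp: abs_square_le_1\<close>)
      then show "\<bar>ip N (ph t) (ze t) * (ip N \<sigma> (ph t))\<^sup>2\<bar> \<le> nrm N (ze t)" by (simp add: abs_mult)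
    qed
    then have "\<beta> / 2 * \<bar>\<Sum>s=1..k. ip N (ph s) (ze s) * (ip N \<sigma> (ph s))\<^sup>2\<bar> \<le> 1 * S" using beta_pos beta_le by (intro mult_mono) auto
    then have c: "\<bar>\<beta> / 2 * (\<Sum>s=1..k. ip N (ph s) (ze s) * (ip N \<sigma> (ph s))\<^sup>2)\<bar> \<le> S" using beta_pos by (simp add: abs_mult)
    have "\<beta>\<^sup>2 / 4 * (ip N (pjx N ph k \<sigma>) (pjx N ph k \<sigma>))\<^sup>2 \<le> 1 * 1"
      by (intro mult_mono pj1 s) (use beta_sq in auto)
    moreover have "0 \<le> \<beta>\<^sup>2 / 4 * (ip N (pjx N ph k \<sigma>) (pjx N ph k \<sigma>))\<^sup>2" by simp
    ultimately show ?thesis using a b c unfolding SS_def by (simp only: abs_le_iff) linarith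
  qed
  define B where "B = 2 * h + 3 + 4 * S"
  define X where "X \<sigma> \<tau> = Sg \<sigma> + Sg \<tau> + \<beta>\<^sup>2 / 2 * (ip N (pjx N ph k \<sigma>) (pjx N ph k \<tau>))\<^sup>2" for \<sigma> \<tau>
  have X: "\<bar>X \<sigma> \<tau>\<bar> \<le> B" if s: "\<sigma> \<in> spins N" and t: "\<tau> \<in> spins N" for \<sigma> \<tau>
  proof -
    have "\<beta>\<^sup>2 / 2 * (ip N (pjx N ph k \<sigma>) (pjx N ph k \<tau>))\<^sup>2 \<le> 1 * 1"
      by (intro mult_mono pj1 s t) (use beta_sq in auto)
    moreover have "0 \<le> \<beta>\<^sup>2 / 2 * (ip N (pjx N ph k \<sigma>) (pjx N ph k \<tau>))\<^sup>2" by simp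
    ultimately show ?thesis using Sg[OF s] Sg[OF t] unfolding X_def B_def by (simp only: abs_le_iff) linarith
  qed
  have card: "(\<Sum>\<sigma>\<in>spins N. \<Sum>\<tau>\<in>spins N. c) = 4 ^ N * (c::real)" for c
  proof -
    have "card (spins N) = 2 ^ N" by (simp add: card_PiE numeral_2_eq_2)
    moreover have "(2::real) ^ N * 2 ^ N = 4 ^ N" by (simp flip: power_mult_distrib)
    ultimately show ?thesis by simp
  qed
  have "Psi \<beta> h N ph ze k \<le> (\<Sum>\<sigma>\<in>spins N. \<Sum>\<tau>\<in>spins N. exp (real N * B)) / 4 ^ N"
    unfolding Psi_def X_def[symmetric]
    by (intro divide_right_mono sum_mono) (use X in \<open>auto simp: abs_le_iff intro!: mult_left_mono\<close>)
  then have u: "Psi \<beta> h N ph ze k \<le> exp (real N * B)" unfolding card by simp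
  have "(\<Sum>\<sigma>\<in>spins N. \<Sum>\<tau>\<in>spins N. exp (- (real N * B))) / 4 ^ N \<le> Psi \<beta> h N ph ze k"
    unfolding Psi_def X_def[symmetric]
  proof (intro divide_right_mono sum_mono)
    fix \<sigma> \<tau> assume "\<sigma> \<in> spins N" "\<tau> \<in> spins N"
    from X[OF this] have "real N * - B \<le> real N * X \<sigma> \<tau>" by (intro mult_left_mono) auto
    then show "exp (- (real N * B)) \<le> exp (real N * X \<sigma> \<tau>)" by simp
  qed simp
  then have l: "exp (- (real N * B)) \<le> Psi \<beta> h N ph ze k" unfolding card by simp
  have P0: "Psi \<beta> h N ph ze k > 0" by (rule less_le_trans[OF _ l]) simp
  have "ln (Psi \<beta> h N ph ze k) \<le> ln (exp (real N * B))" using u P0 by (subst ln_le_cancel_iff) auto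
  moreover have "ln (exp (- (real N * B))) \<le> ln (Psi \<beta> h N ph ze k)" using l P0 by (subst ln_le_cancel_iff) auto
  ultimately have "\<bar>ln (Psi \<beta> h N ph ze k)\<bar> \<le> real N * B" by (simp add: abs_le_iff)
  then have "\<bar>1 / real N * ln (Psi \<beta> h N ph ze k)\<bar> \<le> B" using N by (simp add: abs_mult field_simps)
  then show ?thesis unfolding B_def S_def .
qed

end

end

end

section \<open>From convergence in probability to convergence in mean\<close>

lemma cip_lim: "X \<longlonglongrightarrow> c \<Longrightarrow> cip M (\<lambda>N _. X N) c"
  unfolding cip_def
proof (intro allI impI)
  fix e :: real assume X: "X \<longlonglongrightarrow> c" and e: "e > 0"
  show "whp M (\<lambda>N \<omega>. \<bar>X N - c\<bar> \<le> e)"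
    by (rule whp_mono[where P="\<lambda>_ _. True", OF whp_true])
       (use tendstoD[OF X e] in \<open>auto simp: dist_real_def elim!: eventually_mono\<close>)
qed

text \<open>Off an exceptional set the integrand is nearly at most r. On that set the crude bound is
  linear in variables of bounded second moment, hence uniformly integrable, so the small probability
  makes its contribution negligible.\<close>

lemma limsup_mean_le:
  fixes C c r :: real
  assumes [simp]: "finite J" and c: "c \<ge> 0"
    and P: "\<And>N. N \<ge> 1 \<Longrightarrow> prob_space (M N)" and C: "C \<ge> 0" and r: "r \<ge> 0"
    and w: "\<And>e. e > 0 \<Longrightarrow> whp M (\<lambda>N \<omega>. W N \<omega> \<le> r + e)"
    and Ym: "\<And>N j. N \<ge> 1 \<Longrightarrow> j \<in> J \<Longrightarrow> Y N j \<in> borel_measurable (M N)"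
    and Y2: "\<And>N j. N \<ge> 1 \<Longrightarrow> j \<in> J \<Longrightarrow> (\<integral>\<^sup>+\<omega>. ennreal ((Y N j \<omega>)\<^sup>2) \<partial>M N) \<le> 1"
    and crude: "\<And>N \<omega>. N \<ge> 1 \<Longrightarrow> \<omega> \<in> space (M N) \<Longrightarrow> W N \<omega> \<le> C + c * (\<Sum>j\<in>J. Y N j \<omega>)"
  shows "limsup (\<lambda>N. \<integral>\<^sup>+\<omega>. ennreal (W N \<omega>) \<partial>M N) \<le> ennreal r"
proof (rule ennreal_le_epsilon)
  fix d :: real assume d: "d > 0"
  define n where "n = c * real (card J)"
  have n: "n \<ge> 0" using c by (simp add: n_def)
  \<comment> \<open>The order of choice matters: t makes the quadratic part at most d/3 and fixes
    \<open>D\<close>; only then is e chosen so that the exceptional set contributes at most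
    d/3.\<close>
  define t where "t = d / (3 * (n + 1))"
  have t: "t > 0" using d n by (simp add: t_def)
  define D where "D = C + n / (4 * t)"
  have D: "D \<ge> 0" using C t n by (simp add: D_def)
  define e where "e = d / (3 * (D + 1))"
  have e: "e > 0" using d D by (simp add: e_def)
  have "\<forall>\<^sub>F N in sequentially. \<exists>B\<in>sets (M N). emeasure (M N) B \<le> ennreal e \<and> (\<forall>\<omega>\<in>space (M N) - B. W N \<omega> \<le> r + d / 3)"
    using w[of "d / 3"] d e unfolding whp_def by simp
  moreover have "\<forall>\<^sub>F N in sequentially. N \<ge> (1::nat)" by (rule eventually_ge_at_top)
  ultimately have "\<forall>\<^sub>F N in sequentially. (\<integral>\<^sup>+\<omega>. ennreal (W N \<omega>) \<partial>M N) \<le> ennreal (r + d)"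
  proof eventually_elim
    case (elim N)
    then have N: "N \<ge> 1" by simp
    obtain B where B [measurable]: "B \<in> sets (M N)" and Be: "emeasure (M N) B \<le> ennreal e"
      and good: "\<forall>\<omega>\<in>space (M N) - B. W N \<omega> \<le> r + d / 3" using elim(1) by blast
    interpret prob_space "M N" by (rule P[OF N])
    have [measurable]: "(\<lambda>\<omega>. \<Sum>j\<in>J. (Y N j \<omega>)\<^sup>2) \<in> borel_measurable (M N)"
      by (intro borel_measurable_sum borel_measurable_power Ym[OF N]) simp
    have pt: "ennreal (W N \<omega>) \<le> ennreal (r + d / 3) + (ennreal D * indicator B \<omega> + ennreal (c * t) * ennreal (\<Sum>j\<in>J. (Y N j \<omega>)\<^sup>2))"
      if w: "\<omega> \<in> space (M N)" for \<omega>
    proof (cases "\<omega> \<in> B")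
      case True
      \<comment> \<open>Splits y into a constant and a small multiple of its square: only the
        constant is multiplied by the indicator of \<open>B\<close>, while the squares are
        integrated over the whole space.\<close>
      have y: "y \<le> 1 / (4 * t) + t * y\<^sup>2" for y
      proof -
        have "0 \<le> (2 * t * y - 1)\<^sup>2" by simp
        then have "4 * t * y \<le> 1 + 4 * t * (t * y\<^sup>2)" by (simp add: power2_eq_square algebra_simps)
        then show ?thesis using t by (simp add: field_simps)
      qed
      have "W N \<omega> \<le> C + c * (\<Sum>j\<in>J. Y N j \<omega>)" by (rule crude[OF N w])
      also have "\<dots> \<le> C + c * (\<Sum>j\<in>J. 1 / (4 * t) + t * (Y N j \<omega>)\<^sup>2)" by (intro add_left_mono mult_left_mono sum_mono y c)
      also have "\<dots> = D + c * t * (\<Sum>j\<in>J. (Y N j \<omega>)\<^sup>2)"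
        by (simp add: sum.distrib distrib_left D_def n_def mult.assoc flip: sum_distrib_left)
      finally have "ennreal (W N \<omega>) \<le> ennreal (D + c * t * (\<Sum>j\<in>J. (Y N j \<omega>)\<^sup>2))" by (rule ennreal_leI)
      also have "\<dots> = ennreal D * indicator B \<omega> + ennreal (c * t) * ennreal (\<Sum>j\<in>J. (Y N j \<omega>)\<^sup>2)"
        using True D t c by (simp add: ennreal_plus ennreal_mult sum_nonneg)
      finally show ?thesis by (rule order_trans) simp
    next
      case False
      then have "ennreal (W N \<omega>) \<le> ennreal (r + d / 3)" using good w by (intro ennreal_leI) auto
      then show ?thesis by (rule order_trans) simp
    qed
    have "(\<integral>\<^sup>+\<omega>. ennreal (W N \<omega>) \<partial>M N)
      \<le> (\<integral>\<^sup>+\<omega>. ennreal (r + d / 3) + (ennreal D * indicator B \<omega> + ennreal (c * t) * ennreal (\<Sum>j\<in>J. (Y N j \<omega>)\<^sup>2)) \<partial>M N)"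
      by (rule nn_integral_mono) (rule pt)
    also have "\<dots> = ennreal (r + d / 3) + (ennreal D * emeasure (M N) B + ennreal (c * t) * (\<integral>\<^sup>+\<omega>. ennreal (\<Sum>j\<in>J. (Y N j \<omega>)\<^sup>2) \<partial>M N))"
      by (simp add: nn_integral_add nn_integral_cmult nn_integral_cmult_indicator emeasure_space_1)
    also have "(\<integral>\<^sup>+\<omega>. ennreal (\<Sum>j\<in>J. (Y N j \<omega>)\<^sup>2) \<partial>M N) = (\<Sum>j\<in>J. \<integral>\<^sup>+\<omega>. ennreal ((Y N j \<omega>)\<^sup>2) \<partial>M N)"
    proof -
      have "(\<integral>\<^sup>+\<omega>. ennreal (\<Sum>j\<in>J. (Y N j \<omega>)\<^sup>2) \<partial>M N) = (\<integral>\<^sup>+\<omega>. (\<Sum>j\<in>J. ennreal ((Y N j \<omega>)\<^sup>2)) \<partial>M N)"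
        by (simp add: sum_ennreal)
      also have "\<dots> = (\<Sum>j\<in>J. \<integral>\<^sup>+\<omega>. ennreal ((Y N j \<omega>)\<^sup>2) \<partial>M N)"
        by (intro nn_integral_sum measurable_compose[OF _ measurable_ennreal] borel_measurable_power Ym[OF N]) simp
      finally show ?thesis .
    qed
    also have "ennreal (r + d / 3) + (ennreal D * emeasure (M N) B + ennreal (c * t) * (\<Sum>j\<in>J. \<integral>\<^sup>+\<omega>. ennreal ((Y N j \<omega>)\<^sup>2) \<partial>M N))
       \<le> ennreal (r + d / 3) + (ennreal D * ennreal e + ennreal (c * t) * (\<Sum>j\<in>J. 1))"
      by (intro add_left_mono add_mono mult_left_mono sum_mono Be Y2[OF N]) auto
    also have "\<dots> = ennreal (r + d / 3 + (D * e + c * t * real (card J)))"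
      using r d D e t c by (simp add: ennreal_plus ennreal_mult ennreal_of_nat_eq_real_of_nat)
    also have "\<dots> \<le> ennreal (r + d)"
    proof (rule ennreal_leI)
      have "D * e \<le> d / 3" using D d by (simp add: e_def field_simps)
      moreover have "c * t * real (card J) \<le> d / 3" using d n by (simp add: t_def n_def field_simps)
      ultimately show "r + d / 3 + (D * e + c * t * real (card J)) \<le> r + d" by simp
    qed
    finally show ?case .
  qed
  then have "limsup (\<lambda>N. \<integral>\<^sup>+\<omega>. ennreal (W N \<omega>) \<partial>M N) \<le> ennreal (r + d)" by (rule Limsup_bounded)
  then show "limsup (\<lambda>N. \<integral>\<^sup>+\<omega>. ennreal (W N \<omega>) \<partial>M N) \<le> ennreal r + ennreal d" using r d by (simp add: ennreal_plus)
qed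

section \<open>The limit of the conditional second moment\<close>

context hightemp
begin

context
  fixes k :: nat
  assumes k: "1 \<le> k"
begin

abbreviation Xk where "Xk N v \<equiv> 1 / real N * ln (PsiG \<beta> h N k (dmat \<beta> h N v k))"
abbreviation hk where "hk N v \<equiv> \<lambda>i. h + \<beta> * (\<Sum>s=1..k. cc k s * ZZ k N v s i)"

lemma mt_MM: "(\<lambda>i. tanh (hk N v i)) = MM k N v (Suc k)"
  using MM_form[OF k order_refl] by simp

lemma lim_Del: "cip (\<lambda>N. VV N k) (\<lambda>N v. Del N k (PP k N v) (ZZ k N v)) ((\<gamma> k - sqrt (q - G2 (k - 1)))\<^sup>2)"
proof -
  have "cip (\<lambda>N. VV N k) (\<lambda>N v. Del N k (PP k N v) (ZZ k N v)) (\<Sum>s=1..k. (\<gamma> s - cc k s)\<^sup>2)"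
    unfolding Del_def mt_MM by (intro cip_sum cip_power cip_diff cip_const lim_MP[OF k])
  moreover have "(\<Sum>s=1..k. (\<gamma> s - cc k s)\<^sup>2) = (\<Sum>s=1..k. if s = k then (\<gamma> k - sqrt (q - G2 (k - 1)))\<^sup>2 else 0)"
    by (intro sum.cong) (auto simp: cc_def)
  ultimately show ?thesis using k by simp
qed

lemma lim_Kap: "cip (\<lambda>N. VV N k) (\<lambda>N v. Kap N k (ZZ k N v)) 0"
proof -
  have "cip (\<lambda>N. VV N k) (\<lambda>N v. Kap N k (ZZ k N v)) (\<Sum>s=1..k. (\<beta> * (1 - q) * cc k s - \<beta> * (1 - q) * cc k s)\<^sup>2)"
    unfolding Kap_def mt_MM by (intro cip_sum cip_power cip_diff cip_const lim_MZ[OF k])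
  then show ?thesis by simp
qed

lemma lim_sum_PZ: "cip (\<lambda>N. VV N k) (\<lambda>N v. PZ N k (PP k N v) (ZZ k N v)) 0"
proof -
  have "cip (\<lambda>N. VV N k) (\<lambda>N v. PZ N k (PP k N v) (ZZ k N v)) (\<Sum>s=1..k. \<bar>0\<bar>)"
    unfolding PZ_def by (intro cip_sum cip_abs lim_PZ[OF k])
  then show ?thesis by simp
qed

lemma lim_Mres: "cip (\<lambda>N. VV N k) (\<lambda>N v. Mres N k (PP k N v) (ZZ k N v)) (q - G2 k)"
  unfolding Mres_def mt_MM Gam2_def by (intro cip_diff cip_sum cip_power lim_MM[OF k] lim_MP[OF k])

text \<open>\<gamma>_k lies between 0 and sqrt(q - \<open>G2 (k - 1)\<close>) because \<rho>_k lies
  between \<open>G2 (k - 1)\<close> and q. The single quantity q - \<open>G2 (k - 1)\<close> can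
  then dominate both errors that survive as N grows.\<close>

lemma gamma_gap: "(\<gamma> k - sqrt (q - G2 (k - 1)))\<^sup>2 \<le> q - G2 (k - 1)" "q - G2 k \<le> q - G2 (k - 1)"
proof -
  obtain l where l: "k = Suc l" using k by (cases k) auto
  define s where "s = sqrt (q - G2 l)"
  have q2: "q - G2 l > 0" using G2_bounds(2)[of l] by simp
  have s: "s > 0" "s * s = q - G2 l" using q2 by (auto simp: s_def)
  have g: "\<gamma> k * s = \<rho> k - G2 l" using gam_mult[of l] unfolding l s_def .
  have "\<gamma> k \<ge> 0"
  proof (rule ccontr)
    assume "\<not> \<gamma> k \<ge> 0"
    then have "\<gamma> k * s < 0" using s(1) by (simp add: mult_neg_pos)
    then show False using g G2_bounds(3)[of l] l by simp
  qed
  moreover have "\<gamma> k \<le> s"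
  proof (rule ccontr)
    assume "\<not> \<gamma> k \<le> s"
    then have "\<gamma> k * s > s * s" using s(1) by simp
    then show False using g s(2) rho_bounds(2)[of l] l by simp
  qed
  ultimately have "(s - \<gamma> k) * (s - \<gamma> k) \<le> s * s" using s(1) by (intro mult_mono) auto
  then show "(\<gamma> k - sqrt (q - G2 (k - 1)))\<^sup>2 \<le> q - G2 (k - 1)"
    using s(2) l by (simp add: s_def power2_eq_square algebra_simps)
  show "q - G2 k \<le> q - G2 (k - 1)" using G2_Suc[of l] l by simp
qed

lemma whp_gram:
  "whp (\<lambda>N. VV N k) (\<lambda>N v. \<forall>s\<in>{1..k}. \<forall>t\<in>{1..k}. \<bar>ip N (ZZ k N v s) (ZZ k N v t) - of_bool (s = t)\<bar> \<le> 1 / (2 * real k))"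
proof (intro whp_ball)
  fix s t assume "s \<in> {1..k}" "t \<in> {1..k}"
  from lim_ZZ[OF k this] show "whp (\<lambda>N. VV N k) (\<lambda>N v. \<bar>ip N (ZZ k N v s) (ZZ k N v t) - of_bool (s = t)\<bar> \<le> 1 / (2 * real k))"
    unfolding cip_def using k by simp
qed auto

lemma whp_close_to_RS:
  assumes e: "e > 0"
  shows "whp (\<lambda>N. VV N k) (\<lambda>N v. \<bar>Xk N v - 2 * RS \<beta> h\<bar> \<le> (q - G2 (k - 1)) + e)"
proof -
  define Y where "Y N v = 2 * (3 * \<beta> * Del N k (PP k N v) (ZZ k N v) + \<beta> * Kap N k (ZZ k N v) + \<beta> * PZ N k (PP k N v) (ZZ k N v))
     + 9 * \<beta>\<^sup>2 * Mres N k (PP k N v) (ZZ k N v) + (4 * real k + 2) * ln 2 / real N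
     + 2 * \<bar>ip N (\<lambda>i. lncosh (hk N v i)) (\<lambda>_. 1) - EL \<beta> h q\<bar>" for N v
  define r where "r = 2 * (3 * \<beta> * (\<gamma> k - sqrt (q - G2 (k - 1)))\<^sup>2 + \<beta> * 0 + \<beta> * 0) + 9 * \<beta>\<^sup>2 * (q - G2 k) + 0 + 2 * \<bar>EL \<beta> h q - EL \<beta> h q\<bar>"
  have Y: "cip (\<lambda>N. VV N k) Y r"
    unfolding Y_def r_def
    by (intro cip_add cip_mult cip_const cip_diff cip_abs lim_Del lim_Kap lim_sum_PZ lim_Mres lim_lncosh[OF k] cip_lim lim_const_over_n)
  \<comment> \<open>Since 6 \<beta> and 9 \<beta>^2 are at most 1/2, the limits of
    \<open>Del\<close> and \<open>Mres\<close> each use at most half of the allowed error.\<close>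
  have r: "r \<le> q - G2 (k - 1)"
  proof -
    have g: "q - G2 (k - 1) \<ge> 0" using G2_bounds(2)[of "k - 1"] by simp
    have "6 * \<beta> * (\<gamma> k - sqrt (q - G2 (k - 1)))\<^sup>2 \<le> 1 / 2 * (q - G2 (k - 1))"
      by (rule mult_mono) (use gamma_gap(1) beta_le in auto)
    moreover have "9 * \<beta>\<^sup>2 * (q - G2 k) \<le> 1 / 2 * (q - G2 (k - 1))"
      by (rule mult_mono) (use gamma_gap(2) beta_sq G2_bounds(2)[of k] in auto)
    ultimately show ?thesis unfolding r_def by simp
  qed
  have "whp (\<lambda>N. VV N k) (\<lambda>N v. \<bar>Y N v - r\<bar> \<le> e)" using Y e by (simp add: cip_def)
  from whp_conj[OF whp_gram this] show ?thesis
  proof (rule whp_mono, intro eventually_mono[OF eventually_ge_at_top[of 1]] ballI impI)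
    fix N :: nat and v assume N: "1 \<le> N"
      and h: "(\<forall>s\<in>{1..k}. \<forall>t\<in>{1..k}. \<bar>ip N (ZZ k N v s) (ZZ k N v t) - of_bool (s = t)\<bar> \<le> 1 / (2 * real k)) \<and> \<bar>Y N v - r\<bar> \<le> e"
    have gram: "ip N (\<lambda>i. \<Sum>s=1..k. b s * ZZ k N v s i) (\<lambda>i. \<Sum>s=1..k. b s * ZZ k N v s i) \<le> 3 / 2 * (\<Sum>s=1..k. (b s)\<^sup>2)" for b
      by (rule gram_bound[OF k]) (use h in blast)
    from Psi_bounds[OF N k phi_orth[OF N] gram]
    have "\<bar>Xk N v - 2 * ip N (\<lambda>i. lncosh (hk N v i)) (\<lambda>_. 1) - \<beta>\<^sup>2 * (1 - q)\<^sup>2 / 2\<bar>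
       \<le> 2 * E0 N k (PP k N v) (ZZ k N v) + 9 * \<beta>\<^sup>2 * Mres N k (PP k N v) (ZZ k N v) + (4 * real k + 2) * ln 2 / real N" .
    moreover have "2 * RS \<beta> h = 2 * EL \<beta> h q + \<beta>\<^sup>2 * (1 - q)\<^sup>2 / 2" by (simp add: RS_eq)
    moreover have "\<bar>x - y\<bar> \<le> B + 2 * \<bar>a - b\<bar>" if "\<bar>x - 2 * a - c\<bar> \<le> B" "y = 2 * b + c" for x y a b c B :: real
      using that by (simp add: abs_if split: if_splits)
    ultimately have "\<bar>Xk N v - 2 * RS \<beta> h\<bar> \<le> Y N v" unfolding Y_def E0_def by blast
    then show "\<bar>Xk N v - 2 * RS \<beta> h\<bar> \<le> (q - G2 (k - 1)) + e" using h r by linarith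
  qed
qed

lemma limsup_le: "limsup (\<lambda>N. \<integral>\<^sup>+v. ennreal \<bar>Xk N v - 2 * RS \<beta> h\<bar> \<partial>VV N k) \<le> ennreal (q - G2 (k - 1))"
\<comment> \<open>The pairs in \<open>J\<close> index the two halves of each fresh block, whose
  norms bound that of \<zeta> by \<open>ZZ_norm\<close>; the constants are those of
  \<open>Psi_crude\<close>, together with the subtracted 2 RS.\<close>
proof (rule limsup_mean_le[where J="{1..k} \<times> UNIV" and C="2 * h + 3 + 2 * \<bar>RS \<beta> h\<bar>" and c=4
      and Y="\<lambda>N j v. nrm N (\<lambda>i. v (fst j) ((if snd j then 0 else N) + i))"])
  show "0 \<le> 2 * h + 3 + 2 * \<bar>RS \<beta> h\<bar>" using h_pos by simp
  show "0 \<le> q - G2 (k - 1)" using G2_bounds(2)[of "k - 1"] by simp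
  show "(\<lambda>v. nrm N (\<lambda>i. v (fst j) ((if snd j then 0 else N) + i))) \<in> borel_measurable (VV N k)"
    if "1 \<le> N" "j \<in> {1..k} \<times> UNIV" for N j
    unfolding nrm_def by (intro measurable_compose[OF _ borel_measurable_sqrt] mv_ip mv_fresh) (use that in auto)
  show "(\<integral>\<^sup>+v. ennreal ((nrm N (\<lambda>i. v (fst j) ((if snd j then 0 else N) + i)))\<^sup>2) \<partial>VV N k) \<le> 1"
    if "1 \<le> N" "j \<in> {1..k} \<times> UNIV" for N j
    by (subst fresh_norm_sq) (use that in auto)
  show "\<bar>Xk N v - 2 * RS \<beta> h\<bar> \<le> 2 * h + 3 + 2 * \<bar>RS \<beta> h\<bar> + 4 * (\<Sum>j\<in>{1..k} \<times> UNIV. nrm N (\<lambda>i. v (fst j) ((if snd j then 0 else N) + i)))"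
    if N: "1 \<le> N" for N v
  proof -
    have "\<bar>Xk N v\<bar> \<le> 2 * h + 3 + 4 * (\<Sum>s=1..k. nrm N (ZZ k N v s))"
      by (rule Psi_crude[OF N k phi_orth[OF N]]) (rule PP_norm[OF N], simp)
    moreover have "(\<Sum>s=1..k. nrm N (ZZ k N v s)) \<le> (\<Sum>s=1..k. nrm N (\<lambda>i. v s i) + nrm N (\<lambda>i. v s (N + i)))"
      by (intro sum_mono ZZ_norm[OF N])
    moreover have "(\<Sum>j\<in>{1..k} \<times> UNIV. nrm N (\<lambda>i. v (fst j) ((if snd j then 0 else N) + i)))
       = (\<Sum>s=1..k. nrm N (\<lambda>i. v s i) + nrm N (\<lambda>i. v s (N + i)))"
    proof -
      have "(\<Sum>j\<in>{1..k} \<times> UNIV. nrm N (\<lambda>i. v (fst j) ((if snd j then 0 else N) + i)))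
         = (\<Sum>s=1..k. \<Sum>b\<in>UNIV. nrm N (\<lambda>i. v s ((if b then 0 else N) + i)))"
        unfolding sum.cartesian_product by (simp add: split_beta')
      then show ?thesis by (simp add: UNIV_bool add.commute)
    qed
    ultimately show ?thesis by linarith
  qed
qed (use prob_space_VV whp_close_to_RS in auto)

end

end

text \<open>\<open>disorder_to_fresh\<close> carries each mean from the arbitrary space
  \<open>M N\<close> to the fresh blocks, where the limit superior in N is at most q -
  \<open>G2 (k - 1)\<close>. This tends to 0 by \<open>G2_tendsto\<close>.\<close>

lemma tendsto_RS:
  assumes hb: "h > 0" "0 < \<beta>" "\<beta> \<le> 1 / 100"
    and g: "\<And>N. N \<ge> 1 \<Longrightarrow> gaussian_disorder N (M N) (g N)"
  shows "(\<lambda>k. limsup (\<lambda>N. \<integral>\<^sup>+\<omega>. ennreal \<bar>1 / real N * ln (cond_second_moment \<beta> h N (M N) (g N) k \<omega>)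
       - 2 * RS \<beta> h\<bar> \<partial>(M N))) \<longlonglongrightarrow> 0"
proof -
  interpret hightemp \<beta> h by standard (use hb in auto)
  let ?L = "\<lambda>k. limsup (\<lambda>N. \<integral>\<^sup>+\<omega>. ennreal \<bar>1 / real N * ln (cond_second_moment \<beta> h N (M N) (g N) k \<omega>) - 2 * RS \<beta> h\<bar> \<partial>(M N))"
  have b: "?L k \<le> ennreal (q - G2 (k - 1))" if k: "k \<ge> 1" for k
  proof -
    have "(\<integral>\<^sup>+\<omega>. ennreal \<bar>1 / real N * ln (cond_second_moment \<beta> h N (M N) (g N) k \<omega>) - 2 * RS \<beta> h\<bar> \<partial>(M N))
      = (\<integral>\<^sup>+v. ennreal \<bar>1 / real N * ln (PsiG \<beta> h N k (dmat \<beta> h N v k)) - 2 * RS \<beta> h\<bar> \<partial>VV N k)" if N: "N \<ge> 1" for N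
      by (rule disorder_to_fresh[OF N g[OF N], where H="\<lambda>x. ennreal \<bar>1 / real N * ln x - 2 * RS \<beta> h\<bar>"]) measurable
    then have "?L k = limsup (\<lambda>N. \<integral>\<^sup>+v. ennreal \<bar>1 / real N * ln (PsiG \<beta> h N k (dmat \<beta> h N v k)) - 2 * RS \<beta> h\<bar> \<partial>VV N k)"
      by (intro Limsup_eq eventually_mono[OF eventually_ge_at_top[of 1]])
    then show ?thesis using limsup_le[OF k] by simp
  qed
  have "(\<lambda>k. q - G2 k) \<longlonglongrightarrow> q - q" by (intro tendsto_diff tendsto_const G2_tendsto)
  then have "(\<lambda>k. ennreal (q - G2 k)) \<longlonglongrightarrow> ennreal 0" by (intro tendsto_ennrealI) simp
  then have "(\<lambda>k. ennreal (q - G2 (Suc k - 1))) \<longlonglongrightarrow> 0" by simp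
  then have u: "(\<lambda>k. ennreal (q - G2 (k - 1))) \<longlonglongrightarrow> 0" by (rule LIMSEQ_imp_Suc)
  show ?thesis
  proof (rule tendsto_sandwich[OF _ _ tendsto_const u])
    show "\<forall>\<^sub>F k in sequentially. 0 \<le> ?L k" by simp
    show "\<forall>\<^sub>F k in sequentially. ?L k \<le> ennreal (q - G2 (k - 1))"
      by (rule eventually_mono[OF eventually_ge_at_top[of 1]]) (rule b)
  qed
qed

theorem proposition9:
  shows "\<exists>\<beta>\<^sub>0>0. \<forall>h>0. \<forall>\<beta>>0. \<beta> \<le> \<beta>\<^sub>0 \<longrightarrow>
    (\<forall>(M :: nat \<Rightarrow> 'a measure) (g :: nat \<Rightarrow> nat \<Rightarrow> nat \<Rightarrow> 'a \<Rightarrow> real).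
      (\<forall>N\<ge>1. gaussian_disorder N (M N) (g N)) \<longrightarrow>
      (\<exists>L. (\<lambda>k. limsup (\<lambda>N. \<integral>\<^sup>+\<omega>. ennreal \<bar>1 / real N * ln (cond_second_moment \<beta> h N (M N) (g N) k \<omega>)
                                           - 2 * RS \<beta> h\<bar> \<partial>(M N))) \<longlonglongrightarrow> L
           \<and> L \<le> 0))"
\<comment> \<open>The threshold is the bound on \<beta> in \<open>hightemp\<close>, which does not
  depend on h.\<close>
proof (intro exI[of _ "1 / 100 :: real"] conjI allI impI)
  fix h \<beta> :: real and M :: "nat \<Rightarrow> 'a measure" and g :: "nat \<Rightarrow> nat \<Rightarrow> nat \<Rightarrow> 'a \<Rightarrow> real"
  assume "h > 0" "\<beta> > 0" "\<beta> \<le> 1 / 100" and g: "\<forall>N\<ge>1. gaussian_disorder N (M N) (g N)"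
  from tendsto_RS[OF this(1-3)] g
  show "\<exists>L. (\<lambda>k. limsup (\<lambda>N. \<integral>\<^sup>+\<omega>. ennreal \<bar>1 / real N * ln (cond_second_moment \<beta> h N (M N) (g N) k \<omega>)
       - 2 * RS \<beta> h\<bar> \<partial>(M N))) \<longlonglongrightarrow> L \<and> L \<le> 0"
    by (intro exI[of _ 0]) auto
qed simp

end
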